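(* Let $A$ be an infinite-dimensional simple unital C*-algebra, let $G$ be a finite group with $\mathrm{card}(G)=n$, and let $\alpha\colon G\rightarrow\mathrm{Aut}(A)$ be an action of $G$ on $A$ which has the weak tracial Rokhlin property. Then for any finite subset $F\subset A\rtimes_\alpha G$, any $\varepsilon>0$, and any $s\in(A\rtimes_\alpha G)_+\setminus\{0\}$, there exist an element $a\in A_+^1$, a C*-subalgebra $B$ of $A\rtimes_\alpha G$ with $B\cong\overline{aAa}\otimes M_n$, and an element $d\in B_+^1$ such that (1) $\|dx-xd\|<\varepsilon$ for all $x\in F$; (2) for every $x\in F$ there is $y\in B$ with $\|dx-y\|<\varepsilon$; (3) $1-d\precsim_{A\rtimes_\alpha G}s$; (4) $\|dxd\|>\|x\|-\varepsilon$ for all $x\in F$.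
   Context: For a C*-algebra $D$, $D_+$ is its positive cone and $D_+^1$ the set of positive elements of norm at most $1$. Cuntz subequivalence: for positive $a,b$ in $D\otimes K$ ($K$ the compact operators on a separable infinite-dimensional Hilbert space), $a\precsim_D b$ means there is a sequence $(x_k)$ in $D\otimes K$ with $\|a-x_k^*bx_k\|\to 0$. Weak tracial Rokhlin property: an action $\alpha$ of a finite group $G$ on an infinite-dimensional simple unital C*-algebra $A$ has it if for every finite $F\subset A$, every $\varepsilon>0$ and every $s\in A_+$ with $\|s\|=1$ there exist mutually orthogonal $f_g\in A_+^1$ ($g\in G$) such that (1) $\|f_gx-xf_g\|<\varepsilon$ for all $x\in F$, $g\in G$; (2) $\|\alpha_g(f_h)-f_{gh}\|<\varepsilon$ for all $g,h\in G$; (3) $1-f\precsim_A s$, where $f=\sum_{g\in G}f_g$; (4) $\|fsf\|>1-\varepsilon$. *)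

theory Defs
  imports Complex_Main "HOL-Algebra.Group"
begin

record 'a cstar_alg =
  ca_carr  :: "'a set"
  ca_zero  :: 'a
  ca_add   :: "'a \<Rightarrow> 'a \<Rightarrow> 'a"
  ca_smul  :: "complex \<Rightarrow> 'a \<Rightarrow> 'a"
  ca_mul   :: "'a \<Rightarrow> 'a \<Rightarrow> 'a"
  ca_star  :: "'a \<Rightarrow> 'a"
  ca_norm  :: "'a \<Rightarrow> real"

definition ca_minus :: "'a cstar_alg \<Rightarrow> 'a \<Rightarrow> 'a \<Rightarrow> 'a" where
  "ca_minus D x y = ca_add D x (ca_smul D (-1) y)"

text \<open>Finite sums (intended for finite index sets; independent of the enumeration
  order in a C*-algebra).\<close>
definition ca_sum :: "'a cstar_alg \<Rightarrow> ('b \<Rightarrow> 'a) \<Rightarrow> 'b set \<Rightarrow> 'a" where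
  "ca_sum D f S = foldr (\<lambda>h acc. ca_add D (f h) acc)
      (SOME xs. set xs = S \<and> distinct xs) (ca_zero D)"

definition cstar_algebra :: "'a cstar_alg \<Rightarrow> bool" where
  "cstar_algebra D \<longleftrightarrow>
    ca_zero D \<in> ca_carr D \<and>
    (\<forall>x\<in>ca_carr D. \<forall>y\<in>ca_carr D. ca_add D x y \<in> ca_carr D \<and> ca_mul D x y \<in> ca_carr D) \<and>
    (\<forall>c. \<forall>x\<in>ca_carr D. ca_smul D c x \<in> ca_carr D) \<and>
    (\<forall>x\<in>ca_carr D. ca_star D x \<in> ca_carr D) \<and>
    (\<forall>x\<in>ca_carr D. \<forall>y\<in>ca_carr D. \<forall>z\<in>ca_carr D.
        ca_add D (ca_add D x y) z = ca_add D x (ca_add D y z) \<and>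
        ca_mul D (ca_mul D x y) z = ca_mul D x (ca_mul D y z) \<and>
        ca_mul D (ca_add D x y) z = ca_add D (ca_mul D x z) (ca_mul D y z) \<and>
        ca_mul D x (ca_add D y z) = ca_add D (ca_mul D x y) (ca_mul D x z)) \<and>
    (\<forall>x\<in>ca_carr D. \<forall>y\<in>ca_carr D.
        ca_add D x y = ca_add D y x \<and>
        ca_star D (ca_add D x y) = ca_add D (ca_star D x) (ca_star D y) \<and>
        ca_star D (ca_mul D x y) = ca_mul D (ca_star D y) (ca_star D x) \<and>
        ca_norm D (ca_add D x y) \<le> ca_norm D x + ca_norm D y \<and>
        ca_norm D (ca_mul D x y) \<le> ca_norm D x * ca_norm D y \<and>
        (\<forall>c. ca_smul D c (ca_add D x y) = ca_add D (ca_smul D c x) (ca_smul D c y) \<and>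
             ca_mul D (ca_smul D c x) y = ca_smul D c (ca_mul D x y) \<and>
             ca_mul D x (ca_smul D c y) = ca_smul D c (ca_mul D x y))) \<and>
    (\<forall>x\<in>ca_carr D.
        ca_add D x (ca_zero D) = x \<and>
        ca_add D x (ca_smul D (-1) x) = ca_zero D \<and>
        ca_smul D 1 x = x \<and>
        (\<forall>c d. ca_smul D (c * d) x = ca_smul D c (ca_smul D d x) \<and>
               ca_smul D (c + d) x = ca_add D (ca_smul D c x) (ca_smul D d x)) \<and>
        ca_star D (ca_star D x) = x \<and>
        (\<forall>c. ca_star D (ca_smul D c x) = ca_smul D (cnj c) (ca_star D x)) \<and>
        0 \<le> ca_norm D x \<and>
        (ca_norm D x = 0 \<longleftrightarrow> x = ca_zero D) \<and>
        (\<forall>c. ca_norm D (ca_smul D c x) = cmod c * ca_norm D x) \<and>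
        ca_norm D (ca_mul D (ca_star D x) x) = (ca_norm D x)\<^sup>2) \<and>
    (\<forall>f :: nat \<Rightarrow> 'a. (\<forall>k. f k \<in> ca_carr D) \<longrightarrow>
        (\<forall>e>0. \<exists>N. \<forall>k\<ge>N. \<forall>l\<ge>N. ca_norm D (ca_minus D (f k) (f l)) < e) \<longrightarrow>
        (\<exists>x\<in>ca_carr D. \<forall>e>0. \<exists>N. \<forall>k\<ge>N. ca_norm D (ca_minus D (f k) x) < e))"

definition ca_is_unit :: "'a cstar_alg \<Rightarrow> 'a \<Rightarrow> bool" where
  "ca_is_unit D e \<longleftrightarrow> e \<in> ca_carr D \<and>
     (\<forall>x\<in>ca_carr D. ca_mul D e x = x \<and> ca_mul D x e = x)"

definition unital :: "'a cstar_alg \<Rightarrow> bool" where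
  "unital D \<longleftrightarrow> (\<exists>e. ca_is_unit D e)"

definition ca_one :: "'a cstar_alg \<Rightarrow> 'a" where
  "ca_one D = (THE e. ca_is_unit D e)"

definition ca_positive :: "'a cstar_alg \<Rightarrow> 'a \<Rightarrow> bool" where
  "ca_positive D a \<longleftrightarrow> (\<exists>b\<in>ca_carr D. a = ca_mul D (ca_star D b) b)"

definition ca_pos1 :: "'a cstar_alg \<Rightarrow> 'a \<Rightarrow> bool" where
  "ca_pos1 D a \<longleftrightarrow> ca_positive D a \<and> ca_norm D a \<le> 1"

definition ca_closure :: "'a cstar_alg \<Rightarrow> 'a set \<Rightarrow> 'a set" where
  "ca_closure D S = {x \<in> ca_carr D. \<forall>e>0. \<exists>y\<in>S. ca_norm D (ca_minus D x y) < e}"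

definition closed_ideal :: "'a cstar_alg \<Rightarrow> 'a set \<Rightarrow> bool" where
  "closed_ideal D I \<longleftrightarrow> I \<subseteq> ca_carr D \<and> ca_zero D \<in> I \<and>
     (\<forall>x\<in>I. \<forall>y\<in>I. ca_add D x y \<in> I) \<and> (\<forall>c. \<forall>x\<in>I. ca_smul D c x \<in> I) \<and>
     (\<forall>x\<in>ca_carr D. \<forall>i\<in>I. ca_mul D x i \<in> I \<and> ca_mul D i x \<in> I) \<and>
     ca_closure D I = I"

definition simple_alg :: "'a cstar_alg \<Rightarrow> bool" where
  "simple_alg D \<longleftrightarrow> (\<forall>I. closed_ideal D I \<longrightarrow> I = {ca_zero D} \<or> I = ca_carr D)"

definition ca_span :: "'a cstar_alg \<Rightarrow> 'a set \<Rightarrow> 'a set" where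
  "ca_span D S = {ca_sum D (\<lambda>v. ca_smul D (c v) v) S | c. True}"

definition infinite_dim :: "'a cstar_alg \<Rightarrow> bool" where
  "infinite_dim D \<longleftrightarrow> \<not> (\<exists>S. finite S \<and> S \<subseteq> ca_carr D \<and> ca_carr D \<subseteq> ca_span D S)"

definition subalg :: "'a cstar_alg \<Rightarrow> 'a set \<Rightarrow> 'a cstar_alg" where
  "subalg D S = D\<lparr>ca_carr := S\<rparr>"

definition cstar_subalgebra :: "'a cstar_alg \<Rightarrow> 'a set \<Rightarrow> bool" where
  "cstar_subalgebra D B \<longleftrightarrow> B \<subseteq> ca_carr D \<and> ca_zero D \<in> B \<and>
     (\<forall>x\<in>B. \<forall>y\<in>B. ca_add D x y \<in> B \<and> ca_mul D x y \<in> B) \<and>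
     (\<forall>c. \<forall>x\<in>B. ca_smul D c x \<in> B) \<and> (\<forall>x\<in>B. ca_star D x \<in> B) \<and>
     ca_closure D B = B"

definition hered :: "'a cstar_alg \<Rightarrow> 'a \<Rightarrow> 'a set" where
  "hered D a = ca_closure D {ca_mul D a (ca_mul D x a) | x. x \<in> ca_carr D}"

definition star_iso :: "'a cstar_alg \<Rightarrow> 'b cstar_alg \<Rightarrow> ('a \<Rightarrow> 'b) \<Rightarrow> bool" where
  "star_iso D E \<phi> \<longleftrightarrow> bij_betw \<phi> (ca_carr D) (ca_carr E) \<and>
     (\<forall>x\<in>ca_carr D. \<forall>y\<in>ca_carr D.
        \<phi> (ca_add D x y) = ca_add E (\<phi> x) (\<phi> y) \<and>
        \<phi> (ca_mul D x y) = ca_mul E (\<phi> x) (\<phi> y)) \<and>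
     (\<forall>x\<in>ca_carr D. \<phi> (ca_star D x) = ca_star E (\<phi> x) \<and>
        (\<forall>c. \<phi> (ca_smul D c x) = ca_smul E c (\<phi> x)))"

section \<open>Matrix algebras M_m(D) with their C*-norm (operator norm on the Hilbert module D^m)\<close>

definition mat_vec :: "'a cstar_alg \<Rightarrow> nat \<Rightarrow> (nat \<Rightarrow> nat \<Rightarrow> 'a) \<Rightarrow> (nat \<Rightarrow> 'a) \<Rightarrow> (nat \<Rightarrow> 'a)" where
  "mat_vec D m X v = (\<lambda>i. ca_sum D (\<lambda>k. ca_mul D (X i k) (v k)) {..<m})"

definition vec_inner :: "'a cstar_alg \<Rightarrow> nat \<Rightarrow> (nat \<Rightarrow> 'a) \<Rightarrow> (nat \<Rightarrow> 'a) \<Rightarrow> 'a" where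
  "vec_inner D m v w = ca_sum D (\<lambda>i. ca_mul D (ca_star D (v i)) (w i)) {..<m}"

definition matrix_alg :: "'a cstar_alg \<Rightarrow> nat \<Rightarrow> (nat \<Rightarrow> nat \<Rightarrow> 'a) cstar_alg" where
  "matrix_alg D m = \<lparr>
     ca_carr = {X. (\<forall>i<m. \<forall>j<m. X i j \<in> ca_carr D) \<and>
                   (\<forall>i j. \<not> (i < m \<and> j < m) \<longrightarrow> X i j = ca_zero D)},
     ca_zero = (\<lambda>i j. ca_zero D),
     ca_add = (\<lambda>X Y i j. if i < m \<and> j < m then ca_add D (X i j) (Y i j) else ca_zero D),
     ca_smul = (\<lambda>c X i j. if i < m \<and> j < m then ca_smul D c (X i j) else ca_zero D),
     ca_mul = (\<lambda>X Y i j. if i < m \<and> j < m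
                  then ca_sum D (\<lambda>k. ca_mul D (X i k) (Y k j)) {..<m} else ca_zero D),
     ca_star = (\<lambda>X i j. if i < m \<and> j < m then ca_star D (X j i) else ca_zero D),
     ca_norm = (\<lambda>X. Sup {sqrt (ca_norm D (vec_inner D m (mat_vec D m X v) (mat_vec D m X v))) | v.
                   (\<forall>i<m. v i \<in> ca_carr D) \<and> ca_norm D (vec_inner D m v v) \<le> 1})
   \<rparr>"

definition corner :: "'a cstar_alg \<Rightarrow> 'a \<Rightarrow> (nat \<Rightarrow> nat \<Rightarrow> 'a)" where
  "corner D a = (\<lambda>i j. if i = 0 \<and> j = 0 then a else ca_zero D)"

text \<open>Cuntz subequivalence \<open>a \<precsim>_D b\<close>: \<open>D \<otimes> K\<close> is the closure of the increasing union of
  the matrix algebras \<open>M_m(D)\<close> (with \<open>a\<close> identified with \<open>a \<oplus> 0\<close>), so approximating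
  \<open>a\<close> by \<open>x^* b x\<close> with \<open>x \<in> D \<otimes> K\<close> amounts to approximating with \<open>x \<in> M_m(D)\<close>.\<close>
definition cuntz_below :: "'a cstar_alg \<Rightarrow> 'a \<Rightarrow> 'a \<Rightarrow> bool" where
  "cuntz_below D a b \<longleftrightarrow>
    (\<forall>e>0. \<exists>m\<ge>1. \<exists>X\<in>ca_carr (matrix_alg D m).
       ca_norm (matrix_alg D m)
         (ca_minus (matrix_alg D m) (corner D a)
            (ca_mul (matrix_alg D m) (ca_mul (matrix_alg D m) (ca_star (matrix_alg D m) X) (corner D b)) X))
       < e)"

definition star_automorphism :: "'a cstar_alg \<Rightarrow> ('a \<Rightarrow> 'a) \<Rightarrow> bool" where
  "star_automorphism D \<phi> \<longleftrightarrow> star_iso D D \<phi>"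

definition group_action :: "('g, 'b) monoid_scheme \<Rightarrow> 'a cstar_alg \<Rightarrow> ('g \<Rightarrow> 'a \<Rightarrow> 'a) \<Rightarrow> bool" where
  "group_action G D \<alpha> \<longleftrightarrow>
     (\<forall>g\<in>carrier G. star_automorphism D (\<alpha> g)) \<and>
     (\<forall>x\<in>ca_carr D. \<alpha> \<one>\<^bsub>G\<^esub> x = x) \<and>
     (\<forall>g\<in>carrier G. \<forall>h\<in>carrier G. \<forall>x\<in>ca_carr D. \<alpha> (g \<otimes>\<^bsub>G\<^esub> h) x = \<alpha> g (\<alpha> h x))"

text \<open>Elements of \<open>A \<rtimes>_\<alpha> G\<close> are written \<open>\<Sum>_g x(g) u_g\<close>, i.e. functions \<open>G \<rightarrow> A\<close>;
  product \<open>(a u_h)(b u_k) = a \<alpha>_h(b) u_{hk}\<close>, adjoint \<open>(a u_h)^* = \<alpha>_{h^{-1}}(a^*) u_{h^{-1}}\<close>.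
  The norm is that of the (left) regular representation on the Hilbert module
  \<open>\<ell>^2(G, A)\<close>; for finite \<open>G\<close> full and reduced crossed products coincide.\<close>

definition cp_rep :: "('g, 'b) monoid_scheme \<Rightarrow> 'a cstar_alg \<Rightarrow> ('g \<Rightarrow> 'a \<Rightarrow> 'a)
     \<Rightarrow> ('g \<Rightarrow> 'a) \<Rightarrow> ('g \<Rightarrow> 'a) \<Rightarrow> ('g \<Rightarrow> 'a)" where
  "cp_rep G A \<alpha> x v = (\<lambda>g. ca_sum A
      (\<lambda>h. ca_mul A (\<alpha> (inv\<^bsub>G\<^esub> g) (x h)) (v (inv\<^bsub>G\<^esub> h \<otimes>\<^bsub>G\<^esub> g))) (carrier G))"

definition cp_inner :: "('g, 'b) monoid_scheme \<Rightarrow> 'a cstar_alg \<Rightarrow> ('g \<Rightarrow> 'a) \<Rightarrow> ('g \<Rightarrow> 'a) \<Rightarrow> 'a" where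
  "cp_inner G A v w = ca_sum A (\<lambda>g. ca_mul A (ca_star A (v g)) (w g)) (carrier G)"

definition crossed_product :: "'a cstar_alg \<Rightarrow> ('g, 'b) monoid_scheme \<Rightarrow> ('g \<Rightarrow> 'a \<Rightarrow> 'a)
     \<Rightarrow> ('g \<Rightarrow> 'a) cstar_alg" where
  "crossed_product A G \<alpha> = \<lparr>
     ca_carr = {x. (\<forall>g\<in>carrier G. x g \<in> ca_carr A) \<and> (\<forall>g. g \<notin> carrier G \<longrightarrow> x g = ca_zero A)},
     ca_zero = (\<lambda>g. ca_zero A),
     ca_add = (\<lambda>x y g. if g \<in> carrier G then ca_add A (x g) (y g) else ca_zero A),
     ca_smul = (\<lambda>c x g. if g \<in> carrier G then ca_smul A c (x g) else ca_zero A),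
     ca_mul = (\<lambda>x y g. if g \<in> carrier G then
                 ca_sum A (\<lambda>h. ca_mul A (x h) (\<alpha> h (y (inv\<^bsub>G\<^esub> h \<otimes>\<^bsub>G\<^esub> g)))) (carrier G)
               else ca_zero A),
     ca_star = (\<lambda>x g. if g \<in> carrier G then \<alpha> g (ca_star A (x (inv\<^bsub>G\<^esub> g))) else ca_zero A),
     ca_norm = (\<lambda>x. Sup {sqrt (ca_norm A (cp_inner G A (cp_rep G A \<alpha> x v) (cp_rep G A \<alpha> x v))) | v.
                   (\<forall>g\<in>carrier G. v g \<in> ca_carr A) \<and> ca_norm A (cp_inner G A v v) \<le> 1})
   \<rparr>"

definition weak_tracial_rokhlin :: "'a cstar_alg \<Rightarrow> ('g, 'b) monoid_scheme \<Rightarrow> ('g \<Rightarrow> 'a \<Rightarrow> 'a) \<Rightarrow> bool" where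
  "weak_tracial_rokhlin A G \<alpha> \<longleftrightarrow>
    (\<forall>F e s. finite F \<and> F \<subseteq> ca_carr A \<and> e > 0 \<and> ca_positive A s \<and> s \<in> ca_carr A \<and> ca_norm A s = 1 \<longrightarrow>
      (\<exists>f :: 'g \<Rightarrow> 'a.
         (\<forall>g\<in>carrier G. f g \<in> ca_carr A \<and> ca_pos1 A (f g)) \<and>
         (\<forall>g\<in>carrier G. \<forall>h\<in>carrier G. g \<noteq> h \<longrightarrow> ca_mul A (f g) (f h) = ca_zero A) \<and>
         (\<forall>x\<in>F. \<forall>g\<in>carrier G. ca_norm A (ca_minus A (ca_mul A (f g) x) (ca_mul A x (f g))) < e) \<and>
         (\<forall>g\<in>carrier G. \<forall>h\<in>carrier G. ca_norm A (ca_minus A (\<alpha> g (f h)) (f (g \<otimes>\<^bsub>G\<^esub> h))) < e) \<and>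
         (let ff = ca_sum A f (carrier G) in
            cuntz_below A (ca_minus A (ca_one A) ff) s \<and>
            ca_norm A (ca_mul A ff (ca_mul A s ff)) > 1 - e)))"

end

theory Submission
  imports Defs "HOL-Analysis.Analysis" "HOL-Computational_Algebra.Fundamental_Theorem_Algebra"
begin

text \<open>All unital C*-algebras given by records on one carrier type embed into a single bounded product,
  an instance of a type class of unital C*-algebras, where functional calculus and Cuntz
  comparison are available; \<open>A \<rtimes> G\<close> sits there with a central unit.

  For Rokhlin elements \<open>f g\<close> the elements \<open>f g * u g * w\<close>, with \<open>w\<close> a function of \<open>f \<one>\<close>, have
  orthogonal ranges. Their polar parts, weighted by a function of \<open>f \<one>\<close>, are exact matrix units
  over a positive contraction in \<open>A\<close> acting as a unit on the cut-off \<open>a = (f \<one> - \<omega>)\<^sub>+\<close>, so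
  they span a copy of \<open>M\<^sub>n\<close> over the hereditary subalgebra of \<open>a\<close>. Its diagonal element with all
  entries \<open>a\<close> is close to \<open>\<Sum>g. f g\<close>, and \<open>d\<close> is a truncation of it; truncating makes \<open>1 - d\<close> Cuntz below
  \<open>1 - \<Sum>g. f g\<close>, hence below a positive element of \<open>A\<close> chosen below \<open>s\<close>. The norm estimate holds
  for every almost central positive contraction \<open>d\<close> of norm near \<open>1\<close>: a cut-off of \<open>x\<^sup>* x\<close> near its
  norm generates the full ideal, so it cannot be almost orthogonal to \<open>d\<close>.\<close>

section \<open>C*-algebras as a type class\<close>

text \<open>The Rokhlin elements are neither projections nor exactly permuted by the action, while
  \<open>B\<close> must be an exact copy of a matrix algebra. Exact relations come out of polar
  decomposition, whose partial isometries lie outside a C*-algebra in general; multiplying them by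
  the root of some \<open>c\<close> below all the moduli brings them back inside. The cut-off
  \<open>a\<close> starts at the level from which \<open>c\<close> is 1, which is why
  \<open>c\<close> acts on it as a unit. A second obstacle is that \<open>s\<close> lives in the
  crossed product while the Rokhlin property speaks of \<open>A\<close> only. Compressing
  \<open>s\<close> by a single \<open>f g\<close> nearly removes the coefficients away from the
  identity of \<open>G\<close>, since the other translates of \<open>f g\<close> are nearly
  orthogonal to it; what remains is close to the compressed conditional expectation of
  \<open>s\<close>. The same device shows that nonzero ideals of the crossed product meet
  \<open>A\<close>, which is where simplicity enters the norm estimate. Tolerances are fixed before
  the Rokhlin elements are chosen, so the estimates on functional calculus and polar parts are
  uniform over norm balls.\<close>

text \<open>Complex scalars are encoded by the central element \<open>iu\<close>.\<close>
class cstar = real_normed_algebra_1 + banach +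
  fixes adj :: "'a \<Rightarrow> 'a" and iu :: 'a
  assumes adj_add: "adj (x + y) = adj x + adj y"
    and adj_mult: "adj (x * y) = adj y * adj x"
    and adj_adj [simp]: "adj (adj x) = x"
    and adj_scaleR: "adj (r *\<^sub>R x) = r *\<^sub>R adj x"
    and iu_iu: "iu * iu = - 1"
    and iu_comm: "iu * x = x * iu"
    and adj_iu: "adj iu = - iu"
    and cstar_norm: "norm (adj x * x) = (norm x)\<^sup>2"

lemma adj_zero [simp]: "adj (0::'a::cstar) = 0"
  using adj_add[of "0::'a" 0] by simp

lemma adj_minus: "adj (- x) = - adj (x::'a::cstar)"
  using adj_add[of x "-x"] by (simp add: eq_neg_iff_add_eq_0 add.commute)

lemma adj_diff: "adj (x - y) = adj x - adj (y::'a::cstar)"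
  using adj_add[of x "-y"] by (simp add: adj_minus)

lemma adj_one [simp]: "adj (1::'a::cstar) = 1"
  using adj_mult[of 1 "adj (1::'a)"] by simp

lemma adj_of_real [simp]: "adj (of_real r) = (of_real r :: 'a::cstar)"
  by (simp add: of_real_def adj_scaleR)

lemma adj_sum: "adj (sum f S) = (\<Sum>i\<in>S. adj (f i :: 'a::cstar))"
  by (induction S rule: infinite_finite_induct) (auto simp: adj_add)

lemma norm_adj [simp]: "norm (adj x) = norm (x::'a::cstar)"
proof -
  have *: "norm y \<le> norm (adj y)" for y :: 'a
  proof (cases "y = 0")
    case False
    have "norm y * norm y \<le> norm (adj y) * norm y"
      using cstar_norm[of y] norm_mult_ineq[of "adj y" y] unfolding power2_eq_square by linarith
    then show ?thesis using False by simp
  qed auto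
  show ?thesis using *[of x] *[of "adj x"] by simp
qed

lemma cstar_norm': "norm (x * adj x) = (norm (x::'a::cstar))\<^sup>2"
  using cstar_norm[of "adj x"] by simp

lemma norm_sq_sa: "adj x = x \<Longrightarrow> norm (x * x) = (norm (x::'a::cstar))\<^sup>2"
  using cstar_norm[of x] by simp

lemma of_real_commute: "(x::'a::real_algebra_1) * of_real r = of_real r * x"
  by (simp add: of_real_def)

lemma bounded_linear_adj: "bounded_linear (adj :: 'a::cstar \<Rightarrow> 'a)"
  by (rule bounded_linear_intro[where K=1]) (auto simp: adj_add adj_scaleR)

lemmas tendsto_adj [tendsto_intros] = bounded_linear.tendsto[OF bounded_linear_adj]

section \<open>Square roots by iteration and the positive cone\<close>

lemma commute_mult:
  fixes a b z :: "'a::semigroup_mult"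
  assumes "a * z = z * a" "b * z = z * b" shows "a * b * z = z * (a * b)"
proof -
  have "a * b * z = a * (z * b)" by (simp only: assms mult.assoc)
  also have "\<dots> = (a * z) * b" by (simp only: mult.assoc)
  also have "\<dots> = z * (a * b)" by (simp only: assms(1) mult.assoc)
  finally show ?thesis .
qed

text \<open>The fixed points of the map taking \<open>y\<close> to half of \<open>x + y * y\<close>
  are exactly the solutions of \<open>(1 - y) * (1 - y) = 1 - x\<close>, so iterating it from 0
  yields a square root without spectral theory. The commutation clause survives because every
  iterate is a polynomial in \<open>x\<close>.\<close>

lemma sqrt_one_minus:
  fixes x :: "'a::cstar"
  assumes nx: "norm x \<le> 1" and sa: "adj x = x"
  obtains y where "adj y = y" "norm y \<le> 1" "(1 - y) * (1 - y) = 1 - x"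
    "\<And>z. x * z = z * x \<Longrightarrow> y * z = z * y"
proof -
  define Y where "Y = rec_nat 0 (\<lambda>_ y. (1/2) *\<^sub>R (x + y * y))"
  \<comment> \<open>The same recursion for the scalar \<open>x = 1\<close> is a majorant: it
    increases within [0, 1], hence is Cauchy, and its increments bound those of \<open>Y\<close>,
    even if \<open>norm x = 1\<close> and the map is no strict contraction.\<close>
  define t where "t = rec_nat (0::real) (\<lambda>_ s. (1/2) * (1 + s * s))"
  have Y0: "Y 0 = 0" and YS: "Y (Suc n) = (1/2) *\<^sub>R (x + Y n * Y n)" for n by (auto simp: Y_def)
  have t0: "t 0 = 0" and tS: "t (Suc n) = (1/2) * (1 + t n * t n)" for n by (auto simp: t_def)
  have t01: "0 \<le> t n \<and> t n \<le> 1" for n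
  proof (induction n)
    case (Suc n)
    then have "t n * t n \<le> 1" by (simp add: mult_le_one)
    with Suc show ?case by (simp add: tS)
  qed (simp add: t0)
  have nY: "norm (Y n) \<le> t n" for n
  proof (induction n)
    case (Suc n)
    have "norm (Y n * Y n) \<le> t n * t n"
      using norm_mult_ineq[of "Y n" "Y n"] mult_mono[OF Suc Suc] t01 by (meson norm_ge_zero order_trans)
    then have "norm (x + Y n * Y n) \<le> 1 + t n * t n" using nx norm_triangle_ineq[of x "Y n * Y n"] by linarith
    then show ?case by (simp add: YS tS)
  qed (simp add: Y0 t0)
  have step: "norm (Y (Suc n) - Y n) \<le> t (Suc n) - t n" for n
  proof (induction n)
    case 0
    show ?case using nx by (simp add: YS Y0 tS t0)
  next
    case (Suc n)
    let ?a = "Y (Suc n)" and ?b = "Y n"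
    \<comment> \<open>Difference of two squares in noncommutative form; thus the increments of
      \<open>Y\<close> obey the recursion of the increments of \<open>t\<close>.\<close>
    have eq: "Y (Suc (Suc n)) - ?a = (1/2) *\<^sub>R (?a * (?a - ?b) + (?a - ?b) * ?b)"
      by (simp add: YS[of "Suc n"] YS[of n] algebra_simps flip: scaleR_diff_right)
        (simp add: YS[of n] algebra_simps)
    have "norm (?a * (?a - ?b) + (?a - ?b) * ?b) \<le> norm (?a * (?a - ?b)) + norm ((?a - ?b) * ?b)"
      by (rule norm_triangle_ineq)
    also have "\<dots> \<le> norm ?a * norm (?a - ?b) + norm (?a - ?b) * norm ?b"
      by (intro add_mono norm_mult_ineq)
    also have "\<dots> \<le> t (Suc n) * (t (Suc n) - t n) + (t (Suc n) - t n) * t n"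
      by (intro add_mono mult_mono nY Suc) (use t01 order_trans[OF norm_ge_zero Suc] in auto)
    also have "\<dots> = t (Suc n) * t (Suc n) - t n * t n" by (simp add: algebra_simps)
    finally have "norm (?a * (?a - ?b) + (?a - ?b) * ?b) \<le> t (Suc n) * t (Suc n) - t n * t n" .
    moreover have "t (Suc (Suc n)) - t (Suc n) = (1/2) * (t (Suc n) * t (Suc n) - t n * t n)"
      by (simp add: tS[of "Suc n"] tS[of n] algebra_simps)
    ultimately show ?case unfolding eq by simp
  qed
  have "incseq t"
  proof (rule incseq_SucI)
    fix n show "t n \<le> t (Suc n)" using order_trans[OF norm_ge_zero step[of n]] by simp
  qed
  then obtain l where "t \<longlonglongrightarrow> l" using incseq_convergent[of t 1] t01 by blast
  then have Ct: "Cauchy t" using convergent_Cauchy convergentI by blast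
  have diff: "m \<le> n \<Longrightarrow> norm (Y n - Y m) \<le> t n - t m" for m n
  proof (induction n rule: dec_induct)
    case (step n)
    have "norm (Y (Suc n) - Y m) \<le> norm (Y (Suc n) - Y n) + norm (Y n - Y m)"
      using norm_triangle_ineq[of "Y (Suc n) - Y n" "Y n - Y m"] by simp
    then show ?case using step(3) \<open>\<And>n. norm (Y (Suc n) - Y n) \<le> t (Suc n) - t n\<close>[of n] by linarith
  qed simp
  have "Cauchy Y"
  proof (rule CauchyI)
    fix e :: real assume "0 < e"
    then obtain M where M: "\<forall>m\<ge>M. \<forall>n\<ge>M. norm (t m - t n) < e" using CauchyD[OF Ct] by blast
    show "\<exists>M. \<forall>m\<ge>M. \<forall>n\<ge>M. norm (Y m - Y n) < e"
    proof (intro exI allI impI)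
      fix m n assume "M \<le> m" "M \<le> n"
      then show "norm (Y m - Y n) < e"
        using M[rule_format, of m n] M[rule_format, of n m] diff[of m n] diff[of n m] 
        by (cases "m \<le> n") (auto simp: norm_minus_commute)
    qed
  qed
  then obtain y where y: "Y \<longlonglongrightarrow> y" using Cauchy_convergent convergent_def by blast
  have "(\<lambda>n. Y (Suc n)) \<longlonglongrightarrow> (1/2) *\<^sub>R (x + y * y)"
    unfolding YS by (intro tendsto_intros y)
  then have fixp: "y = (1/2) *\<^sub>R (x + y * y)"
    using LIMSEQ_Suc[OF y] LIMSEQ_unique by blast
  have "adj (Y n) = Y n" for n by (induction n) (auto simp: Y0 YS adj_scaleR adj_add adj_mult sa)
  then have 1: "adj y = y" using tendsto_adj[OF y] LIMSEQ_unique y by simp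
  have 2: "norm y \<le> 1"
    by (rule LIMSEQ_le_const2[OF tendsto_norm[OF y]]) (intro exI allI impI, rule order_trans[OF nY], simp add: t01)
  have "2 *\<^sub>R y = x + y * y" using arg_cong[OF fixp, of "\<lambda>z. 2 *\<^sub>R z"] by simp
  then have 3: "(1 - y) * (1 - y) = 1 - x" by (simp add: algebra_simps scaleR_2)
  have 4: "y * z = z * y" if z: "x * z = z * x" for z
  proof -
    have c: "Y n * z = z * Y n" for n
    proof (induction n)
      case (Suc n)
      have "Y n * Y n * z = z * (Y n * Y n)" by (rule commute_mult[OF Suc Suc])
      then show ?case by (simp add: YS distrib_left distrib_right z)
    qed (simp add: Y0)
    have "(\<lambda>n. Y n * z) \<longlonglongrightarrow> y * z" "(\<lambda>n. z * Y n) \<longlonglongrightarrow> z * y" by (intro tendsto_intros y)+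
    then show ?thesis using LIMSEQ_unique by (fastforce simp: c)
  qed
  show ?thesis by (rule that[OF 1 2 3 4])
qed

subsection \<open>Positive elements\<close>

text \<open>For self-adjoint \<open>b\<close> the norm condition says that the spectrum lies in
  \<open>[0, 2 * M]\<close>. In this form no spectrum is mentioned and closure under sums is
  visible; that every \<open>adj x * x\<close> is positive is a theorem proved after the functional
  calculus.\<close>

definition pos :: "'a::cstar \<Rightarrow> bool" where
  "pos b \<longleftrightarrow> adj b = b \<and> (\<exists>M. norm (of_real M - b) \<le> M)"

lemma posI: "adj b = b \<Longrightarrow> norm (of_real M - b) \<le> M \<Longrightarrow> pos b"
  by (auto simp: pos_def)

lemma pos_sa: "pos b \<Longrightarrow> adj b = b" by (simp add: pos_def)

text \<open>The element \<open>u = y + iu * s\<close> is normal with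
  \<open>adj u * u = y * y + s * s\<close> and real part \<open>y\<close>, and a real part is never
  longer than the element. This substitutes for monotonicity of the norm while the order is not yet
  available.\<close>

lemma norm_le_sum_squares:
  fixes y s :: "'a::cstar"
  assumes "adj y = y" "adj s = s" "y * s = s * y"
  shows "norm (y * y) \<le> norm (y * y + s * s)"
proof -
  define u where "u = y + iu * s"
  have au: "adj u = y - iu * s"
    by (simp add: u_def adj_add adj_mult adj_iu assms iu_comm)
  have a: "iu * s * (iu * s) = - (s * s)"
  proof -
    have "iu * s * (iu * s) = iu * (s * iu) * s" by (simp only: mult.assoc)
    also have "\<dots> = iu * iu * s * s" by (simp only: iu_comm[of s, symmetric] mult.assoc)
    finally show ?thesis by (simp add: iu_iu)
  qed
  have b: "y * (iu * s) = iu * s * y"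
    using iu_comm[of y] assms(3) by (metis mult.assoc)
  have "adj u * u = y * y + s * s" unfolding au unfolding u_def
    by (simp add: distrib_left distrib_right left_diff_distrib right_diff_distrib a b)
  then have n: "norm (y * y + s * s) = (norm u)\<^sup>2" using cstar_norm[of u] by simp
  have "2 *\<^sub>R y = u + adj u" unfolding au unfolding u_def by (simp add: scaleR_2)
  then have "2 * norm y \<le> norm u + norm (adj u)" 
    using norm_triangle_ineq[of u "adj u"] by (metis abs_numeral norm_scaleR)
  then have "norm y \<le> norm u" by simp
  then show ?thesis unfolding n norm_sq_sa[OF assms(1)] by (simp add: power_mono)
qed

text \<open>Rescaling by the constant \<open>M\<close> of the definition turns \<open>b\<close> into
  \<open>1 - x\<close> with \<open>norm x \<le> 1\<close>. That the root commutes with the whole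
  commutant of \<open>b\<close> makes roots of commuting elements commute.\<close>

lemma pos_sqrt:
  fixes b :: "'a::cstar"
  assumes "pos b"
  obtains s where "adj s = s" "s * s = b" "pos s" "\<And>z. b * z = z * b \<Longrightarrow> s * z = z * s"
proof -
  from assms obtain M where sa: "adj b = b" and M: "norm (of_real M - b) \<le> M" by (auto simp: pos_def)
  have M0: "0 \<le> M" using M norm_ge_zero order_trans by blast
  show ?thesis
  proof (cases "M = 0")
    case True
    then have "b = 0" using M by simp
    then show ?thesis using that[of 0] posI[of 0 0] by simp
  next
    case False
    then have Mp: "M > 0" using M0 by simp
    define x where "x = 1 - (1/M) *\<^sub>R b"
    have "norm x = (1/M) * norm (of_real M - b)"
    proof -
      have "x = (1/M) *\<^sub>R (of_real M - b)" using Mp by (simp add: x_def of_real_def algebra_simps)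
      then show ?thesis using Mp by simp
    qed
    then have nx: "norm x \<le> 1" using M Mp by (simp add: pos_divide_le_eq)
    have sx: "adj x = x" by (simp add: x_def adj_diff adj_scaleR sa)
    obtain y where y: "adj y = y" "norm y \<le> 1" "(1 - y) * (1 - y) = 1 - x"
      "\<And>z. x * z = z * x \<Longrightarrow> y * z = z * y" using sqrt_one_minus[OF nx sx] by metis
    define s where "s = sqrt M *\<^sub>R (1 - y)"
    have "s * s = (sqrt M * sqrt M) *\<^sub>R ((1 - y) * (1 - y))" by (simp only: s_def mult_scaleR_left mult_scaleR_right scaleR_scaleR)
    also have "\<dots> = b" using Mp by (simp add: y(3) x_def)
    finally have ss: "s * s = b" .
    have "of_real (sqrt M) - s = sqrt M *\<^sub>R y" by (simp add: s_def of_real_def algebra_simps)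
    then have ps: "norm (of_real (sqrt M) - s) \<le> sqrt M" using y(2) Mp by (simp add: mult_left_le)
    have as: "adj s = s" by (simp add: s_def adj_diff adj_scaleR y)
    have cs: "s * z = z * s" if "b * z = z * b" for z
    proof -
      have "x * z = z * x" using that by (simp add: x_def algebra_simps)
      then show ?thesis using y(4) by (simp add: s_def algebra_simps)
    qed
    show ?thesis by (rule that[OF as ss posI[OF as ps] cs])
  qed
qed

text \<open>For \<open>w\<close> obtained from the root of \<open>1 - y * y\<close>, the commuting
  elements \<open>1 - w\<close> and \<open>y\<close> have squares adding up to 1, and the norm of
  one square is at most that of the sum.\<close>

lemma pos_square_aux:
  fixes y :: "'a::cstar"
  assumes sa: "adj y = y" and ny: "norm y \<le> 1"
  shows "norm (1 - y * y) \<le> 1"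
proof -
  have "norm (y * y) \<le> 1" using norm_mult_ineq[of y y] ny by (meson mult_le_one norm_ge_zero order_trans)
  moreover have "adj (y * y) = y * y" by (simp add: adj_mult sa)
  ultimately obtain w where w: "adj w = w" "(1 - w) * (1 - w) = 1 - y * y"
      "\<And>z. (y * y) * z = z * (y * y) \<Longrightarrow> w * z = z * w" using sqrt_one_minus by metis
  have "w * y = y * w" using w(3)[of y] by (simp add: mult.assoc)
  then have "norm ((1 - w) * (1 - w)) \<le> norm ((1 - w) * (1 - w) + y * y)"
    by (intro norm_le_sum_squares) (auto simp: adj_diff w sa algebra_simps)
  then show ?thesis by (simp add: w)
qed

lemma pos_scaleR:
  assumes "pos b" "0 \<le> r" shows "pos (r *\<^sub>R b)"
proof -
  from assms obtain M where sa: "adj b = b" and M: "norm (of_real M - b) \<le> M" by (auto simp: pos_def)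
  have "of_real (r * M) - r *\<^sub>R b = r *\<^sub>R (of_real M - b)" by (simp add: of_real_def algebra_simps)
  then have "norm (of_real (r * M) - r *\<^sub>R b) \<le> r * M" using M assms(2) by (simp add: mult_left_mono)
  then show ?thesis unfolding pos_def using sa by (auto simp: adj_scaleR simp del: of_real_mult)
qed

lemma pos_square:
  fixes y :: "'a::cstar"
  assumes sa: "adj y = y"
  shows "pos (y * y)"
proof (cases "y = 0")
  case False
  define z where "z = (1 / norm y) *\<^sub>R y"
  have "adj z = z" "norm z \<le> 1" using False by (auto simp: z_def adj_scaleR sa)
  then have "norm (of_real 1 - z * z) \<le> 1" using pos_square_aux by simp
  then have "pos (z * z)" using \<open>adj z = z\<close> by (intro posI[where M=1]) (auto simp: adj_mult)
  then have "pos ((norm y)\<^sup>2 *\<^sub>R (z * z))" by (rule pos_scaleR) simp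
  moreover have "(norm y)\<^sup>2 *\<^sub>R (z * z) = y * y" using False by (simp add: z_def power2_eq_square)
  ultimately show ?thesis by simp
qed (auto intro: posI[where M=0])

lemma pos_add:
  assumes "pos a" "pos b" shows "pos (a + b)"
proof -
  from assms obtain M N where M: "norm (of_real M - a) \<le> M" and N: "norm (of_real N - b) \<le> N" and "adj a = a" "adj b = b"
    by (auto simp: pos_def)
  have "of_real (M + N) - (a + b) = (of_real M - a) + (of_real N - b)" by simp
  then have "norm (of_real (M + N) - (a + b)) \<le> M + N"
    using norm_triangle_ineq[of "of_real M - a" "of_real N - b"] M N by (metis add_mono order_trans)
  then show ?thesis using \<open>adj a = a\<close> \<open>adj b = b\<close> by (intro posI[where M="M+N"]) (simp_all add: adj_add)
qed

lemma pos_0 [simp]: "pos 0"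
  by (auto intro: posI[where M=0])

lemma pos_of_real: "0 \<le> r \<Longrightarrow> pos (of_real r)"
  by (auto intro: posI[where M=r])

lemma pos_sum: "(\<And>i. i \<in> S \<Longrightarrow> pos (f i)) \<Longrightarrow> pos (sum f S)"
  by (induction S rule: infinite_finite_induct) (auto intro: pos_add)

lemma pos_of_real_minus: "adj a = a \<Longrightarrow> norm a \<le> r \<Longrightarrow> pos (of_real r - a)"
  by (auto simp: adj_diff intro: posI[where M=r])

lemma pos_of_real_plus: "adj a = a \<Longrightarrow> norm a \<le> r \<Longrightarrow> pos (of_real r + a)"
  using pos_of_real_minus[of "-a" r] by (simp add: adj_minus)

text \<open>The product is the square of the product of the two roots, which commute because each
  root commutes with the commutant of its element.\<close>

lemma pos_commute_mult:
  assumes "pos a" "pos b" "a * b = b * a" shows "pos (a * b)"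
proof -
  obtain s where s: "adj s = s" "s * s = a" "\<And>z. a * z = z * a \<Longrightarrow> s * z = z * s" using pos_sqrt[OF assms(1)] by metis
  obtain t where t: "adj t = t" "t * t = b" "\<And>z. b * z = z * b \<Longrightarrow> t * z = z * t" using pos_sqrt[OF assms(2)] by metis
  have "s * b = b * s" using s(3) assms(3) by simp
  then have st: "t * s = s * t" using t(3)[of s] by simp
  have "adj (s * t) = s * t" by (simp add: adj_mult s t st)
  then have "pos ((s * t) * (s * t))" by (rule pos_square)
  moreover have "(s * t) * (s * t) = a * b" by (metis mult.assoc s(2) st t(2))
  ultimately show ?thesis by simp
qed

text \<open>The roots of \<open>a\<close> and of \<open>of_real r - a\<close> commute and their
  squares add up to \<open>r\<close>. The absolute value is there because the sign of
  \<open>r\<close> is not known at this point.\<close>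

lemma pos_le_norm:
  assumes "pos a" "pos (of_real r - a)" shows "norm a \<le> \<bar>r\<bar>"
proof -
  obtain s where s: "adj s = s" "s * s = a" "\<And>z. a * z = z * a \<Longrightarrow> s * z = z * s" using pos_sqrt[OF assms(1)] by metis
  obtain t where t: "adj t = t" "t * t = of_real r - a" "\<And>z. (of_real r - a) * z = z * (of_real r - a) \<Longrightarrow> t * z = z * t"
    using pos_sqrt[OF assms(2)] by metis
  have "s * (of_real r - a) = (of_real r - a) * s" 
    by (rule s(3)) (simp add: of_real_def algebra_simps)
  then have "s * t = t * s" using t(3)[of s] by simp
  then have "norm (s * s) \<le> norm (s * s + t * t)" by (rule norm_le_sum_squares[OF s(1) t(1)])
  then show ?thesis by (simp add: s t)
qed

lemma pos_mono_norm:
  assumes a: "pos a" and ba: "pos (b - a)" shows "norm a \<le> norm b"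
proof -
  have b: "pos b" using pos_add[OF a ba] by simp
  have "pos ((b - a) + (of_real (norm b) - b))" 
    by (rule pos_add[OF ba pos_of_real_minus]) (simp_all add: pos_sa b)
  then have "pos (of_real (norm b) - a)" by simp
  then show ?thesis using pos_le_norm[OF a, of "norm b"] by simp
qed

lemma pos_antisym: "pos a \<Longrightarrow> pos (- a) \<Longrightarrow> a = 0"
  using pos_mono_norm[of a 0] by simp

text \<open>The commuting positive factors \<open>of_real r - y\<close> and
  \<open>of_real r + y\<close> have product \<open>r\<^sup>2 - y * y\<close>. This converts two
  order bounds into a norm bound and is the source of the norm estimates for functional
  calculus.\<close>

lemma norm_le_if_pos:
  assumes sa: "adj y = y" and "0 \<le> r" "pos (of_real r - y)" "pos (of_real r + y)"
  shows "norm y \<le> r"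
proof -
  have "pos ((of_real r - y) * (of_real r + y))"
    by (rule pos_commute_mult) (use assms in \<open>auto simp: of_real_def algebra_simps\<close>)
  moreover have "(of_real r - y) * (of_real r + y) = of_real (r\<^sup>2) - y * y"
    by (simp add: of_real_def algebra_simps power2_eq_square)
  ultimately have "pos (of_real (r\<^sup>2) - y * y)" by simp
  then have "norm (y * y) \<le> r\<^sup>2" using pos_le_norm[OF pos_square[OF sa], of "r\<^sup>2"] by simp
  then show ?thesis using norm_sq_sa[OF sa] assms(2) by (simp add: power2_le_iff_abs_le)
qed

section \<open>Continuous functional calculus\<close>

subsection \<open>Polynomials\<close>

text \<open>Horner evaluation. The type is any real unital algebra rather than \<open>cstar\<close>,
  because the positivity proof below also evaluates at complex numbers.\<close>

definition peval :: "real poly \<Rightarrow> 'a::real_algebra_1 \<Rightarrow> 'a" where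
  "peval p a = fold_coeffs (\<lambda>c x. of_real c + a * x) p 0"

lemma peval_0 [simp]: "peval 0 a = 0"
  by (simp add: peval_def)

lemma peval_pCons [simp]: "peval (pCons c p) a = of_real c + a * peval p a"
  by (cases "p = 0 \<and> c = 0") (auto simp: peval_def)

lemma peval_add: "peval (p + q) a = peval p a + peval q a"
  by (induction p q rule: poly_induct2) (simp_all add: algebra_simps)

lemma peval_smult: "peval (smult c p) a = of_real c * peval p a"
  by (induction p) (simp_all add: of_real_def algebra_simps)

lemma peval_minus: "peval (- p) a = - peval p a"
  using peval_smult[of "-1" p a] by simp

lemma peval_diff: "peval (p - q) a = peval p a - peval q a"
  using peval_add[of p "-q" a] by (simp add: peval_minus)

lemma peval_mult: "peval (p * q) a = peval p a * peval q a"
  by (induction p) (simp_all add: peval_add peval_smult algebra_simps)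

lemma peval_intertwine:
  assumes "a * x = x * b" shows "peval p a * x = x * peval p b"
proof (induction p)
  case (pCons c p)
  have "a * peval p a * x = a * x * peval p b" by (simp only: mult.assoc pCons)
  also have "\<dots> = x * (b * peval p b)" by (simp only: assms mult.assoc)
  finally show ?case by (simp add: distrib_left distrib_right of_real_commute)
qed simp

lemma peval_self_commute: "a * peval p a = peval p a * a"
  by (rule peval_intertwine[symmetric]) simp

lemma adj_peval: "adj a = a \<Longrightarrow> adj (peval p (a::'a::cstar)) = peval p a"
  by (induction p) (simp_all add: adj_add adj_mult peval_self_commute)

lemma peval_of_real: "peval p (of_real t) = of_real (poly p t)"
  by (induction p) simp_all

lemma peval_complex: "peval p (z::complex) = poly (map_poly of_real p) z"
  by (induction p) (simp_all add: map_poly_pCons)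

text \<open>The operator inequalities \<open>m \<le> a \<le> M\<close>; they take the place of the
  inclusion of the spectrum of \<open>a\<close> in the interval from \<open>m\<close> to
  \<open>M\<close>.\<close>

definition btw :: "real \<Rightarrow> 'a::cstar \<Rightarrow> real \<Rightarrow> bool" where
  "btw m a M \<longleftrightarrow> pos (a - of_real m) \<and> pos (of_real M - a)"

lemma btw_sa: "btw m a M \<Longrightarrow> adj a = a"
  unfolding btw_def using pos_sa[of "a - of_real m"] by (simp add: adj_diff)

lemma pos_of_real_iff [simp]: "pos (of_real r :: 'a::cstar) \<longleftrightarrow> 0 \<le> r"
proof
  assume p: "pos (of_real r :: 'a)"
  show "0 \<le> r"
  proof (rule ccontr)
    assume "\<not> 0 \<le> r"
    then have "pos (- (of_real r) :: 'a)" using pos_of_real[of "-r", where ?'a='a] by simp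
    then have "(of_real r :: 'a) = 0" using pos_antisym p by blast
    then show False using \<open>\<not> 0 \<le> r\<close> by simp
  qed
qed (rule pos_of_real)

lemma btw_le: "btw m (a::'a::cstar) M \<Longrightarrow> m \<le> M"
proof -
  assume "btw m a M"
  then have "pos ((a - of_real m) + (of_real M - a))" unfolding btw_def by (intro pos_add) auto
  then have "pos (of_real (M - m) :: 'a)" by simp
  then show ?thesis unfolding pos_of_real_iff by simp
qed

lemma btw_norm: "adj a = a \<Longrightarrow> norm a \<le> r \<Longrightarrow> btw (- r) a r"
  unfolding btw_def using pos_of_real_plus[of a r] pos_of_real_minus[of a r] by (simp add: add.commute)

lemma btw_pos: "pos a \<Longrightarrow> norm a \<le> r \<Longrightarrow> btw 0 a r"
  unfolding btw_def using pos_of_real_minus[of a r] pos_sa[of a] by simp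

text \<open>Splits off a real root outside the interval or a conjugate pair of complex roots;
  either factor is of constant sign.\<close>
lemma peval_pos:
  fixes a :: "'a::cstar"
  assumes btw: "btw m a M" and "\<And>t. m \<le> t \<Longrightarrow> t \<le> M \<Longrightarrow> poly p t > 0"
  shows "pos (peval p a)"
  using assms(2)
proof (induction "degree p" arbitrary: p rule: less_induct)
  case less
  have mM: "m \<le> M" using btw by (rule btw_le)
  have sa: "adj a = a" using btw by (rule btw_sa)
  show ?case
  proof (cases "degree p = 0")
    case True
    then obtain c where c: "p = [:c:]" by (metis degree_eq_zeroE)
    then have "c > 0" using less.prems[of m] mM by simp
    then show ?thesis by (simp add: c)
  next
    case False
    have "degree (map_poly complex_of_real p) = degree p" by (rule degree_map_poly) auto
    then have "\<not> constant (poly (map_poly complex_of_real p))" using False by (simp add: constant_degree)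
    then obtain z where "poly (map_poly complex_of_real p) z = 0" using fundamental_theorem_of_algebra by blast
    then have z: "peval p z = 0" by (simp add: peval_complex)
    have p0: "p \<noteq> 0" using False by auto
    show ?thesis
    proof (cases "Im z = 0")
      case True
      then have zr: "z = of_real (Re z)" by (simp add: complex_eq_iff)
      define r where "r = Re z"
      have "complex_of_real (poly p r) = 0" using z zr unfolding r_def by (metis peval_of_real)
      then have "poly p r = 0" by simp
      then obtain q where q: "p = [:-r, 1:] * q" by (metis dvdE poly_eq_0_iff_dvd)
      have dq: "degree q < degree p" "degree (- q) < degree p" using p0 unfolding q by (subst degree_mult_eq; force)+
      have "\<not> (m \<le> r \<and> r \<le> M)" using less.prems[of r] \<open>poly p r = 0\<close> by force
      then consider "r < m" | "M < r" by linarith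
      then show ?thesis
      proof cases
        case 1
        have "poly q t > 0" if "m \<le> t" "t \<le> M" for t
        proof -
          have "0 < (t - r) * poly q t" using less.prems[OF that] unfolding q poly_mult by simp
          then show ?thesis using that 1 by (auto simp: zero_less_mult_iff)
        qed
        then have "pos (peval q a)" using less.hyps[OF dq(1)] by blast
        moreover have "pos (a - of_real r)"
          using pos_add[of "a - of_real m" "of_real (m - r)"] btw 1 pos_of_real[of "m - r", where ?'a='a]
          unfolding btw_def by simp
        moreover have "(a - of_real r) * peval q a = peval q a * (a - of_real r)"
          by (simp add: algebra_simps peval_self_commute of_real_commute)
        ultimately have "pos ((a - of_real r) * peval q a)" by (blast intro: pos_commute_mult)
        then show ?thesis unfolding q peval_mult by simp
      next
        case 2
        \<comment> \<open>Here \<open>t - r\<close> is negative on the interval, so the induction is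
          applied to \<open>- q\<close> and the sign moves to the linear factor.\<close>
        have "poly (-q) t > 0" if "m \<le> t" "t \<le> M" for t
        proof -
          have "0 < (t - r) * poly q t" using less.prems[OF that] unfolding q poly_mult by simp
          then show ?thesis using that 2 by (auto simp: zero_less_mult_iff)
        qed
        then have "pos (peval (-q) a)" using less.hyps[OF dq(2)] by blast
        moreover have "pos (of_real r - a)"
          using pos_add[of "of_real M - a" "of_real (r - M)"] btw 2 pos_of_real[of "r - M", where ?'a='a]
          unfolding btw_def by simp
        moreover have "(of_real r - a) * peval (-q) a = peval (-q) a * (of_real r - a)"
          by (simp add: algebra_simps peval_minus peval_self_commute of_real_commute)
        ultimately have "pos ((of_real r - a) * peval (-q) a)" by (blast intro: pos_commute_mult)
        then show ?thesis unfolding q peval_mult peval_minus by (simp add: algebra_simps)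
      qed
    next
      case False
      \<comment> \<open>The real quadratic with roots \<open>z\<close> and its conjugate. At
        \<open>a\<close> it is the square of a self-adjoint element plus a positive constant, the
        square of \<open>Im z\<close>.\<close>
      define Q where "Q = [:(Re z)\<^sup>2 + (Im z)\<^sup>2, - 2 * Re z, 1:]"
      have Qz: "peval Q z = 0"
        unfolding Q_def by (simp add: complex_eq_iff power2_eq_square algebra_simps)
      have "p = (p div Q) * Q + p mod Q" by simp
      then have "peval (p mod Q) z = 0" using z Qz by (metis add_0 mult_zero_right peval_add peval_mult)
      moreover have "degree (p mod Q) < 2" using degree_mod_less[of Q p] by (auto simp: Q_def)
      then have bc: "p mod Q = [:b, c:]" if "b = coeff (p mod Q) 0" "c = coeff (p mod Q) 1" for b c
        unfolding that by (intro poly_eqI) (auto simp: coeff_pCons coeff_eq_0 split: nat.split)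
      define b c where "b = coeff (p mod Q) 0" and "c = coeff (p mod Q) 1"
      note bc = bc[OF this]
      ultimately have "of_real b + z * of_real c = 0" by simp
      \<comment> \<open>The remainder is linear with real coefficients and vanishes at the nonreal
        \<open>z\<close>, hence it is zero.\<close>
      then have "c = 0" "b = 0" using False by (auto simp: complex_eq_iff)
      then have "Q dvd p" using bc by (simp add: dvd_eq_mod_eq_0)
      then obtain q where q: "p = Q * q" by (elim dvdE)
      have "q \<noteq> 0" using p0 q by auto
      then have dq: "degree q < degree p" unfolding q by (subst degree_mult_eq) (auto simp: Q_def)
      have Qt: "poly Q t = (t - Re z)\<^sup>2 + (Im z)\<^sup>2" for t 
        unfolding Q_def by (simp add: power2_eq_square algebra_simps)
      have "poly Q t > 0" for t unfolding Qt using False by (simp add: add_nonneg_pos)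
      then have "poly q t > 0" if "m \<le> t" "t \<le> M" for t
        using less.prems[OF that] zero_less_mult_pos unfolding q poly_mult by blast
      then have pq: "pos (peval q a)" using less.hyps[OF dq] by blast
      have "pos ((a - of_real (Re z)) * (a - of_real (Re z)) + of_real ((Im z)\<^sup>2))"
        by (intro pos_add pos_square pos_of_real) (simp_all add: adj_diff sa)
      moreover have "(a - of_real (Re z)) * (a - of_real (Re z)) + of_real ((Im z)\<^sup>2) = peval Q a"
        unfolding Q_def by (simp add: of_real_def algebra_simps power2_eq_square scaleR_2)
          (simp add: flip: scaleR_add_left)
      ultimately have "pos (peval Q a)" by simp
      then have "pos (peval Q a * peval q a)" 
        by (rule pos_commute_mult[OF _ pq]) (metis peval_mult mult.commute)
      then show ?thesis unfolding q peval_mult .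
    qed
  qed
qed

text \<open>Positivity of polynomial values was shown for strictly positive polynomials, hence the
  enlargement of \<open>K\<close> by an arbitrary \<open>e\<close>.\<close>

lemma norm_peval_le:
  fixes a :: "'a::cstar"
  assumes btw: "btw m a M" and K: "\<And>t. m \<le> t \<Longrightarrow> t \<le> M \<Longrightarrow> \<bar>poly p t\<bar> \<le> K"
  shows "norm (peval p a) \<le> K"
proof (rule field_le_epsilon)
  fix e :: real assume e: "e > 0"
  have K0: "0 \<le> K" using K[of m] btw_le[OF btw] by auto
  have "pos (peval ([:K + e:] - p) a)" "pos (peval ([:K + e:] + p) a)"
    using K e by (auto intro!: peval_pos[OF btw] dest!: K simp: abs_le_iff)
  then show "norm (peval p a) \<le> K + e"
    using K0 e by (intro norm_le_if_pos adj_peval btw_sa[OF btw]) (auto simp: peval_diff peval_add)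
qed

subsection \<open>Continuous functions\<close>

lemma poly_approx:
  assumes "continuous_on {m..M} \<phi>" "e > 0"
  obtains p :: "real poly" where "\<And>t. m \<le> t \<Longrightarrow> t \<le> M \<Longrightarrow> \<bar>\<phi> t - poly p t\<bar> < e"
proof -
  obtain g where g: "real_polynomial_function g" "\<And>t. t \<in> {m..M} \<Longrightarrow> \<bar>\<phi> t - g t\<bar> < e"
    using Stone_Weierstrass_real_polynomial_function[of "{m..M}" \<phi> e] assms by auto
  obtain c n where "g = (\<lambda>x. \<Sum>i\<le>n. c i * x ^ i)" using g(1) real_polynomial_function_iff_sum by blast
  then have "poly (\<Sum>i\<le>n. monom (c i) i) t = g t" for t by (simp add: poly_sum poly_monom)
  then show ?thesis using that[of "\<Sum>i\<le>n. monom (c i) i"] g(2) by simp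
qed

abbreviation cont :: "(real \<Rightarrow> real) \<Rightarrow> bool" where "cont \<equiv> continuous_on UNIV"

text \<open>Interval and precision both improve with \<open>n\<close>, so that one sequence of
  polynomials eventually serves every self-adjoint element.\<close>

definition apx :: "(real \<Rightarrow> real) \<Rightarrow> nat \<Rightarrow> real poly" where
  "apx \<phi> n = (SOME p. \<forall>t. - real n \<le> t \<and> t \<le> real n \<longrightarrow> \<bar>\<phi> t - poly p t\<bar> < 1 / real (Suc n))"

text \<open>The approximating polynomials do not depend on the element, so that the
  functional calculus commutes with limits and intertwiners. Meaningful for continuous \<open>\<phi>\<close>.\<close>
definition fc :: "(real \<Rightarrow> real) \<Rightarrow> 'a::cstar \<Rightarrow> 'a" where
  "fc \<phi> a = lim (\<lambda>n. peval (apx \<phi> n) a)"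

lemma apx:
  assumes "cont \<phi>" "\<bar>t\<bar> \<le> real n"
  shows "\<bar>\<phi> t - poly (apx \<phi> n) t\<bar> < 1 / real (Suc n)"
proof -
  have "continuous_on {- real n..real n} \<phi>" using assms(1) by (rule continuous_on_subset) simp
  then obtain p where "\<And>t. - real n \<le> t \<Longrightarrow> t \<le> real n \<Longrightarrow> \<bar>\<phi> t - poly p t\<bar> < 1 / real (Suc n)"
    using poly_approx[of "-real n" "real n" \<phi> "1 / real (Suc n)"] by fastforce
  then have "\<exists>p. \<forall>t. - real n \<le> t \<and> t \<le> real n \<longrightarrow> \<bar>\<phi> t - poly p t\<bar> < 1 / real (Suc n)"
    by blast
  from someI_ex[OF this, folded apx_def] show ?thesis using assms(2) by (simp add: abs_le_iff)
qed

lemma fc_tendsto: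
  fixes a :: "'a::cstar"
  assumes c: "cont \<phi>" and sa: "adj a = a"
  shows "(\<lambda>n. peval (apx \<phi> n) a) \<longlonglongrightarrow> fc \<phi> a"
proof -
  have "Cauchy (\<lambda>n. peval (apx \<phi> n) a)"
  proof (rule CauchyI)
    fix e :: real assume e: "0 < e"
    obtain N where N: "norm a \<le> real N" "2 / e < real N" using real_arch_simple[of "max (norm a) (2/e + 1)"] by auto
    have "norm (peval (apx \<phi> k) a - peval (apx \<phi> l) a) < e" if kl: "N \<le> k" "N \<le> l" for k l
    proof -
      have "norm (peval (apx \<phi> k - apx \<phi> l) a) \<le> 2 / real (Suc N)"
      proof (rule norm_peval_le[OF btw_norm[OF sa N(1)]])
        fix t assume "- real N \<le> t" "t \<le> real N"
        then have "\<bar>\<phi> t - poly (apx \<phi> k) t\<bar> < 1 / real (Suc k)" "\<bar>\<phi> t - poly (apx \<phi> l) t\<bar> < 1 / real (Suc l)"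
          using kl by (intro apx[OF c]; simp add: abs_le_iff)+
        moreover have "1 / real (Suc k) \<le> 1 / real (Suc N)" "1 / real (Suc l) \<le> 1 / real (Suc N)"
          using kl by (auto simp: field_simps)
        ultimately show "\<bar>poly (apx \<phi> k - apx \<phi> l) t\<bar> \<le> 2 / real (Suc N)" by simp
      qed
      also have "\<dots> < e" using N(2) e by (simp add: field_simps)
      finally show ?thesis by (simp add: peval_diff)
    qed
    then show "\<exists>M. \<forall>m\<ge>M. \<forall>n\<ge>M. norm (peval (apx \<phi> m) a - peval (apx \<phi> n) a) < e" by blast
  qed
  then show ?thesis unfolding fc_def by (simp add: Cauchy_convergent_iff convergent_LIMSEQ_iff)
qed

text \<open>Compares \<open>p\<close> with the approximants of \<open>\<phi>\<close> on the interval
  and passes to the limit. Most properties of \<open>fc\<close> are read off from this estimate;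
  norm bounds are the case \<open>p = 0\<close>.\<close>

lemma fc_close:
  fixes a :: "'a::cstar"
  assumes c: "cont \<phi>" and btw: "btw m a M" and K: "\<And>t. m \<le> t \<Longrightarrow> t \<le> M \<Longrightarrow> \<bar>\<phi> t - poly p t\<bar> \<le> K"
  shows "norm (fc \<phi> a - peval p a) \<le> K"
proof -
  have "(\<lambda>n. norm (peval (apx \<phi> n) a - peval p a) - 1 / real (Suc n)) \<longlonglongrightarrow> norm (fc \<phi> a - peval p a) - 0"
    by (intro tendsto_intros fc_tendsto c btw_sa[OF btw] LIMSEQ_Suc[OF lim_1_over_n])
  then have "norm (fc \<phi> a - peval p a) - 0 \<le> K"
  proof (rule LIMSEQ_le_const2)
    obtain N where N: "\<bar>m\<bar> + \<bar>M\<bar> \<le> real N" using real_arch_simple by blast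
    have "norm (peval (apx \<phi> n) a - peval p a) \<le> K + 1 / real (Suc n)" if "N \<le> n" for n
    proof -
      have "norm (peval (apx \<phi> n - p) a) \<le> K + 1 / real (Suc n)"
      proof (rule norm_peval_le[OF btw])
        fix t assume t: "m \<le> t" "t \<le> M"
        then have "\<bar>\<phi> t - poly (apx \<phi> n) t\<bar> < 1 / real (Suc n)" using N that by (intro apx[OF c]) auto
        then show "\<bar>poly (apx \<phi> n - p) t\<bar> \<le> K + 1 / real (Suc n)" using K[OF t] by simp
      qed
      then show ?thesis by (simp add: peval_diff)
    qed
    then show "\<exists>N. \<forall>n\<ge>N. norm (peval (apx \<phi> n) a - peval p a) - 1 / real (Suc n) \<le> K" 
      by (metis diff_le_eq)
  qed
  then show ?thesis by simp
qed

lemma fc_lim: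
  fixes a :: "'a::cstar"
  assumes c: "cont \<phi>" and btw: "btw m a M" and e: "e \<longlonglongrightarrow> 0"
    and K: "\<And>n t. m \<le> t \<Longrightarrow> t \<le> M \<Longrightarrow> \<bar>\<phi> t - poly (p n) t\<bar> \<le> e n"
  shows "(\<lambda>n. peval (p n) a) \<longlonglongrightarrow> fc \<phi> a"
proof -
  have "(\<lambda>n. fc \<phi> a - peval (p n) a) \<longlonglongrightarrow> 0"
    by (rule tendsto_0_le[OF e, where K=1]) 
      (use fc_close[OF c btw K] in \<open>auto intro!: always_eventually order_trans[OF fc_close[OF c btw K]]\<close>)
  then have "(\<lambda>n. fc \<phi> a - (fc \<phi> a - peval (p n) a)) \<longlonglongrightarrow> fc \<phi> a - 0" by (intro tendsto_intros)
  then show ?thesis by simp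
qed

lemma fc_norm_le:
  assumes "cont \<phi>" "btw m a M" "\<And>t. m \<le> t \<Longrightarrow> t \<le> M \<Longrightarrow> \<bar>\<phi> t\<bar> \<le> K"
  shows "norm (fc \<phi> a) \<le> K"
  using fc_close[of \<phi> m a M 0 K] assms by simp

lemma fc_poly: "adj a = a \<Longrightarrow> fc (poly p) a = peval p a"
  using fc_close[of "poly p" "-norm a" a "norm a" p 0] btw_norm[of a "norm a"] by (simp add: continuous_on_poly)

lemma fc_const: "adj a = a \<Longrightarrow> fc (\<lambda>t. r) a = of_real r"
proof -
  assume "adj a = a"
  moreover have "poly [:r:] = (\<lambda>t. r)" by auto
  ultimately show ?thesis using fc_poly[of a "[:r:]"] by simp
qed

lemma fc_id: "adj a = a \<Longrightarrow> fc (\<lambda>t. t) a = a"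
proof -
  assume "adj a = a"
  moreover have "poly [:0, 1:] = (\<lambda>t::real. t)" by auto
  ultimately show ?thesis using fc_poly[of a "[:0, 1:]"] by simp
qed

text \<open>A shift of the standard approximants, so that the error bound holds on a fixed interval
  from index 0 on.\<close>

lemma apx_seq:
  assumes "cont \<phi>"
  obtains p where "\<And>n t. \<bar>t\<bar> \<le> R \<Longrightarrow> \<bar>\<phi> t - poly (p n) t\<bar> \<le> 1 / real (Suc n)"
proof -
  obtain N where N: "R \<le> real N" using real_arch_simple by blast
  show ?thesis
  proof (rule that[of "\<lambda>n. apx \<phi> (n + N)"])
    fix n t assume "\<bar>t\<bar> \<le> R"
    then have "\<bar>\<phi> t - poly (apx \<phi> (n + N)) t\<bar> < 1 / real (Suc (n + N))" using N by (intro apx assms) auto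
    also have "\<dots> \<le> 1 / real (Suc n)" by (simp add: field_simps)
    finally show "\<bar>\<phi> t - poly (apx \<phi> (n + N)) t\<bar> \<le> 1 / real (Suc n)" by simp
  qed
qed

lemma cont_bound:
  assumes "cont \<phi>" obtains B where "B \<ge> 0" "\<And>t. \<bar>t\<bar> \<le> R \<Longrightarrow> \<bar>\<phi> t\<bar> \<le> B"
proof -
  have "compact (\<phi> ` {-R..R})" by (rule compact_continuous_image) (use assms continuous_on_subset in auto)
  then obtain B where "\<forall>x\<in>\<phi> ` {-R..R}. norm x \<le> B" using compact_imp_bounded bounded_iff by metis
  then have "\<bar>\<phi> t\<bar> \<le> \<bar>B\<bar>" if "\<bar>t\<bar> \<le> R" for t
  proof -
    have "t \<in> {-R..R}" using that by (auto simp: abs_le_iff)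
    then have "norm (\<phi> t) \<le> B" using \<open>\<forall>x\<in>\<phi> ` {-R..R}. norm x \<le> B\<close> by blast
    then show ?thesis by simp
  qed
  then show ?thesis using that[of "\<bar>B\<bar>"] by simp
qed

lemma fc_seq:
  fixes a :: "'a::cstar"
  assumes "cont \<phi>" "adj a = a" "norm a \<le> R" "\<And>n t. \<bar>t\<bar> \<le> R \<Longrightarrow> \<bar>\<phi> t - poly (p n) t\<bar> \<le> 1 / real (Suc n)"
  shows "(\<lambda>n. peval (p n) a) \<longlonglongrightarrow> fc \<phi> a"
  by (rule fc_lim[OF assms(1) btw_norm[OF assms(2,3)] LIMSEQ_Suc[OF lim_1_over_n]]) (use assms(4) in auto)

lemma fc_add:
  assumes c: "cont \<phi>" "cont \<psi>" and sa: "adj a = a"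
  shows "fc (\<lambda>t. \<phi> t + \<psi> t) a = fc \<phi> a + fc \<psi> a"
proof -
  obtain p where p: "\<And>n t. \<bar>t\<bar> \<le> norm a \<Longrightarrow> \<bar>\<phi> t - poly (p n) t\<bar> \<le> 1 / real (Suc n)" using apx_seq[OF c(1)] by blast
  obtain q where q: "\<And>n t. \<bar>t\<bar> \<le> norm a \<Longrightarrow> \<bar>\<psi> t - poly (q n) t\<bar> \<le> 1 / real (Suc n)" using apx_seq[OF c(2)] by blast
  have e: "(\<lambda>n. 2 * (1 / real (Suc n))) \<longlonglongrightarrow> 2 * 0" by (intro tendsto_intros LIMSEQ_Suc[OF lim_1_over_n])
  have "(\<lambda>n. peval (p n + q n) a) \<longlonglongrightarrow> fc (\<lambda>t. \<phi> t + \<psi> t) a"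
  proof (rule fc_lim[OF _ btw_norm[OF sa order_refl] e[simplified mult_zero_right]])
    fix n t assume "- norm a \<le> t" "t \<le> norm a"
    then have "\<bar>t\<bar> \<le> norm a" by linarith
    then show "\<bar>\<phi> t + \<psi> t - poly (p n + q n) t\<bar> \<le> 2 * (1 / real (Suc n))" using p[of t n] q[of t n] by simp
  qed (intro continuous_intros c)
  moreover have "(\<lambda>n. peval (p n) a + peval (q n) a) \<longlonglongrightarrow> fc \<phi> a + fc \<psi> a"
    by (intro tendsto_intros fc_seq[OF _ sa order_refl] c p q)
  ultimately show ?thesis using LIMSEQ_unique by (simp add: peval_add) blast
qed

lemma fc_mult:
  assumes c: "cont \<phi>" "cont \<psi>" and sa: "adj a = a"
  shows "fc (\<lambda>t. \<phi> t * \<psi> t) a = fc \<phi> a * fc \<psi> a"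
proof -
  obtain p where p: "\<And>n t. \<bar>t\<bar> \<le> norm a \<Longrightarrow> \<bar>\<phi> t - poly (p n) t\<bar> \<le> 1 / real (Suc n)" using apx_seq[OF c(1)] by blast
  obtain q where q: "\<And>n t. \<bar>t\<bar> \<le> norm a \<Longrightarrow> \<bar>\<psi> t - poly (q n) t\<bar> \<le> 1 / real (Suc n)" using apx_seq[OF c(2)] by blast
  obtain A where A: "A \<ge> 0" "\<And>t. \<bar>t\<bar> \<le> norm a \<Longrightarrow> \<bar>\<phi> t\<bar> \<le> A" using cont_bound[OF c(1)] by blast
  obtain B where B: "B \<ge> 0" "\<And>t. \<bar>t\<bar> \<le> norm a \<Longrightarrow> \<bar>\<psi> t\<bar> \<le> B" using cont_bound[OF c(2)] by blast
  have e: "(\<lambda>n. (A + B + 1) * (1 / real (Suc n))) \<longlonglongrightarrow> (A + B + 1) * 0" by (intro tendsto_intros LIMSEQ_Suc[OF lim_1_over_n])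
  have "(\<lambda>n. peval (p n * q n) a) \<longlonglongrightarrow> fc (\<lambda>t. \<phi> t * \<psi> t) a"
  proof (rule fc_lim[OF _ btw_norm[OF sa order_refl] e[simplified mult_zero_right]])
    fix n t assume "- norm a \<le> t" "t \<le> norm a"
    then have t: "\<bar>t\<bar> \<le> norm a" by linarith
    let ?d = "1 / real (Suc n)"
    have d1: "?d \<le> 1" by simp
    have "\<bar>\<phi> t * \<psi> t - poly (p n * q n) t\<bar> = \<bar>\<phi> t * (\<psi> t - poly (q n) t) + (\<phi> t - poly (p n) t) * poly (q n) t\<bar>"
      by (simp add: algebra_simps)
    also have "\<dots> \<le> \<bar>\<phi> t\<bar> * \<bar>\<psi> t - poly (q n) t\<bar> + \<bar>\<phi> t - poly (p n) t\<bar> * \<bar>poly (q n) t\<bar>"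
      by (metis abs_mult abs_triangle_ineq)
    also have "\<dots> \<le> A * ?d + ?d * (B + 1)"
    proof (intro add_mono mult_mono A(2) t p q)
      show "\<bar>poly (q n) t\<bar> \<le> B + 1" using q[OF t, of n] B(2)[OF t] d1 by linarith
    qed (use A in auto)
    finally show "\<bar>\<phi> t * \<psi> t - poly (p n * q n) t\<bar> \<le> (A + B + 1) * ?d" by (simp add: algebra_simps add_divide_distrib)
  qed (intro continuous_intros c)
  moreover have "(\<lambda>n. peval (p n) a * peval (q n) a) \<longlonglongrightarrow> fc \<phi> a * fc \<psi> a"
    by (intro tendsto_intros fc_seq[OF _ sa order_refl] c p q)
  ultimately show ?thesis using LIMSEQ_unique by (simp add: peval_mult) blast
qed

lemma fc_cmult: "cont \<phi> \<Longrightarrow> adj a = a \<Longrightarrow> fc (\<lambda>t. r * \<phi> t) a = of_real r * fc \<phi> a"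
  using fc_mult[of "\<lambda>t. r" \<phi> a] by (simp add: fc_const)

lemma fc_diff:
  assumes c: "cont \<phi>" "cont \<psi>" and sa: "adj a = a"
  shows "fc (\<lambda>t. \<phi> t - \<psi> t) a = fc \<phi> a - fc \<psi> a"
  using fc_add[OF c(1) _ sa, of "\<lambda>t. -1 * \<psi> t"] fc_cmult[OF c(2) sa, of "-1"]
  by (simp add: continuous_on_minus c)

lemma fc_norm_diff_le:
  assumes "cont \<phi>" "cont \<psi>" "btw m a M" "\<And>t. m \<le> t \<Longrightarrow> t \<le> M \<Longrightarrow> \<bar>\<phi> t - \<psi> t\<bar> \<le> K"
  shows "norm (fc \<phi> a - fc \<psi> a) \<le> K"
  using fc_norm_le[of "\<lambda>t. \<phi> t - \<psi> t" m a M K] assms fc_diff[OF assms(1,2) btw_sa[OF assms(3)]]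
  by (auto intro: continuous_on_diff)

lemma fc_cong:
  assumes "cont \<phi>" "cont \<psi>" "btw m a M" "\<And>t. m \<le> t \<Longrightarrow> t \<le> M \<Longrightarrow> \<phi> t = \<psi> t"
  shows "fc \<phi> a = fc \<psi> a"
  using fc_norm_diff_le[of \<phi> \<psi> m a M 0] assms by simp

lemma fc_intertwine:
  assumes c: "cont \<phi>" and sa: "adj a = a" "adj b = b" and "a * x = x * b"
  shows "fc \<phi> a * x = x * fc \<phi> b"
proof -
  have "(\<lambda>n. peval (apx \<phi> n) a * x) \<longlonglongrightarrow> fc \<phi> a * x" "(\<lambda>n. x * peval (apx \<phi> n) b) \<longlonglongrightarrow> x * fc \<phi> b"
    by (intro tendsto_intros fc_tendsto c sa)+
  then show ?thesis using LIMSEQ_unique unfolding peval_intertwine[OF assms(4)] by blast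
qed

lemma fc_commute: "cont \<phi> \<Longrightarrow> adj a = a \<Longrightarrow> a * x = x * a \<Longrightarrow> fc \<phi> a * x = x * fc \<phi> a"
  by (rule fc_intertwine)

lemma adj_fc: "cont \<phi> \<Longrightarrow> adj a = a \<Longrightarrow> adj (fc \<phi> a) = fc \<phi> a"
  using LIMSEQ_unique[OF tendsto_adj[OF fc_tendsto[of \<phi> a]], of "fc \<phi> a"] fc_tendsto[of \<phi> a]
  by (simp add: adj_peval)

lemma fc_pos:
  assumes c: "cont \<phi>" and btw: "btw m a M" and "\<And>t. m \<le> t \<Longrightarrow> t \<le> M \<Longrightarrow> 0 \<le> \<phi> t"
  shows "pos (fc \<phi> a)"
proof -
  let ?s = "\<lambda>t. sqrt (max (\<phi> t) 0)"
  have cs: "cont ?s" by (intro continuous_intros c)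
  have "fc \<phi> a = fc (\<lambda>t. ?s t * ?s t) a"
    by (rule fc_cong[OF c _ btw]) (use assms(3) in \<open>auto intro!: continuous_intros c simp: max_absorb1\<close>)
  also have "\<dots> = fc ?s a * fc ?s a" by (rule fc_mult[OF cs cs btw_sa[OF btw]])
  finally show ?thesis using pos_square[OF adj_fc[OF cs btw_sa[OF btw]]] by simp
qed

text \<open>For polynomial \<open>\<phi>\<close> the claim follows by induction from additivity and
  multiplicativity. In general \<open>\<phi>\<close> is approximated on an interval that contains
  both the relevant values of \<open>\<psi>\<close> and the norm of \<open>fc \<psi> a\<close>, so
  that one sequence of polynomials converges on both sides.\<close>

lemma fc_comp:
  assumes c: "cont \<phi>" "cont \<psi>" and sa: "adj a = a"
  shows "fc \<phi> (fc \<psi> a) = fc (\<lambda>t. \<phi> (\<psi> t)) a"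
proof -
  have pc: "cont (\<lambda>t. poly p (\<psi> t))" for p 
    using continuous_on_compose2[OF continuous_on_poly c(2)] by (auto intro!: continuous_intros c)
  have poly: "peval p (fc \<psi> a) = fc (\<lambda>t. poly p (\<psi> t)) a" for p
  proof (induction p)
    case 0
    then show ?case by (simp add: fc_const sa)
  next
    case (pCons r p)
    have "fc (\<lambda>t. r + \<psi> t * poly p (\<psi> t)) a = fc (\<lambda>t. r) a + fc (\<lambda>t. \<psi> t * poly p (\<psi> t)) a"
      by (rule fc_add) (auto intro!: continuous_intros c pc sa)
    then show ?case using pCons by (simp add: fc_const sa fc_mult[OF c(2) pc sa])
  qed
  have sb: "adj (fc \<psi> a) = fc \<psi> a" by (rule adj_fc[OF c(2) sa])
  obtain B where B: "B \<ge> 0" "\<And>t. \<bar>t\<bar> \<le> norm a \<Longrightarrow> \<bar>\<psi> t\<bar> \<le> B" using cont_bound[OF c(2)] by blast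
  obtain p where p: "\<And>n t. \<bar>t\<bar> \<le> max B (norm (fc \<psi> a)) \<Longrightarrow> \<bar>\<phi> t - poly (p n) t\<bar> \<le> 1 / real (Suc n)"
    using apx_seq[OF c(1)] by blast
  have cc: "cont (\<lambda>t. \<phi> (\<psi> t))" using continuous_on_compose2[OF c] by auto
  have 1: "(\<lambda>n. peval (p n) (fc \<psi> a)) \<longlonglongrightarrow> fc \<phi> (fc \<psi> a)"
    by (rule fc_seq[OF c(1) sb _ p]) auto
  have "norm (fc (\<lambda>t. poly (p n) (\<psi> t)) a - fc (\<lambda>t. \<phi> (\<psi> t)) a) \<le> 1 / real (Suc n)" for n
  proof (rule fc_norm_diff_le[OF pc cc btw_norm[OF sa order_refl]])
    fix t assume "- norm a \<le> t" "t \<le> norm a"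
    then have "\<bar>t\<bar> \<le> norm a" by linarith
    then have "\<bar>\<psi> t\<bar> \<le> max B (norm (fc \<psi> a))" using B(2) by fastforce
    from p[OF this, of n] show "\<bar>poly (p n) (\<psi> t) - \<phi> (\<psi> t)\<bar> \<le> 1 / real (Suc n)" by linarith
  qed
  then have "(\<lambda>n. fc (\<lambda>t. poly (p n) (\<psi> t)) a - fc (\<lambda>t. \<phi> (\<psi> t)) a) \<longlonglongrightarrow> 0"
    by (intro tendsto_0_le[OF LIMSEQ_Suc[OF lim_1_over_n[where 'a=real]], where K=1] always_eventually allI) simp
  then have "(\<lambda>n. fc (\<lambda>t. poly (p n) (\<psi> t)) a) \<longlonglongrightarrow> fc (\<lambda>t. \<phi> (\<psi> t)) a" by (simp add: LIM_zero_iff)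
  then show ?thesis using LIMSEQ_unique[OF 1] unfolding poly by simp
qed

section \<open>Approximate intertwining, uniformly on norm balls\<close>

lemma peval_bounded: "\<exists>K\<ge>0. \<forall>b::'a::cstar. norm b \<le> R \<longrightarrow> norm (peval p b) \<le> K"
proof (induction p)
  case (pCons c p)
  then obtain K where K: "K \<ge> 0" "\<And>b::'a. norm b \<le> R \<Longrightarrow> norm (peval p b) \<le> K" by blast
  have "norm (peval (pCons c p) b) \<le> \<bar>c\<bar> + \<bar>R\<bar> * K" if "norm b \<le> R" for b :: 'a
  proof -
    have "norm (b * peval p b) \<le> \<bar>R\<bar> * K" by (rule order_trans[OF norm_mult_ineq mult_mono]) (use K that in auto)
    then show ?thesis using norm_triangle_ineq[of "of_real c" "b * peval p b"] by simp
  qed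
  then show ?case using K(1) by (intro exI[of _ "\<bar>c\<bar> + \<bar>R\<bar> * K"]) auto
qed auto

text \<open>A Leibniz rule along the Horner recursion; \<open>C\<close> depends on \<open>p\<close>
  and \<open>R\<close> alone.\<close>

lemma peval_intertwine_approx:
  "\<exists>C\<ge>0. \<forall>a b x::'a::cstar. norm a \<le> R \<longrightarrow> norm b \<le> R \<longrightarrow>
     norm (peval p a * x - x * peval p b) \<le> C * norm (a * x - x * b)"
proof (induction p)
  case (pCons c p)
  then obtain C where C: "C \<ge> 0" "\<And>a b x::'a. norm a \<le> R \<Longrightarrow> norm b \<le> R \<Longrightarrow>
     norm (peval p a * x - x * peval p b) \<le> C * norm (a * x - x * b)" by blast
  obtain K where K: "K \<ge> 0" "\<And>b::'a. norm b \<le> R \<Longrightarrow> norm (peval p b) \<le> K" using peval_bounded by blast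
  have "norm (peval (pCons c p) a * x - x * peval (pCons c p) b) \<le> (\<bar>R\<bar> * C + K) * norm (a * x - x * b)"
    if ab: "norm a \<le> R" "norm b \<le> R" for a b x :: 'a
  proof -
    have "peval (pCons c p) a * x - x * peval (pCons c p) b
      = a * (peval p a * x - x * peval p b) + (a * x - x * b) * peval p b"
      by (simp add: algebra_simps of_real_commute)
    also have "norm \<dots> \<le> norm a * norm (peval p a * x - x * peval p b) + norm (a * x - x * b) * norm (peval p b)"
      by (intro order_trans[OF norm_triangle_ineq] add_mono norm_mult_ineq)
    also have "\<dots> \<le> \<bar>R\<bar> * (C * norm (a * x - x * b)) + norm (a * x - x * b) * K"
      by (intro add_mono mult_mono C K ab) (use ab C K in auto)
    finally show ?thesis by (simp add: algebra_simps)
  qed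
  then show ?case using C(1) K(1) by (intro exI[of _ "\<bar>R\<bar> * C + K"]) auto
qed auto

text \<open>The order of the quantifiers is the point: \<open>d\<close> depends on
  \<open>\<phi>\<close>, \<open>e\<close> and \<open>R\<close> only, so it can be fixed before the
  Rokhlin elements are known. With two elements \<open>a\<close> and \<open>b\<close> the case
  \<open>x = 1\<close> is uniform continuity.\<close>

lemma fc_intertwine_approx:
  assumes c: "cont \<phi>" and e: "e > 0"
  shows "\<exists>d>0. \<forall>a b x::'a::cstar. adj a = a \<longrightarrow> adj b = b \<longrightarrow> norm a \<le> R \<longrightarrow> norm b \<le> R \<longrightarrow> norm x \<le> R \<longrightarrow>
     norm (a * x - x * b) < d \<longrightarrow> norm (fc \<phi> a * x - x * fc \<phi> b) < e"
proof -
  define e' where "e' = e / (4 * (\<bar>R\<bar> + 1))"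
  have e': "e' > 0" "e' * \<bar>R\<bar> \<le> e / 4" using e by (auto simp: e'_def field_simps)
  obtain p where p: "\<And>t. - R \<le> t \<Longrightarrow> t \<le> R \<Longrightarrow> \<bar>\<phi> t - poly p t\<bar> < e'"
    using poly_approx[OF continuous_on_subset[OF c], of "-R" R e'] e' by auto
  obtain C where C: "C \<ge> 0" "\<And>a b x::'a. norm a \<le> R \<Longrightarrow> norm b \<le> R \<Longrightarrow>
     norm (peval p a * x - x * peval p b) \<le> C * norm (a * x - x * b)" using peval_intertwine_approx by blast
  have "norm (fc \<phi> a * x - x * fc \<phi> b) < e" if h: "adj a = a" "adj b = b" "norm a \<le> R" "norm b \<le> R" "norm x \<le> R"
     "norm (a * x - x * b) < e / (4 * (C + 1))" for a b x :: 'a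
  proof -
    have 1: "norm (fc \<phi> y - peval p y) \<le> e'" if "adj y = y" "norm y \<le> R" for y :: 'a
      by (rule fc_close[OF c btw_norm[OF that]]) (use p in \<open>auto intro: less_imp_le\<close>)
    have "fc \<phi> a * x - x * fc \<phi> b = (fc \<phi> a - peval p a) * x - x * (fc \<phi> b - peval p b) + (peval p a * x - x * peval p b)"
      by (simp add: algebra_simps)
    also have "norm \<dots> \<le> norm (fc \<phi> a - peval p a) * norm x + norm x * norm (fc \<phi> b - peval p b) + norm (peval p a * x - x * peval p b)"
      by (intro order_trans[OF norm_triangle_ineq] add_mono order_trans[OF norm_triangle_ineq4] norm_mult_ineq order_refl)
    also have "\<dots> \<le> e' * \<bar>R\<bar> + \<bar>R\<bar> * e' + C * norm (a * x - x * b)"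
      by (intro add_mono mult_mono 1 C(2) h) (use h e' in auto)
    also have "C * norm (a * x - x * b) \<le> (C + 1) * (e / (4 * (C + 1)))"
      by (intro mult_mono) (use h C in auto)
    also have "(C + 1) * (e / (4 * (C + 1))) = e / 4" using C by (simp add: field_simps)
    finally show ?thesis using e' e by (simp add: mult.commute)
  qed
  then show ?thesis using e C(1) by (intro exI[of _ "e / (4 * (C + 1))"]) auto
qed

lemma fc_uniform_cont:
  assumes c: "cont \<phi>" and e: "e > 0"
  shows "\<exists>d>0. \<forall>a b::'a::cstar. adj a = a \<longrightarrow> adj b = b \<longrightarrow> norm a \<le> R \<longrightarrow> norm b \<le> R \<longrightarrow>
     norm (a - b) < d \<longrightarrow> norm (fc \<phi> a - fc \<phi> b) < e"
proof -
  obtain d where d: "d > 0" "\<And>a b x::'a. adj a = a \<Longrightarrow> adj b = b \<Longrightarrow> norm a \<le> max R 1 \<Longrightarrow> norm b \<le> max R 1 \<Longrightarrow> 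
     norm x \<le> max R 1 \<Longrightarrow> norm (a * x - x * b) < d \<Longrightarrow> norm (fc \<phi> a * x - x * fc \<phi> b) < e"
    using fc_intertwine_approx[OF c e, of "max R 1"] by blast
  show ?thesis using d(1) d(2)[of _ _ 1] by (intro exI[of _ d]) auto
qed

text \<open>Since \<open>\<phi>\<close> vanishes at 0 it is a limit of polynomials without constant
  term, so membership holds in closed subalgebras that miss the unit of the type, such as the
  corners and blocks used later.\<close>

lemma fc_mem:
  fixes a :: "'a::cstar"
  assumes c: "cont \<phi>" and sa: "adj a = a" and "\<phi> 0 = 0" and "closed S" "a \<in> S"
    and "\<And>x y. x \<in> S \<Longrightarrow> y \<in> S \<Longrightarrow> x + y \<in> S" "\<And>x y. x \<in> S \<Longrightarrow> y \<in> S \<Longrightarrow> x * y \<in> S"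
    and "\<And>r x. x \<in> S \<Longrightarrow> r *\<^sub>R x \<in> S"
  shows "fc \<phi> a \<in> S"
proof -
  have pv: "peval p a * a \<in> S" for p
  proof (induction p)
    case 0 
    have "0 *\<^sub>R a \<in> S" using assms by blast
    then show ?case by simp
  next
    case (pCons c p)
    have "c *\<^sub>R a + a * (peval p a * a) \<in> S" using assms pCons by blast
    then show ?case by (simp add: of_real_def algebra_simps)
  qed
  obtain p where p: "\<And>n t. \<bar>t\<bar> \<le> norm a \<Longrightarrow> \<bar>\<phi> t - poly (p n) t\<bar> \<le> 1 / real (Suc n)" using apx_seq[OF c] by blast
  \<comment> \<open>Removing the constant term moves the approximant by at most its error at 0,
    which doubles the bound.\<close>
  define q where "q n = p n - [:poly (p n) 0:]" for n
  have e: "(\<lambda>n. 2 * (1 / real (Suc n))) \<longlonglongrightarrow> 2 * 0" by (intro tendsto_intros LIMSEQ_Suc[OF lim_1_over_n])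
  have lim: "(\<lambda>n. peval (q n) a) \<longlonglongrightarrow> fc \<phi> a"
  proof (rule fc_lim[OF c btw_norm[OF sa order_refl] e[simplified mult_zero_right]])
    fix n t assume "- norm a \<le> t" "t \<le> norm a"
    then have "\<bar>t\<bar> \<le> norm a" by linarith
    then show "\<bar>\<phi> t - poly (q n) t\<bar> \<le> 2 * (1 / real (Suc n))" 
      using p[of t n] p[of 0 n] assms(3) by (simp add: q_def)
  qed
  have "peval (q n) a \<in> S" for n
  proof -
    have "poly (q n) 0 = 0" by (simp add: q_def)
    then obtain r where "q n = pCons 0 r" by (cases "q n" rule: pCons_cases) auto
    then show ?thesis using pv[of r] by (simp add: peval_self_commute)
  qed
  then show ?thesis using closed_sequentially[OF \<open>closed S\<close> _ lim] by blast
qed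

section \<open>Positivity of \<open>x\<^sup>* x\<close>, polar decomposition and Cuntz comparison\<close>

lemma fc_self_mult: "cont \<phi> \<Longrightarrow> adj a = a \<Longrightarrow> fc \<phi> a * a = fc (\<lambda>t. \<phi> t * t) a"
  using fc_mult[of \<phi> "\<lambda>t. t" a] by (simp add: fc_id)

lemma sa_square_eq_0: "adj a = a \<Longrightarrow> a * a = 0 \<Longrightarrow> a = (0::'a::cstar)"
  using norm_sq_sa[of a] by simp

text \<open>Kelley--Vaught: the negative part of \<open>x\<^sup>* x\<close> yields \<open>y\<close> with \<open>z = y\<^sup>* y \<le> 0\<close>, hence
  \<open>w = y y\<^sup>* \<ge> 0\<close>. As \<open>y\<close> intertwines \<open>w\<close> and \<open>z\<close>, the positive part of \<open>w\<close> kills \<open>y\<close>.\<close>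
lemma pos_adj_mult:
  fixes x :: "'a::cstar"
  shows "pos (adj x * x)"
proof -
  define b where "b = adj x * x"
  have sb: "adj b = b" by (simp add: b_def adj_mult)
  let ?n = "\<lambda>t::real. max (- t) 0" and ?p = "\<lambda>t::real. max t 0"
  let ?f = "\<lambda>t::real. sqrt (max (- t) 0)"
  have cn: "cont ?n" and cp: "cont ?p" and cf: "cont ?f" by (intro continuous_intros)+
  define c where "c = fc ?f b"
  have sc: "adj c = c" unfolding c_def by (rule adj_fc[OF cf sb])
  define y where "y = x * c"
  define z where "z = adj y * y"
  define w where "w = y * adj y"
  have sz: "adj z = z" and sw: "adj w = w" by (simp_all add: z_def w_def adj_mult)
  define u where "u = fc ?n b"
  have su: "adj u = u" unfolding u_def by (rule adj_fc[OF cn sb])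
  have "z = c * b * c" by (simp add: z_def y_def adj_mult sc b_def mult.assoc)
  also have "\<dots> = fc (\<lambda>t. ?f t * t * ?f t) b"
    unfolding c_def fc_self_mult[OF cf sb] by (rule fc_mult[symmetric]) (intro continuous_intros sb)+
  also have "\<dots> = fc (\<lambda>t. - 1 * (?n t * ?n t)) b"
  proof (rule fc_cong[OF _ _ btw_norm[OF sb order_refl]])
    fix t :: real 
    have "?f t * t * ?f t = t * (?f t * ?f t)" by (simp only: ac_simps)
    also have "?f t * ?f t = ?n t" by (rule real_sqrt_mult_self[THEN trans]) simp
    finally have *: "?f t * t * ?f t = t * ?n t" .
    show "?f t * t * ?f t = - 1 * (?n t * ?n t)" unfolding * by (simp add: max_def)
  qed (intro continuous_intros)+
  also have "\<dots> = - (u * u)"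
    unfolding u_def by (subst fc_cmult, intro continuous_intros, rule sb, subst fc_mult[OF cn cn sb], simp)
  finally have zu: "z = - (u * u)" .
  have pz: "pos (- z)" unfolding zu using pos_square[OF su] by simp
  \<comment> \<open>Up to sign \<open>\<alpha>\<close> and \<open>\<beta>\<close> are twice the real
    and imaginary parts of \<open>y\<close>. Their squares add up to
    \<open>2 *\<^sub>R (w + z)\<close>, so \<open>w + z\<close> is positive before this is known of
    \<open>w\<close>.\<close>
  define \<alpha> where "\<alpha> = y + adj y"
  define \<beta> where "\<beta> = iu * (y - adj y)"
  have sab: "adj \<alpha> = \<alpha>" "adj \<beta> = \<beta>"
    by (simp_all add: \<alpha>_def \<beta>_def adj_add adj_diff adj_mult adj_iu iu_comm algebra_simps)
  have "\<beta> * \<beta> = iu * ((y - adj y) * iu) * (y - adj y)" by (simp only: \<beta>_def mult.assoc)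
  also have "\<dots> = (iu * iu) * (y - adj y) * (y - adj y)" by (simp only: iu_comm[of "y - adj y", symmetric] mult.assoc)
  finally have "\<alpha> * \<alpha> + \<beta> * \<beta> = 2 *\<^sub>R (w + z)"
    by (simp add: iu_iu \<alpha>_def w_def z_def algebra_simps scaleR_2)
  then have "w + z = (1/2) *\<^sub>R (\<alpha> * \<alpha> + \<beta> * \<beta>)" by simp
  then have "pos (w + z)" using pos_scaleR[OF pos_add[OF pos_square[OF sab(1)] pos_square[OF sab(2)]], of "1/2"] by simp
  then have pw: "pos w" using pos_add[OF _ pz] by fastforce
  have "w * y = y * z" by (simp add: w_def z_def mult.assoc)
  then have "fc ?p w * y = y * fc ?p z" by (rule fc_intertwine[OF cp sw sz])
  moreover have "fc ?p w = fc (\<lambda>t. t) w"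
    by (rule fc_cong[OF cp _ btw_pos[OF pw order_refl]]) (auto intro!: continuous_intros)
  moreover have "btw (- norm z) z 0"
    using btw_pos[OF pz, of "norm z"] unfolding btw_def by (simp add: add.commute)
  then have "fc ?p z = fc (\<lambda>t. 0) z"
    by (intro fc_cong[OF cp _ \<open>btw _ z 0\<close>]) (auto intro!: continuous_intros)
  ultimately have "w * y = 0" by (simp add: fc_id fc_const sw sz)
  then have "w * y * adj y = 0" by simp
  then have "w * w = 0" by (simp add: w_def mult.assoc)
  then have "w = 0" by (rule sa_square_eq_0[OF sw])
  then have "y = 0" unfolding w_def using cstar_norm'[of y] by simp
  then have "u * u = 0" using zu unfolding z_def by simp
  then have "u = 0" by (rule sa_square_eq_0[OF su])
  have "fc (\<lambda>t. ?p t - ?n t) b = fc ?p b - u" unfolding u_def by (rule fc_diff[OF cp cn sb])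
  moreover have "(\<lambda>t. ?p t - ?n t) = (\<lambda>t. t)" by auto
  ultimately have "b = fc ?p b" using \<open>u = 0\<close> by (simp add: fc_id sb)
  moreover have "pos (fc ?p b)" by (rule fc_pos[OF cp btw_norm[OF sb order_refl]]) auto
  ultimately show ?thesis unfolding b_def by simp
qed

lemma pos_conj: 
  assumes "pos b" shows "pos (adj x * b * x)"
proof -
  obtain s where s: "adj s = s" "s * s = b" using pos_sqrt[OF assms] by metis
  have "adj (s * x) * (s * x) = adj x * (s * s) * x"
    by (simp only: adj_mult s(1) mult.assoc)
  then have "adj x * b * x = adj (s * x) * (s * x)" using s(2) by simp
  then show ?thesis using pos_adj_mult by simp
qed

lemma pos_conj': "pos b \<Longrightarrow> pos (x * b * adj x)"
  using pos_conj[of b "adj x"] by simp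

lemma pos_conj_sa: "pos b \<Longrightarrow> adj x = x \<Longrightarrow> pos (x * b * x)"
  using pos_conj[of b x] by simp

lemma norm_conj_mono:
  assumes "pos a" "pos (b - a)" "adj x = x" shows "norm (x * a * x) \<le> norm (x * b * x)"
proof (rule pos_mono_norm)
  show "pos (x * a * x)" by (rule pos_conj_sa[OF assms(1,3)])
  have "pos (x * (b - a) * x)" by (rule pos_conj_sa[OF assms(2,3)])
  then show "pos (x * b * x - x * a * x)" by (simp add: algebra_simps)
qed

section \<open>Roots and polar parts\<close>

definition rt :: "'a::cstar \<Rightarrow> 'a" where "rt a = fc sqrt a"

lemma cont_sqrt: "cont sqrt" by (intro continuous_intros)

lemma adj_rt: "pos a \<Longrightarrow> adj (rt a) = rt a"
  unfolding rt_def by (rule adj_fc[OF cont_sqrt pos_sa])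

lemma rt_rt: 
  assumes "pos a" shows "rt a * rt a = a"
proof -
  have sa: "adj a = a" by (rule pos_sa[OF assms])
  have "rt a * rt a = fc (\<lambda>t. sqrt t * sqrt t) a" unfolding rt_def by (rule fc_mult[OF cont_sqrt cont_sqrt sa, symmetric])
  also have "\<dots> = fc (\<lambda>t. t) a"
    by (rule fc_cong[OF _ _ btw_pos[OF assms order_refl]]) (auto intro!: continuous_intros)
  finally show ?thesis by (simp add: fc_id sa)
qed

lemma rt_fc_square:
  assumes "cont \<phi>" "btw m a M" "\<And>t. m \<le> t \<Longrightarrow> t \<le> M \<Longrightarrow> 0 \<le> \<phi> t"
  shows "rt (fc \<phi> a * fc \<phi> a) = fc \<phi> a"
proof -
  note sa = btw_sa[OF assms(2)]
  have c2: "cont (\<lambda>t. \<phi> t * \<phi> t)" by (intro continuous_intros assms)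
  have "rt (fc \<phi> a * fc \<phi> a) = fc (\<lambda>t. sqrt (\<phi> t * \<phi> t)) a"
    unfolding rt_def fc_mult[OF assms(1,1) sa, symmetric] by (rule fc_comp[OF cont_sqrt c2 sa])
  also have "\<dots> = fc \<phi> a"
    by (rule fc_cong[OF _ assms(1,2)]) (use assms(3) in \<open>auto intro!: continuous_intros assms(1)\<close>)
  finally show ?thesis .
qed

lemma rt_square: "pos q \<Longrightarrow> rt (q * q) = q"
  using rt_fc_square[of "\<lambda>t. t" 0 q "norm q"] btw_pos[of q "norm q"] by (simp add: fc_id pos_sa)

text \<open>The square of the norm is that of \<open>fc \<phi> m * c * fc \<phi> m\<close>, and
  replacing \<open>c\<close> by the larger \<open>m\<close> leaves a function of \<open>m\<close>
  alone. This reduces the estimates on polar parts to scalar ones.\<close>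

lemma norm_fc_rt_le:
  assumes c: "cont \<phi>" and "pos c" "pos (m - c)" "K \<ge> 0"
    and K: "\<And>t. 0 \<le> t \<Longrightarrow> t \<le> norm m \<Longrightarrow> \<phi> t * \<phi> t * t \<le> K\<^sup>2"
  shows "norm (fc \<phi> m * rt c) \<le> K"
proof -
  have pm: "pos m" using pos_add[OF assms(2,3)] by simp
  note sm = pos_sa[OF pm]
  have sf: "adj (fc \<phi> m) = fc \<phi> m" by (rule adj_fc[OF c sm])
  let ?s = "fc \<phi> m"
  have "(norm (?s * rt c))\<^sup>2 = norm ((?s * rt c) * adj (?s * rt c))" by (simp add: cstar_norm')
  also have "(?s * rt c) * adj (?s * rt c) = ?s * (rt c * rt c) * ?s"
    by (simp add: adj_mult sf adj_rt[OF assms(2)] mult.assoc)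
  also have "norm \<dots> \<le> norm (?s * m * ?s)" 
    unfolding rt_rt[OF assms(2)] by (rule norm_conj_mono[OF assms(2,3) sf])
  also have "?s * m * ?s = fc (\<lambda>t. \<phi> t * t * \<phi> t) m"
    unfolding fc_self_mult[OF c sm] by (rule fc_mult[symmetric]) (intro continuous_intros c sm)+
  also have "norm \<dots> \<le> K\<^sup>2"
    by (rule fc_norm_le[OF _ btw_pos[OF pm order_refl]]) (use K in \<open>auto intro!: continuous_intros c simp: abs_mult ac_simps\<close>)
  finally show ?thesis using assms(4) by (simp add: power2_le_iff_abs_le)
qed

text \<open>A regularised inverse square root. The \<open>max\<close> makes it continuous on the
  whole line; its arguments are positive elements.\<close>

definition invrt :: "real \<Rightarrow> real \<Rightarrow> real" where "invrt \<eta> t = 1 / sqrt (max t 0 + \<eta>)"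

lemma cont_invrt [continuous_intros]: "\<eta> > 0 \<Longrightarrow> cont (invrt \<eta>)"
  unfolding invrt_def by (intro continuous_intros) (auto simp: add_nonneg_pos less_imp_neq[symmetric])

lemma invrt_bounds:
  assumes "\<eta> > 0" "0 \<le> t"
  shows "\<bar>t * invrt \<eta> t - sqrt t\<bar> \<le> sqrt \<eta>" "0 \<le> invrt \<eta> t" "invrt \<eta> t \<le> 1 / sqrt \<eta>"
    "invrt \<eta> t * invrt \<eta> t = 1 / (t + \<eta>)"
proof -
  have pos: "0 < sqrt (t + \<eta>)" using assms by simp
  have le: "sqrt t \<le> sqrt (t + \<eta>)" using assms by simp
  have "sqrt t * (sqrt (t + \<eta>) - sqrt t) \<le> sqrt (t + \<eta>) * sqrt \<eta>"
    using le sqrt_add_le_add_sqrt[of t \<eta>] assms by (intro mult_mono) auto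
  then have "sqrt t * sqrt (t + \<eta>) - t \<le> sqrt \<eta> * sqrt (t + \<eta>)" using assms by (simp add: algebra_simps)
  moreover have "t \<le> sqrt t * sqrt (t + \<eta>)" using mult_left_mono[OF le, of "sqrt t"] assms by simp
  ultimately have "\<bar>t - sqrt t * sqrt (t + \<eta>)\<bar> \<le> sqrt \<eta> * sqrt (t + \<eta>)" by linarith
  moreover have "t * invrt \<eta> t - sqrt t = (t - sqrt t * sqrt (t + \<eta>)) / sqrt (t + \<eta>)"
    using pos assms by (simp add: invrt_def field_simps)
  ultimately show "\<bar>t * invrt \<eta> t - sqrt t\<bar> \<le> sqrt \<eta>" using pos by (simp add: abs_div_pos[symmetric] pos_divide_le_eq)
  show "0 \<le> invrt \<eta> t" using assms by (simp add: invrt_def)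
  show "invrt \<eta> t \<le> 1 / sqrt \<eta>" using assms by (simp add: invrt_def frac_le)
  show "invrt \<eta> t * invrt \<eta> t = 1 / (t + \<eta>)" using assms by (simp add: invrt_def)
qed

text \<open>If \<open>x\<close> has polar decomposition \<open>w * rt (adj x * x)\<close>, this
  tends to \<open>w * rt c\<close> as \<open>\<eta>\<close> tends to 0. For \<open>c\<close> below
  \<open>adj x * x\<close> the limit exists in norm, although \<open>w\<close> itself may lie
  outside the algebra.\<close>

definition polar :: "real \<Rightarrow> 'a::cstar \<Rightarrow> 'a \<Rightarrow> 'a" where
  "polar \<eta> x c = x * fc (invrt \<eta>) (adj x * x) * rt c"

text \<open>In norm estimates \<open>x\<close> may be replaced by the root of
  \<open>adj x * x\<close>, and this root is absorbed into \<open>\<phi>\<close> as the factor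
  \<open>sqrt t\<close>.\<close>

lemma norm_mult_fc_rt_le:
  assumes c: "cont \<phi>" and "pos c" "pos (adj x * x - c)" "K \<ge> 0"
    and K: "\<And>t. 0 \<le> t \<Longrightarrow> \<bar>t * \<phi> t\<bar> \<le> K"
  shows "norm (x * fc \<phi> (adj x * x) * rt c) \<le> K"
proof -
  define m where "m = adj x * x"
  have pm: "pos m" unfolding m_def by (rule pos_adj_mult)
  note sm = pos_sa[OF pm]
  let ?\<psi> = "\<lambda>t. sqrt t * \<phi> t"
  have cp: "cont ?\<psi>" by (intro continuous_intros c)
  have st: "adj (fc \<phi> m) = fc \<phi> m" "adj (fc ?\<psi> m) = fc ?\<psi> m" by (rule adj_fc[OF _ sm]; intro c cp)+
  have e: "fc \<phi> m * m * fc \<phi> m = fc ?\<psi> m * fc ?\<psi> m"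
  proof -
    have "fc \<phi> m * m * fc \<phi> m = fc (\<lambda>t. \<phi> t * t * \<phi> t) m"
      unfolding fc_self_mult[OF c sm] by (rule fc_mult[symmetric]) (intro continuous_intros c sm)+
    also have "\<dots> = fc (\<lambda>t. ?\<psi> t * ?\<psi> t) m"
    proof (rule fc_cong[OF _ _ btw_pos[OF pm order_refl]])
      fix t :: real assume t: "0 \<le> t"
      have "?\<psi> t * ?\<psi> t = (sqrt t * sqrt t) * (\<phi> t * \<phi> t)" by (simp only: ac_simps)
      then show "\<phi> t * t * \<phi> t = ?\<psi> t * ?\<psi> t" using t by simp
    qed (intro continuous_intros c cp)+
    also have "\<dots> = fc ?\<psi> m * fc ?\<psi> m" by (rule fc_mult[OF cp cp sm])
    finally show ?thesis .
  qed
  have "(norm (x * fc \<phi> m * rt c))\<^sup>2 = norm (adj (x * fc \<phi> m * rt c) * (x * fc \<phi> m * rt c))"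
    by (rule cstar_norm[symmetric])
  also have "adj (x * fc \<phi> m * rt c) * (x * fc \<phi> m * rt c) = rt c * (fc \<phi> m * m * fc \<phi> m) * rt c"
    by (simp add: adj_mult st[unfolded m_def] adj_rt[OF assms(2)] m_def mult.assoc)
  also have "\<dots> = adj (fc ?\<psi> m * rt c) * (fc ?\<psi> m * rt c)"
    unfolding e by (simp add: adj_mult st adj_rt[OF assms(2)] mult.assoc)
  also have "norm \<dots> = (norm (fc ?\<psi> m * rt c))\<^sup>2" by (rule cstar_norm)
  finally have "norm (x * fc \<phi> m * rt c) = norm (fc ?\<psi> m * rt c)" by simp
  also have "\<dots> \<le> K"
  proof (rule norm_fc_rt_le[OF cp assms(2)])
    fix t :: real assume t: "0 \<le> t"
    have "?\<psi> t * ?\<psi> t * t = (sqrt t * sqrt t) * t * (\<phi> t * \<phi> t)" by (simp only: ac_simps)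
    then have "?\<psi> t * ?\<psi> t * t = (t * \<phi> t)\<^sup>2" using t by (simp add: power2_eq_square)
    then show "?\<psi> t * ?\<psi> t * t \<le> K\<^sup>2" using K[OF t] by (metis abs_ge_zero power2_abs power_mono)
  qed (use assms m_def in auto)
  finally show ?thesis unfolding m_def .
qed

lemma polar_diff:
  assumes "pos c" "pos (adj x * x - c)" "\<eta> > 0" "\<eta>' > 0"
  shows "norm (polar \<eta> x c - polar \<eta>' x c) \<le> sqrt \<eta> + sqrt \<eta>'"
proof -
  have sm: "adj (adj x * x) = adj x * x" by (simp add: adj_mult)
  have "polar \<eta> x c - polar \<eta>' x c = x * fc (\<lambda>t. invrt \<eta> t - invrt \<eta>' t) (adj x * x) * rt c"
    unfolding polar_def by (subst fc_diff) (auto intro!: cont_invrt assms simp: sm algebra_simps)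
  also have "norm \<dots> \<le> sqrt \<eta> + sqrt \<eta>'"
  proof (rule norm_mult_fc_rt_le[OF _ assms(1,2)])
    fix t :: real assume "0 \<le> t"
    then show "\<bar>t * (invrt \<eta> t - invrt \<eta>' t)\<bar> \<le> sqrt \<eta> + sqrt \<eta>'"
      using invrt_bounds(1)[OF assms(3), of t] invrt_bounds(1)[OF assms(4), of t] by (simp add: right_diff_distrib)
  qed (use assms in \<open>auto intro!: continuous_intros add_nonneg_nonneg\<close>)
  finally show ?thesis .
qed

text \<open>With \<open>m = adj x * x\<close> the defect is \<open>\<eta> / (m + \<eta>)\<close>
  between two factors \<open>rt c\<close>. As \<open>c \<le> m\<close>, it is controlled by
  \<open>\<eta> * t / (t + \<eta>)\<close>, which never exceeds \<open>\<eta>\<close>.\<close>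

lemma polar_square:
  assumes "pos c" "pos (adj x * x - c)" "\<eta> > 0"
  shows "norm (c - adj (polar \<eta> x c) * polar \<eta> x c) \<le> \<eta>"
proof -
  define m where "m = adj x * x"
  have pm: "pos m" unfolding m_def by (rule pos_adj_mult)
  note sm = pos_sa[OF pm]
  let ?g = "invrt \<eta>" and ?\<psi> = "\<lambda>t. sqrt (\<eta> / (max t 0 + \<eta>))"
  have cg: "cont ?g" by (rule cont_invrt[OF assms(3)])
  have ne: "max t 0 + \<eta> \<noteq> 0" for t using assms(3) by (auto simp: max_def)
  have cp: "cont ?\<psi>" by (intro continuous_intros) (use ne in auto)
  have st: "adj (fc ?g m) = fc ?g m" "adj (fc ?\<psi> m) = fc ?\<psi> m" by (rule adj_fc[OF _ sm]; intro cg cp)+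
  have e: "1 - fc ?g m * m * fc ?g m = fc ?\<psi> m * fc ?\<psi> m"
  proof -
    have "fc ?g m * m * fc ?g m = fc (\<lambda>t. ?g t * t * ?g t) m"
      unfolding fc_self_mult[OF cg sm] by (rule fc_mult[symmetric]) (intro continuous_intros cg sm)+
    then have "1 - fc ?g m * m * fc ?g m = fc (\<lambda>t. 1 - ?g t * t * ?g t) m"
      by (subst fc_diff) (auto intro!: continuous_intros cg simp: fc_const sm)
    also have "\<dots> = fc (\<lambda>t. ?\<psi> t * ?\<psi> t) m"
    proof (rule fc_cong[OF _ _ btw_pos[OF pm order_refl]])
      fix t :: real assume t: "0 \<le> t"
      have "?g t * t * ?g t = t * (?g t * ?g t)" by simp
      also have "\<dots> = t / (t + \<eta>)" using invrt_bounds(4)[OF assms(3) t] by simp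
      finally show "1 - ?g t * t * ?g t = ?\<psi> t * ?\<psi> t" using t assms(3) by (simp add: field_simps)
    qed (intro continuous_intros cg cp)+
    also have "\<dots> = fc ?\<psi> m * fc ?\<psi> m" by (rule fc_mult[OF cp cp sm])
    finally show ?thesis .
  qed
  have "adj (polar \<eta> x c) * polar \<eta> x c = rt c * (fc ?g m * m * fc ?g m) * rt c"
    by (simp add: polar_def adj_mult st adj_rt[OF assms(1)] mult.assoc flip: m_def)
      (simp add: m_def mult.assoc)
  then have "c - adj (polar \<eta> x c) * polar \<eta> x c = rt c * (1 - fc ?g m * m * fc ?g m) * rt c"
    using rt_rt[OF assms(1)] by (simp add: left_diff_distrib right_diff_distrib)
  also have "\<dots> = adj (fc ?\<psi> m * rt c) * (fc ?\<psi> m * rt c)"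
    unfolding e by (simp add: adj_mult st adj_rt[OF assms(1)] mult.assoc)
  finally have "norm (c - adj (polar \<eta> x c) * polar \<eta> x c) = (norm (fc ?\<psi> m * rt c))\<^sup>2"
    using cstar_norm by metis
  also have "norm (fc ?\<psi> m * rt c) \<le> sqrt \<eta>"
  proof (rule norm_fc_rt_le[OF cp assms(1)])
    fix t :: real assume t: "0 \<le> t"
    have "\<eta> * t / (t + \<eta>) \<le> \<eta>" using t assms(3) by (simp add: field_simps)
    then show "?\<psi> t * ?\<psi> t * t \<le> (sqrt \<eta>)\<^sup>2" using t assms(3) by simp
  qed (use assms m_def in auto)
  then have "(norm (fc ?\<psi> m * rt c))\<^sup>2 \<le> (sqrt \<eta>)\<^sup>2" by (rule power_mono) simp
  finally show ?thesis using assms(3) by simp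
qed

text \<open>The last clause holds since \<open>y\<close> is a limit of right multiples of
  \<open>x\<close>. It later transfers orthogonality of ranges and invariance under the unit of the
  corner from \<open>x\<close> to \<open>y\<close>.\<close>

lemma polar_limit:
  fixes x c :: "'a::cstar"
  assumes "pos c" "pos (adj x * x - c)"
  obtains y where "adj y * y = c" "\<And>\<eta>. \<eta> > 0 \<Longrightarrow> norm (y - polar \<eta> x c) \<le> sqrt \<eta>"
    "\<And>t. t * x = 0 \<Longrightarrow> t * y = 0"
proof -
  define e where "e n = 1 / real (Suc n)" for n
  have e0: "e n > 0" for n by (simp add: e_def)
  have el: "e \<longlonglongrightarrow> 0" unfolding e_def by (rule LIMSEQ_Suc[OF lim_1_over_n])
  have sl: "(\<lambda>n. sqrt (e n)) \<longlonglongrightarrow> 0" using tendsto_real_sqrt[OF el] by simp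
  let ?p = "\<lambda>n. polar (e n) x c"
  have "Cauchy ?p"
  proof (rule CauchyI)
    fix d :: real assume d: "0 < d"
    then obtain N where N: "\<And>n. n \<ge> N \<Longrightarrow> sqrt (e n) < d / 2"
      using sl[THEN LIMSEQ_D, of "d/2"] by (metis abs_less_iff diff_zero half_gt_zero real_norm_def)
    have "norm (?p k - ?p l) < d" if "k \<ge> N" "l \<ge> N" for k l
      using polar_diff[OF assms e0 e0, of k l] N[OF that(1)] N[OF that(2)] by linarith
    then show "\<exists>M. \<forall>m\<ge>M. \<forall>n\<ge>M. norm (?p m - ?p n) < d" by blast
  qed
  then obtain y where y: "?p \<longlonglongrightarrow> y" using Cauchy_convergent convergent_def by blast
  have "(\<lambda>n. c - adj (?p n) * ?p n) \<longlonglongrightarrow> 0"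
    by (rule tendsto_0_le[OF el, where K=1]) 
      (use polar_square[OF assms e0] e0 in \<open>auto intro!: always_eventually simp: abs_of_pos\<close>)
  moreover have "(\<lambda>n. c - adj (?p n) * ?p n) \<longlonglongrightarrow> c - adj y * y" by (intro tendsto_intros y)
  ultimately have "c - adj y * y = 0" using LIMSEQ_unique by blast
  then have 1: "adj y * y = c" by simp
  have 2: "norm (y - polar \<eta> x c) \<le> sqrt \<eta>" if "\<eta> > 0" for \<eta>
  proof -
    have "(\<lambda>n. norm (?p n - polar \<eta> x c) - sqrt (e n)) \<longlonglongrightarrow> norm (y - polar \<eta> x c) - 0"
      by (intro tendsto_intros y sl)
    then have "norm (y - polar \<eta> x c) - 0 \<le> sqrt \<eta>"
      by (rule LIMSEQ_le_const2) (use polar_diff[OF assms e0 that] in \<open>auto simp: algebra_simps\<close>)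
    then show ?thesis by simp
  qed
  have 3: "t * y = 0" if "t * x = 0" for t
  proof -
    have "t * ?p n = 0" for n using that by (simp add: polar_def flip: mult.assoc)
    moreover have "(\<lambda>n. t * ?p n) \<longlonglongrightarrow> t * y" by (intro tendsto_intros y)
    ultimately have "(\<lambda>n::nat. 0) \<longlonglongrightarrow> t * y" by simp
    then show ?thesis by (rule LIMSEQ_const_iff[THEN iffD1, symmetric])
  qed
  show ?thesis by (rule that[OF 1 2 3])
qed

text \<open>The regularised polar part depends continuously on \<open>x\<close>, and at
  \<open>x = u * q\<close> it is \<open>u\<close> times a function of \<open>q\<close>, which up to
  regularisation gives \<open>u * rt c\<close>. Uniform continuity of functional calculus yields a
  \<open>\<delta>\<close> depending on \<open>R\<close> and \<open>\<epsilon>\<close> alone.\<close>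

lemma polar_near:
  assumes R: "R > 0" and eps: "\<epsilon> > 0"
  shows "\<exists>\<delta>>0. \<forall>x q c u :: 'a::cstar. pos q \<longrightarrow> norm q \<le> R \<longrightarrow> norm x \<le> R \<longrightarrow> norm u \<le> 1 \<longrightarrow>
     adj u * u * q = q \<longrightarrow> pos c \<longrightarrow> pos (adj x * x - c) \<longrightarrow> pos (q * q - c) \<longrightarrow> norm (x - u * q) < \<delta> \<longrightarrow>
     (\<exists>y. adj y * y = c \<and> norm (y - u * rt c) < \<epsilon> \<and> (\<forall>t. t * x = 0 \<longrightarrow> t * y = 0))"
proof -
  \<comment> \<open>A share for each of the four terms into which \<open>y - u * rt c\<close> is
    split below. Regularisation costs the root of \<open>\<eta>\<close>, so \<open>\<eta>\<close> is
    taken as the square of a share.\<close>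
  define s where "s = \<epsilon> / 8"
  define \<eta> where "\<eta> = s\<^sup>2"
  have s0: "s > 0" and \<eta>0: "\<eta> > 0" and s\<eta>: "sqrt \<eta> = s" using eps by (auto simp: \<eta>_def s_def)
  let ?g = "invrt \<eta>"
  have cg: "cont ?g" by (rule cont_invrt[OF \<eta>0])
  obtain d1 where d1: "d1 > 0" "\<And>a b::'a. adj a = a \<Longrightarrow> adj b = b \<Longrightarrow> norm a \<le> R\<^sup>2 \<Longrightarrow> norm b \<le> R\<^sup>2 \<Longrightarrow>
     norm (a - b) < d1 \<Longrightarrow> norm (fc ?g a - fc ?g b) < s / R\<^sup>2"
    using fc_uniform_cont[OF cg, of "s / R\<^sup>2" "R\<^sup>2", where ?'a='a] s0 R by auto
  define \<delta> where "\<delta> = min (d1 / (2 * R)) (s * s / R)"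
  have \<delta>: "\<delta> > 0" "\<delta> \<le> d1 / (2 * R)" "\<delta> \<le> s * s / R" using d1 s0 R by (auto simp: \<delta>_def)
  have "\<exists>y. adj y * y = c \<and> norm (y - u * rt c) < \<epsilon> \<and> (\<forall>t. t * x = 0 \<longrightarrow> t * y = 0)"
    if h: "pos q" "norm q \<le> R" "norm x \<le> R" "norm u \<le> 1" "adj u * u * q = q" "pos c" "pos (adj x * x - c)"
      "pos (q * q - c)" "norm (x - u * q) < \<delta>" for x q c u :: 'a
  proof -
    define m where "m = adj x * x"
    have pm: "pos m" and sm: "adj m = m" unfolding m_def by (auto simp: pos_adj_mult pos_sa)
    have sq: "adj q = q" by (rule pos_sa[OF h(1)])
    have pqq: "pos (q * q)" by (rule pos_square[OF sq])
    have nrc: "norm (rt c) \<le> R"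
    proof -
      have "(norm (rt c))\<^sup>2 = norm c" using norm_sq_sa[OF adj_rt[OF h(6)]] rt_rt[OF h(6)] by simp
      also have "\<dots> \<le> norm (q * q)" by (rule pos_mono_norm[OF h(6,8)])
      also have "\<dots> \<le> R\<^sup>2" using norm_sq_sa[OF sq] h(2) by (simp add: power_mono)
      finally show ?thesis using R by (simp add: power2_le_iff_abs_le)
    qed
    have nu: "norm (u * q) \<le> R" using order_trans[OF norm_mult_ineq mult_mono[OF h(4,2)]] R by simp
    have uq: "adj (u * q) * (u * q) = q * q"
    proof -
      have "adj (u * q) * (u * q) = q * (adj u * u * q)" by (simp add: adj_mult sq mult.assoc)
      then show ?thesis by (simp add: h)
    qed
    have "m - q * q = adj x * (x - u * q) + adj (x - u * q) * (u * q)"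
      unfolding m_def uq[symmetric] by (simp add: algebra_simps adj_diff)
    also have "norm \<dots> \<le> norm x * norm (x - u * q) + norm (x - u * q) * norm (u * q)"
      by (intro order_trans[OF norm_triangle_ineq] add_mono order_trans[OF norm_mult_ineq]) simp_all
    also have "\<dots> \<le> R * norm (x - u * q) + norm (x - u * q) * R"
      by (intro add_mono mult_mono h nu) (use R in auto)
    also have "\<dots> < 2 * R * \<delta>" using h(9) R by simp
    also have "\<dots> \<le> d1" using \<delta>(2) R by (simp add: field_simps)
    finally have mq: "norm (m - q * q) < d1" .
    have nm: "norm m \<le> R\<^sup>2" "norm (q * q) \<le> R\<^sup>2"
      unfolding m_def using cstar_norm[of x] norm_sq_sa[OF sq] h(2,3) by (simp_all add: power_mono)
    have gd: "norm (fc ?g m - fc ?g (q * q)) \<le> s / R\<^sup>2"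
      using d1(2)[OF sm _ nm mq] pos_sa[OF pqq] by simp
    have gm: "norm (fc ?g m) \<le> 1 / s"
      by (rule fc_norm_le[OF cg btw_pos[OF pm order_refl]]) (use invrt_bounds(2,3)[OF \<eta>0] s\<eta> in auto)
    obtain y where y: "adj y * y = c" "\<And>\<eta>. \<eta> > 0 \<Longrightarrow> norm (y - polar \<eta> x c) \<le> sqrt \<eta>"
       "\<And>t. t * x = 0 \<Longrightarrow> t * y = 0" using polar_limit[OF h(6,7)] by metis
    \<comment> \<open>The function \<open>sqrt t * invrt \<eta> t\<close> need not be close to 1
      near 0, but its defect becomes small after multiplication by \<open>rt c\<close>, because
      \<open>c \<le> q * q\<close>.\<close>
    have last: "norm (q * fc ?g (q * q) * rt c - rt c) \<le> s"
    proof -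
      let ?\<psi> = "\<lambda>t. sqrt t * ?g t - 1"
      have "q * fc ?g (q * q) - 1 = fc ?\<psi> (q * q)"
        by (subst fc_diff, (intro continuous_intros cg pos_sa[OF pqq])+, subst fc_mult[OF cont_sqrt cg pos_sa[OF pqq]])
          (simp add: fc_const pos_sa[OF pqq] rt_square[OF h(1)] flip: rt_def)
      then have "q * fc ?g (q * q) * rt c - rt c = fc ?\<psi> (q * q) * rt c" by (simp add: algebra_simps)
      also have "norm \<dots> \<le> s"
      proof (rule norm_fc_rt_le[OF _ h(6,8)])
        fix t :: real assume t: "0 \<le> t"
        have "?\<psi> t * ?\<psi> t * (sqrt t * sqrt t) = (sqrt t * sqrt t * ?g t - sqrt t)\<^sup>2"
          by (simp only: power2_eq_square algebra_simps)
        then have "?\<psi> t * ?\<psi> t * t = (t * ?g t - sqrt t)\<^sup>2" using t by simp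
        also have "\<dots> \<le> s\<^sup>2" using invrt_bounds(1)[OF \<eta>0 t] s\<eta> by (metis abs_ge_zero power2_abs power_mono)
        finally show "?\<psi> t * ?\<psi> t * t \<le> s\<^sup>2" .
      qed (use s0 in \<open>auto intro!: continuous_intros cg\<close>)
      finally show ?thesis .
    qed
    have "y - u * rt c = (y - polar \<eta> x c) + ((x - u * q) * fc ?g m * rt c
       + (u * q * (fc ?g m - fc ?g (q * q)) * rt c + u * (q * fc ?g (q * q) * rt c - rt c)))"
      by (simp add: polar_def algebra_simps flip: m_def)
    also have "norm \<dots> \<le> norm (y - polar \<eta> x c) + (norm (x - u * q) * norm (fc ?g m) * norm (rt c)
       + (norm (u * q) * norm (fc ?g m - fc ?g (q * q)) * norm (rt c) + norm u * norm (q * fc ?g (q * q) * rt c - rt c)))"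
      by (intro order_trans[OF norm_triangle_ineq] add_mono order_refl order_trans[OF norm_mult_ineq] mult_right_mono) auto
    also have "\<dots> \<le> s + (\<delta> * (1 / s) * R + (R * (s / R\<^sup>2) * R + 1 * s))"
      by (intro add_mono mult_mono gm gd h nrc nu last less_imp_le[OF h(9)] y(2)[OF \<eta>0, unfolded s\<eta>])
        (use s0 R \<delta> in auto)
    also have "R * (s / R\<^sup>2) * R = s" using R by (simp add: power2_eq_square)
    also have "\<delta> * (1 / s) * R \<le> s" using \<delta>(3) s0 R by (simp add: field_simps)
    also have "s + (s + (s + 1 * s)) < \<epsilon>" using eps by (simp add: s_def)
    finally show ?thesis using y by (intro exI[of _ y]) auto
  qed
  then show ?thesis using \<delta>(1) by blast
qed

section \<open>Cuntz comparison inside one algebra\<close>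

text \<open>Cuntz subequivalence with witnesses in the algebra itself instead of matrices over it.
  For elements of the algebra both notions agree, as is shown later by compressing a matrix witness
  to one entry.\<close>

definition cz :: "'a::cstar \<Rightarrow> 'a \<Rightarrow> bool" where
  "cz a b \<longleftrightarrow> (\<forall>e>0. \<exists>r. norm (a - adj r * b * r) < e)"

lemma cz_conj: "cz (adj r * b * r) b"
  unfolding cz_def by (intro allI impI exI[of _ r]) simp

lemma cz_trans:
  fixes a b c :: "'a::cstar"
  assumes "cz a b" "cz b c" shows "cz a c"
  unfolding cz_def
proof (intro allI impI)
  fix e :: real assume e: "e > 0"
  then obtain r where r: "norm (a - adj r * b * r) < e / 2" using assms(1) unfolding cz_def by (meson half_gt_zero)
  \<comment> \<open>The second approximation gets multiplied by \<open>r\<close> on both sides, so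
    it has to be better by the factor \<open>(norm r)\<^sup>2\<close>.\<close>
  define e' where "e' = e / (2 * ((norm r)\<^sup>2 + 1))"
  have e': "e' > 0" "e' * (norm r)\<^sup>2 \<le> e / 2" using e 
  proof -
    have n: "0 < 2 * ((norm r)\<^sup>2 + 1)" by (simp add: add_nonneg_pos)
    then show "e' > 0" using e by (simp add: e'_def)
    have "e * (norm r)\<^sup>2 \<le> e * ((norm r)\<^sup>2 + 1)" using e by simp
    then show "e' * (norm r)\<^sup>2 \<le> e / 2" unfolding e'_def using n by (simp add: divide_simps) (simp add: algebra_simps)
  qed
  obtain s where s: "norm (b - adj s * c * s) < e'" using assms(2) e' unfolding cz_def by blast
  have "a - adj (s * r) * c * (s * r) = (a - adj r * b * r) + adj r * (b - adj s * c * s) * r"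
    by (simp add: adj_mult algebra_simps)
  also have "norm \<dots> \<le> norm (a - adj r * b * r) + norm r * norm (b - adj s * c * s) * norm r"
    by (intro order_trans[OF norm_triangle_ineq] add_mono order_refl order_trans[OF norm_mult_ineq] mult_right_mono)
      (auto intro: order_trans[OF norm_mult_ineq])
  also have "norm r * norm (b - adj s * c * s) * norm r = norm (b - adj s * c * s) * (norm r)\<^sup>2"
    by (simp add: power2_eq_square)
  also have "\<dots> \<le> e' * (norm r)\<^sup>2" using s by (intro mult_right_mono) auto
  finally show "\<exists>t. norm (a - adj t * c * t) < e" using r e' by (intro exI[of _ "s * r"]) linarith
qed

text \<open>The regularised polar part of \<open>rt b * w\<close> has the form
  \<open>rt b * p\<close>; hence \<open>adj p * b * p\<close> is its square, which is within
  \<open>e / 2\<close> of \<open>c\<close>.\<close>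

lemma cz_if_le_conj:
  assumes "pos b" "pos c" "pos (adj w * b * w - c)" shows "cz c b"
  unfolding cz_def
proof (intro allI impI)
  fix e :: real assume e: "e > 0"
  define x where "x = rt b * w"
  have "adj x * x = adj w * (rt b * rt b) * w" by (simp add: x_def adj_mult adj_rt[OF assms(1)] mult.assoc)
  then have xx: "adj x * x = adj w * b * w" by (simp add: rt_rt[OF assms(1)])
  define p where "p = w * fc (invrt (e/2)) (adj x * x) * rt c"
  have "adj (polar (e/2) x c) * polar (e/2) x c = adj p * (rt b * rt b) * p"
    by (simp add: polar_def p_def adj_mult adj_rt[OF assms(1)] mult.assoc) (simp add: x_def adj_mult adj_rt[OF assms(1)] mult.assoc)
  then have "norm (c - adj p * b * p) \<le> e / 2"
    using polar_square[OF assms(2), of x "e/2"] assms(3) e xx by (simp add: rt_rt[OF assms(1)])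
  then show "\<exists>r. norm (c - adj r * b * r) < e" using e by (intro exI[of _ p]) linarith
qed

text \<open>\<open>a - of_real \<delta>\<close> lies below \<open>b\<close>, and conjugation by
  \<open>w\<close> preserves this. For \<open>w\<close> a function of \<open>a\<close> will be
  inserted that makes the left side a cut-off.\<close>

lemma cz_perturb:
  fixes a b w :: "'a::cstar"
  assumes "pos b" "adj a = a" "norm (a - b) \<le> \<delta>" "adj w = w" "pos (w * (a - of_real \<delta>) * w)"
  shows "cz (w * (a - of_real \<delta>) * w) b"
proof (rule cz_if_le_conj[OF assms(1,5), of w])
  have "pos (of_real \<delta> - (a - b))" by (rule pos_of_real_minus) (auto simp: adj_diff assms pos_sa)
  then have "pos (w * (of_real \<delta> - (a - b)) * w)" by (rule pos_conj_sa[OF _ assms(4)])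
  then show "pos (adj w * b * w - w * (a - of_real \<delta>) * w)" by (simp add: assms(4) algebra_simps)
qed

section \<open>Matrices acting on a finite free Hilbert module\<close>

definition sc :: "complex \<Rightarrow> 'a::cstar" where "sc c = of_real (Re c) + of_real (Im c) * iu"

lemma sc_commute: "x * sc c = sc c * (x::'a::cstar)"
  by (simp add: sc_def distrib_left distrib_right of_real_def iu_comm)

lemma sc_add: "sc (c + d) = sc c + (sc d :: 'a::cstar)"
  by (simp add: sc_def of_real_def algebra_simps)

lemma sc_mult: "sc (c * d) = sc c * (sc d :: 'a::cstar)"
  by (simp add: sc_def of_real_def algebra_simps iu_iu)

lemma sc_1 [simp]: "sc 1 = 1" and sc_0 [simp]: "sc 0 = 0" and sc_minus_1: "sc (-1) = - 1" 
  and sc_of_real: "sc (complex_of_real r) = of_real r"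
  by (simp_all add: sc_def)

lemma adj_sc: "adj (sc c) = (sc (cnj c) :: 'a::cstar)"
  by (simp add: sc_def adj_add adj_mult adj_iu of_real_def adj_scaleR)

lemma adj_sc_mult_sc: "adj (sc c * x) * (sc c * y) = sc (cnj c) * (sc c * (adj x * (y::'a::cstar)))"
proof -
  have "adj (sc c * x) * (sc c * y) = sc (cnj c) * ((adj x * sc c) * y)"
    by (simp only: adj_mult adj_sc sc_commute[of "adj x" "cnj c"] mult.assoc)
  also have "(adj x * sc c) * y = sc c * (adj x * y)" by (simp only: sc_commute[of "adj x"] mult.assoc)
  finally show ?thesis .
qed

lemma norm_sc_mult: "norm (sc c * (y::'a::cstar)) = cmod c * norm y"
proof -
  have c: "cnj c * c = complex_of_real ((cmod c)\<^sup>2)"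
    by (simp add: complex_norm_square[symmetric] mult.commute del: of_real_power)
  have "adj (sc c * y) * (sc c * y) = sc (cnj c) * sc c * (adj y * y)"
    by (simp only: adj_sc_mult_sc mult.assoc)
  also have "\<dots> = (cmod c)\<^sup>2 *\<^sub>R (adj y * y)"
    unfolding sc_mult[symmetric] c sc_of_real by (simp add: of_real_def)
  finally have "(norm (sc c * y))\<^sup>2 = (cmod c * norm y)\<^sup>2"
    by (simp add: cstar_norm[symmetric] power_mult_distrib)
  then show ?thesis by (simp add: power2_eq_iff_nonneg)
qed

definition hip :: "'i set \<Rightarrow> ('i \<Rightarrow> 'a::cstar) \<Rightarrow> ('i \<Rightarrow> 'a) \<Rightarrow> 'a" where
  "hip I v w = (\<Sum>i\<in>I. adj (v i) * w i)"

definition vn :: "'i set \<Rightarrow> ('i \<Rightarrow> 'a::cstar) \<Rightarrow> real" where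
  "vn I v = sqrt (norm (hip I v v))"

definition mvec :: "'i set \<Rightarrow> ('i \<Rightarrow> 'i \<Rightarrow> 'a::cstar) \<Rightarrow> ('i \<Rightarrow> 'a) \<Rightarrow> 'i \<Rightarrow> 'a" where
  "mvec I X v = (\<lambda>i. \<Sum>k\<in>I. X i k * v k)"

definition mmul :: "'i set \<Rightarrow> ('i \<Rightarrow> 'i \<Rightarrow> 'a::cstar) \<Rightarrow> ('i \<Rightarrow> 'i \<Rightarrow> 'a) \<Rightarrow> 'i \<Rightarrow> 'i \<Rightarrow> 'a" where
  "mmul I X Y = (\<lambda>i j. \<Sum>k\<in>I. X i k * Y k j)"

text \<open>The norm of \<open>X\<close> as an operator on the free right Hilbert module over the
  whole type; it serves matrix algebras as well as the regular representation.\<close>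

definition opn :: "'i set \<Rightarrow> ('i \<Rightarrow> 'i \<Rightarrow> 'a::cstar) \<Rightarrow> real" where
  "opn I X = Sup {sqrt (norm (hip I (mvec I X v) (mvec I X v))) | v. norm (hip I v v) \<le> 1}"

lemma pos_hip: "pos (hip I v v)"
  unfolding hip_def by (intro pos_sum pos_adj_mult)

lemma adj_hip: "adj (hip I v w) = hip I w v"
  by (simp add: hip_def adj_sum adj_mult)

lemma vn_nonneg [simp]: "0 \<le> vn I v"
  by (simp add: vn_def)

lemma vn_sq: "(vn I v)\<^sup>2 = norm (hip I v v)"
  by (simp add: vn_def)

lemma vn_le_1: "vn I v \<le> 1 \<longleftrightarrow> norm (hip I v v) \<le> 1"
  by (simp add: vn_def)

lemma hip_cong: "(\<And>i. i \<in> I \<Longrightarrow> v i = v' i) \<Longrightarrow> (\<And>i. i \<in> I \<Longrightarrow> w i = w' i) \<Longrightarrow> hip I v w = hip I v' w'"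
  unfolding hip_def by (intro sum.cong) auto

lemma vn_cong: "(\<And>i. i \<in> I \<Longrightarrow> v i = v' i) \<Longrightarrow> vn I v = vn I v'"
  unfolding vn_def by (intro arg_cong[where f = "\<lambda>x. sqrt (norm x)"] hip_cong) auto

section \<open>Norm estimates on the free Hilbert module\<close>

context
  fixes I :: "'i set"
  assumes fin: "finite I"
begin

lemma norm_comp_le_vn:
  assumes "i \<in> I" shows "norm (v i :: 'a::cstar) \<le> vn I v"
proof -
  have "hip I v v - adj (v i) * v i = (\<Sum>j\<in>I - {i}. adj (v j) * v j)"
    unfolding hip_def using sum.remove[OF fin assms, of "\<lambda>j. adj (v j) * v j"] by simp
  then have "pos (hip I v v - adj (v i) * v i)" by (simp add: pos_sum pos_adj_mult)
  then have "norm (adj (v i) * v i) \<le> norm (hip I v v)" by (rule pos_mono_norm[OF pos_adj_mult])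
  then have "(norm (v i))\<^sup>2 \<le> (vn I v)\<^sup>2" by (simp add: cstar_norm vn_sq)
  then show ?thesis by (simp add: power2_le_iff_abs_le)
qed

lemma vn_le_sum: "vn I v \<le> (\<Sum>i\<in>I. norm (v i :: 'a::cstar))"
proof -
  have "norm (hip I v v) \<le> (\<Sum>i\<in>I. norm (adj (v i) * v i))" unfolding hip_def by (rule norm_sum)
  also have "\<dots> = (\<Sum>i\<in>I. norm (v i) * norm (v i))" by (simp add: cstar_norm power2_eq_square)
  also have "\<dots> \<le> (\<Sum>i\<in>I. norm (v i) * (\<Sum>i\<in>I. norm (v i)))"
    by (intro sum_mono mult_left_mono member_le_sum fin) auto
  also have "\<dots> = (\<Sum>i\<in>I. norm (v i))\<^sup>2" by (simp add: power2_eq_square sum_distrib_right)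
  finally have "(vn I v)\<^sup>2 \<le> (\<Sum>i\<in>I. norm (v i))\<^sup>2" by (simp add: vn_sq)
  then show ?thesis by (rule power2_le_imp_le) (simp add: sum_nonneg)
qed

lemma hip_cauchy_schwarz: "norm (hip I v w) \<le> vn I v * vn I (w :: 'i \<Rightarrow> 'a::cstar)"
proof (cases "norm (hip I v v) = 0")
  case True
  then have "v i = 0" if "i \<in> I" for i using norm_comp_le_vn[OF that, of v] by (simp add: vn_def)
  then have "hip I v w = 0" by (simp add: hip_def)
  then show ?thesis by simp
next
  case False
  define l where "l = norm (hip I v v)"
  define C where "C = hip I v w"
  have l: "l > 0" using False by (simp add: l_def)
  \<comment> \<open>The usual combination for module-valued inner products: positivity of
    \<open>hip I u u\<close> together with \<open>hip I v v \<le> l\<close> gives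
    \<open>adj C * C \<le> l *\<^sub>R hip I w w\<close>.\<close>
  define u where "u i = v i * C - l *\<^sub>R w i" for i
  have "hip I u u = adj C * hip I v v * C - l *\<^sub>R (adj C * hip I v w) - l *\<^sub>R (hip I w v * C) + (l * l) *\<^sub>R hip I w w"
    by (simp add: hip_def u_def adj_diff adj_mult adj_scaleR sum.distrib sum_subtractf sum_distrib_left sum_distrib_right
        scaleR_sum_right left_diff_distrib right_diff_distrib mult.assoc) (simp add: algebra_simps sum_subtractf)
  also have "\<dots> = adj C * hip I v v * C - l *\<^sub>R (adj C * C) - l *\<^sub>R (adj C * C) + (l * l) *\<^sub>R hip I w w"
    by (simp add: C_def adj_hip)
  finally have hu: "hip I u u = \<dots>" .
  have p1: "pos (adj C * (of_real l - hip I v v) * C)"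
    by (rule pos_conj, rule pos_of_real_minus) (simp_all add: adj_hip l_def)
  have "hip I u u + adj C * (of_real l - hip I v v) * C = l *\<^sub>R (l *\<^sub>R hip I w w - adj C * C)"
    unfolding hu by (simp add: algebra_simps of_real_def)
  then have "pos (l *\<^sub>R (l *\<^sub>R hip I w w - adj C * C))" using pos_add[OF pos_hip p1] by metis
  then have "pos ((1/l) *\<^sub>R (l *\<^sub>R (l *\<^sub>R hip I w w - adj C * C)))" by (rule pos_scaleR) (use l in simp)
  then have "pos (l *\<^sub>R hip I w w - adj C * C)" using l by simp
  then have "norm (adj C * C) \<le> norm (l *\<^sub>R hip I w w)" by (rule pos_mono_norm[OF pos_adj_mult])
  then have "(norm C)\<^sup>2 \<le> (vn I v * vn I w)\<^sup>2" using l by (simp add: cstar_norm power_mult_distrib vn_sq l_def)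
  then show ?thesis unfolding C_def by (simp add: power2_le_iff_abs_le)
qed

lemma vn_add: "vn I (\<lambda>i. v i + w i :: 'a::cstar) \<le> vn I v + vn I w"
proof -
  have "hip I (\<lambda>i. v i + w i) (\<lambda>i. v i + w i) = hip I v v + hip I v w + hip I w v + hip I w w"
    by (simp add: hip_def adj_add algebra_simps sum.distrib)
  then have "(vn I (\<lambda>i. v i + w i))\<^sup>2 \<le> norm (hip I v v) + norm (hip I v w) + norm (hip I w v) + norm (hip I w w)"
    unfolding vn_sq by (simp only:) (intro order_trans[OF norm_triangle_ineq] add_mono order_refl)
  also have "\<dots> \<le> (vn I v)\<^sup>2 + vn I v * vn I w + vn I w * vn I v + (vn I w)\<^sup>2"
    by (intro add_mono hip_cauchy_schwarz) (simp_all add: vn_sq)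
  also have "\<dots> = (vn I v + vn I w)\<^sup>2" by (simp add: power2_eq_square algebra_simps)
  finally show ?thesis by (simp add: power2_le_iff_abs_le)
qed

lemma vn_sc: "vn I (\<lambda>i. sc c * v i :: 'a::cstar) = cmod c * vn I v"
proof -
  have "hip I (\<lambda>i. sc c * v i) (\<lambda>i. sc c * v i) = sc (cnj c) * (sc c * hip I v v)"
    unfolding hip_def sum_distrib_left by (intro sum.cong) (simp_all only: adj_sc_mult_sc)
  then have "(vn I (\<lambda>i. sc c * v i))\<^sup>2 = cmod c * (cmod c * (vn I v)\<^sup>2)"
    by (simp only: vn_sq norm_sc_mult complex_mod_cnj)
  then have "(vn I (\<lambda>i. sc c * v i))\<^sup>2 = (cmod c * vn I v)\<^sup>2"
    by (simp add: power_mult_distrib power2_eq_square[of "cmod c"])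
  then show ?thesis by (simp add: power2_eq_iff_nonneg)
qed

text \<open>A crude bound whose use is that the supremum defining \<open>opn\<close> is taken over a
  bounded set.\<close>

lemma norm_mvec_sum: "vn I (mvec I X v) \<le> (\<Sum>i\<in>I. \<Sum>k\<in>I. norm (X i k :: 'a::cstar)) * vn I v"
proof -
  have "vn I (mvec I X v) \<le> (\<Sum>i\<in>I. norm (mvec I X v i))" by (rule vn_le_sum)
  also have "\<dots> \<le> (\<Sum>i\<in>I. \<Sum>k\<in>I. norm (X i k) * vn I v)"
    unfolding mvec_def
    by (intro sum_mono order_trans[OF norm_sum] order_trans[OF norm_mult_ineq] mult_left_mono norm_comp_le_vn) auto
  finally show ?thesis by (simp add: sum_distrib_right)
qed

lemma opn_bdd: "bdd_above {sqrt (norm (hip I (mvec I X v) (mvec I X v))) | v. norm (hip I v (v :: 'i \<Rightarrow> 'a::cstar)) \<le> 1}"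
proof (rule bdd_aboveI)
  fix r assume "r \<in> {sqrt (norm (hip I (mvec I X v) (mvec I X v))) | v. norm (hip I v v) \<le> 1}"
  then obtain v where v: "r = vn I (mvec I X v)" "vn I v \<le> 1" unfolding vn_def by auto
  have "r \<le> (\<Sum>i\<in>I. \<Sum>k\<in>I. norm (X i k)) * vn I v" unfolding v by (rule norm_mvec_sum)
  also have "\<dots> \<le> (\<Sum>i\<in>I. \<Sum>k\<in>I. norm (X i k)) * 1" by (intro mult_left_mono v sum_nonneg) auto
  finally show "r \<le> (\<Sum>i\<in>I. \<Sum>k\<in>I. norm (X i k))" by simp
qed

lemma opn_ge: "vn I v \<le> 1 \<Longrightarrow> vn I (mvec I X v) \<le> opn I (X :: _ \<Rightarrow> _ \<Rightarrow> 'a::cstar)"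
  unfolding opn_def vn_le_1 by (rule cSup_upper[OF _ opn_bdd]) (auto simp: vn_def)

lemma opn_le:
  assumes "\<And>v. vn I v \<le> 1 \<Longrightarrow> vn I (mvec I X v) \<le> K" shows "opn I (X :: _ \<Rightarrow> _ \<Rightarrow> 'a::cstar) \<le> K"
  unfolding opn_def
proof (rule cSup_least)
  have "norm (hip I (\<lambda>_. 0::'a) (\<lambda>_. 0)) \<le> 1" by (simp add: hip_def)
  then show "{sqrt (norm (hip I (mvec I X v) (mvec I X v))) |v. norm (hip I v v) \<le> 1} \<noteq> {}" by blast
qed (use assms in \<open>auto simp: vn_le_1 simp flip: vn_def\<close>)

lemma opn_nonneg [simp]: "0 \<le> opn I (X :: _ \<Rightarrow> _ \<Rightarrow> 'a::cstar)"
  by (rule order_trans[OF vn_nonneg opn_ge[of "\<lambda>_. 0"]]) (simp add: vn_def hip_def)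

lemma vn_mvec_le: "vn I (mvec I X v) \<le> opn I X * vn I (v :: 'i \<Rightarrow> 'a::cstar)"
proof (cases "vn I v = 0")
  case True
  then show ?thesis using norm_mvec_sum[of X v] by simp
next
  case False
  then have p: "vn I v > 0" using vn_nonneg[of I v] by linarith
  let ?c = "complex_of_real (1 / vn I v)"
  have "vn I (\<lambda>i. sc ?c * v i) \<le> 1" unfolding vn_sc using p by (simp add: norm_divide)
  then have "vn I (mvec I X (\<lambda>i. sc ?c * v i)) \<le> opn I X" by (rule opn_ge)
  also have "mvec I X (\<lambda>i. sc ?c * v i) = (\<lambda>i. sc ?c * mvec I X v i)"
    unfolding mvec_def sum_distrib_left by (intro ext sum.cong) (simp_all add: mult.assoc[symmetric] sc_commute)
  finally have "cmod ?c * vn I (mvec I X v) \<le> opn I X" unfolding vn_sc .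
  then show ?thesis using p by (simp add: norm_divide pos_divide_le_eq)
qed

lemma opn_le_sum: "opn I X \<le> (\<Sum>i\<in>I. \<Sum>k\<in>I. norm (X i k :: 'a::cstar))"
proof (rule opn_le)
  fix v :: "'i \<Rightarrow> 'a" assume "vn I v \<le> 1"
  then have "(\<Sum>i\<in>I. \<Sum>k\<in>I. norm (X i k)) * vn I v \<le> (\<Sum>i\<in>I. \<Sum>k\<in>I. norm (X i k)) * 1"
    by (intro mult_left_mono sum_nonneg) auto
  then show "vn I (mvec I X v) \<le> (\<Sum>i\<in>I. \<Sum>k\<in>I. norm (X i k))" using norm_mvec_sum[of X v] by simp
qed

lemma entry_le_opn:
  assumes "i \<in> I" "j \<in> I" shows "norm (X i j :: 'a::cstar) \<le> opn I X"
proof -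
  let ?v = "\<lambda>k. if k = j then 1 else 0 :: 'a"
  have "hip I ?v ?v = 1" by (simp add: hip_def if_distrib if_distribR fin assms cong: if_cong)
  then have v: "vn I ?v \<le> 1" by (simp add: vn_def)
  have "mvec I X ?v i = X i j" by (simp add: mvec_def if_distrib fin assms cong: if_cong)
  then show ?thesis using norm_comp_le_vn[OF assms(1), of "mvec I X ?v"] opn_ge[OF v, of X] by simp
qed

lemma opn_add: "opn I (\<lambda>i j. X i j + Y i j :: 'a::cstar) \<le> opn I X + opn I Y"
proof (rule opn_le)
  fix v :: "'i \<Rightarrow> 'a" assume v: "vn I v \<le> 1"
  have "mvec I (\<lambda>i j. X i j + Y i j) v = (\<lambda>i. mvec I X v i + mvec I Y v i)"
    by (simp add: mvec_def distrib_right sum.distrib)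
  then show "vn I (mvec I (\<lambda>i j. X i j + Y i j) v) \<le> opn I X + opn I Y"
    using vn_add[of "mvec I X v" "mvec I Y v"] opn_ge[OF v, of X] opn_ge[OF v, of Y] by simp
qed

lemma opn_sc_le: "opn I (\<lambda>i j. sc c * X i j :: 'a::cstar) \<le> cmod c * opn I X"
proof (rule opn_le)
  fix v :: "'i \<Rightarrow> 'a" assume v: "vn I v \<le> 1"
  have "mvec I (\<lambda>i j. sc c * X i j) v = (\<lambda>i. sc c * mvec I X v i)"
    by (simp add: mvec_def sum_distrib_left mult.assoc)
  then show "vn I (mvec I (\<lambda>i j. sc c * X i j) v) \<le> cmod c * opn I X"
    using opn_ge[OF v, of X] by (simp add: vn_sc mult_left_mono)
qed

lemma opn_sc: "opn I (\<lambda>i j. sc c * X i j :: 'a::cstar) = cmod c * opn I X"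
proof (cases "c = 0")
  case True
  then show ?thesis using opn_sc_le[of 0 X] by (intro antisym) auto
next
  case False
  have "opn I (\<lambda>i j. sc (inverse c) * (sc c * X i j)) \<le> cmod (inverse c) * opn I (\<lambda>i j. sc c * X i j)" by (rule opn_sc_le)
  moreover have "(\<lambda>i j. sc (inverse c) * (sc c * X i j)) = X" using False by (simp flip: mult.assoc sc_mult)
  ultimately have "cmod c * opn I X \<le> opn I (\<lambda>i j. sc c * X i j)" using False unfolding norm_inverse by (simp add: inverse_eq_divide divide_simps mult.commute)
  then show ?thesis using opn_sc_le[of c X] by simp
qed

lemma mvec_mmul: "mvec I (mmul I X Y) v = mvec I X (mvec I Y (v :: 'i \<Rightarrow> 'a::cstar))"
  unfolding mvec_def mmul_def sum_distrib_left sum_distrib_right by (subst sum.swap) (simp add: mult.assoc)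

lemma opn_mmul: "opn I (mmul I X Y) \<le> opn I X * opn I (Y :: _ \<Rightarrow> _ \<Rightarrow> 'a::cstar)"
proof (rule opn_le)
  fix v :: "'i \<Rightarrow> 'a" assume v: "vn I v \<le> 1"
  have "vn I (mvec I X (mvec I Y v)) \<le> opn I X * vn I (mvec I Y v)" by (rule vn_mvec_le)
  also have "\<dots> \<le> opn I X * opn I Y" by (intro mult_left_mono opn_ge v) simp
  finally show "vn I (mvec I (mmul I X Y) v) \<le> opn I X * opn I Y" unfolding mvec_mmul .
qed

lemma hip_mvec: "hip I (mvec I X v) w = hip I v (mvec I (\<lambda>i j. adj (X j i)) (w :: 'i \<Rightarrow> 'a::cstar))"
  unfolding hip_def mvec_def adj_sum sum_distrib_left sum_distrib_right adj_mult mult.assoc by (rule sum.swap)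

text \<open>The square of \<open>vn I (mvec I X v)\<close> is the norm of the inner product of
  \<open>v\<close> with the product matrix applied to \<open>v\<close>, so Cauchy-Schwarz gives one
  inequality. Dividing by \<open>opn I X\<close> then compares \<open>X\<close> with its adjoint,
  which gives the other.\<close>

lemma opn_star_mult: "opn I (mmul I (\<lambda>i j. adj (X j i)) X) = (opn I (X :: _ \<Rightarrow> _ \<Rightarrow> 'a::cstar))\<^sup>2"
proof -
  have 1: "(opn I X)\<^sup>2 \<le> opn I (mmul I (\<lambda>i j. adj (X j i)) X)" for X :: "'i \<Rightarrow> 'i \<Rightarrow> 'a"
  proof -
    let ?Y = "mmul I (\<lambda>i j. adj (X j i)) X"
    have "opn I X \<le> sqrt (opn I ?Y)"
    proof (rule opn_le)
      fix v :: "'i \<Rightarrow> 'a" assume v: "vn I v \<le> 1"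
      have "(vn I (mvec I X v))\<^sup>2 = norm (hip I v (mvec I ?Y v))" unfolding vn_sq hip_mvec mvec_mmul ..
      also have "\<dots> \<le> vn I v * vn I (mvec I ?Y v)" by (rule hip_cauchy_schwarz)
      also have "\<dots> \<le> 1 * opn I ?Y" by (intro mult_mono v opn_ge) auto
      finally show "vn I (mvec I X v) \<le> sqrt (opn I ?Y)" by (simp add: real_le_rsqrt)
    qed
    then have "(opn I X)\<^sup>2 \<le> (sqrt (opn I ?Y))\<^sup>2" by (rule power_mono) simp
    then show ?thesis by simp
  qed
  have 2: "opn I X \<le> opn I (\<lambda>i j. adj (X j i))" for X :: "'i \<Rightarrow> 'i \<Rightarrow> 'a"
  proof (cases "opn I X = 0")
    case False
    have "opn I X * opn I X \<le> opn I (\<lambda>i j. adj (X j i)) * opn I X"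
      using order_trans[OF 1[of X] opn_mmul] by (simp add: power2_eq_square)
    then show ?thesis using False opn_nonneg[of X] by (simp add: mult_le_cancel_right)
  qed simp
  have "opn I (\<lambda>i j. adj (X j i)) \<le> opn I X" using 2[of "\<lambda>i j. adj (X j i)"] by simp
  then have "opn I (mmul I (\<lambda>i j. adj (X j i)) X) \<le> opn I X * opn I X"
    by (intro order_trans[OF opn_mmul] mult_right_mono) auto
  then show ?thesis using 1[of X] by (simp add: power2_eq_square)
qed

text \<open>If the central projection \<open>e\<close> fixes the entries of \<open>X\<close>, each
  test vector may be replaced by its multiple by \<open>e\<close>, which is no longer than the
  vector. So the norm over the whole type is the norm over the corner, which is where the records
  compute it.\<close>

lemma opn_corner:
  fixes e :: "'a::cstar"
  assumes e: "\<And>x. e * x = x * e" "e * e = e" "adj e = e" and X: "\<And>i j. i \<in> I \<Longrightarrow> j \<in> I \<Longrightarrow> e * X i j = X i j"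
  shows "opn I X = Sup {sqrt (norm (hip I (mvec I X v) (mvec I X v))) | v. (\<forall>i\<in>I. e * v i = v i) \<and> norm (hip I v v) \<le> 1}"
proof -
  have "{sqrt (norm (hip I (mvec I X v) (mvec I X v))) | v. norm (hip I v v) \<le> 1} \<subseteq>
    {sqrt (norm (hip I (mvec I X v) (mvec I X v))) | v. (\<forall>i\<in>I. e * v i = v i) \<and> norm (hip I v v) \<le> 1}"
  proof
  fix r assume "r \<in> {sqrt (norm (hip I (mvec I X v) (mvec I X v))) | v. norm (hip I v v) \<le> 1}"
  then obtain v where v: "r = vn I (mvec I X v)" "vn I v \<le> 1" unfolding vn_le_1 unfolding vn_def by auto
  let ?w = "\<lambda>i. e * v i"
  have xe: "X i k * (e * y) = X i k * y" if "i \<in> I" "k \<in> I" for i k y 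
  proof -
    have "X i k * (e * y) = e * X i k * y" by (simp only: e(1)[of "X i k"] mult.assoc)
    then show ?thesis by (simp only: X[OF that])
  qed
  have "vn I (mvec I X v) = vn I (mvec I X ?w)"
    by (rule vn_cong) (simp add: mvec_def xe)
  moreover have ne: "norm e \<le> 1"
  proof -
    have "norm e * norm e = norm e" using cstar_norm[of e] by (simp only: e(2,3) power2_eq_square)
    then show ?thesis by (cases "norm e = 0") auto
  qed
  have "hip I ?w ?w = e * hip I v v"
    unfolding hip_def sum_distrib_left
  proof (intro sum.cong refl)
    fix i
    have "adj (e * v i) * (e * v i) = (adj (v i) * (e * e)) * v i" by (simp only: adj_mult e(3) mult.assoc)
    also have "\<dots> = e * adj (v i) * v i" by (simp only: e(2) e(1)[of "adj (v i)"])
    finally show "adj (e * v i) * (e * v i) = e * (adj (v i) * v i)" by (simp only: mult.assoc)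
  qed
  then have "norm (hip I ?w ?w) \<le> 1 * norm (hip I v v)"
    using norm_mult_ineq[of e "hip I v v"] mult_right_mono[OF ne, of "norm (hip I v v)"] by simp
  then have "norm (hip I ?w ?w) \<le> 1" using v(2) vn_le_1[of I v] by simp
  moreover have "e * ?w i = ?w i" for i by (simp add: e(2) flip: mult.assoc)
  ultimately show "r \<in> {sqrt (norm (hip I (mvec I X v) (mvec I X v))) | v. (\<forall>i\<in>I. e * v i = v i) \<and> norm (hip I v v) \<le> 1}"
    unfolding v(1) vn_def by blast
  qed
  then have "{sqrt (norm (hip I (mvec I X v) (mvec I X v))) | v. norm (hip I v v) \<le> 1} =
    {sqrt (norm (hip I (mvec I X v) (mvec I X v))) | v. (\<forall>i\<in>I. e * v i = v i) \<and> norm (hip I v v) \<le> 1}"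
    by blast
  then show ?thesis unfolding opn_def by simp
qed

end

section \<open>A single type containing all C*-algebras on a carrier type\<close>

locale csalg =
  fixes D :: "'a cstar_alg" (structure)
  assumes cs: "cstar_algebra D"
begin

lemma zero_in [simp, intro]: "ca_zero D \<in> ca_carr D"
  and add_in [simp, intro]: "x \<in> ca_carr D \<Longrightarrow> y \<in> ca_carr D \<Longrightarrow> ca_add D x y \<in> ca_carr D"
  and mul_in [simp, intro]: "x \<in> ca_carr D \<Longrightarrow> y \<in> ca_carr D \<Longrightarrow> ca_mul D x y \<in> ca_carr D"
  and smul_in [simp, intro]: "x \<in> ca_carr D \<Longrightarrow> ca_smul D c x \<in> ca_carr D"
  and star_in [simp, intro]: "x \<in> ca_carr D \<Longrightarrow> ca_star D x \<in> ca_carr D"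
  using cs unfolding cstar_algebra_def by blast+

lemma add_assoc: "x \<in> ca_carr D \<Longrightarrow> y \<in> ca_carr D \<Longrightarrow> z \<in> ca_carr D \<Longrightarrow> ca_add D (ca_add D x y) z = ca_add D x (ca_add D y z)"
  and mul_assoc: "x \<in> ca_carr D \<Longrightarrow> y \<in> ca_carr D \<Longrightarrow> z \<in> ca_carr D \<Longrightarrow> ca_mul D (ca_mul D x y) z = ca_mul D x (ca_mul D y z)"
  and distr: "x \<in> ca_carr D \<Longrightarrow> y \<in> ca_carr D \<Longrightarrow> z \<in> ca_carr D \<Longrightarrow> ca_mul D (ca_add D x y) z = ca_add D (ca_mul D x z) (ca_mul D y z)"
  and distl: "x \<in> ca_carr D \<Longrightarrow> y \<in> ca_carr D \<Longrightarrow> z \<in> ca_carr D \<Longrightarrow> ca_mul D x (ca_add D y z) = ca_add D (ca_mul D x y) (ca_mul D x z)"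
  using cs unfolding cstar_algebra_def by blast+

lemma add_comm: "x \<in> ca_carr D \<Longrightarrow> y \<in> ca_carr D \<Longrightarrow> ca_add D x y = ca_add D y x"
  and star_add: "x \<in> ca_carr D \<Longrightarrow> y \<in> ca_carr D \<Longrightarrow> ca_star D (ca_add D x y) = ca_add D (ca_star D x) (ca_star D y)"
  and star_mul: "x \<in> ca_carr D \<Longrightarrow> y \<in> ca_carr D \<Longrightarrow> ca_star D (ca_mul D x y) = ca_mul D (ca_star D y) (ca_star D x)"
  and norm_add: "x \<in> ca_carr D \<Longrightarrow> y \<in> ca_carr D \<Longrightarrow> ca_norm D (ca_add D x y) \<le> ca_norm D x + ca_norm D y"
  and norm_mul: "x \<in> ca_carr D \<Longrightarrow> y \<in> ca_carr D \<Longrightarrow> ca_norm D (ca_mul D x y) \<le> ca_norm D x * ca_norm D y"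
  and smul_add: "x \<in> ca_carr D \<Longrightarrow> y \<in> ca_carr D \<Longrightarrow> ca_smul D c (ca_add D x y) = ca_add D (ca_smul D c x) (ca_smul D c y)"
  and smul_mul_l: "x \<in> ca_carr D \<Longrightarrow> y \<in> ca_carr D \<Longrightarrow> ca_mul D (ca_smul D c x) y = ca_smul D c (ca_mul D x y)"
  and smul_mul_r: "x \<in> ca_carr D \<Longrightarrow> y \<in> ca_carr D \<Longrightarrow> ca_mul D x (ca_smul D c y) = ca_smul D c (ca_mul D x y)"
  using cs unfolding cstar_algebra_def by blast+

lemma add_zero [simp]: "x \<in> ca_carr D \<Longrightarrow> ca_add D x (ca_zero D) = x"
  and add_inv: "x \<in> ca_carr D \<Longrightarrow> ca_add D x (ca_smul D (-1) x) = ca_zero D"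
  and smul_one [simp]: "x \<in> ca_carr D \<Longrightarrow> ca_smul D 1 x = x"
  and smul_smul: "x \<in> ca_carr D \<Longrightarrow> ca_smul D (c * d) x = ca_smul D c (ca_smul D d x)"
  and smul_plus: "x \<in> ca_carr D \<Longrightarrow> ca_smul D (c + d) x = ca_add D (ca_smul D c x) (ca_smul D d x)"
  and star_star [simp]: "x \<in> ca_carr D \<Longrightarrow> ca_star D (ca_star D x) = x"
  and star_smul: "x \<in> ca_carr D \<Longrightarrow> ca_star D (ca_smul D c x) = ca_smul D (cnj c) (ca_star D x)"
  and norm_nonneg: "x \<in> ca_carr D \<Longrightarrow> 0 \<le> ca_norm D x"
  and norm_zero_iff: "x \<in> ca_carr D \<Longrightarrow> ca_norm D x = 0 \<longleftrightarrow> x = ca_zero D"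
  and norm_smul: "x \<in> ca_carr D \<Longrightarrow> ca_norm D (ca_smul D c x) = cmod c * ca_norm D x"
  and norm_star_mul: "x \<in> ca_carr D \<Longrightarrow> ca_norm D (ca_mul D (ca_star D x) x) = (ca_norm D x)\<^sup>2"
  using cs unfolding cstar_algebra_def by blast+

lemma complete:
  assumes "\<And>k::nat. f k \<in> ca_carr D" "\<And>e. e > 0 \<Longrightarrow> \<exists>N. \<forall>k\<ge>N. \<forall>l\<ge>N. ca_norm D (ca_minus D (f k) (f l)) < e"
  shows "\<exists>x\<in>ca_carr D. \<forall>e>0. \<exists>N. \<forall>k\<ge>N. ca_norm D (ca_minus D (f k) x) < e"
proof -
  have "\<forall>f :: nat \<Rightarrow> 'a. (\<forall>k. f k \<in> ca_carr D) \<longrightarrow>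
        (\<forall>e>0. \<exists>N. \<forall>k\<ge>N. \<forall>l\<ge>N. ca_norm D (ca_minus D (f k) (f l)) < e) \<longrightarrow>
        (\<exists>x\<in>ca_carr D. \<forall>e>0. \<exists>N. \<forall>k\<ge>N. ca_norm D (ca_minus D (f k) x) < e)"
    using cs unfolding cstar_algebra_def by (elim conjE)
  then show ?thesis using assms by simp
qed

lemma zero_add [simp]: "x \<in> ca_carr D \<Longrightarrow> ca_add D (ca_zero D) x = x"
  using add_comm[of "ca_zero D" x] by simp

lemma idem_zero: "x \<in> ca_carr D \<Longrightarrow> ca_add D x x = x \<Longrightarrow> x = ca_zero D"
  using add_assoc[of x x "ca_smul D (-1) x"] by (simp add: add_inv)

lemma mul_zero [simp]: "x \<in> ca_carr D \<Longrightarrow> ca_mul D x (ca_zero D) = ca_zero D"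
  using distl[of x "ca_zero D" "ca_zero D"] by (intro idem_zero) simp_all

lemma zero_mul [simp]: "x \<in> ca_carr D \<Longrightarrow> ca_mul D (ca_zero D) x = ca_zero D"
  using distr[of "ca_zero D" "ca_zero D" x] by (intro idem_zero) simp_all

lemma smul_zero [simp]: "ca_smul D c (ca_zero D) = ca_zero D"
  using smul_add[of "ca_zero D" "ca_zero D" c] by (intro idem_zero) simp_all

lemma star_zero [simp]: "ca_star D (ca_zero D) = ca_zero D"
  using star_add[of "ca_zero D" "ca_zero D"] by (intro idem_zero) simp_all

lemma norm_zero [simp]: "ca_norm D (ca_zero D) = 0"
  using norm_zero_iff by blast

lemma minus_in [simp, intro]: "x \<in> ca_carr D \<Longrightarrow> y \<in> ca_carr D \<Longrightarrow> ca_minus D x y \<in> ca_carr D"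
  by (simp add: ca_minus_def)

end

locale ucsalg = csalg +
  assumes unital: "unital D"
begin

lemma unit_one: "ca_is_unit D (ca_one D)"
proof -
  obtain e where e: "ca_is_unit D e" using unital unfolding unital_def by blast
  have "f = e" if "ca_is_unit D f" for f using e that unfolding ca_is_unit_def by metis
  then show ?thesis unfolding ca_one_def using e by (metis theI)
qed

lemma one_in [simp, intro]: "ca_one D \<in> ca_carr D"
  and mul_one [simp]: "x \<in> ca_carr D \<Longrightarrow> ca_mul D x (ca_one D) = x"
  and one_mul [simp]: "x \<in> ca_carr D \<Longrightarrow> ca_mul D (ca_one D) x = x"
  using unit_one unfolding ca_is_unit_def by blast+

lemma unit_unique: "ca_is_unit D e \<Longrightarrow> ca_one D = e"
  using unit_one unfolding ca_is_unit_def by metis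

lemma star_one [simp]: "ca_star D (ca_one D) = ca_one D"
proof -
  have "ca_one D = ca_star D (ca_one D)"
    using star_mul[of "ca_star D (ca_one D)" "ca_one D"] by simp
  then show ?thesis by (rule sym)
qed

lemma norm_one_le: "ca_norm D (ca_one D) \<le> 1"
  using norm_star_mul[of "ca_one D"] norm_nonneg[of "ca_one D"] 
  by (cases "ca_norm D (ca_one D) = 0") (auto simp: power2_eq_square)

end

text \<open>A unital C*-algebra in the sense of the definitions, with unit equal to zero; it exists
  on every carrier type.\<close>

definition triv_alg :: "'a cstar_alg" where
  "triv_alg = \<lparr>ca_carr = {undefined}, ca_zero = undefined, ca_add = \<lambda>_ _. undefined, ca_smul = \<lambda>_ _. undefined,
     ca_mul = \<lambda>_ _. undefined, ca_star = \<lambda>_. undefined, ca_norm = \<lambda>_. 0\<rparr>"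

text \<open>Replaces everything that is not a unital C*-algebra by the zero algebra, to index a product by all records.\<close>
definition vca :: "'a cstar_alg \<Rightarrow> 'a cstar_alg" where
  "vca D = (if cstar_algebra D \<and> unital D then D else triv_alg)"

lemma ucsalg_vca: "ucsalg (vca D)"
proof -
  have "cstar_algebra (triv_alg :: 'a cstar_alg)" "unital (triv_alg :: 'a cstar_alg)"
    by (auto simp: triv_alg_def cstar_algebra_def ca_minus_def unital_def ca_is_unit_def)
  then show ?thesis by unfold_locales (auto simp: vca_def)
qed

interpretation V: ucsalg "vca D" for D :: "'a cstar_alg" by (rule ucsalg_vca)

lemma (in ucsalg) vca_eq: "vca D = D" by (simp add: vca_def cs unital)

text \<open>The extra complex coordinate keeps 1 different from 0 and of norm one, as the type class
  demands, even if all coordinate algebras were zero. The bound is common to all coordinates so that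
  the supremum norm exists.\<close>

typedef 'a cprod = "{(z :: complex, F :: 'a cstar_alg \<Rightarrow> 'a).
    (\<forall>D. F D \<in> ca_carr (vca D)) \<and> (\<exists>B. \<forall>D. ca_norm (vca D) (F D) \<le> B)}"
  by (rule exI[of _ "(0, \<lambda>D. ca_zero (vca D))"]) auto

setup_lifting type_definition_cprod

lift_definition scal :: "'a cprod \<Rightarrow> complex" is fst .
lift_definition cmp :: "'a cprod \<Rightarrow> 'a cstar_alg \<Rightarrow> 'a" is snd .

lemma cmp_in [simp, intro]: "cmp x D \<in> ca_carr (vca D)"
  by transfer auto

lemma cmp_bdd: "\<exists>B. \<forall>D. ca_norm (vca D) (cmp x D) \<le> B"
  by (transfer, auto) blast

lemma cprod_eqI: "scal x = scal y \<Longrightarrow> (\<And>D. cmp x D = cmp y D) \<Longrightarrow> x = y"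
  by transfer (auto simp: prod_eq_iff)

instantiation cprod :: (type) "{zero, one, plus, minus, uminus, times, scaleR}"
begin

lift_definition zero_cprod :: "'a cprod" is "(0, \<lambda>D. ca_zero (vca D))" by auto
lift_definition one_cprod :: "'a cprod" is "(1, \<lambda>D. ca_one (vca D))" using V.norm_one_le by auto
lift_definition plus_cprod :: "'a cprod \<Rightarrow> 'a cprod \<Rightarrow> 'a cprod" is
  "\<lambda>x y. (fst x + fst y, \<lambda>D. ca_add (vca D) (snd x D) (snd y D))"
  by (auto intro!: order_trans[OF V.norm_add add_mono] intro: exI[of _ "_ + _"])
    (meson V.norm_add add_mono order_trans)
lift_definition times_cprod :: "'a cprod \<Rightarrow> 'a cprod \<Rightarrow> 'a cprod" is
  "\<lambda>x y. (fst x * fst y, \<lambda>D. ca_mul (vca D) (snd x D) (snd y D))"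
proof -
  fix x y :: "complex \<times> ('a cstar_alg \<Rightarrow> 'a)"
  assume "x \<in> {(z, F). (\<forall>D. F D \<in> ca_carr (vca D)) \<and> (\<exists>B. \<forall>D. ca_norm (vca D) (F D) \<le> B)}"
    and "y \<in> {(z, F). (\<forall>D. F D \<in> ca_carr (vca D)) \<and> (\<exists>B. \<forall>D. ca_norm (vca D) (F D) \<le> B)}"
  then obtain A B where *: "\<forall>D. snd x D \<in> ca_carr (vca D)" "\<forall>D. snd y D \<in> ca_carr (vca D)"
     "\<forall>D. ca_norm (vca D) (snd x D) \<le> A" "\<forall>D. ca_norm (vca D) (snd y D) \<le> B" by auto
  have "ca_norm (vca D) (ca_mul (vca D) (snd x D) (snd y D)) \<le> \<bar>A\<bar> * B" for D
    by (rule order_trans[OF V.norm_mul mult_mono]) (use * in \<open>auto intro: order_trans[OF _ abs_ge_self] V.norm_nonneg\<close>)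
  then show "(fst x * fst y, \<lambda>D. ca_mul (vca D) (snd x D) (snd y D))
    \<in> {(z, F). (\<forall>D. F D \<in> ca_carr (vca D)) \<and> (\<exists>B. \<forall>D. ca_norm (vca D) (F D) \<le> B)}" using * by auto
qed
lift_definition scaleR_cprod :: "real \<Rightarrow> 'a cprod \<Rightarrow> 'a cprod" is
  "\<lambda>r x. (of_real r * fst x, \<lambda>D. ca_smul (vca D) (of_real r) (snd x D))"
  by (auto simp: V.norm_smul) (metis abs_ge_zero mult_left_mono)
lift_definition uminus_cprod :: "'a cprod \<Rightarrow> 'a cprod" is
  "\<lambda>x. (- fst x, \<lambda>D. ca_smul (vca D) (-1) (snd x D))"
  by (auto simp: V.norm_smul) blast
definition minus_cprod :: "'a cprod \<Rightarrow> 'a cprod \<Rightarrow> 'a cprod" where "minus_cprod x y = x + (- y)"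

instance ..
end

lemma scal_simps [simp]: "scal 0 = 0" "scal 1 = 1" "scal (x + y) = scal x + scal y" "scal (x * y) = scal x * scal y"
    "scal (r *\<^sub>R x) = of_real r * scal x" "scal (- x) = - scal x" "scal (x - y) = scal x - scal y"
  unfolding minus_cprod_def by (transfer; simp)+

lemma cmp_simps [simp]: "cmp 0 D = ca_zero (vca D)" "cmp 1 D = ca_one (vca D)" 
    "cmp (x + y) D = ca_add (vca D) (cmp x D) (cmp y D)" "cmp (x * y) D = ca_mul (vca D) (cmp x D) (cmp y D)"
    "cmp (r *\<^sub>R x) D = ca_smul (vca D) (of_real r) (cmp x D)" "cmp (- x) D = ca_smul (vca D) (-1) (cmp x D)" 
    "cmp (x - y) D = ca_minus (vca D) (cmp x D) (cmp y D)"
  unfolding minus_cprod_def ca_minus_def by (transfer; simp)+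

instance cprod :: (type) ring_1
proof
  fix x y z :: "'a cprod"
  have "scal (0::'a cprod) \<noteq> scal 1" by simp
  then show "(0::'a cprod) \<noteq> 1" by metis
  show "- x + x = 0" by (rule cprod_eqI) (simp_all add: V.add_comm V.add_inv)
  show "x + y = y + x" by (rule cprod_eqI) (simp_all add: V.add_comm add.commute)
qed (rule cprod_eqI; simp add: algebra_simps V.add_assoc V.mul_assoc V.distl V.distr ca_minus_def)+

instance cprod :: (type) real_algebra_1
  by standard (rule cprod_eqI; 
    simp add: algebra_simps V.smul_add V.smul_plus V.smul_smul V.smul_mul_l V.smul_mul_r)+

definition cnorm :: "'a cprod \<Rightarrow> real" where
  "cnorm x = max (cmod (scal x)) (SUP D. ca_norm (vca D) (cmp x D))"

lemma cnorm_le_iff: "cnorm x \<le> K \<longleftrightarrow> cmod (scal x) \<le> K \<and> (\<forall>D. ca_norm (vca D) (cmp x D) \<le> K)"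
proof -
  obtain B where "\<forall>D. ca_norm (vca D) (cmp x D) \<le> B" using cmp_bdd[of x] by blast
  then have "bdd_above (range (\<lambda>D. ca_norm (vca D) (cmp x D)))" by (intro bdd_aboveI[of _ B]) auto
  then show ?thesis by (auto simp: cnorm_def cSUP_le_iff)
qed

lemma cnorm_scal_le: "cmod (scal x) \<le> cnorm x" and cnorm_cmp_le: "ca_norm (vca D) (cmp x D) \<le> cnorm x"
  using cnorm_le_iff[of x "cnorm x"] by auto

instantiation cprod :: (type) real_normed_algebra_1
begin

definition norm_cprod :: "'a cprod \<Rightarrow> real" where "norm_cprod = cnorm"
definition dist_cprod :: "'a cprod \<Rightarrow> 'a cprod \<Rightarrow> real" where "dist_cprod x y = norm (x - y)"
definition sgn_cprod :: "'a cprod \<Rightarrow> 'a cprod" where "sgn_cprod x = inverse (norm x) *\<^sub>R x"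
definition uniformity_cprod :: "('a cprod \<times> 'a cprod) filter" where
  "uniformity_cprod = (INF e\<in>{0 <..}. principal {(x, y). dist x y < e})"
definition open_cprod :: "'a cprod set \<Rightarrow> bool" where
  "open_cprod U \<longleftrightarrow> (\<forall>x\<in>U. eventually (\<lambda>(x', y). x' = x \<longrightarrow> y \<in> U) uniformity)"

instance
proof
  fix x y :: "'a cprod" and r :: real
  show "norm x = 0 \<longleftrightarrow> x = 0" unfolding norm_cprod_def
  proof
    assume "cnorm x = 0"
    then have "scal x = 0" "ca_norm (vca D) (cmp x D) = 0" for D
      using cnorm_scal_le[of x] cnorm_cmp_le[of D x] V.norm_nonneg[of "cmp x D" D] by auto
    then show "x = 0" using V.norm_zero_iff[OF cmp_in] by (intro cprod_eqI) auto
  next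
    assume "x = 0"
    then have "cnorm x \<le> 0" unfolding cnorm_le_iff by simp
    moreover have "cnorm x \<ge> 0" using cnorm_scal_le[of x] norm_ge_zero order_trans by blast
    ultimately show "cnorm x = 0" by simp
  qed
  show "norm (x + y) \<le> norm x + norm y" unfolding norm_cprod_def cnorm_le_iff
  proof (intro conjI allI)
    show "cmod (scal (x + y)) \<le> cnorm x + cnorm y" 
      using norm_triangle_ineq[of "scal x" "scal y"] cnorm_scal_le[of x] cnorm_scal_le[of y] by simp
    show "ca_norm (vca D) (cmp (x + y) D) \<le> cnorm x + cnorm y" for D
      using V.norm_add[of "cmp x D" D "cmp y D"] cnorm_cmp_le[of D x] cnorm_cmp_le[of D y] by simp
  qed
  have n0: "0 \<le> cnorm x" for x :: "'a cprod" using cnorm_scal_le[of x] norm_ge_zero order_trans by blast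
  have sle: "cnorm (r *\<^sub>R x) \<le> \<bar>r\<bar> * cnorm x" for r and x :: "'a cprod"
    unfolding cnorm_le_iff by (auto simp: norm_mult V.norm_smul cnorm_scal_le cnorm_cmp_le intro!: mult_left_mono)
  show "norm (r *\<^sub>R x) = \<bar>r\<bar> * norm x" unfolding norm_cprod_def
  proof (cases "r = 0")
    case True
    then show "cnorm (r *\<^sub>R x) = \<bar>r\<bar> * cnorm x" using sle[of r x] n0[of "r *\<^sub>R x"] by simp
  next
    case False
    have "cnorm x \<le> \<bar>inverse r\<bar> * cnorm (r *\<^sub>R x)" using sle[of "inverse r" "r *\<^sub>R x"] False by simp
    then have "\<bar>r\<bar> * cnorm x \<le> cnorm (r *\<^sub>R x)" using False by (simp add: inverse_eq_divide divide_simps mult.commute)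
    then show "cnorm (r *\<^sub>R x) = \<bar>r\<bar> * cnorm x" using sle[of r x] by simp
  qed
  show "norm (x * y) \<le> norm x * norm y" unfolding norm_cprod_def cnorm_le_iff
  proof (intro conjI allI)
    show "cmod (scal (x * y)) \<le> cnorm x * cnorm y" by (simp add: norm_mult mult_mono cnorm_scal_le n0)
    show "ca_norm (vca D) (cmp (x * y) D) \<le> cnorm x * cnorm y" for D
      using order_trans[OF V.norm_mul mult_mono[OF cnorm_cmp_le cnorm_cmp_le], of x D y] n0[of x] V.norm_nonneg[OF cmp_in[of y D]] by simp
  qed
  show "norm (1::'a cprod) = 1" unfolding norm_cprod_def
  proof (rule antisym)
    show "cnorm (1::'a cprod) \<le> 1" unfolding cnorm_le_iff by (simp add: V.norm_one_le)
    show "1 \<le> cnorm (1::'a cprod)" using cnorm_scal_le[of "1::'a cprod"] by simp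
  qed
qed (simp_all add: dist_cprod_def sgn_cprod_def uniformity_cprod_def open_cprod_def)

end

lemmas norm_cprod_le_iff = cnorm_le_iff[folded norm_cprod_def]
  and norm_scal_le = cnorm_scal_le[folded norm_cprod_def]
  and norm_cmp_le = cnorm_cmp_le[folded norm_cprod_def]

lemma norm_cmp_diff: "ca_norm (vca D) (ca_minus (vca D) (cmp x D) (cmp y D)) \<le> norm (x - y)"
  using norm_cmp_le[of D "x - y"] by simp

text \<open>Families that are unbounded or leave the carriers are sent to zero, so that the
  constructor is total.\<close>

lift_definition mk_cprod :: "complex \<Rightarrow> ('a cstar_alg \<Rightarrow> 'a) \<Rightarrow> 'a cprod" is
  "\<lambda>z F. if (\<forall>D. F D \<in> ca_carr (vca D)) \<and> (\<exists>B. \<forall>D. ca_norm (vca D) (F D) \<le> B) then (z, F) else (0, \<lambda>D. ca_zero (vca D))"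
proof -
  fix z :: complex and F :: "'a cstar_alg \<Rightarrow> 'a"
  show "(if (\<forall>D. F D \<in> ca_carr (vca D)) \<and> (\<exists>B. \<forall>D. ca_norm (vca D) (F D) \<le> B) then (z, F) else (0, \<lambda>D. ca_zero (vca D)))
     \<in> {(z, F). (\<forall>D. F D \<in> ca_carr (vca D)) \<and> (\<exists>B. \<forall>D. ca_norm (vca D) (F D) \<le> B)}" (is "(if ?P then _ else _) \<in> _")
  proof (cases ?P)
    case True
    then show ?thesis by simp
  next
    case False
    have "(0, \<lambda>D. ca_zero (vca D)) \<in> {(z, F). (\<forall>D. F D \<in> ca_carr (vca D)) \<and> (\<exists>B. \<forall>D. ca_norm (vca D) (F D) \<le> B)}"
      by (simp add: exI[of _ 0])
    then show ?thesis unfolding if_not_P[OF False] .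
  qed
qed

lemma mk_cprod:
  assumes "\<And>D. F D \<in> ca_carr (vca D)" "\<And>D. ca_norm (vca D) (F D) \<le> B"
  shows "scal (mk_cprod z F) = z" "cmp (mk_cprod z F) D = F D"
proof -
  have P: "(\<forall>D. F D \<in> ca_carr (vca D)) \<and> (\<exists>B. \<forall>D. ca_norm (vca D) (F D) \<le> B)" using assms by blast
  have "Rep_cprod (mk_cprod z F) = (z, F)" unfolding mk_cprod.rep_eq by (rule if_P[OF P])
  then show "scal (mk_cprod z F) = z" "cmp (mk_cprod z F) D = F D" by (simp_all add: scal.rep_eq cmp.rep_eq)
qed

instance cprod :: (type) banach
proof
  fix X :: "nat \<Rightarrow> 'a cprod" assume C: "Cauchy X"
  have "Cauchy (\<lambda>n. scal (X n))"
  proof (rule CauchyI)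
    fix e :: real assume "e > 0"
    then obtain M where "\<forall>m\<ge>M. \<forall>n\<ge>M. norm (X m - X n) < e" using CauchyD[OF C] by blast
    then show "\<exists>M. \<forall>m\<ge>M. \<forall>n\<ge>M. norm (scal (X m) - scal (X n)) < e"
      using norm_scal_le[of "X _ - X _"] by (metis scal_simps(7) le_less_trans)
  qed
  then obtain z where z: "(\<lambda>n. scal (X n)) \<longlonglongrightarrow> z" using Cauchy_convergent convergent_def by blast
  have "\<exists>y\<in>ca_carr (vca D). \<forall>e>0. \<exists>N. \<forall>k\<ge>N. ca_norm (vca D) (ca_minus (vca D) (cmp (X k) D) y) < e" for D
  proof (rule V.complete)
    fix e :: real assume "e > 0"
    then obtain M where "\<forall>m\<ge>M. \<forall>n\<ge>M. norm (X m - X n) < e" using CauchyD[OF C] by blast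
    then show "\<exists>N. \<forall>k\<ge>N. \<forall>l\<ge>N. ca_norm (vca D) (ca_minus (vca D) (cmp (X k) D) (cmp (X l) D)) < e"
      using norm_cmp_diff le_less_trans by blast
  qed simp
  then obtain F where F: "\<And>D. F D \<in> ca_carr (vca D)"
    "\<And>D e. e > 0 \<Longrightarrow> \<exists>N. \<forall>k\<ge>N. ca_norm (vca D) (ca_minus (vca D) (cmp (X k) D) (F D)) < e" by metis
  \<comment> \<open>The index \<open>N\<close> comes from the supremum norm and is the same for all
    coordinates, so the coordinatewise limits are approached uniformly. This also bounds the limit
    family.\<close>
  have near: "ca_norm (vca D) (ca_minus (vca D) (cmp (X k) D) (F D)) \<le> e"
    if N: "\<forall>m\<ge>N. \<forall>n\<ge>N. norm (X m - X n) < e" "k \<ge> N" for D N k e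
  proof (rule field_le_epsilon)
    fix d :: real assume "d > 0"
    then obtain L where L: "\<forall>k\<ge>L. ca_norm (vca D) (ca_minus (vca D) (cmp (X k) D) (F D)) < d" using F(2) by blast
    let ?l = "max L N"
    have in_: "F D \<in> ca_carr (vca D)" by (rule F)
    have "ca_minus (vca D) (cmp (X k) D) (F D) =
       ca_add (vca D) (ca_minus (vca D) (cmp (X k) D) (cmp (X ?l) D)) (ca_minus (vca D) (cmp (X ?l) D) (F D))"
    proof -
      have "ca_add (vca D) (ca_smul (vca D) (-1) (cmp (X ?l) D)) (ca_add (vca D) (cmp (X ?l) D) (ca_smul (vca D) (-1) (F D)))
         = ca_smul (vca D) (-1) (F D)"
        using in_ by (subst V.add_assoc[symmetric]) (simp_all add: V.add_comm[of "ca_smul _ _ _" _ "cmp _ _"] V.add_inv)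
      then show ?thesis unfolding ca_minus_def using in_ by (simp add: V.add_assoc)
    qed
    then have "ca_norm (vca D) (ca_minus (vca D) (cmp (X k) D) (F D)) \<le>
       ca_norm (vca D) (ca_minus (vca D) (cmp (X k) D) (cmp (X ?l) D)) + ca_norm (vca D) (ca_minus (vca D) (cmp (X ?l) D) (F D))"
      using in_ by (simp add: V.norm_add)
    also have "\<dots> \<le> norm (X k - X ?l) + ca_norm (vca D) (ca_minus (vca D) (cmp (X ?l) D) (F D))"
      by (intro add_right_mono norm_cmp_diff)
    also have "\<dots> \<le> e + d" using N L by (intro add_mono less_imp_le) auto
    finally show "ca_norm (vca D) (ca_minus (vca D) (cmp (X k) D) (F D)) \<le> e + d" .
  qed
  obtain N1 where N1: "\<forall>m\<ge>N1. \<forall>n\<ge>N1. norm (X m - X n) < 1" using CauchyD[OF C, of 1] by auto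
  have "ca_norm (vca D) (F D) \<le> norm (X N1) + 1" for D
  proof -
    have in_: "F D \<in> ca_carr (vca D)" by (rule F)
    have "F D = ca_add (vca D) (cmp (X N1) D) (ca_smul (vca D) (-1) (ca_minus (vca D) (cmp (X N1) D) (F D)))"
    proof -
      have "ca_smul (vca D) (-1) (ca_smul (vca D) (-1) (F D)) = F D" using in_ by (simp flip: V.smul_smul)
      then show ?thesis using in_
        by (simp add: ca_minus_def V.smul_add V.add_assoc[symmetric] V.add_inv)
    qed
    then have "ca_norm (vca D) (F D) \<le> ca_norm (vca D) (cmp (X N1) D) + ca_norm (vca D) (ca_minus (vca D) (cmp (X N1) D) (F D))"
      using V.norm_add[of "cmp (X N1) D" D "ca_smul (vca D) (-1) (ca_minus (vca D) (cmp (X N1) D) (F D))"] in_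
      by (simp add: V.norm_smul)
    then show ?thesis using norm_cmp_le[of D "X N1"] near[OF N1, of N1 D] by simp
  qed
  note F' = mk_cprod[of F, OF F(1) this]
  define x where "x = mk_cprod z F"
  have "X \<longlonglongrightarrow> x"
  proof (rule LIMSEQ_I)
    fix e :: real assume e: "e > 0"
    obtain N where N: "\<forall>m\<ge>N. \<forall>n\<ge>N. norm (X m - X n) < e / 2" using CauchyD[OF C, of "e/2"] e by auto
    obtain M where M: "\<forall>n\<ge>M. norm (scal (X n) - z) < e / 2" using LIMSEQ_D[OF z, of "e/2"] e by auto
    have "norm (X n - x) \<le> e / 2" if "n \<ge> max M N" for n
      unfolding norm_cprod_le_iff using M near[OF N] that by (auto simp: x_def F' intro: less_imp_le)
    then show "\<exists>no. \<forall>n\<ge>no. norm (X n - x) < e" using e by (intro exI[of _ "max M N"]) fastforce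
  qed
  then show "convergent X" by (rule convergentI)
qed

instantiation cprod :: (type) cstar
begin

definition iu_cprod :: "'a cprod" where "iu_cprod = mk_cprod \<i> (\<lambda>D. ca_smul (vca D) \<i> (ca_one (vca D)))"
definition adj_cprod :: "'a cprod \<Rightarrow> 'a cprod" where 
  "adj_cprod x = mk_cprod (cnj (scal x)) (\<lambda>D. ca_star (vca D) (cmp x D))"

lemma norm_star_cs: "x \<in> ca_carr (vca D) \<Longrightarrow> ca_norm (vca D) (ca_star (vca D) x) \<le> ca_norm (vca D) x"
proof -
  assume x: "x \<in> ca_carr (vca D)"
  let ?n = "ca_norm (vca D) (ca_star (vca D) x)"
  have "?n * ?n \<le> ca_norm (vca D) x * ?n"
    using V.norm_star_mul[of "ca_star (vca D) x" D] V.norm_mul[of x D "ca_star (vca D) x"] x by (simp add: power2_eq_square)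
  then show ?thesis using V.norm_nonneg[of "ca_star (vca D) x" D] V.norm_nonneg[of x D] x
    by (cases "?n = 0") (auto simp: mult_le_cancel_right)
qed

lemma scal_adj [simp]: "scal (adj x) = cnj (scal x)" and cmp_adj [simp]: "cmp (adj x) D = ca_star (vca D) (cmp x D)"
  unfolding adj_cprod_def 
  by (rule mk_cprod[of _ "norm x"], simp, rule order_trans[OF norm_star_cs norm_cmp_le], simp)+

lemma scal_iu [simp]: "scal iu = \<i>" and cmp_iu [simp]: "cmp iu D = ca_smul (vca D) \<i> (ca_one (vca D))"
  unfolding iu_cprod_def 
  by (rule mk_cprod[of _ 1], simp, simp add: V.norm_smul V.norm_one_le)+

instance
proof
  fix x y :: "'a cprod" and r :: real
  show "adj (x + y) = adj x + adj y" by (rule cprod_eqI) (simp_all add: V.star_add)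
  show "adj (x * y) = adj y * adj x" by (rule cprod_eqI) (simp_all add: V.star_mul)
  show "adj (adj x) = x" by (rule cprod_eqI) simp_all
  show "adj (r *\<^sub>R x) = r *\<^sub>R adj x" by (rule cprod_eqI) (simp_all add: V.star_smul)
  show "iu * iu = (- 1 :: 'a cprod)" by (rule cprod_eqI) (simp_all add: V.smul_mul_l flip: V.smul_smul)
  show "iu * x = x * iu" by (rule cprod_eqI) (simp_all add: V.smul_mul_l V.smul_mul_r)
  show "adj iu = (- iu :: 'a cprod)" by (rule cprod_eqI) (simp_all add: V.star_smul flip: V.smul_smul)
  show "norm (adj x * x) = (norm x)\<^sup>2"
  proof (rule antisym)
    show "norm (adj x * x) \<le> (norm x)\<^sup>2" unfolding norm_cprod_le_iff
      by (auto simp: V.norm_star_mul norm_mult norm_scal_le norm_cmp_le V.norm_nonneg power2_eq_square intro!: mult_mono)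
    have "norm x \<le> sqrt (norm (adj x * x))" unfolding norm_cprod_le_iff[of x]
    proof (intro conjI allI real_le_rsqrt)
      show "(cmod (scal x))\<^sup>2 \<le> norm (adj x * x)"
        using norm_scal_le[of "adj x * x"] by (simp add: norm_mult power2_eq_square)
      show "(ca_norm (vca D) (cmp x D))\<^sup>2 \<le> norm (adj x * x)" for D
        using norm_cmp_le[of D "adj x * x"] by (simp add: V.norm_star_mul)
    qed
    then have "(norm x)\<^sup>2 \<le> (sqrt (norm (adj x * x)))\<^sup>2" by (rule power_mono) simp
    then show "(norm x)\<^sup>2 \<le> norm (adj x * x)" by simp
  qed
qed

end

section \<open>One algebra as a coordinate of the product\<close>

text \<open>The other coordinates are zero, so the unit of \<open>D\<close> becomes a central
  projection different from 1. This is the element \<open>e\<close> carried through the abstract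
  arguments.\<close>

definition emb :: "'a cstar_alg \<Rightarrow> 'a \<Rightarrow> 'a cprod" where
  "emb D x = mk_cprod 0 (\<lambda>E. if E = D \<and> x \<in> ca_carr (vca D) then x else ca_zero (vca E))"

lemma cmp_sc: "cmp (sc c) E = ca_smul (vca E) c (ca_one (vca E))"
proof -
  have "(sc c :: 'a cprod) = Re c *\<^sub>R 1 + Im c *\<^sub>R iu" by (simp add: sc_def of_real_def)
  then have "cmp (sc c) E = ca_add (vca E) (ca_smul (vca E) (complex_of_real (Re c)) (ca_one (vca E)))
     (ca_smul (vca E) (complex_of_real (Im c) * \<i>) (ca_one (vca E)))"
    by (simp add: V.smul_smul)
  also have "\<dots> = ca_smul (vca E) (complex_of_real (Re c) + complex_of_real (Im c) * \<i>) (ca_one (vca E))"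
    by (simp add: V.smul_plus)
  also have "complex_of_real (Re c) + complex_of_real (Im c) * \<i> = c" by (simp add: complex_eq_iff)
  finally show ?thesis .
qed

context ucsalg begin

lemma scal_emb [simp]: "scal (emb D x) = 0"
  and cmp_emb_gen: "cmp (emb D x) E = (if E = D \<and> x \<in> ca_carr (vca D) then x else ca_zero (vca E))"
proof -
  let ?F = "\<lambda>E. if E = D \<and> x \<in> ca_carr (vca D) then x else ca_zero (vca E)"
  have 1: "?F E \<in> ca_carr (vca E)" for E by auto
  have 2: "ca_norm (vca E) (?F E) \<le> \<bar>ca_norm (vca D) x\<bar>" for E by auto
  show "scal (emb D x) = 0" "cmp (emb D x) E = ?F E" unfolding emb_def by (rule mk_cprod[OF 1 2])+
qed

lemma cmp_emb: "x \<in> ca_carr D \<Longrightarrow> cmp (emb D x) E = (if E = D then x else ca_zero (vca E))"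
  by (simp add: cmp_emb_gen vca_eq)

lemma cmp_emb_D [simp]: "x \<in> ca_carr D \<Longrightarrow> cmp (emb D x) D = x"
  by (simp add: cmp_emb)

lemma cmp_in_D [simp, intro]: "cmp t D \<in> ca_carr D"
  using cmp_in[of t D] by (simp add: vca_eq)

lemma emb_zero [simp]: "emb D (ca_zero D) = 0"
  by (rule cprod_eqI) (auto simp: cmp_emb vca_eq)

lemma emb_add: "x \<in> ca_carr D \<Longrightarrow> y \<in> ca_carr D \<Longrightarrow> emb D (ca_add D x y) = emb D x + emb D y"
  by (rule cprod_eqI) (auto simp: cmp_emb vca_eq)

lemma emb_mul: "x \<in> ca_carr D \<Longrightarrow> y \<in> ca_carr D \<Longrightarrow> emb D (ca_mul D x y) = emb D x * emb D y"
  by (rule cprod_eqI) (auto simp: cmp_emb vca_eq)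

lemma emb_star: "x \<in> ca_carr D \<Longrightarrow> emb D (ca_star D x) = adj (emb D x)"
  by (rule cprod_eqI) (auto simp: cmp_emb vca_eq)

lemma emb_smul: "x \<in> ca_carr D \<Longrightarrow> emb D (ca_smul D c x) = sc c * emb D x"
  by (rule cprod_eqI) (auto simp: cmp_emb cmp_sc vca_eq smul_mul_l V.smul_mul_l)

lemma emb_minus: "x \<in> ca_carr D \<Longrightarrow> y \<in> ca_carr D \<Longrightarrow> emb D (ca_minus D x y) = emb D x - emb D y"
  by (simp add: ca_minus_def emb_add emb_smul sc_minus_1)

lemma norm_emb: 
  assumes "x \<in> ca_carr D" shows "norm (emb D x) = ca_norm D x"
proof (rule antisym)
  show "norm (emb D x) \<le> ca_norm D x"
    unfolding norm_cprod_le_iff using norm_nonneg[OF assms] assms by (auto simp: cmp_emb vca_eq)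
  show "ca_norm D x \<le> norm (emb D x)" using norm_cmp_le[of D "emb D x"] assms by (simp add: vca_eq)
qed

lemma emb_inj: "x \<in> ca_carr D \<Longrightarrow> y \<in> ca_carr D \<Longrightarrow> emb D x = emb D y \<Longrightarrow> x = y"
  using cmp_emb_D by metis

definition ue :: "'a cprod" where "ue = emb D (ca_one D)"

lemma ue_mult: "ue * t = emb D (cmp t D)"
proof (rule cprod_eqI)
  fix E show "cmp (ue * t) E = cmp (emb D (cmp t D)) E"
    by (cases "E = D") (auto simp: ue_def cmp_emb vca_eq)
qed (simp add: ue_def)

lemma mult_ue: "t * ue = emb D (cmp t D)"
proof (rule cprod_eqI)
  fix E show "cmp (t * ue) E = cmp (emb D (cmp t D)) E"
    by (cases "E = D") (auto simp: ue_def cmp_emb vca_eq)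
qed (simp add: ue_def)

lemma ue_comm: "ue * t = t * ue" by (simp add: ue_mult mult_ue)
lemma ue_emb [simp]: "x \<in> ca_carr D \<Longrightarrow> ue * emb D x = emb D x" by (simp add: ue_mult)
lemma emb_cmp: "ue * t = t \<Longrightarrow> emb D (cmp t D) = t" by (simp add: ue_mult)
lemma ue_ue [simp]: "ue * ue = ue" by (simp add: ue_def flip: emb_mul)
lemma adj_ue [simp]: "adj ue = ue" by (simp add: ue_def flip: emb_star)

text \<open>The embedding turns the fold over a chosen enumeration into a commutative sum, which
  removes the dependence on the choice.\<close>

lemma ca_sum_emb:
  assumes "finite S" "\<And>i. i \<in> S \<Longrightarrow> f i \<in> ca_carr D"
  shows "ca_sum D f S \<in> ca_carr D" "emb D (ca_sum D f S) = (\<Sum>i\<in>S. emb D (f i))"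
proof -
  define xs where "xs = (SOME xs. set xs = S \<and> distinct xs)"
  have "\<exists>xs. set xs = S \<and> distinct xs" using finite_distinct_list[OF assms(1)] .
  then have xs: "set xs = S \<and> distinct xs" unfolding xs_def by (rule someI_ex)
  have *: "set ys \<subseteq> S \<Longrightarrow> distinct ys \<Longrightarrow> foldr (\<lambda>h acc. ca_add D (f h) acc) ys (ca_zero D) \<in> ca_carr D \<and>
      emb D (foldr (\<lambda>h acc. ca_add D (f h) acc) ys (ca_zero D)) = (\<Sum>i\<in>set ys. emb D (f i))" for ys
    by (induction ys) (auto simp: emb_add assms(2))
  show "ca_sum D f S \<in> ca_carr D" "emb D (ca_sum D f S) = (\<Sum>i\<in>S. emb D (f i))"
    using *[of xs] xs unfolding ca_sum_def xs_def[symmetric] by auto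
qed

text \<open>The root taken in the product is multiplied by \<open>ue\<close> to bring it into the
  coordinate of \<open>D\<close>. As \<open>ue\<close> is a central projection fixing the element,
  the square is unchanged.\<close>

lemma positive_iff: 
  assumes x: "x \<in> ca_carr D" shows "ca_positive D x \<longleftrightarrow> pos (emb D x)"
proof
  assume "ca_positive D x"
  then obtain b where "b \<in> ca_carr D" "x = ca_mul D (ca_star D b) b" unfolding ca_positive_def by blast
  then show "pos (emb D x)" by (simp add: emb_mul emb_star pos_adj_mult)
next
  assume p: "pos (emb D x)"
  let ?s = "ue * rt (emb D x)"
  have s: "emb D (cmp (rt (emb D x)) D) = ?s" by (simp add: ue_mult)
  have "adj ?s * ?s = (rt (emb D x) * (ue * ue)) * rt (emb D x)"
    by (simp only: adj_mult adj_ue adj_rt[OF p] mult.assoc)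
  also have "\<dots> = (ue * rt (emb D x)) * rt (emb D x)" by (simp only: ue_ue ue_comm[of "rt (emb D x)"])
  also have "\<dots> = emb D x" using x by (simp add: mult.assoc rt_rt[OF p])
  finally have "emb D (ca_mul D (ca_star D (cmp (rt (emb D x)) D)) (cmp (rt (emb D x)) D)) = emb D x"
    by (simp add: emb_mul emb_star s)
  then have "x = ca_mul D (ca_star D (cmp (rt (emb D x)) D)) (cmp (rt (emb D x)) D)"
    using x emb_inj by (metis cmp_in_D mul_in star_in)
  then show "ca_positive D x" unfolding ca_positive_def by blast
qed

text \<open>Covers both the matrix norm and the norm of the regular representation.\<close>
lemma Sup_hilbert_module:
  assumes fin: "finite I"
    and rep: "\<And>v i. \<forall>i\<in>I. v i \<in> ca_carr D \<Longrightarrow> i \<in> I \<Longrightarrow> rep v i \<in> ca_carr D"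
      "\<And>v i. \<forall>i\<in>I. v i \<in> ca_carr D \<Longrightarrow> i \<in> I \<Longrightarrow> emb D (rep v i) = mvec I M (\<lambda>i. emb D (v i)) i"
    and M: "\<And>i j. i \<in> I \<Longrightarrow> j \<in> I \<Longrightarrow> ue * M i j = M i j"
  shows "Sup {sqrt (ca_norm D (ca_sum D (\<lambda>i. ca_mul D (ca_star D (rep v i)) (rep v i)) I)) | v.
      (\<forall>i\<in>I. v i \<in> ca_carr D) \<and> ca_norm D (ca_sum D (\<lambda>i. ca_mul D (ca_star D (v i)) (v i)) I) \<le> 1} = opn I M"
proof -
  have inner: "ca_norm D (ca_sum D (\<lambda>i. ca_mul D (ca_star D (w i)) (w i)) I) = norm (hip I (\<lambda>i. emb D (w i)) (\<lambda>i. emb D (w i)))"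
    if "\<forall>i\<in>I. w i \<in> ca_carr D" for w
  proof -
    have "ca_norm D (ca_sum D (\<lambda>i. ca_mul D (ca_star D (w i)) (w i)) I) = norm (emb D (ca_sum D (\<lambda>i. ca_mul D (ca_star D (w i)) (w i)) I))"
      using that by (intro norm_emb[symmetric] ca_sum_emb fin) auto
    also have "emb D (ca_sum D (\<lambda>i. ca_mul D (ca_star D (w i)) (w i)) I) = hip I (\<lambda>i. emb D (w i)) (\<lambda>i. emb D (w i))"
      using that unfolding hip_def by (subst ca_sum_emb(2)[OF fin]) (auto simp: emb_mul emb_star intro!: sum.cong)
    finally show ?thesis .
  qed
  have innerr: "ca_norm D (ca_sum D (\<lambda>i. ca_mul D (ca_star D (rep v i)) (rep v i)) I) =
      norm (hip I (mvec I M (\<lambda>i. emb D (v i))) (mvec I M (\<lambda>i. emb D (v i))))" if "\<forall>i\<in>I. v i \<in> ca_carr D" for v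
    using inner[of "rep v"] rep(1)[OF that] rep(2)[OF that] hip_cong[of I "\<lambda>i. emb D (rep v i)" "mvec I M (\<lambda>i. emb D (v i))"]
    by simp
  let ?L = "{sqrt (ca_norm D (ca_sum D (\<lambda>i. ca_mul D (ca_star D (rep v i)) (rep v i)) I)) | v.
      (\<forall>i\<in>I. v i \<in> ca_carr D) \<and> ca_norm D (ca_sum D (\<lambda>i. ca_mul D (ca_star D (v i)) (v i)) I) \<le> 1}"
  let ?R = "{sqrt (norm (hip I (mvec I M v) (mvec I M v))) | v. (\<forall>i\<in>I. ue * v i = v i) \<and> norm (hip I v v) \<le> 1}"
  have "?L \<subseteq> ?R"
  proof
    fix r assume "r \<in> ?L"
    then obtain v where v: "\<forall>i\<in>I. v i \<in> ca_carr D" "ca_norm D (ca_sum D (\<lambda>i. ca_mul D (ca_star D (v i)) (v i)) I) \<le> 1"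
      "r = sqrt (ca_norm D (ca_sum D (\<lambda>i. ca_mul D (ca_star D (rep v i)) (rep v i)) I))" by blast
    let ?w = "\<lambda>i. emb D (v i)"
    have "r = sqrt (norm (hip I (mvec I M ?w) (mvec I M ?w)))" using v(3) innerr[OF v(1)] by simp
    moreover have "\<forall>i\<in>I. ue * ?w i = ?w i" using v(1) by simp
    moreover have "norm (hip I ?w ?w) \<le> 1" using inner[OF v(1)] v(2) by simp
    ultimately show "r \<in> ?R" by blast
  qed
  moreover have "?R \<subseteq> ?L"
  proof
    fix r assume "r \<in> ?R"
    then obtain w where w: "\<forall>i\<in>I. ue * w i = w i" "norm (hip I w w) \<le> 1"
      "r = sqrt (norm (hip I (mvec I M w) (mvec I M w)))" by blast
    let ?v = "\<lambda>i. cmp (w i) D"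
    have v: "\<forall>i\<in>I. ?v i \<in> ca_carr D" by simp
    have ev: "emb D (?v i) = w i" if "i \<in> I" for i using w(1) that emb_cmp by blast
    have "hip I (\<lambda>i. emb D (?v i)) (\<lambda>i. emb D (?v i)) = hip I w w" by (rule hip_cong) (simp_all add: ev)
    then have 1: "ca_norm D (ca_sum D (\<lambda>i. ca_mul D (ca_star D (?v i)) (?v i)) I) \<le> 1" using inner[OF v] w(2) by simp
    have "mvec I M (\<lambda>i. emb D (?v i)) = mvec I M w" unfolding mvec_def by (intro ext sum.cong) (simp_all add: ev)
    then have "r = sqrt (ca_norm D (ca_sum D (\<lambda>i. ca_mul D (ca_star D (rep ?v i)) (rep ?v i)) I))"
      using innerr[OF v] w(3) by simp
    then show "r \<in> ?L" using 1 v by blast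
  qed
  ultimately have "?L = ?R" by blast
  then show ?thesis using opn_corner[OF fin, of ue M, OF ue_comm ue_ue adj_ue M] by simp
qed

end

section \<open>The crossed product\<close>

lemma opn_cong: "finite I \<Longrightarrow> (\<And>i j. i \<in> I \<Longrightarrow> j \<in> I \<Longrightarrow> X i j = Y i j) \<Longrightarrow> opn I X = opn I (Y :: _ \<Rightarrow> _ \<Rightarrow> 'a::cstar)"
proof -
  assume fin: "finite I" and eq: "\<And>i j. i \<in> I \<Longrightarrow> j \<in> I \<Longrightarrow> X i j = Y i j"
  have "vn I (mvec I X v) = vn I (mvec I Y v)" for v
    by (rule vn_cong) (auto simp: mvec_def eq intro!: sum.cong)
  then show ?thesis unfolding opn_def vn_def[symmetric] by simp
qed

locale crossed = ucsalg A + group G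
  for A :: "'a cstar_alg" and G :: "('g, 'b) monoid_scheme" (structure) +
  fixes \<alpha> :: "'g \<Rightarrow> 'a \<Rightarrow> 'a"
  assumes finG: "finite (carrier G)" and act: "group_action G A \<alpha>"
begin

abbreviation C where "C \<equiv> crossed_product A G \<alpha>"

lemma act_iso: "g \<in> carrier G \<Longrightarrow> star_iso A A (\<alpha> g)"
  using act unfolding group_action_def star_automorphism_def by blast

lemma act_in [simp, intro]: "g \<in> carrier G \<Longrightarrow> x \<in> ca_carr A \<Longrightarrow> \<alpha> g x \<in> ca_carr A"
  using act_iso[of g] unfolding star_iso_def bij_betw_def by blast

lemma act_add: "g \<in> carrier G \<Longrightarrow> x \<in> ca_carr A \<Longrightarrow> y \<in> ca_carr A \<Longrightarrow> \<alpha> g (ca_add A x y) = ca_add A (\<alpha> g x) (\<alpha> g y)"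
  and act_mul: "g \<in> carrier G \<Longrightarrow> x \<in> ca_carr A \<Longrightarrow> y \<in> ca_carr A \<Longrightarrow> \<alpha> g (ca_mul A x y) = ca_mul A (\<alpha> g x) (\<alpha> g y)"
  and act_star: "g \<in> carrier G \<Longrightarrow> x \<in> ca_carr A \<Longrightarrow> \<alpha> g (ca_star A x) = ca_star A (\<alpha> g x)"
  and act_smul: "g \<in> carrier G \<Longrightarrow> x \<in> ca_carr A \<Longrightarrow> \<alpha> g (ca_smul A c x) = ca_smul A c (\<alpha> g x)"
  using act_iso[of g] unfolding star_iso_def by blast+

lemma act_one [simp]: "x \<in> ca_carr A \<Longrightarrow> \<alpha> \<one> x = x"
  and act_mult: "g \<in> carrier G \<Longrightarrow> h \<in> carrier G \<Longrightarrow> x \<in> ca_carr A \<Longrightarrow> \<alpha> (g \<otimes> h) x = \<alpha> g (\<alpha> h x)"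
  using act unfolding group_action_def by blast+

lemma act_zero [simp]: "g \<in> carrier G \<Longrightarrow> \<alpha> g (ca_zero A) = ca_zero A"
  using act_add[of g "ca_zero A" "ca_zero A"] by (intro idem_zero) simp_all

lemma act_unit [simp]: 
  assumes g: "g \<in> carrier G" shows "\<alpha> g (ca_one A) = ca_one A"
proof -
  have "ca_is_unit A (\<alpha> g (ca_one A))" unfolding ca_is_unit_def
  proof (intro conjI ballI)
    fix x assume x: "x \<in> ca_carr A"
    obtain y where y: "y \<in> ca_carr A" "x = \<alpha> g y" using act_iso[OF g] x unfolding star_iso_def bij_betw_def by blast
    show "ca_mul A (\<alpha> g (ca_one A)) x = x" "ca_mul A x (\<alpha> g (ca_one A)) = x"
      using y g by (simp_all flip: act_mul)
  qed (use g in auto)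
  then show ?thesis by (rule unit_unique[symmetric])
qed

text \<open>Automorphisms are given algebraically, so contractivity has to be derived: the squared
  norm of \<open>x\<close> times the unit, minus \<open>adj x * x\<close>, is of the form
  \<open>adj y * y\<close>, a relation that \<open>\<alpha> g\<close> preserves.\<close>

lemma norm_act_le:
  assumes g: "g \<in> carrier G" and x: "x \<in> ca_carr A" shows "ca_norm A (\<alpha> g x) \<le> ca_norm A x"
proof -
  define K where "K = (ca_norm A x)\<^sup>2"
  let ?X = "emb A x"
  have "pos (of_real K - adj ?X * ?X)"
    by (rule pos_of_real_minus) (simp_all add: adj_mult cstar_norm norm_emb[OF x] K_def)
  then obtain s where s: "adj s = s" "s * s = of_real K - adj ?X * ?X" using pos_sqrt by metis
  define y where "y = cmp s A"
  have y: "y \<in> ca_carr A" "emb A y = ue * s" by (simp_all add: y_def ue_mult)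
  have "emb A (ca_mul A (ca_star A y) y) = (s * (ue * ue)) * s"
    using y by (simp only: emb_mul emb_star star_in adj_mult adj_ue s(1) mult.assoc)
  also have "\<dots> = ue * (s * s)" by (simp only: ue_ue ue_comm[of s, symmetric] mult.assoc)
  also have "\<dots> = sc (complex_of_real K) * ue - adj ?X * ?X"
    using x unfolding s(2) sc_of_real by (simp add: right_diff_distrib of_real_def flip: emb_star emb_mul)
  also have "\<dots> = emb A (ca_minus A (ca_smul A K (ca_one A)) (ca_mul A (ca_star A x) x))"
    using x by (simp add: emb_minus emb_smul emb_mul emb_star ue_def)
  finally have "ca_mul A (ca_star A y) y = ca_minus A (ca_smul A K (ca_one A)) (ca_mul A (ca_star A x) x)"
    using x y by (intro emb_inj) auto
  then have "\<alpha> g (ca_mul A (ca_star A y) y) = \<alpha> g (ca_minus A (ca_smul A K (ca_one A)) (ca_mul A (ca_star A x) x))" by simp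
  then have "ca_mul A (ca_star A (\<alpha> g y)) (\<alpha> g y) = ca_minus A (ca_smul A K (ca_one A)) (ca_mul A (ca_star A (\<alpha> g x)) (\<alpha> g x))"
    using x y g by (simp add: act_mul act_star act_add act_smul ca_minus_def)
  then have "adj (emb A (\<alpha> g y)) * emb A (\<alpha> g y) = emb A (ca_minus A (ca_smul A K (ca_one A)) (ca_mul A (ca_star A (\<alpha> g x)) (\<alpha> g x)))"
    using y g by (simp flip: emb_mul emb_star)
  also have "\<dots> = K *\<^sub>R ue - adj (emb A (\<alpha> g x)) * emb A (\<alpha> g x)"
    using x g by (simp add: emb_minus emb_smul emb_mul emb_star ue_def sc_of_real) (simp add: of_real_def)
  finally have "pos (K *\<^sub>R ue - adj (emb A (\<alpha> g x)) * emb A (\<alpha> g x))" using pos_adj_mult by metis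
  from pos_mono_norm[OF pos_adj_mult this] have "(ca_norm A (\<alpha> g x))\<^sup>2 \<le> K * norm (ue)"
    using x g by (simp add: cstar_norm norm_emb K_def)
  also have "\<dots> \<le> K * 1" using norm_one_le by (intro mult_left_mono) (simp_all add: ue_def norm_emb K_def)
  finally show ?thesis unfolding K_def using norm_nonneg[OF x] by (simp add: power2_le_iff_abs_le norm_nonneg)
qed

lemma carr_C: "x \<in> ca_carr C \<longleftrightarrow> (\<forall>g\<in>carrier G. x g \<in> ca_carr A) \<and> (\<forall>g. g \<notin> carrier G \<longrightarrow> x g = ca_zero A)"
  by (simp add: crossed_product_def)

lemma C_in [simp]: "x \<in> ca_carr C \<Longrightarrow> g \<in> carrier G \<Longrightarrow> x g \<in> ca_carr A"
  by (simp add: carr_C)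

lemma C_simps: "ca_zero C = (\<lambda>g. ca_zero A)"
   "ca_add C x y = (\<lambda>g. if g \<in> carrier G then ca_add A (x g) (y g) else ca_zero A)"
   "ca_smul C c x = (\<lambda>g. if g \<in> carrier G then ca_smul A c (x g) else ca_zero A)"
   "ca_mul C x y = (\<lambda>g. if g \<in> carrier G then ca_sum A (\<lambda>h. ca_mul A (x h) (\<alpha> h (y (inv h \<otimes> g)))) (carrier G) else ca_zero A)"
   "ca_star C x = (\<lambda>g. if g \<in> carrier G then \<alpha> g (ca_star A (x (inv g))) else ca_zero A)"
  unfolding crossed_product_def cstar_alg.select_convs by (rule refl)+

lemma C_closed: "ca_zero C \<in> ca_carr C" "x \<in> ca_carr C \<Longrightarrow> y \<in> ca_carr C \<Longrightarrow> ca_add C x y \<in> ca_carr C"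
  "x \<in> ca_carr C \<Longrightarrow> ca_smul C c x \<in> ca_carr C" "x \<in> ca_carr C \<Longrightarrow> y \<in> ca_carr C \<Longrightarrow> ca_mul C x y \<in> ca_carr C"
  "x \<in> ca_carr C \<Longrightarrow> ca_star C x \<in> ca_carr C"
  by (auto simp: carr_C C_simps intro!: ca_sum_emb(1) finG)

text \<open>The matrix of \<open>x\<close> in the regular representation. Its row at
  \<open>\<one>\<close> contains all coefficients of \<open>x\<close>, so the representation is
  faithful.\<close>

definition M :: "('g \<Rightarrow> 'a) \<Rightarrow> 'g \<Rightarrow> 'g \<Rightarrow> 'a cprod" where
  "M x g k = emb A (\<alpha> (inv g) (x (g \<otimes> inv k)))"

lemma M_one: "x \<in> ca_carr C \<Longrightarrow> g \<in> carrier G \<Longrightarrow> M x \<one> (inv g) = emb A (x g)"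
  by (simp add: M_def)

lemma M_inj:
  assumes "x \<in> ca_carr C" "y \<in> ca_carr C" "\<And>g k. g \<in> carrier G \<Longrightarrow> k \<in> carrier G \<Longrightarrow> M x g k = M y g k"
  shows "x = y"
proof
  fix g show "x g = y g"
  proof (cases "g \<in> carrier G")
    case True
    then have "emb A (x g) = emb A (y g)" using assms(3)[of \<one> "inv g"] assms(1,2) by (simp add: M_one)
    then show ?thesis using assms(1,2) True by (intro emb_inj) auto
  qed (use assms(1,2) carr_C in auto)
qed

lemma ue_M: "x \<in> ca_carr C \<Longrightarrow> g \<in> carrier G \<Longrightarrow> k \<in> carrier G \<Longrightarrow> ue * M x g k = M x g k"
  by (simp add: M_def)

lemma M_zero: "g \<in> carrier G \<Longrightarrow> k \<in> carrier G \<Longrightarrow> M (ca_zero C) g k = 0"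
  by (simp add: M_def C_simps)

lemma M_add: "x \<in> ca_carr C \<Longrightarrow> y \<in> ca_carr C \<Longrightarrow> g \<in> carrier G \<Longrightarrow> k \<in> carrier G \<Longrightarrow> M (ca_add C x y) g k = M x g k + M y g k"
  by (simp add: M_def C_simps act_add emb_add)

lemma M_smul: "x \<in> ca_carr C \<Longrightarrow> g \<in> carrier G \<Longrightarrow> k \<in> carrier G \<Longrightarrow> M (ca_smul C c x) g k = sc c * M x g k"
  by (simp add: M_def C_simps act_smul emb_smul)

lemma M_star: 
  assumes "x \<in> ca_carr C" "g \<in> carrier G" "k \<in> carrier G" shows "M (ca_star C x) g k = adj (M x k g)"
proof -
  have i: "inv (g \<otimes> inv k) = k \<otimes> inv g" and j: "inv g \<otimes> (g \<otimes> inv k) = inv k"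
    using assms by (simp_all add: inv_mult_group flip: m_assoc)
  have "M (ca_star C x) g k = emb A (\<alpha> (inv g) (\<alpha> (g \<otimes> inv k) (ca_star A (x (inv (g \<otimes> inv k))))))"
    using assms unfolding M_def C_simps by simp
  also have "\<dots> = emb A (\<alpha> (inv g \<otimes> (g \<otimes> inv k)) (ca_star A (x (k \<otimes> inv g))))"
    unfolding i using assms by (subst act_mult) auto
  also have "\<dots> = adj (M x k g)" unfolding j using assms by (simp add: M_def act_star emb_star)
  finally show ?thesis .
qed

lemma sum_reindex_inv:
  assumes "g \<in> carrier G" shows "(\<Sum>h\<in>carrier G. F (inv h \<otimes> g)) = (\<Sum>k\<in>carrier G. F k)"
proof (rule sum.reindex_bij_witness[where i = "\<lambda>k. g \<otimes> inv k" and j = "\<lambda>h. inv h \<otimes> g"])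
  fix h assume h: "h \<in> carrier G"
  then show "g \<otimes> inv (inv h \<otimes> g) = h" using assms by (simp add: inv_mult_group flip: m_assoc)
  show "inv (g \<otimes> inv h) \<otimes> g = h" using assms h by (simp add: inv_mult_group m_assoc)
qed (use assms in auto)

text \<open>Substituting \<open>l = inv h \<otimes> g\<close> turns the convolution into a matrix
  product, since \<open>\<alpha> (inv g)\<close> composed with \<open>\<alpha> h\<close> is the
  automorphism of \<open>inv l\<close>.\<close>

lemma M_mul: 
  assumes x: "x \<in> ca_carr C" and y: "y \<in> ca_carr C" and g: "g \<in> carrier G" and k: "k \<in> carrier G"
  shows "M (ca_mul C x y) g k = mmul (carrier G) (M x) (M y) g k"
proof -
  let ?l = "g \<otimes> inv k" and ?g = "inv g"
  let ?f = "\<lambda>h. ca_mul A (x h) (\<alpha> h (y (inv h \<otimes> ?l)))"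
  have f: "h \<in> carrier G \<Longrightarrow> ?f h \<in> ca_carr A" for h using x y g k by simp
  \<comment> \<open>The sum is a fold, so compatibility with the automorphism is shown for all lists
    before the chosen enumeration is inserted.\<close>
  have lin: "set ys \<subseteq> carrier G \<Longrightarrow> \<alpha> ?g (foldr (\<lambda>h acc. ca_add A (?f h) acc) ys (ca_zero A)) =
      foldr (\<lambda>h acc. ca_add A (\<alpha> ?g (?f h)) acc) ys (ca_zero A) \<and> foldr (\<lambda>h acc. ca_add A (?f h) acc) ys (ca_zero A) \<in> ca_carr A" for ys
    using g by (induction ys) (auto simp: act_add f)
  have "\<exists>xs. set xs = carrier G \<and> distinct xs" using finite_distinct_list[OF finG] .
  then have xs: "set (SOME xs. set xs = carrier G \<and> distinct xs) \<subseteq> carrier G" by (metis (mono_tags, lifting) someI_ex order_refl)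
  have "M (ca_mul C x y) g k = emb A (ca_sum A (\<lambda>h. \<alpha> ?g (?f h)) (carrier G))"
    using g k lin[OF xs] by (simp add: M_def C_simps ca_sum_def)
  also have "\<dots> = (\<Sum>h\<in>carrier G. emb A (\<alpha> ?g (?f h)))" using g f by (intro ca_sum_emb finG) auto
  also have "\<dots> = (\<Sum>h\<in>carrier G. M x g (inv h \<otimes> g) * M y (inv h \<otimes> g) k)"
  proof (rule sum.cong[OF refl])
    fix h assume h: "h \<in> carrier G"
    have "g \<otimes> inv (inv h \<otimes> g) = h" using g h by (simp add: inv_mult_group flip: m_assoc)
    moreover have "inv (inv h \<otimes> g) = ?g \<otimes> h" using g h by (simp add: inv_mult_group)
    moreover have "(inv h \<otimes> g) \<otimes> inv k = inv h \<otimes> ?l" using g h k by (simp add: m_assoc)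
    ultimately show "emb A (\<alpha> ?g (?f h)) = M x g (inv h \<otimes> g) * M y (inv h \<otimes> g) k"
      using x y g k h by (simp add: M_def act_mul act_mult emb_mul)
  qed
  also have "\<dots> = (\<Sum>l\<in>carrier G. M x g l * M y l k)" by (rule sum_reindex_inv[OF g])
  finally show ?thesis by (simp add: mmul_def)
qed

lemma norm_C: 
  assumes x: "x \<in> ca_carr C" shows "ca_norm C x = opn (carrier G) (M x)"
proof -
  have "ca_norm C x = Sup {sqrt (ca_norm A (ca_sum A (\<lambda>i. ca_mul A (ca_star A (cp_rep G A \<alpha> x v i)) (cp_rep G A \<alpha> x v i)) (carrier G))) | v.
      (\<forall>i\<in>carrier G. v i \<in> ca_carr A) \<and> ca_norm A (ca_sum A (\<lambda>i. ca_mul A (ca_star A (v i)) (v i)) (carrier G)) \<le> 1}"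
    unfolding crossed_product_def cstar_alg.select_convs cp_inner_def by (rule refl)
  also have "\<dots> = opn (carrier G) (M x)"
  proof (rule Sup_hilbert_module[OF finG])
    fix v g assume v: "\<forall>i\<in>carrier G. v i \<in> ca_carr A" and g: "g \<in> carrier G"
    show "cp_rep G A \<alpha> x v g \<in> ca_carr A" unfolding cp_rep_def using x v g by (intro ca_sum_emb finG) auto
    have "emb A (cp_rep G A \<alpha> x v g) = (\<Sum>h\<in>carrier G. emb A (ca_mul A (\<alpha> (inv g) (x h)) (v (inv h \<otimes> g))))"
      unfolding cp_rep_def using x v g by (intro ca_sum_emb finG) auto
    also have "\<dots> = (\<Sum>h\<in>carrier G. M x g (inv h \<otimes> g) * emb A (v (inv h \<otimes> g)))"
    proof (rule sum.cong[OF refl])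
      fix h assume h: "h \<in> carrier G"
      have "g \<otimes> inv (inv h \<otimes> g) = h" using g h by (simp add: inv_mult_group flip: m_assoc)
      then show "emb A (ca_mul A (\<alpha> (inv g) (x h)) (v (inv h \<otimes> g))) = M x g (inv h \<otimes> g) * emb A (v (inv h \<otimes> g))"
        using x v g h by (simp add: M_def emb_mul)
    qed
    also have "\<dots> = (\<Sum>k\<in>carrier G. M x g k * emb A (v k))" by (rule sum_reindex_inv[OF g])
    finally show "emb A (cp_rep G A \<alpha> x v g) = mvec (carrier G) (M x) (\<lambda>i. emb A (v i)) g" by (simp add: mvec_def)
  qed (rule ue_M[OF x])
  finally show ?thesis .
qed

lemma norm_coeff_le: "x \<in> ca_carr C \<Longrightarrow> g \<in> carrier G \<Longrightarrow> ca_norm A (x g) \<le> ca_norm C x"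
  using entry_le_opn[OF finG, of \<one> "inv g" "M x"] by (simp add: norm_C M_one norm_emb)

text \<open>Together with the preceding bound this makes the norm equivalent to the largest
  coefficient norm, on which completeness rests.\<close>

lemma norm_le_coeff:
  assumes x: "x \<in> ca_carr C" and K: "\<And>g. g \<in> carrier G \<Longrightarrow> ca_norm A (x g) \<le> K"
  shows "ca_norm C x \<le> (real (card (carrier G)))\<^sup>2 * K"
proof -
  have "ca_norm C x \<le> (\<Sum>g\<in>carrier G. \<Sum>k\<in>carrier G. norm (M x g k))" unfolding norm_C[OF x] by (rule opn_le_sum[OF finG])
  also have "\<dots> \<le> (\<Sum>g\<in>carrier G. \<Sum>k\<in>carrier G. K)"
  proof (intro sum_mono)
    fix g k assume "g \<in> carrier G" "k \<in> carrier G"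
    then show "norm (M x g k) \<le> K" using x norm_act_le[of "inv g" "x (g \<otimes> inv k)"] K[of "g \<otimes> inv k"]
      by (simp add: M_def norm_emb)
  qed
  finally show ?thesis by (simp add: power2_eq_square)
qed

lemma C_minus: "x \<in> ca_carr C \<Longrightarrow> y \<in> ca_carr C \<Longrightarrow> ca_minus C x y \<in> ca_carr C"
  by (simp add: ca_minus_def C_closed)

lemma minus_coeff: "g \<in> carrier G \<Longrightarrow> ca_minus C x y g = ca_minus A (x g) (y g)"
  by (simp add: ca_minus_def C_simps)

lemma complete_C:
  assumes f: "\<forall>k::nat. f k \<in> ca_carr C" and Cau: "\<forall>e>0. \<exists>N. \<forall>k\<ge>N. \<forall>l\<ge>N. ca_norm C (ca_minus C (f k) (f l)) < e"
  shows "\<exists>x\<in>ca_carr C. \<forall>e>0. \<exists>N. \<forall>k\<ge>N. ca_norm C (ca_minus C (f k) x) < e"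
proof -
  have "\<exists>y\<in>ca_carr A. \<forall>e>0. \<exists>N. \<forall>k\<ge>N. ca_norm A (ca_minus A (f k g) y) < e" if g: "g \<in> carrier G" for g
  proof (rule complete)
    fix e :: real assume "e > 0"
    then obtain N where N: "\<forall>k\<ge>N. \<forall>l\<ge>N. ca_norm C (ca_minus C (f k) (f l)) < e" using Cau by blast
    have "ca_norm A (ca_minus A (f k g) (f l g)) \<le> ca_norm C (ca_minus C (f k) (f l))" for k l
      using norm_coeff_le[OF C_minus g, of "f k" "f l"] f g by (simp add: minus_coeff)
    then show "\<exists>N. \<forall>k\<ge>N. \<forall>l\<ge>N. ca_norm A (ca_minus A (f k g) (f l g)) < e" using N le_less_trans by blast
  qed (use f g in auto)
  then obtain L where L: "\<And>g. g \<in> carrier G \<Longrightarrow> L g \<in> ca_carr A"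
    "\<And>g e. g \<in> carrier G \<Longrightarrow> e > 0 \<Longrightarrow> \<exists>N. \<forall>k\<ge>N. ca_norm A (ca_minus A (f k g) (L g)) < e" by metis
  define x where "x g = (if g \<in> carrier G then L g else ca_zero A)" for g
  have x: "x \<in> ca_carr C" by (simp add: carr_C x_def L)
  have "\<exists>N. \<forall>k\<ge>N. ca_norm C (ca_minus C (f k) x) < e" if e: "e > 0" for e
  proof -
    define e' where "e' = e / ((real (card (carrier G)))\<^sup>2 + 1)"
    have n: "0 < (real (card (carrier G)))\<^sup>2 + 1" by (simp add: add_nonneg_pos)
    then have e': "e' > 0" using e by (simp add: e'_def)
    have "\<forall>g\<in>carrier G. \<exists>N. \<forall>k\<ge>N. ca_norm A (ca_minus A (f k g) (L g)) < e'" using L(2) e' by blast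
    then obtain N where N: "\<And>g k. g \<in> carrier G \<Longrightarrow> k \<ge> N g \<Longrightarrow> ca_norm A (ca_minus A (f k g) (L g)) < e'" by metis
    have "ca_norm C (ca_minus C (f k) x) < e" if k: "k \<ge> Max (N ` carrier G)" for k
    proof -
      have "ca_norm C (ca_minus C (f k) x) \<le> (real (card (carrier G)))\<^sup>2 * e'"
      proof (rule norm_le_coeff)
        fix g assume g: "g \<in> carrier G"
        have "N g \<le> k" using g finG by (intro order_trans[OF Max_ge k]) auto
        then show "ca_norm A (ca_minus C (f k) x g) \<le> e'" using N[OF g] g by (simp add: minus_coeff x_def less_imp_le)
      qed (use f x C_minus in auto)
      also have "\<dots> < e"
      proof -
        have "(real (card (carrier G)))\<^sup>2 * e' < ((real (card (carrier G)))\<^sup>2 + 1) * e'" using e' by simp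
        also have "\<dots> = e" using n by (simp add: e'_def)
        finally show ?thesis .
      qed
      finally show ?thesis .
    qed
    then show ?thesis by blast
  qed
  then show ?thesis using x by blast
qed

lemma mmul_assoc: "mmul I (mmul I X Y) Z i j = mmul I X (mmul I Y (Z :: _ \<Rightarrow> _ \<Rightarrow> 'c::cstar)) i j"
  unfolding mmul_def sum_distrib_left sum_distrib_right by (subst sum.swap) (simp add: mult.assoc)

lemma mmul_cong: "(\<And>k. k \<in> I \<Longrightarrow> X i k = X' i k) \<Longrightarrow> (\<And>k. k \<in> I \<Longrightarrow> Y k j = Y' k j) \<Longrightarrow> mmul I X Y i j = mmul I X' Y' i j"
  unfolding mmul_def by (intro sum.cong) auto

lemma M_mul3:
  assumes "x \<in> ca_carr C" "y \<in> ca_carr C" "z \<in> ca_carr C" "g \<in> carrier G" "k \<in> carrier G"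
  shows "M (ca_mul C (ca_mul C x y) z) g k = mmul (carrier G) (mmul (carrier G) (M x) (M y)) (M z) g k"
    "M (ca_mul C x (ca_mul C y z)) g k = mmul (carrier G) (M x) (mmul (carrier G) (M y) (M z)) g k"
  using assms by (auto simp: M_mul C_closed intro!: mmul_cong)

text \<open>Identities and norm axioms are checked on the faithful matrices \<open>M x\<close>,
  where they become matrix identities and properties of \<open>opn\<close>; completeness comes from
  the coefficients.\<close>

sublocale C: csalg C
proof
  show "cstar_algebra C" unfolding cstar_algebra_def
  proof (intro conjI ballI allI impI)
    fix x y z c d assume x: "x \<in> ca_carr C"
    show "ca_norm C x = 0 \<longleftrightarrow> x = ca_zero C"
    proof
      assume "ca_norm C x = 0"
      then have "x g = ca_zero A" if "g \<in> carrier G" for g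
        using norm_coeff_le[OF x that] norm_nonneg[of "x g"] norm_zero_iff[of "x g"] x that by simp
      then show "x = ca_zero C" using x by (auto simp: carr_C C_simps)
    next
      assume "x = ca_zero C"
      then have "opn (carrier G) (M x) \<le> 0" using opn_le_sum[OF finG, of "M x"] by (simp add: M_zero)
      then show "ca_norm C x = 0" using opn_nonneg[OF finG, of "M x"] by (simp add: norm_C[OF x])
    qed
    show "0 \<le> ca_norm C x" by (simp add: norm_C[OF x] opn_nonneg[OF finG])
    show "ca_norm C (ca_smul C c x) = cmod c * ca_norm C x"
      using x opn_sc[OF finG, of c "M x"] opn_cong[OF finG, of "M (ca_smul C c x)" "\<lambda>i j. sc c * M x i j"]
      by (simp add: norm_C C_closed M_smul)
    show "ca_norm C (ca_mul C (ca_star C x) x) = (ca_norm C x)\<^sup>2"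
      using x opn_star_mult[OF finG, of "M x"] 
        opn_cong[OF finG, of "M (ca_mul C (ca_star C x) x)" "mmul (carrier G) (\<lambda>i j. adj (M x j i)) (M x)"]
      by (simp add: norm_C C_closed M_mul M_star cong: mmul_cong)
    show "ca_add C x (ca_smul C (- 1) x) = ca_zero C" 
      using x by (intro M_inj) (auto simp: C_closed M_add M_smul M_zero sc_minus_1)
    show "ca_add C x (ca_zero C) = x" "ca_smul C 1 x = x" "ca_star C (ca_star C x) = x"
      using x by (intro M_inj; simp add: C_closed M_add M_smul M_zero M_star)+
    show "ca_smul C (c * d) x = ca_smul C c (ca_smul C d x)" "ca_smul C (c + d) x = ca_add C (ca_smul C c x) (ca_smul C d x)"
      using x by (intro M_inj; simp add: C_closed M_add M_smul sc_mult sc_add distrib_right mult.assoc)+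
    show "ca_star C (ca_smul C c x) = ca_smul C (cnj c) (ca_star C x)"
      using x by (intro M_inj; simp add: C_closed M_smul M_star adj_mult adj_sc sc_commute[of "adj _"])
    show "ca_star C x \<in> ca_carr C" "ca_smul C c x \<in> ca_carr C" using x by (simp_all add: C_closed)
    assume y: "y \<in> ca_carr C"
    show "ca_add C x y \<in> ca_carr C" "ca_mul C x y \<in> ca_carr C" using x y by (simp_all add: C_closed)
    show "ca_add C x y = ca_add C y x" "ca_star C (ca_add C x y) = ca_add C (ca_star C x) (ca_star C y)"
      "ca_smul C c (ca_add C x y) = ca_add C (ca_smul C c x) (ca_smul C c y)"
      using x y by (intro M_inj; simp add: C_closed M_add M_smul M_star adj_add algebra_simps)+
    show "ca_star C (ca_mul C x y) = ca_mul C (ca_star C y) (ca_star C x)"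
      using x y by (intro M_inj) (simp_all add: C_closed M_mul M_star mmul_def adj_sum adj_mult)
    show "ca_mul C (ca_smul C c x) y = ca_smul C c (ca_mul C x y)"
      using x y by (intro M_inj) (simp_all add: C_closed M_mul M_smul mmul_def sum_distrib_left mult.assoc)
    show "ca_mul C x (ca_smul C c y) = ca_smul C c (ca_mul C x y)"
      using x y by (intro M_inj) (simp_all add: C_closed M_mul M_smul mmul_def sum_distrib_left sc_commute[of _ c] flip: mult.assoc)
    show "ca_norm C (ca_add C x y) \<le> ca_norm C x + ca_norm C y"
      using x y opn_add[OF finG, of "M x" "M y"] opn_cong[OF finG, of "M (ca_add C x y)" "\<lambda>i j. M x i j + M y i j"]
      by (simp add: norm_C C_closed M_add)
    show "ca_norm C (ca_mul C x y) \<le> ca_norm C x * ca_norm C y"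
      using x y opn_mmul[OF finG, of "M x" "M y"] opn_cong[OF finG, of "M (ca_mul C x y)" "mmul (carrier G) (M x) (M y)"]
      by (simp add: norm_C C_closed M_mul)
    assume z: "z \<in> ca_carr C"
    show "ca_add C (ca_add C x y) z = ca_add C x (ca_add C y z)"
      using x y z by (intro M_inj) (simp_all add: C_closed M_add algebra_simps)
    show "ca_mul C (ca_mul C x y) z = ca_mul C x (ca_mul C y z)"
      using x y z by (intro M_inj) (simp_all add: C_closed M_mul3 mmul_assoc)
    show "ca_mul C (ca_add C x y) z = ca_add C (ca_mul C x z) (ca_mul C y z)"
      "ca_mul C x (ca_add C y z) = ca_add C (ca_mul C x y) (ca_mul C x z)"
      using x y z by (intro M_inj; simp add: C_closed M_add M_mul mmul_def algebra_simps sum.distrib)+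
  qed (use complete_C C_closed in auto)
qed

text \<open>The element \<open>a u_g\<close>, with \<open>u_g\<close> the canonical unitary of the
  crossed product.\<close>

definition dlt :: "'g \<Rightarrow> 'a \<Rightarrow> 'g \<Rightarrow> 'a" where
  "dlt g a = (\<lambda>h. if h = g then a else ca_zero A)"

lemma dlt_in [simp]: "g \<in> carrier G \<Longrightarrow> a \<in> ca_carr A \<Longrightarrow> dlt g a \<in> ca_carr C"
  by (auto simp: carr_C dlt_def)

lemma unit_C: "ca_is_unit C (dlt \<one> (ca_one A))"
proof -
  have M1: "M (dlt \<one> (ca_one A)) g k = (if g = k then ue else 0)" if "g \<in> carrier G" "k \<in> carrier G" for g k
  proof -
    have "g \<otimes> inv k = \<one> \<longleftrightarrow> g = k" using that by (metis inv_equality inv_inv r_inv inv_closed)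
    then show ?thesis using that by (simp add: M_def dlt_def ue_def)
  qed
  show ?thesis unfolding ca_is_unit_def
  proof (intro conjI ballI)
    show d: "dlt \<one> (ca_one A) \<in> ca_carr C" by simp
    fix x assume x: "x \<in> ca_carr C"
    show "ca_mul C (dlt \<one> (ca_one A)) x = x"
    proof (rule M_inj)
      fix g k assume gk: "g \<in> carrier G" "k \<in> carrier G"
      have "(\<Sum>l\<in>carrier G. M (dlt \<one> (ca_one A)) g l * M x l k) = (\<Sum>l\<in>carrier G. if g = l then M x l k else 0)"
        using gk by (intro sum.cong) (auto simp: M1 ue_M[OF x])
      then show "M (ca_mul C (dlt \<one> (ca_one A)) x) g k = M x g k"
        using x d gk finG by (simp add: M_mul mmul_def)
    qed (use x d in \<open>auto simp: C_closed\<close>)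
    show "ca_mul C x (dlt \<one> (ca_one A)) = x"
    proof (rule M_inj)
      fix g k assume gk: "g \<in> carrier G" "k \<in> carrier G"
      have "(\<Sum>l\<in>carrier G. M x g l * M (dlt \<one> (ca_one A)) l k) = (\<Sum>l\<in>carrier G. if l = k then M x g l else 0)"
        using gk by (intro sum.cong) (auto simp: M1 ue_M[OF x] ue_comm[symmetric])
      then show "M (ca_mul C x (dlt \<one> (ca_one A))) g k = M x g k"
        using x d gk finG by (simp add: M_mul mmul_def)
    qed (use x d in \<open>auto simp: C_closed\<close>)
  qed
qed

sublocale C: ucsalg C
  by unfold_locales (use unit_C unital_def in blast)

lemma one_C: "ca_one C = dlt \<one> (ca_one A)"
  by (rule C.unit_unique[OF unit_C])

end

section \<open>Cut-offs and Cuntz comparison\<close>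

text \<open>Subtracting \<open>\<delta>\<close> from \<open>p\<close> goes below \<open>b\<close>;
  cutting off at \<open>2 * \<delta>\<close> instead of \<open>\<delta>\<close> leaves room for a
  conjugating function that is continuous.\<close>

lemma cz_cutoff:
  fixes p b :: "'a::cstar"
  assumes p: "pos p" and b: "pos b" and d: "\<delta> > 0" and pb: "norm (p - b) \<le> \<delta>"
  shows "cz (fc (\<lambda>t. max (t - 2 * \<delta>) 0) p) b"
proof -
  note sp = pos_sa[OF p]
  let ?c = "\<lambda>t. max (t - 2 * \<delta>) 0"
  \<comment> \<open>Chosen so that \<open>?w t * (t - \<delta>) * ?w t\<close> is the cut-off. Where
    the numerator is nonzero, \<open>t - \<delta>\<close> exceeds \<open>\<delta>\<close> and the
    \<open>max\<close> below it is inactive; elsewhere the \<open>max\<close> prevents division by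
    zero.\<close>
  let ?w = "\<lambda>t. sqrt (max (t - 2 * \<delta>) 0 / max (t - \<delta>) \<delta>)"
  have ne: "max (t - \<delta>) \<delta> \<noteq> 0" for t using d by auto
  have cw: "cont ?w" and cc: "cont ?c" by (intro continuous_intros; use ne in auto)+
  define w where "w = fc ?w p"
  have sw: "adj w = w" unfolding w_def by (rule adj_fc[OF cw sp])
  have ce: "cont (\<lambda>t. t - \<delta>)" by (intro continuous_intros)
  have pe: "p - of_real \<delta> = fc (\<lambda>t. t - \<delta>) p" by (subst fc_diff) (auto intro!: continuous_intros simp: fc_id fc_const sp)
  have "w * (p - of_real \<delta>) * w = fc (\<lambda>t. ?w t * (t - \<delta>) * ?w t) p"
    unfolding pe w_def by (simp add: fc_mult[symmetric] cw ce sp continuous_on_mult)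
  also have "\<dots> = fc ?c p"
  proof (rule fc_cong[OF _ cc btw_pos[OF p order_refl]])
    show "cont (\<lambda>t. ?w t * (t - \<delta>) * ?w t)" by (intro continuous_intros cw ce)
    fix t :: real
    have "?w t * (t - \<delta>) * ?w t = (?w t * ?w t) * (t - \<delta>)" by (simp only: ac_simps)
    also have "?w t * ?w t = ?c t / max (t - \<delta>) \<delta>" using d by simp
    also have "\<dots> * (t - \<delta>) = ?c t" using d by (cases "t \<le> 2 * \<delta>") (auto simp: max_def)
    finally show "?w t * (t - \<delta>) * ?w t = ?c t" .
  qed
  finally have eq: "w * (p - of_real \<delta>) * w = fc ?c p" .
  have "pos (fc ?c p)" by (rule fc_pos[OF cc btw_pos[OF p order_refl]]) auto
  then show ?thesis using cz_perturb[OF b sp pb sw] unfolding eq by blast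
qed

lemma fc_cutoff_nonzero:
  assumes p: "pos p" and "\<delta> \<ge> 0" "norm p > \<delta>"
  shows "fc (\<lambda>t. max (t - \<delta>) 0) p \<noteq> 0"
proof
  assume z: "fc (\<lambda>t. max (t - \<delta>) 0) p = 0"
  note sp = pos_sa[OF p]
  have cc: "cont (\<lambda>t. max (t - \<delta>) 0)" by (intro continuous_intros)
  have "norm (fc (\<lambda>t. t) p - fc (\<lambda>t. max (t - \<delta>) 0) p) \<le> \<delta>"
    by (rule fc_norm_diff_le[OF _ cc btw_pos[OF p order_refl]]) (use assms in \<open>auto intro!: continuous_intros simp: max_def\<close>)
  then show False using z assms(3) by (simp add: fc_id sp)
qed

lemma fc_corner:
  fixes e :: "'a::cstar"
  assumes "cont \<phi>" "adj a = a" "\<phi> 0 = 0" "e * a = a"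
  shows "e * fc \<phi> a = fc \<phi> a"
proof -
  have cl: "closed {x. e * x = x}" by (intro closed_Collect_eq continuous_intros)
  have "fc \<phi> a \<in> {x. e * x = x}"
    by (rule fc_mem[OF assms(1-3) cl]) (auto simp: assms distrib_left mult.assoc[symmetric])
  then show ?thesis by simp
qed

text \<open>One minus this function is the cut-off of \<open>1 - t\<close> at
  \<open>2 * \<delta>\<close>, divided by \<open>1 - 2 * \<delta>\<close>. So truncating
  \<open>d\<close> from above cuts off \<open>1 - d\<close>, as Cuntz comparison wants it.\<close>

definition trunc :: "real \<Rightarrow> real \<Rightarrow> real" where "trunc \<delta> t = min (t / (1 - 2 * \<delta>)) 1"

lemma cont_trunc: "\<delta> < 1/2 \<Longrightarrow> cont (trunc \<delta>)"
  unfolding trunc_def by (intro continuous_intros) auto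

text \<open>Conjugating \<open>1 - d - of_real \<delta>\<close> by a suitable function of
  \<open>d\<close> gives exactly \<open>1 - fc (trunc \<delta>) d\<close>. As \<open>e - d\<close>
  is within \<open>\<delta>\<close> of \<open>b\<close>, the perturbation lemma applies once this is
  cut down to the corner of \<open>e\<close>.\<close>

lemma cz_one_minus:
  fixes d b e :: "'a::cstar"
  assumes e: "\<And>x. e * x = x * e" "e * e = e" "adj e = e"
    and d: "adj d = d" "e * d = d" and b: "pos b" and \<delta>: "0 < \<delta>" "\<delta> < 1/2" and near: "norm ((e - d) - b) \<le> \<delta>"
  shows "cz (e - fc (trunc \<delta>) d) b"
proof -
  let ?w = "\<lambda>t. sqrt (max (1 - 2 * \<delta> - t) 0 / (max (1 - t - \<delta>) \<delta> * (1 - 2 * \<delta>)))"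
  let ?k = "trunc \<delta>"
  have ck: "cont ?k" by (rule cont_trunc[OF \<delta>(2)])
  have ne: "max (1 - t - \<delta>) \<delta> * (1 - 2 * \<delta>) > 0" for t using \<delta> by (auto simp: less_max_iff_disj)
  have cw: "cont ?w" by (intro continuous_intros) (use \<delta> in \<open>auto simp: max_def split: if_splits\<close>)
  define w where "w = fc ?w d"
  have sw: "adj w = w" unfolding w_def by (rule adj_fc[OF cw d(1)])
  have ce: "cont (\<lambda>t. 1 - t - \<delta>)" by (intro continuous_intros)
  have pe: "1 - d - of_real \<delta> = fc (\<lambda>t. 1 - t - \<delta>) d" 
    by (subst fc_diff, (intro continuous_intros d)+, subst fc_diff) (auto intro!: continuous_intros simp: fc_id fc_const d)
  have "w * (1 - d - of_real \<delta>) * w = fc (\<lambda>t. ?w t * (1 - t - \<delta>) * ?w t) d"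
    unfolding pe w_def by (simp add: fc_mult[symmetric] cw ce d continuous_on_mult)
  also have "(\<lambda>t. ?w t * (1 - t - \<delta>) * ?w t) = (\<lambda>t. 1 - ?k t)"
  proof
    fix t :: real
    have "?w t * (1 - t - \<delta>) * ?w t = (?w t * ?w t) * (1 - t - \<delta>)" by (simp only: ac_simps)
    also have "?w t * ?w t = max (1 - 2 * \<delta> - t) 0 / (max (1 - t - \<delta>) \<delta> * (1 - 2 * \<delta>))" using ne[of t] by simp
    also have "\<dots> * (1 - t - \<delta>) = 1 - ?k t"
    proof (cases "t \<le> 1 - 2 * \<delta>")
      case True
      then have "t / (1 - 2 * \<delta>) \<le> 1" using \<delta> by simp
      then have k: "?k t = t / (1 - 2 * \<delta>)" by (simp add: trunc_def)
      have m: "max (1 - 2 * \<delta> - t) 0 = 1 - 2 * \<delta> - t" "max (1 - t - \<delta>) \<delta> = 1 - t - \<delta>" "1 - t - \<delta> > 0"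
        using True \<delta> by auto
      have "(1 - 2 * \<delta> - t) / ((1 - t - \<delta>) * (1 - 2 * \<delta>)) * (1 - t - \<delta>) = (1 - 2 * \<delta> - t) / (1 - 2 * \<delta>)" using m(3) by simp
      also have "\<dots> = 1 - t / (1 - 2 * \<delta>)" using \<delta> by (simp add: diff_divide_distrib)
      finally show ?thesis unfolding m k .
    next
      case False
      then have "t / (1 - 2 * \<delta>) \<ge> 1" using \<delta> by simp
      then show ?thesis using False \<delta> by (simp add: trunc_def max_def min_def)
    qed
    finally show "?w t * (1 - t - \<delta>) * ?w t = 1 - ?k t" .
  qed
  also have "fc (\<lambda>t. 1 - ?k t) d = 1 - fc ?k d" by (subst fc_diff) (auto intro!: continuous_intros ck simp: fc_const d)
  finally have eq: "w * (1 - d - of_real \<delta>) * w = 1 - fc ?k d" .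
  have kd: "e * fc ?k d = fc ?k d" by (rule fc_corner[OF ck d(1) _ d(2)]) (use \<delta> in \<open>simp add: trunc_def\<close>)
  have pk: "pos (1 - fc ?k d)"
  proof -
    have "pos (fc (\<lambda>t. 1 - ?k t) d)"
    proof (rule fc_pos[OF _ btw_norm[OF d(1) order_refl]])
      show "cont (\<lambda>t. 1 - ?k t)" by (rule continuous_on_diff[OF continuous_on_const ck])
    qed (simp add: trunc_def)
    then show ?thesis using \<open>fc (\<lambda>t. 1 - ?k t) d = 1 - fc ?k d\<close> by simp
  qed
  \<comment> \<open>Multiplying by the central \<open>e\<close> exchanges the unit of the type for
    that of the corner, since \<open>z\<close> annihilates \<open>1 - e\<close>.\<close>
  define z where "z = e * w"
  have sz: "adj z = z" by (simp add: z_def adj_mult sw e(1)[symmetric] e(3))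
  have "e - d - of_real \<delta> = (1 - d - of_real \<delta>) - (1 - e)" by simp
  have ze: "z * (1 - e) = 0"
  proof -
    have "z * e = e * e * w" unfolding e(1)[of z, symmetric] by (simp only: z_def mult.assoc)
    then show ?thesis by (simp add: right_diff_distrib e(2) z_def)
  qed
  have "z * (e - d - of_real \<delta>) * z = z * (1 - d - of_real \<delta>) * z - z * (1 - e) * z"
    by (simp add: algebra_simps)
  also have "\<dots> = z * (1 - d - of_real \<delta>) * z" by (simp add: ze)
  also have "\<dots> = e * (w * (1 - d - of_real \<delta>) * w) * e"
  proof -
    have zw: "w * e = z" by (simp only: z_def e(1))
    have "e * (w * (1 - d - of_real \<delta>) * w) * e = (e * w) * (1 - d - of_real \<delta>) * (w * e)" by (simp only: mult.assoc)
    also have "\<dots> = z * (1 - d - of_real \<delta>) * z" by (simp only: zw z_def[symmetric])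
    finally show ?thesis by (rule sym)
  qed
  also have "\<dots> = e * (1 - fc ?k d) * e" unfolding eq ..
  also have "\<dots> = e - fc ?k d" using e(1)[of "fc ?k d"] by (simp add: algebra_simps e(2) kd mult.assoc)
  finally have eq2: "z * (e - d - of_real \<delta>) * z = e - fc ?k d" .
  have "e * (1 - fc ?k d) * e = e - fc ?k d" using e(1)[of "fc ?k d"] by (simp add: algebra_simps e(2) kd mult.assoc)
  then have "pos (e - fc ?k d)" using pos_conj_sa[OF pk e(3)] by simp
  then show ?thesis using cz_perturb[OF b _ near sz] unfolding eq2 by (simp add: adj_diff e d)
qed

lemma cz_scaleR: 
  fixes a b :: "'a::cstar"
  assumes "cz a b" "0 < r" shows "cz (r *\<^sub>R a) b"
  unfolding cz_def
proof (intro allI impI)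
  fix \<epsilon> :: real assume "\<epsilon> > 0"
  then obtain x where x: "norm (a - adj x * b * x) < \<epsilon> / r" using assms unfolding cz_def by (meson divide_pos_pos)
  have "r *\<^sub>R a - adj (sqrt r *\<^sub>R x) * b * (sqrt r *\<^sub>R x) = r *\<^sub>R (a - adj x * b * x)"
    using assms(2) by (simp add: adj_scaleR scaleR_diff_right flip: power2_eq_square)
  then have "norm (r *\<^sub>R a - adj (sqrt r *\<^sub>R x) * b * (sqrt r *\<^sub>R x)) < \<epsilon>" using x assms(2) by (simp add: pos_less_divide_eq mult.commute)
  then show "\<exists>x. norm (r *\<^sub>R a - adj x * b * x) < \<epsilon>" by blast
qed

text \<open>\<open>\<beta>\<close> is meant to vanish below \<open>\<kappa>\<^sup>2\<close>. On its
  support \<open>adj x * x\<close> is at least \<open>\<kappa>\<^sup>2\<close>, so there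
  \<open>x\<close> shrinks norms by no more than the factor \<open>\<kappa>\<close>.\<close>

lemma fc_lower_mult:
  assumes b: "\<And>t. 0 \<le> t \<Longrightarrow> \<beta> t * \<beta> t * t \<ge> \<kappa>\<^sup>2 * (\<beta> t * \<beta> t)" and cb: "cont \<beta>" and "\<kappa> \<ge> 0"
  shows "\<kappa> * norm (fc \<beta> (adj x * x) * w) \<le> norm (x * fc \<beta> (adj x * x) * (w::'a::cstar))"
proof -
  define X where "X = adj x * x"
  have pX: "pos X" unfolding X_def by (rule pos_adj_mult)
  note sX = pos_sa[OF pX]
  let ?b = "fc \<beta> X"
  have sb: "adj ?b = ?b" by (rule adj_fc[OF cb sX])
  have bX: "?b * X * ?b - \<kappa>\<^sup>2 *\<^sub>R (?b * ?b) = fc (\<lambda>t. \<beta> t * t * \<beta> t - \<kappa>\<^sup>2 * (\<beta> t * \<beta> t)) X"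
    by (subst fc_diff, (intro continuous_intros cb sX)+, subst fc_cmult, (intro continuous_intros cb sX)+)
      (simp add: fc_mult[symmetric] fc_self_mult cb sX continuous_on_mult of_real_def)
  have "pos (?b * X * ?b - \<kappa>\<^sup>2 *\<^sub>R (?b * ?b))" unfolding bX
    by (rule fc_pos[OF _ btw_pos[OF pX order_refl]]) (use b in \<open>auto intro!: continuous_intros cb simp: ac_simps\<close>)
  then have "pos (adj w * (?b * X * ?b - \<kappa>\<^sup>2 *\<^sub>R (?b * ?b)) * w)" by (rule pos_conj)
  then have p: "pos (adj (x * ?b * w) * (x * ?b * w) - \<kappa>\<^sup>2 *\<^sub>R (adj (?b * w) * (?b * w)))"
    by (simp add: algebra_simps adj_mult sb X_def mult.assoc sb[unfolded X_def])
  have "pos (\<kappa>\<^sup>2 *\<^sub>R (adj (?b * w) * (?b * w)))" by (rule pos_scaleR[OF pos_adj_mult]) simp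
  from pos_mono_norm[OF this p] have "(\<kappa> * norm (?b * w))\<^sup>2 \<le> (norm (x * ?b * w))\<^sup>2"
    by (simp add: cstar_norm power_mult_distrib)
  then show ?thesis unfolding X_def by (rule power2_le_imp_le) simp
qed

section \<open>Rokhlin elements in a crossed product\<close>

text \<open>The weak tracial Rokhlin conditions inside one ambient algebra: the automorphism of
  \<open>g\<close> has become conjugation by \<open>u g\<close>, and the unit is
  \<open>e\<close>.\<close>

definition rokhlin_family :: "('g, 'b) monoid_scheme \<Rightarrow> 'v::cstar \<Rightarrow> 'v set \<Rightarrow> ('g \<Rightarrow> 'v) \<Rightarrow> 'v set \<Rightarrow> real \<Rightarrow> 'v \<Rightarrow> ('g \<Rightarrow> 'v) \<Rightarrow> bool"
where "rokhlin_family G e S u F \<epsilon> s f \<longleftrightarrow>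
   (\<forall>g\<in>carrier G. f g \<in> S \<and> pos (f g) \<and> norm (f g) \<le> 1) \<and>
   (\<forall>g\<in>carrier G. \<forall>h\<in>carrier G. g \<noteq> h \<longrightarrow> f g * f h = 0) \<and>
   (\<forall>x\<in>F. \<forall>g\<in>carrier G. norm (f g * x - x * f g) < \<epsilon>) \<and>
   (\<forall>g\<in>carrier G. \<forall>h\<in>carrier G. norm (u g * f h * adj (u g) - f (g \<otimes>\<^bsub>G\<^esub> h)) < \<epsilon>) \<and>
   cz (e - (\<Sum>g\<in>carrier G. f g)) s \<and>
   norm ((\<Sum>g\<in>carrier G. f g) * (s * (\<Sum>g\<in>carrier G. f g))) > 1 - \<epsilon>"

lemma rokhlin_familyD:
  assumes "rokhlin_family G e S u F \<epsilon> s f"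
  shows "\<And>g. g \<in> carrier G \<Longrightarrow> f g \<in> S \<and> pos (f g) \<and> norm (f g) \<le> 1"
    "\<And>g h. g \<in> carrier G \<Longrightarrow> h \<in> carrier G \<Longrightarrow> g \<noteq> h \<Longrightarrow> f g * f h = 0"
    "\<And>x g. x \<in> F \<Longrightarrow> g \<in> carrier G \<Longrightarrow> norm (f g * x - x * f g) < \<epsilon>"
    "\<And>g h. g \<in> carrier G \<Longrightarrow> h \<in> carrier G \<Longrightarrow> norm (u g * f h * adj (u g) - f (g \<otimes>\<^bsub>G\<^esub> h)) < \<epsilon>"
    "norm ((\<Sum>g\<in>carrier G. f g) * (s * (\<Sum>g\<in>carrier G. f g))) > 1 - \<epsilon>"
    "cz (e - (\<Sum>g\<in>carrier G. f g)) s"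
  using assms unfolding rokhlin_family_def by simp_all

text \<open>Collects what the argument uses of the crossed product: \<open>S\<close> is the copy of
  \<open>A\<close>, \<open>u\<close> the unitary representation, \<open>expect\<close> the faithful
  conditional expectation onto \<open>S\<close> read off at the identity, and \<open>simple\<close>
  the simplicity of \<open>A\<close>.\<close>

locale rokhlin_alg = group G for G :: "('g, 'b) monoid_scheme" (structure) +
  fixes e :: "'v::cstar" and S :: "'v set" and u :: "'g \<Rightarrow> 'v"
  assumes finG: "finite (carrier G)"
    and e_comm: "\<And>x. e * x = x * e" and e_e [simp]: "e * e = e" and adj_e [simp]: "adj e = e"
    and closed_S: "closed S" and e_S [simp]: "e \<in> S"
    and S_add: "\<And>x y. x \<in> S \<Longrightarrow> y \<in> S \<Longrightarrow> x + y \<in> S" and S_mult: "\<And>x y. x \<in> S \<Longrightarrow> y \<in> S \<Longrightarrow> x * y \<in> S"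
    and S_adj: "\<And>x. x \<in> S \<Longrightarrow> adj x \<in> S" and S_sc: "\<And>c x. x \<in> S \<Longrightarrow> sc c * x \<in> S"
    and S_e: "\<And>x. x \<in> S \<Longrightarrow> e * x = x"
    and u_e: "\<And>g. g \<in> carrier G \<Longrightarrow> e * u g = u g"
    and u_mult: "\<And>g h. g \<in> carrier G \<Longrightarrow> h \<in> carrier G \<Longrightarrow> u g * u h = u (g \<otimes> h)"
    and u_one [simp]: "u \<one> = e" and adj_u: "\<And>g. g \<in> carrier G \<Longrightarrow> adj (u g) = u (inv g)"
    and u_conj: "\<And>g x. g \<in> carrier G \<Longrightarrow> x \<in> S \<Longrightarrow> u g * x * adj (u g) \<in> S"
    and coeffs: "\<And>x. e * x = x \<Longrightarrow> \<exists>y. (\<forall>g\<in>carrier G. y g \<in> S) \<and> x = (\<Sum>g\<in>carrier G. y g * u g)"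
    and expect: "\<And>s. e * s = s \<Longrightarrow> pos s \<Longrightarrow> s \<noteq> 0 \<Longrightarrow> 
       \<exists>y. (\<forall>g\<in>carrier G. y g \<in> S) \<and> s = (\<Sum>g\<in>carrier G. y g * u g) \<and> pos (y \<one>) \<and> y \<one> \<noteq> 0"
    and simple: "\<And>I. I \<subseteq> S \<Longrightarrow> closed I \<Longrightarrow> 0 \<in> I \<Longrightarrow> (\<And>x y. x \<in> I \<Longrightarrow> y \<in> I \<Longrightarrow> x + y \<in> I) \<Longrightarrow>
       (\<And>c x. x \<in> I \<Longrightarrow> sc c * x \<in> I) \<Longrightarrow>
       (\<And>x y. x \<in> I \<Longrightarrow> y \<in> S \<Longrightarrow> x * y \<in> I \<and> y * x \<in> I) \<Longrightarrow> \<exists>x\<in>I. x \<noteq> 0 \<Longrightarrow> e \<in> I"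
    and rokhlin: "\<And>F \<epsilon> s. finite F \<Longrightarrow> F \<subseteq> S \<Longrightarrow> \<epsilon> > 0 \<Longrightarrow> s \<in> S \<Longrightarrow> pos s \<Longrightarrow> norm s = 1 \<Longrightarrow>
       \<exists>f. rokhlin_family G e S u F \<epsilon> s f"
begin

lemma S_scaleR: "x \<in> S \<Longrightarrow> r *\<^sub>R x \<in> S"
  using S_sc[of x "complex_of_real r"] by (simp add: sc_of_real scaleR_conv_of_real)

lemma S_0 [simp]: "0 \<in> S"
  using S_scaleR[OF e_S, of 0] by simp

lemma S_fc: "cont \<phi> \<Longrightarrow> adj a = a \<Longrightarrow> \<phi> 0 = 0 \<Longrightarrow> a \<in> S \<Longrightarrow> fc \<phi> a \<in> S"
  by (rule fc_mem[OF _ _ _ closed_S]) (auto intro: S_add S_mult S_scaleR)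

lemma S_sum: "(\<And>i. i \<in> I \<Longrightarrow> f i \<in> S) \<Longrightarrow> sum f I \<in> S"
  by (induction I rule: infinite_finite_induct) (auto intro: S_add)

lemma norm_e_le: "norm e \<le> 1"
proof -
  have "norm e * norm e = norm e" using cstar_norm[of e] by (simp add: power2_eq_square)
  then show ?thesis by (cases "norm e = 0") auto
qed

lemma adj_u_u [simp]: "g \<in> carrier G \<Longrightarrow> adj (u g) * u g = e"
  by (simp add: adj_u u_mult)

lemma u_adj_u [simp]: "g \<in> carrier G \<Longrightarrow> u g * adj (u g) = e"
  by (simp add: adj_u u_mult)

lemma norm_u_le: "g \<in> carrier G \<Longrightarrow> norm (u g) \<le> 1"
  using cstar_norm[of "u g"] norm_e_le power2_le_imp_le[of "norm (u g)" 1] by simp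

lemma norm_mult_u_le: "g \<in> carrier G \<Longrightarrow> norm (x * u g) \<le> norm x" "g \<in> carrier G \<Longrightarrow> norm (u g * x) \<le> norm x"
  "g \<in> carrier G \<Longrightarrow> norm (x * adj (u g)) \<le> norm x"  "g \<in> carrier G \<Longrightarrow> norm (adj (u g) * x) \<le> norm x"
proof -
  assume g: "g \<in> carrier G"
  have r: "norm (x * w) \<le> norm x" if "norm w \<le> 1" for w
    using that by (intro order_trans[OF norm_mult_ineq]) (simp add: mult_left_le)
  have l: "norm (w * x) \<le> norm x" if "norm w \<le> 1" for w
    using that by (intro order_trans[OF norm_mult_ineq]) (simp add: mult_left_le_one_le)
  show "norm (x * u g) \<le> norm x" "norm (x * adj (u g)) \<le> norm x" "norm (u g * x) \<le> norm x" "norm (adj (u g) * x) \<le> norm x"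
    using norm_u_le[OF g] by (auto intro: l r)
qed

lemma card_pos: "card (carrier G) > 0"
  using finG one_closed by (auto simp: card_gt_0_iff)

text \<open>Compression by \<open>f g\<close> nearly kills the coefficients of \<open>s\<close> off
  the identity, because \<open>u k * f g\<close> is close to \<open>f (k \<otimes> g) * u k\<close>
  and \<open>f g * f (k \<otimes> g) = 0\<close>. So \<open>f g * s * f g\<close> is close to an
  element of \<open>S\<close>, whose cut-off lies below \<open>s\<close>. The norm condition on
  Rokhlin elements keeps it nonzero for a suitable \<open>g\<close>.\<close>

lemma nonzero_below:
  assumes s: "e * s = s" "pos s" "s \<noteq> 0"
  shows "\<exists>s0\<in>S. pos s0 \<and> s0 \<noteq> 0 \<and> cz s0 s"
proof -
  obtain y where y: "\<And>g. g \<in> carrier G \<Longrightarrow> y g \<in> S" "s = (\<Sum>g\<in>carrier G. y g * u g)" "pos (y \<one>)" "y \<one> \<noteq> 0"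
    using expect[OF s] by blast
  define N where "N = norm (y \<one>)"
  define T where "T = (\<Sum>g\<in>carrier G. norm (y g))"
  define n where "n = real (card (carrier G))"
  have N: "N > 0" using y(4) by (simp add: N_def)
  have T: "T \<ge> 0" "\<And>g. g \<in> carrier G \<Longrightarrow> norm (y g) \<le> T"
    unfolding T_def using finG by (auto intro: sum_nonneg member_le_sum)
  have n: "n \<ge> 1" using card_pos by (simp add: n_def)
  \<comment> \<open>If all \<open>n\<close> diagonal compressions had norm at most
    \<open>4 * \<delta>\<close>, they would add up to at most \<open>N / 2\<close> and the
    off-diagonal ones to \<open>N / 4\<close>, contradicting the lower bound
    \<open>(1 - \<epsilon>) * N\<close>.\<close>
  define \<delta> where "\<delta> = N / (8 * n)"
  define \<epsilon> where "\<epsilon> = min (1/4) (min (\<delta> / (n * (1 + T))) (N / (4 * n * n)))"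
  have \<delta>: "\<delta> > 0" using N n by (simp add: \<delta>_def)
  have \<epsilon>: "\<epsilon> > 0" "\<epsilon> \<le> 1/4" "\<epsilon> \<le> \<delta> / (n * (1 + T))" "\<epsilon> \<le> N / (4 * n * n)"
  proof -
    show "\<epsilon> > 0" using N n T(1) \<delta> by (simp add: \<epsilon>_def)
    show "\<epsilon> \<le> 1/4" unfolding \<epsilon>_def by (rule min.cobounded1)
    show "\<epsilon> \<le> \<delta> / (n * (1 + T))" "\<epsilon> \<le> N / (4 * n * n)"
      unfolding \<epsilon>_def by (meson min.cobounded1 min.cobounded2 order_trans)+
  qed
  have "norm ((1 / N) *\<^sub>R y \<one>) = 1" using N by (simp add: N_def)
  moreover have "pos ((1 / N) *\<^sub>R y \<one>)" using N by (intro pos_scaleR y) simp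
  moreover have "finite (y ` carrier G)" "y ` carrier G \<subseteq> S" using finG y(1) by auto
  moreover have "(1 / N) *\<^sub>R y \<one> \<in> S" by (rule S_scaleR[OF y(1)[OF one_closed]])
  ultimately obtain f where "rokhlin_family G e S u (y ` carrier G) \<epsilon> ((1 / N) *\<^sub>R y \<one>) f"
    using rokhlin \<epsilon>(1) by presburger
  note f = rokhlin_familyD[OF this]
  have fle: "norm (f g * z) \<le> norm z" "norm (z * f g) \<le> norm z" if "g \<in> carrier G" for g z
    using f(1)[OF that] order_trans[OF norm_mult_ineq[of "f g" z]] order_trans[OF norm_mult_ineq[of z "f g"]]
      mult_right_mono[of "norm (f g)" 1 "norm z"] mult_left_mono[of "norm (f g)" 1 "norm z"] by auto
  define f0 where "f0 = (\<Sum>g\<in>carrier G. f g)"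
  have "\<exists>g\<in>carrier G. norm (f g * y \<one> * f g) \<ge> 4 * \<delta>"
  proof (rule ccontr)
    assume "\<not> ?thesis"
    then have lt: "norm (f g * y \<one> * f g) \<le> 4 * \<delta>" if "g \<in> carrier G" for g using that by force
    have off: "norm (f g * y \<one> * f h) \<le> \<epsilon>" if "g \<in> carrier G" "h \<in> carrier G" "g \<noteq> h" for g h
    proof -
      have "f g * y \<one> * f h = (f g * y \<one> - y \<one> * f g) * f h"
        using f(2)[OF that] by (simp add: left_diff_distrib mult.assoc)
      also have "norm \<dots> \<le> norm (f g * y \<one> - y \<one> * f g)" by (rule fle[OF that(2)])
      also have "\<dots> \<le> \<epsilon>" using f(3)[of "y \<one>" g] that by (simp add: less_imp_le)
      finally show ?thesis .
    qed
    have entry: "norm (f g * y \<one> * f h) \<le> (if g = h then 4 * \<delta> else 0) + \<epsilon>" if "g \<in> carrier G" "h \<in> carrier G" for g h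
      using lt[OF that(1)] off[OF that] \<epsilon>(1) by auto
    have "f0 * y \<one> * f0 = (\<Sum>g\<in>carrier G. \<Sum>h\<in>carrier G. f g * y \<one> * f h)"
      unfolding f0_def sum_distrib_left sum_distrib_right by (rule sum.swap)
    then have "norm (f0 * y \<one> * f0) \<le> (\<Sum>g\<in>carrier G. \<Sum>h\<in>carrier G. (if g = h then 4 * \<delta> else 0) + \<epsilon>)"
      by (auto intro!: order_trans[OF norm_sum] sum_mono entry)
    also have "\<dots> = n * (4 * \<delta>) + n * n * \<epsilon>"
      using finG by (simp add: sum.distrib n_def distrib_left)
    also have "n * (4 * \<delta>) = N / 2" using n by (simp add: \<delta>_def field_simps)
    also have "n * n * \<epsilon> \<le> n * n * (N / (4 * n * n))" using \<epsilon>(4) n by (intro mult_left_mono) auto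
    also have "\<dots> = N / 4" using n by simp
    finally have 1: "norm (f0 * y \<one> * f0) \<le> 3/4 * N" by simp
    have "f0 * (((1 / N) *\<^sub>R y \<one>) * f0) = (1 / N) *\<^sub>R (f0 * y \<one> * f0)" by (simp add: mult.assoc)
    then have "1 - \<epsilon> < norm (f0 * y \<one> * f0) / N" using f(5) N by (simp add: f0_def[symmetric])
    then have "(1 - \<epsilon>) * N < norm (f0 * y \<one> * f0)" using N by (simp add: pos_less_divide_eq)
    moreover have "(1 - \<epsilon>) * N \<ge> 3/4 * N" using \<epsilon>(2) N by (intro mult_right_mono) auto
    ultimately show False using 1 by linarith
  qed
  then obtain g where g: "g \<in> carrier G" "norm (f g * y \<one> * f g) \<ge> 4 * \<delta>" by blast
  define p where "p = f g * y \<one> * f g"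
  define b where "b = f g * s * f g"
  have sf: "adj (f g) = f g" using f(1)[OF g(1)] pos_sa by blast
  have pp: "pos p" and pb: "pos b" unfolding p_def b_def by (auto intro!: pos_conj_sa sf y s)
  have pS: "p \<in> S" unfolding p_def using f(1)[OF g(1)] y(1) by (auto intro!: S_mult)
  have "b - p = (\<Sum>k\<in>carrier G. f g * (y k * u k) * f g) - p" by (simp add: b_def y(2) sum_distrib_left sum_distrib_right)
  also have "\<dots> = (\<Sum>k\<in>carrier G - {\<one>}. f g * (y k * u k) * f g)"
  proof -
    have "f g * (y \<one> * u \<one>) * f g = p" using S_e[OF y(1)[OF one_closed]] by (simp add: p_def e_comm[symmetric])
    then show ?thesis using sum.remove[OF finG one_closed, of "\<lambda>k. f g * (y k * u k) * f g"] by simp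
  qed
  also have "norm \<dots> \<le> (\<Sum>k\<in>carrier G - {\<one>}. \<epsilon> + T * \<epsilon>)"
  proof (rule order_trans[OF norm_sum sum_mono])
    fix k assume k: "k \<in> carrier G - {\<one>}"
    then have kG: "k \<in> carrier G" and kg: "k \<otimes> g \<in> carrier G" "k \<otimes> g \<noteq> g" using g(1) r_cancel_one' by auto
    have fu: "u k * f g = (u k * f g * adj (u k)) * u k"
    proof -
      have "u k * f g * adj (u k) * u k = u k * (f g * (adj (u k) * u k))" by (simp only: mult.assoc)
      also have "\<dots> = u k * f g" using kG S_e f(1)[OF g(1)] by (simp add: e_comm[symmetric])
      finally show ?thesis by simp
    qed
    have z: "f g * f (k \<otimes> g) = 0" by (rule f(2)[OF g(1) kg(1)]) (use kg in auto)
    let ?D = "u k * f g * adj (u k) - f (k \<otimes> g)"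
    have "f g * (y k * u k) * f g = (f g * y k - y k * f g) * (u k * f g) + y k * (f g * (u k * f g))"
      by (simp add: algebra_simps)
    also have "f g * (u k * f g) = f g * ?D * u k + f g * f (k \<otimes> g) * u k"
      by (subst fu) (simp add: algebra_simps)
    also have "\<dots> = f g * (?D * u k)" by (simp add: z mult.assoc)
    \<comment> \<open>Both summands are small: \<open>f g\<close> almost commutes with
      \<open>y k\<close>, and \<open>?D\<close> is the defect of covariance.\<close>
    finally have eq: "f g * (y k * u k) * f g = (f g * y k - y k * f g) * (u k * f g) + y k * (f g * (?D * u k))" .
    have n1: "norm ((f g * y k - y k * f g) * (u k * f g)) \<le> \<epsilon>"
    proof -
      have "norm ((f g * y k - y k * f g) * (u k * f g)) = norm ((f g * y k - y k * f g) * u k * f g)" by (simp only: mult.assoc)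
      also have "\<dots> \<le> norm ((f g * y k - y k * f g) * u k)" by (rule fle[OF g(1)])
      also have "\<dots> \<le> norm (f g * y k - y k * f g)" by (rule norm_mult_u_le[OF kG])
      finally show ?thesis using f(3)[of "y k" g] kG g(1) by fastforce
    qed
    have n2: "norm (y k * (f g * (?D * u k))) \<le> T * \<epsilon>"
    proof (rule order_trans[OF norm_mult_ineq mult_mono[OF T(2)[OF kG]]])
      have "norm (f g * (?D * u k)) \<le> norm (?D * u k)" by (rule fle[OF g(1)])
      also have "\<dots> \<le> norm ?D" by (rule norm_mult_u_le[OF kG])
      also have "\<dots> \<le> \<epsilon>" using f(4)[OF kG g(1)] by simp
      finally show "norm (f g * (?D * u k)) \<le> \<epsilon>" .
    qed (use T in auto)
    show "norm (f g * (y k * u k) * f g) \<le> \<epsilon> + T * \<epsilon>"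
      unfolding eq by (rule order_trans[OF norm_triangle_ineq add_mono[OF n1 n2]])
  qed
  also have "\<dots> \<le> n * (\<epsilon> + T * \<epsilon>)"
  proof -
    have "card (carrier G - {\<one>}) \<le> card (carrier G)" by (intro card_mono finG) auto
    then show ?thesis unfolding sum_constant n_def using \<epsilon>(1) T by (intro mult_right_mono) auto
  qed
  also have "\<dots> = (n * (1 + T)) * \<epsilon>" by (simp add: algebra_simps)
  also have "\<dots> \<le> \<delta>" using \<epsilon>(3) n T by (simp add: pos_le_divide_eq mult.commute add_pos_nonneg)
  finally have near: "norm (p - b) \<le> \<delta>" by (simp add: norm_minus_commute)
  \<comment> \<open>The compression has norm at least \<open>4 * \<delta>\<close>, so its cut-off at
    \<open>2 * \<delta>\<close> is nonzero.\<close>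
  let ?s = "fc (\<lambda>t. max (t - 2 * \<delta>) 0) p"
  have cc: "cont (\<lambda>t. max (t - 2 * \<delta>) 0)" by (intro continuous_intros)
  have "cz b s" using cz_conj[of "f g" s] by (simp add: b_def sf)
  then have "cz ?s s" by (rule cz_trans[OF cz_cutoff[OF pp pb \<delta> near]])
  moreover have "?s \<noteq> 0" by (rule fc_cutoff_nonzero[OF pp]) (use \<delta> g(2) in \<open>auto simp: p_def[symmetric]\<close>)
  moreover have "?s \<in> S" by (rule S_fc[OF cc pos_sa[OF pp] _ pS]) (use \<delta> in simp)
  moreover have "pos ?s" by (rule fc_pos[OF cc btw_pos[OF pp order_refl]]) simp
  ultimately show ?thesis by blast
qed

section \<open>Ideals of the crossed product and detection of norms\<close>

text \<open>The algebraic two-sided ideal generated by \<open>b\<close>. Right factors are taken in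
  the corner of \<open>e\<close>, because they later join the finite set with which \<open>d\<close>
  has to commute approximately.\<close>

inductive idl :: "'v \<Rightarrow> 'v \<Rightarrow> bool" for b where
  idl_0: "idl b 0"
| idl_step: "idl b x \<Longrightarrow> e * r = r \<Longrightarrow> idl b (x + l * b * r)"

lemma idl_add: "idl b y \<Longrightarrow> idl b x \<Longrightarrow> idl b (x + y)"
  by (induction rule: idl.induct) (auto simp: idl_step simp flip: add.assoc)

lemma idl_mult: "idl b x \<Longrightarrow> idl b (z * x)" "idl b x \<Longrightarrow> idl b (x * z)"
proof -
  show "idl b x \<Longrightarrow> idl b (z * x)"
  proof (induction rule: idl.induct)
    case (idl_step x r l)
    have "idl b (z * x + (z * l) * b * r)" by (rule idl.idl_step) (use idl_step in auto)
    then show ?case by (simp add: distrib_left mult.assoc)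
  qed (simp add: idl_0)
  show "idl b x \<Longrightarrow> idl b (x * z)"
  proof (induction rule: idl.induct)
    case (idl_step x r l)
    have "idl b (x * z + l * b * (r * z))" by (rule idl.idl_step) (use idl_step in \<open>auto simp flip: mult.assoc\<close>)
    then show ?case by (simp add: distrib_right mult.assoc)
  qed (simp add: idl_0)
qed

text \<open>The closed ideal contains everything Cuntz below \<open>b\<close>, in particular a
  nonzero element of \<open>S\<close>; simplicity of \<open>A\<close> then puts the unit into it. In
  effect this is simplicity of the crossed product.\<close>

lemma e_in_closure_idl:
  assumes b: "e * b = b" "pos b" "b \<noteq> 0"
  shows "e \<in> closure (Collect (idl b))"
proof -
  let ?J = "closure (Collect (idl b))"
  obtain s0 where s0: "s0 \<in> S" "s0 \<noteq> 0" "cz s0 b" using nonzero_below[OF b] by blast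
  have J_add: "x + y \<in> ?J" if xy: "x \<in> ?J" "y \<in> ?J" for x y
  proof -
    obtain X Y where "\<And>n. idl b (X n)" "X \<longlonglongrightarrow> x" "\<And>n. idl b (Y n)" "Y \<longlonglongrightarrow> y"
      using xy unfolding closure_sequential by auto
    then have "\<And>n. idl b (X n + Y n)" "(\<lambda>n. X n + Y n) \<longlonglongrightarrow> x + y" by (auto intro: idl_add tendsto_add)
    then show ?thesis unfolding closure_sequential by (intro exI[of _ "\<lambda>n. X n + Y n"]) auto
  qed
  have J_mult: "z * x \<in> ?J" "x * z \<in> ?J" if x: "x \<in> ?J" for x z
  proof -
    obtain X where X: "\<And>n. idl b (X n)" "X \<longlonglongrightarrow> x" using x unfolding closure_sequential by auto
    have "(\<lambda>n. z * X n) \<longlonglongrightarrow> z * x" "(\<lambda>n. X n * z) \<longlonglongrightarrow> x * z" by (intro tendsto_intros X)+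
    then show "z * x \<in> ?J" "x * z \<in> ?J" unfolding closure_sequential
      using X(1) idl_mult by (auto intro: exI[of _ "\<lambda>n. z * X n"] exI[of _ "\<lambda>n. X n * z"])
  qed
  have "s0 \<in> ?J" unfolding closure_approachable
  proof (intro allI impI)
    fix \<eta> :: real assume "\<eta> > 0"
    then obtain r where r: "norm (s0 - adj r * b * r) < \<eta>" using s0(3) unfolding cz_def by blast
    have "idl b (0 + adj r * b * (e * r))" by (rule idl_step[OF idl_0]) (simp flip: mult.assoc)
    moreover have "adj r * b * (e * r) = adj r * b * r"
    proof -
      have "adj r * b * (e * r) = adj r * (b * e) * r" by (simp only: mult.assoc)
      then show ?thesis by (simp only: e_comm[symmetric] b)
    qed
    ultimately have "idl b (adj r * b * r)" by simp
    then show "\<exists>y\<in>Collect (idl b). dist y s0 < \<eta>" using r by (auto simp: dist_norm norm_minus_commute)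
  qed
  have "e \<in> S \<inter> ?J"
  proof (rule simple)
    show "closed (S \<inter> ?J)" using closed_S by auto
    have "0 \<in> ?J" by (rule closure_subset[THEN subsetD]) (simp add: idl_0)
    then show "0 \<in> S \<inter> ?J" by simp
    show "\<exists>x\<in>S \<inter> ?J. x \<noteq> 0" using s0 \<open>s0 \<in> ?J\<close> by blast
  qed (auto intro: S_add J_add J_mult S_mult S_sc)
  then show ?thesis by simp
qed

text \<open>In \<open>l * b * r * h\<close> the factor \<open>h\<close> is moved past
  \<open>r\<close> at small cost and then meets \<open>b\<close>. So an \<open>h\<close> that almost
  annihilates \<open>b\<close> on the right almost annihilates each fixed element of the ideal, with
  constants independent of \<open>h\<close>.\<close>

lemma idl_detect:
  assumes "idl b y"
  shows "\<exists>C R. C \<ge> 0 \<and> finite R \<and> (\<forall>r\<in>R. e * r = r) \<and>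
    (\<forall>h \<delta>. \<delta> \<ge> 0 \<longrightarrow> (\<forall>r\<in>R. norm (h * r - r * h) \<le> \<delta>) \<longrightarrow> norm (y * h) \<le> C * norm (b * h) + C * \<delta>)"
  using assms
proof (induction rule: idl.induct)
  case idl_0
  show ?case by (intro exI[of _ 0] exI[of _ "{}"]) auto
next
  case (idl_step x r l)
  then obtain C R where C: "C \<ge> 0" "finite R" "\<forall>r\<in>R. e * r = r"
    "\<And>h \<delta>. \<delta> \<ge> 0 \<Longrightarrow> (\<forall>r\<in>R. norm (h * r - r * h) \<le> \<delta>) \<Longrightarrow> norm (x * h) \<le> C * norm (b * h) + C * \<delta>" by blast
  define C' where "C' = C + norm l * norm r + norm (l * b)"
  have "norm ((x + l * b * r) * h) \<le> C' * norm (b * h) + C' * \<delta>"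
    if d: "\<delta> \<ge> 0" "\<forall>r\<in>insert r R. norm (h * r - r * h) \<le> \<delta>" for h \<delta>
  proof -
    have "(x + l * b * r) * h = x * h + (l * (b * h) * r - l * b * (h * r - r * h))"
      by (simp add: algebra_simps)
    also have "norm \<dots> \<le> norm (x * h) + (norm l * norm (b * h) * norm r + norm (l * b) * norm (h * r - r * h))"
      by (intro order_trans[OF norm_triangle_ineq] add_mono order_refl order_trans[OF norm_triangle_ineq4] norm_mult_ineq
        order_trans[OF norm_mult_ineq] mult_right_mono) auto
    also have "\<dots> \<le> (C * norm (b * h) + C * \<delta>) + (norm l * norm (b * h) * norm r + norm (l * b) * \<delta>)"
      using d by (intro add_mono order_refl C(4) mult_left_mono) auto
    also have "\<dots> \<le> C' * norm (b * h) + C' * \<delta>"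
    proof -
      have "0 \<le> norm (l * b) * norm (b * h)" "0 \<le> norm l * norm r * \<delta>" using d by auto
      then show ?thesis by (simp add: C'_def algebra_simps)
    qed
    finally show ?thesis .
  qed
  then show ?case using C(1-3) idl_step by (intro exI[of _ C'] exI[of _ "insert r R"]) (auto simp: C'_def)
qed

end

text \<open>The pointwise inequality orders the squares of the two functions of \<open>a\<close>,
  and conjugation by \<open>w\<close> preserves that order.\<close>

lemma norm_fc_mult_mono:
  assumes c: "cont \<phi>" "cont \<psi>" and btw: "btw m a M" and le: "\<And>t. m \<le> t \<Longrightarrow> t \<le> M \<Longrightarrow> \<bar>\<phi> t\<bar> \<le> \<bar>\<psi> t\<bar>"
  shows "norm (fc \<phi> a * w) \<le> norm (fc \<psi> a * (w :: 'a::cstar))"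
proof -
  note sa = btw_sa[OF btw]
  have s: "adj (fc \<phi> a) = fc \<phi> a" "adj (fc \<psi> a) = fc \<psi> a" by (intro adj_fc c sa)+
  have c2: "cont (\<lambda>t. \<psi> t * \<psi> t)" "cont (\<lambda>t. \<phi> t * \<phi> t)" by (intro continuous_intros c)+
  have "pos (fc (\<lambda>t. \<psi> t * \<psi> t - \<phi> t * \<phi> t) a)"
    by (rule fc_pos[OF continuous_on_diff[OF c2] btw]) (use le in \<open>simp add: abs_le_square_iff power2_eq_square\<close>)
  then have "pos (fc \<psi> a * fc \<psi> a - fc \<phi> a * fc \<phi> a)" by (simp add: fc_diff c2 sa fc_mult c)
  then have "pos (adj w * (fc \<psi> a * fc \<psi> a - fc \<phi> a * fc \<phi> a) * w)" by (rule pos_conj)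
  then have "pos (adj (fc \<psi> a * w) * (fc \<psi> a * w) - adj (fc \<phi> a * w) * (fc \<phi> a * w))"
    by (simp add: adj_mult s left_diff_distrib right_diff_distrib mult.assoc)
  then have "(norm (fc \<phi> a * w))\<^sup>2 \<le> (norm (fc \<psi> a * w))\<^sup>2"
    using pos_mono_norm[OF pos_adj_mult, of "fc \<psi> a * w" "fc \<phi> a * w"] pos_mono_norm[OF pos_adj_mult] by (metis cstar_norm)
  then show ?thesis by (rule power2_le_imp_le) simp
qed

context rokhlin_alg begin

text \<open>Norms are detected as follows: \<open>b\<close> lives where \<open>x\<^sup>* x\<close> is almost \<open>\<parallel>x\<parallel>\<^sup>2\<close>, \<open>h\<close> where \<open>d\<close> is
  almost \<open>1\<close>, and since the ideal generated by \<open>b\<close> contains the unit, \<open>b h\<close> is bounded below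
  for all approximately central \<open>d\<close>.\<close>
lemma norm_detect:
  assumes x: "e * x = x" and eps: "\<epsilon> > 0"
  shows "\<exists>Y \<delta>. finite Y \<and> (\<forall>y\<in>Y. e * y = y) \<and> \<delta> > 0 \<and>
    (\<forall>d. pos d \<longrightarrow> norm d \<le> 1 \<longrightarrow> e * d = d \<longrightarrow> norm d > 1 - \<delta> \<longrightarrow>
      (\<forall>y\<in>Y. norm (d * y - y * d) < \<delta>) \<longrightarrow> norm (d * (x * d)) > norm x - \<epsilon>)"
proof (cases "x = 0")
  case True
  then show ?thesis using eps by (intro exI[of _ "{}"] exI[of _ 1]) auto
next
  case False
  define N where "N = norm x"
  have N: "N > 0" using False by (simp add: N_def)
  \<comment> \<open>At the end a relative loss of \<open>5 * \<theta>\<close> is incurred, from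
    \<open>\<kappa>\<close> and from the square of \<open>1 - 2 * \<theta>\<close>; times
    \<open>N\<close> it must stay well below \<open>\<epsilon>\<close>.\<close>
  define \<theta> where "\<theta> = min (1/4) (\<epsilon> / (16 * N))"
  have \<theta>: "\<theta> > 0" "\<theta> \<le> 1/4" using N eps by (simp_all add: \<theta>_def)
  have "\<theta> \<le> \<epsilon> / (16 * N)" unfolding \<theta>_def by (rule min.cobounded2)
  then have \<theta>N: "N * \<theta> \<le> \<epsilon> / 16" using N by (simp add: pos_le_divide_eq ac_simps)
  define \<kappa> where "\<kappa> = N * (1 - \<theta>)"
  have \<kappa>: "\<kappa> \<ge> 0" "\<kappa> < N" using N \<theta> by (auto simp: \<kappa>_def)
  define X where "X = adj x * x"
  have pX: "pos X" unfolding X_def by (rule pos_adj_mult)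
  note sX = pos_sa[OF pX]
  have eX: "e * X = X"
  proof -
    have "adj (e * x) = adj x" using x by simp
    then have "adj x * e = adj x" by (simp add: adj_mult)
    then have "e * adj x = adj x" by (simp only: e_comm)
    then show ?thesis by (simp add: X_def flip: mult.assoc)
  qed
  have nX: "norm X = N\<^sup>2" by (simp add: X_def cstar_norm N_def)
  let ?\<beta> = "\<lambda>t. max (t - \<kappa>\<^sup>2) 0"
  have c\<beta>: "cont ?\<beta>" by (intro continuous_intros)
  define b where "b = fc ?\<beta> X"
  have pb: "pos b" unfolding b_def by (rule fc_pos[OF c\<beta> btw_pos[OF pX order_refl]]) simp
  note sb = pos_sa[OF pb]
  have eb: "e * b = b" unfolding b_def by (rule fc_corner[OF c\<beta> sX _ eX]) simp
  have "\<kappa>\<^sup>2 < N\<^sup>2" using \<kappa> by (intro power_strict_mono) auto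
  then have b0: "b \<noteq> 0" unfolding b_def by (intro fc_cutoff_nonzero[OF pX]) (simp_all add: nX)
  have xb: "\<kappa> * norm (b * w) \<le> norm (x * b * w)" for w
    unfolding b_def X_def
  proof (rule fc_lower_mult[OF _ c\<beta> \<kappa>(1)])
    fix t :: real assume "0 \<le> t"
    show "?\<beta> t * ?\<beta> t * t \<ge> \<kappa>\<^sup>2 * (?\<beta> t * ?\<beta> t)"
      by (cases "t \<le> \<kappa>\<^sup>2") (auto simp: mult.commute intro!: mult_right_mono)
  qed
  obtain y where y: "idl b y" "norm (e - y) < 1/2"
    using e_in_closure_idl[OF eb pb b0] unfolding closure_approachable dist_norm
    by (auto simp: norm_minus_commute dest: spec[of _ "1/2"])
  obtain C R where C: "C \<ge> 0" "finite R" "\<forall>r\<in>R. e * r = r"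
    "\<And>h \<delta>. \<delta> \<ge> 0 \<Longrightarrow> (\<forall>r\<in>R. norm (h * r - r * h) \<le> \<delta>) \<Longrightarrow> norm (y * h) \<le> C * norm (b * h) + C * \<delta>"
    using idl_detect[OF y(1)] by blast
  define c1 where "c1 = 1 / (8 * (C + 1))"
  have c1: "c1 > 0" "C * c1 \<le> 1/8" using C(1) by (auto simp: c1_def field_simps)
  define R0 where "R0 = 1 + (\<Sum>r\<in>R. norm r)"
  have R0: "1 \<le> R0" by (simp add: R0_def sum_nonneg)
  have R0': "norm r \<le> R0" if "r \<in> R" for r
    using member_le_sum[OF that _ C(2), of norm] by (simp add: R0_def)
  \<comment> \<open>Supported where \<open>t\<close> exceeds \<open>1 - 2 * \<theta>\<close> and
    equal to 1 at 1: a continuous stand-in for the spectral projection of \<open>d\<close> near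
    1.\<close>
  let ?h = "\<lambda>t. max (t - (1 - 2 * \<theta>)) 0 / (2 * \<theta>)"
  have ch: "cont ?h" by (intro continuous_intros) (use \<theta> in auto)
  obtain dI where dI: "dI > 0" "\<And>a b x::'v. adj a = a \<Longrightarrow> adj b = b \<Longrightarrow> norm a \<le> R0 \<Longrightarrow> norm b \<le> R0 \<Longrightarrow> norm x \<le> R0 \<Longrightarrow>
     norm (a * x - x * b) < dI \<Longrightarrow> norm (fc ?h a * x - x * fc ?h b) < c1"
    using fc_intertwine_approx[OF ch c1(1), of R0, where ?'a='v] by blast
  \<comment> \<open>The last bound contains \<open>c1\<close> because the commutator error is
    eventually divided by \<open>norm (b * h)\<close>, of which only the lower bound
    \<open>c1\<close> is known.\<close>
  define \<delta> where "\<delta> = min (min \<theta> dI) (min (\<epsilon> / 8) (c1 * \<epsilon> / (16 * N)))"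
  have \<delta>: "\<delta> > 0" "\<delta> \<le> \<theta>" "\<delta> \<le> dI" "\<delta> \<le> \<epsilon> / 8" "\<delta> \<le> c1 * \<epsilon> / (16 * N)"
    using \<theta> dI(1) eps c1 N unfolding \<delta>_def by (auto simp: min_le_iff_disj)
  have "norm (d * (x * d)) > norm x - \<epsilon>"
    if d: "pos d" "norm d \<le> 1" "e * d = d" "norm d > 1 - \<delta>" 
      "\<forall>y\<in>insert b (insert x R). norm (d * y - y * d) < \<delta>" for d
  proof -
    note sd = pos_sa[OF d(1)]
    note btw = btw_pos[OF d(1,2)]
    define h where "h = fc ?h d"
    have sh: "adj h = h" unfolding h_def by (rule adj_fc[OF ch sd])
    have eh: "e * h = h" unfolding h_def by (rule fc_corner[OF ch sd _ d(3)]) (use \<theta> in simp)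
    have nh: "norm h \<le> 1" unfolding h_def
      by (rule fc_norm_le[OF ch btw]) (use \<theta> in auto)
    \<comment> \<open>Pointwise \<open>t \<le> (1 - 2 * \<theta>) + 2 * \<theta> * ?h t\<close>, so
      a norm of \<open>d\<close> above \<open>1 - \<theta>\<close> forces the norm of
      \<open>h\<close> above one half.\<close>
    have h_low: "norm h \<ge> 1/2"
    proof -
      have eq: "fc (\<lambda>t. ((1 - 2 * \<theta>) + 2 * \<theta> * ?h t) - t) d = (of_real (1 - 2 * \<theta>) + of_real (2 * \<theta>) * h) - d"
      proof -
        have c1': "cont (\<lambda>t. 2 * \<theta> * ?h t)" by (rule continuous_on_mult[OF continuous_on_const ch])
        have "fc (\<lambda>t. ((1 - 2 * \<theta>) + 2 * \<theta> * ?h t) - t) d = fc (\<lambda>t. (1 - 2 * \<theta>) + 2 * \<theta> * ?h t) d - fc (\<lambda>t. t) d"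
          by (rule fc_diff[OF continuous_on_add[OF continuous_on_const c1'] continuous_on_id sd])
        also have "fc (\<lambda>t. (1 - 2 * \<theta>) + 2 * \<theta> * ?h t) d = fc (\<lambda>t. 1 - 2 * \<theta>) d + fc (\<lambda>t. 2 * \<theta> * ?h t) d"
          by (rule fc_add[OF continuous_on_const c1' sd])
        also have "fc (\<lambda>t. 2 * \<theta> * ?h t) d = of_real (2 * \<theta>) * h" unfolding h_def by (rule fc_cmult[OF ch sd])
        finally show ?thesis by (simp only: fc_const[OF sd] fc_id[OF sd])
      qed
      have "pos (fc (\<lambda>t. ((1 - 2 * \<theta>) + 2 * \<theta> * ?h t) - t) d)"
        by (rule fc_pos[OF _ btw]) (use \<theta> in \<open>auto intro!: continuous_intros\<close>)
      from pos_mono_norm[OF d(1) this[unfolded eq]]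
      have "norm d \<le> norm (of_real (1 - 2 * \<theta>) + of_real (2 * \<theta>) * h)" .
      also have "\<dots> \<le> norm (of_real (1 - 2 * \<theta>) :: 'v) + norm (of_real (2 * \<theta>) * h)" by (rule norm_triangle_ineq)
      also have "\<dots> \<le> (1 - 2 * \<theta>) + 2 * \<theta> * norm h"
        using norm_mult_ineq[of "of_real (2 * \<theta>)" h] \<theta> by (simp del: of_real_mult of_real_diff)
      finally have "1 - \<theta> < (1 - 2 * \<theta>) + 2 * \<theta> * norm h" using d(4) \<delta>(2) by linarith
      then have "\<theta> * 1 < \<theta> * (2 * norm h)" by simp
      then have "1 < 2 * norm h" using \<theta>(1) by (simp only: mult_less_cancel_left_pos)
      then show ?thesis by simp
    qed
    have comm: "\<forall>r\<in>R. norm (h * r - r * h) \<le> c1"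
    proof
      fix r assume r: "r \<in> R"
      have "norm (d * r - r * d) < dI" using d(5) r \<delta>(3) by force
      then show "norm (h * r - r * h) \<le> c1"
        unfolding h_def using dI(2)[OF sd sd _ _ R0'[OF r]] d(2) R0 by simp
    qed
    define q where "q = norm (b * h)"
    \<comment> \<open>As \<open>y\<close> is within one half of the unit, \<open>y * h\<close>
      carries at least half of the norm of \<open>h\<close>, and the ideal estimate bounds it in
      terms of \<open>b * h\<close>.\<close>
    have q: "q \<ge> c1"
    proof -
      have "h = (e - y) * h + y * h" using eh by (simp add: algebra_simps)
      then have "norm h \<le> norm (e - y) * norm h + norm (y * h)"
        using norm_triangle_ineq[of "(e - y) * h" "y * h"] norm_mult_ineq[of "e - y" h] by simp
      also have "\<dots> \<le> (1/2) * norm h + (C * q + C * c1)"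
        using y(2) C(4)[OF less_imp_le[OF c1(1)] comm] unfolding q_def by (intro add_mono mult_right_mono) auto
      finally have "1/8 \<le> C * q" using h_low c1(2) by simp
      also have "\<dots> \<le> (C + 1) * q" by (intro mult_right_mono) (auto simp: q_def)
      finally show ?thesis using C(1) by (simp add: c1_def field_simps)
    qed
    define \<mu> where "\<mu> = 1 - 2 * \<theta>"
    have \<mu>: "\<mu> > 0" using \<theta> by (simp add: \<mu>_def)
    have c2: "cont (\<lambda>t. t * t * ?h t)" by (intro continuous_on_mult continuous_on_id ch)
    have ddh: "fc (\<lambda>t. t * t * ?h t) d = d * d * h"
    proof -
      have "fc (\<lambda>t. (t * t) * ?h t) d = fc (\<lambda>t. t * t) d * fc ?h d"
        by (rule fc_mult[OF continuous_on_mult[OF continuous_on_id continuous_on_id] ch sd])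
      also have "fc (\<lambda>t. t * t) d = d * d" unfolding fc_mult[OF continuous_on_id continuous_on_id sd] fc_id[OF sd] ..
      finally show ?thesis unfolding h_def .
    qed
    have hdd: "h * d * d = d * d * h"
    proof -
      have "h * d = d * h" unfolding h_def by (rule fc_commute[OF ch sd]) simp
      then have "h * d * d = d * (h * d)" by (simp only: mult.assoc)
      also have "\<dots> = d * d * h" by (simp only: \<open>h * d = d * h\<close> mult.assoc)
      finally show ?thesis .
    qed
    have low2: "\<mu>\<^sup>2 * q \<le> norm (b * (d * d * h))"
    proof -
      have "norm (fc (\<lambda>t. \<mu>\<^sup>2 * ?h t) d * b) \<le> norm (fc (\<lambda>t. t * t * ?h t) d * b)"
      proof (rule norm_fc_mult_mono[OF continuous_on_mult[OF continuous_on_const ch] c2 btw])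
        fix t :: real assume t: "0 \<le> t" "t \<le> 1"
        show "\<bar>\<mu>\<^sup>2 * ?h t\<bar> \<le> \<bar>t * t * ?h t\<bar>"
        proof (cases "t \<le> 1 - 2 * \<theta>")
          case False
          then have "\<mu>\<^sup>2 \<le> t * t" using \<mu> by (auto simp: power2_eq_square \<mu>_def intro!: mult_mono)
          then show ?thesis by (simp only: abs_mult) (intro mult_right_mono, auto)
        qed simp
      qed
      also have "fc (\<lambda>t. \<mu>\<^sup>2 * ?h t) d = of_real (\<mu>\<^sup>2) * h" unfolding h_def by (rule fc_cmult[OF ch sd])
      also have "norm (of_real (\<mu>\<^sup>2) * h * b) = \<mu>\<^sup>2 * norm (h * b)" by (simp add: mult.assoc scaleR_conv_of_real[symmetric] del: of_real_power)
      also have "norm (h * b) = q" using norm_adj[of "b * h"] unfolding q_def by (simp add: adj_mult sh sb)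
      also have "norm (fc (\<lambda>t. t * t * ?h t) d * b) = norm (b * (d * d * h))"
        unfolding ddh hdd[symmetric] using norm_adj[of "b * (h * d * d)"] hdd by (simp add: adj_mult sh sb sd mult.assoc)
      finally show ?thesis .
    qed
    have bd: "norm (d * b - b * d) \<le> \<delta>" and xd: "norm (d * x - x * d) \<le> \<delta>" using d(5) by auto
    define Z where "Z = d * (d * b - b * d) + (d * b - b * d) * d"
    have nZ: "norm Z \<le> 2 * \<delta>"
    proof -
      have "norm (d * (d * b - b * d)) \<le> 1 * \<delta>"
        by (rule order_trans[OF norm_mult_ineq mult_mono[OF d(2) bd]]) auto
      moreover have "norm ((d * b - b * d) * d) \<le> \<delta> * 1"
        by (rule order_trans[OF norm_mult_ineq mult_mono[OF bd d(2)]]) (use \<delta>(1) in auto)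
      ultimately
      show ?thesis unfolding Z_def using norm_triangle_ineq[of "d * (d * b - b * d)" "(d * b - b * d) * d"] by linarith
    qed
    have nxZ: "norm (x * Z * h) \<le> N * (2 * \<delta>) * 1"
      by (rule order_trans[OF norm_mult_ineq mult_mono[OF order_trans[OF norm_mult_ineq mult_mono[OF _ nZ]] nh]])
        (use N \<delta>(1) in \<open>auto simp: N_def\<close>)
    \<comment> \<open>The central chain: \<open>x\<close> is bounded below on the range of
      \<open>b\<close> and \<open>d * d\<close> on the support of \<open>h\<close>. Moving both
      factors \<open>d\<close> past \<open>b\<close> leaves \<open>x * d * d\<close> times
      \<open>b * h\<close>, with commutator error \<open>Z\<close>.\<close>
    have "\<kappa> * (\<mu>\<^sup>2 * q) \<le> \<kappa> * norm (b * (d * d * h))" by (intro mult_left_mono low2 \<kappa>)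
    also have "\<dots> \<le> norm (x * b * (d * d * h))" by (rule xb)
    also have "x * b * (d * d * h) = (x * d * d) * (b * h) - x * Z * h"
      by (simp add: Z_def algebra_simps)
    also have "norm \<dots> \<le> norm (x * d * d) * q + N * (2 * \<delta>) * 1"
      unfolding q_def by (rule order_trans[OF norm_triangle_ineq4 add_mono[OF norm_mult_ineq nxZ]])
    finally have "\<kappa> * \<mu>\<^sup>2 * q \<le> norm (x * d * d) * q + 2 * N * \<delta>" by simp
    moreover have "2 * N * \<delta> \<le> (\<epsilon> / 8) * q"
    proof -
      have "2 * N * \<delta> \<le> 2 * N * (c1 * \<epsilon> / (16 * N))" using \<delta>(5) N by (intro mult_left_mono) auto
      also have "\<dots> = (\<epsilon> / 8) * c1" using N by simp
      also have "\<dots> \<le> (\<epsilon> / 8) * q" using q eps by (intro mult_left_mono) auto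
      finally show ?thesis .
    qed
    ultimately have "\<kappa> * \<mu>\<^sup>2 * q \<le> (norm (x * d * d) + \<epsilon> / 8) * q" by (simp add: distrib_right)
    then have "\<kappa> * \<mu>\<^sup>2 \<le> norm (x * d * d) + \<epsilon> / 8" using q c1(1) by (simp only: mult_le_cancel_right_pos)
    also have "norm (x * d * d) \<le> norm (d * (x * d)) + \<delta>"
    proof -
      have "x * d * d = d * (x * d) - (d * x - x * d) * d" by (simp add: algebra_simps)
      also have "norm \<dots> \<le> norm (d * (x * d)) + \<delta> * 1"
        by (rule order_trans[OF norm_triangle_ineq4 add_mono[OF order_refl order_trans[OF norm_mult_ineq mult_mono[OF xd d(2)]]]])
          (use \<delta>(1) in auto)
      finally show ?thesis by simp
    qed
    finally have 1: "\<kappa> * \<mu>\<^sup>2 \<le> norm (d * (x * d)) + \<delta> + \<epsilon> / 8" by simp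
    have "N * (1 - 5 * \<theta>) \<le> N * ((1 - \<theta>) * \<mu>\<^sup>2)"
    proof (rule mult_left_mono)
      have "(1 - \<theta>) * \<mu>\<^sup>2 - (1 - 5 * \<theta>) = 4 * \<theta> * \<theta> * (2 - \<theta>)" by (simp add: \<mu>_def power2_eq_square algebra_simps)
      moreover have "4 * \<theta> * \<theta> * (2 - \<theta>) \<ge> 0" using \<theta> by (intro mult_nonneg_nonneg) auto
      ultimately show "1 - 5 * \<theta> \<le> (1 - \<theta>) * \<mu>\<^sup>2" by linarith
    qed (use N in simp)
    then have "N - 5 * (N * \<theta>) \<le> \<kappa> * \<mu>\<^sup>2" by (simp add: \<kappa>_def algebra_simps)
    then show ?thesis using 1 \<theta>N \<delta>(4) eps unfolding N_def by linarith
  qed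
  then show ?thesis using C(2,3) eb x \<delta>(1) by (intro exI[of _ "insert b (insert x R)"] exI[of _ \<delta>]) auto
qed

section \<open>Matrix units and the block subalgebra\<close>

definition her :: "'v \<Rightarrow> 'v set" where "her a = closure {a * x * a | x. x \<in> S}"

definition blk :: "('g \<Rightarrow> 'v) \<Rightarrow> ('g \<Rightarrow> 'g \<Rightarrow> 'v) \<Rightarrow> 'v" where
  "blk v Q = (\<Sum>g\<in>carrier G. \<Sum>h\<in>carrier G. v g * Q g h * adj (v h))"

definition blocks :: "'v \<Rightarrow> ('g \<Rightarrow> 'v) \<Rightarrow> 'v set" where
  "blocks a v = {blk v Q | Q. \<forall>g\<in>carrier G. \<forall>h\<in>carrier G. Q g h \<in> her a}"

text \<open>A function not vanishing at 0 leaves \<open>S\<close> by a multiple of the unit of the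
  type, yet it still multiplies \<open>S\<close> into itself.\<close>

lemma S_fc_mult:
  assumes c: "cont \<phi>" and a: "adj a = a" "a \<in> S" and z: "z \<in> S"
  shows "fc \<phi> a * z \<in> S" "z * fc \<phi> a \<in> S"
proof -
  have "fc (\<lambda>t. \<phi> t - \<phi> 0) a \<in> S" by (rule S_fc) (auto intro!: continuous_intros c a)
  then have m: "fc \<phi> a - of_real (\<phi> 0) \<in> S" using c a by (simp add: fc_diff fc_const)
  have "(fc \<phi> a - of_real (\<phi> 0)) * z + \<phi> 0 *\<^sub>R z \<in> S" "z * (fc \<phi> a - of_real (\<phi> 0)) + \<phi> 0 *\<^sub>R z \<in> S"
    using m z by (auto intro!: S_add S_mult S_scaleR)
  then show "fc \<phi> a * z \<in> S" "z * fc \<phi> a \<in> S" by (simp_all add: of_real_def algebra_simps)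
qed

text \<open>The elements \<open>a * fc (invrt \<eta>) a\<close> tend to \<open>rt a\<close>, so the
  closure absorbs the root. Block entries will be produced in the form
  \<open>rt a * z * rt a\<close>.\<close>

lemma her_rt:
  assumes a: "pos a" "a \<in> S" and z: "z \<in> S" shows "rt a * z * rt a \<in> her a"
proof -
  note sa = pos_sa[OF a(1)]
  define \<eta> where "\<eta> n = (1 / real (Suc n))\<^sup>2" for n
  have \<eta>: "\<eta> n > 0" "sqrt (\<eta> n) = 1 / real (Suc n)" for n by (simp_all add: \<eta>_def)
  define g where "g n = fc (invrt (\<eta> n)) a" for n
  have cg: "cont (invrt (\<eta> n))" for n by (rule cont_invrt[OF \<eta>(1)])
  have ag: "a * g n = g n * a" for n unfolding g_def by (rule fc_commute[symmetric, OF cg sa refl])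
  have near: "norm (a * g n - rt a) \<le> 1 / real (Suc n)" for n
  proof -
    have "a * g n = fc (\<lambda>t. t * invrt (\<eta> n) t) a"
      unfolding g_def by (simp add: fc_mult[OF continuous_on_id cg sa] fc_id[OF sa])
    then have "norm (a * g n - rt a) = norm (fc (\<lambda>t. t * invrt (\<eta> n) t) a - fc sqrt a)" by (simp add: rt_def)
    also have "\<dots> \<le> sqrt (\<eta> n)"
      by (rule fc_norm_diff_le[OF _ cont_sqrt btw_pos[OF a(1) order_refl]])
        (auto intro!: continuous_intros cg invrt_bounds(1) \<eta>)
    finally show ?thesis by (simp add: \<eta>)
  qed
  have "(\<lambda>n. a * g n - rt a) \<longlonglongrightarrow> 0"
    by (rule tendsto_0_le[OF LIMSEQ_Suc[OF lim_1_over_n[where 'a=real]], where K=1]) (use near in \<open>auto intro!: always_eventually simp del: of_nat_Suc\<close>)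
  then have lim: "(\<lambda>n. a * g n) \<longlonglongrightarrow> rt a" by (simp add: LIM_zero_iff)
  have "(\<lambda>n. (a * g n) * z * (a * g n)) \<longlonglongrightarrow> rt a * z * rt a" by (intro tendsto_intros lim)
  moreover have "(a * g n) * z * (a * g n) \<in> {a * x * a | x. x \<in> S}" for n
  proof -
    have "(a * g n) * z * (a * g n) = a * (g n * z * g n) * a" by (subst (2) ag) (simp only: mult.assoc)
    moreover have "g n * z * g n \<in> S" unfolding g_def by (intro S_fc_mult cg sa a z)
    ultimately show ?thesis by blast
  qed
  ultimately show ?thesis unfolding her_def closure_sequential by (intro exI[of _ "\<lambda>n. (a * g n) * z * (a * g n)"] conjI allI)
qed

end

text \<open>The columns \<open>v g\<close> are orthogonal with common square \<open>c\<close>, and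
  \<open>c\<close> is a unit for \<open>a\<close>. On the hereditary subalgebra of \<open>a\<close>
  they therefore behave exactly like one column of a system of matrix units.\<close>

locale block_alg = rokhlin_alg G e S u
  for G :: "('g, 'b) monoid_scheme" (structure) and e :: "'v::cstar" and S u +
  fixes a c :: 'v and v :: "'g \<Rightarrow> 'v"
  assumes aS: "a \<in> S" and sa: "adj a = a" and v_e: "\<And>g. g \<in> carrier G \<Longrightarrow> e * v g = v g"
    and vv: "\<And>g h. g \<in> carrier G \<Longrightarrow> h \<in> carrier G \<Longrightarrow> adj (v g) * v h = (if g = h then c else 0)"
    and ca: "c * a = a" and ac: "a * c = a"
begin

lemma closed_her: "closed (her a)" by (simp add: her_def)

lemma her_prop:
  assumes cl: "closed P" and "\<And>x. x \<in> S \<Longrightarrow> a * x * a \<in> P" shows "her a \<subseteq> P"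
  unfolding her_def by (rule closure_minimal[OF _ cl]) (use assms in auto)

lemma her_c: "q \<in> her a \<Longrightarrow> c * q = q" "q \<in> her a \<Longrightarrow> q * c = q"
proof -
  have "her a \<subseteq> {q. c * q = q}"
    by (rule her_prop) (auto intro!: closed_Collect_eq continuous_intros simp: ca simp flip: mult.assoc)
  then show "q \<in> her a \<Longrightarrow> c * q = q" by blast
  have "her a \<subseteq> {q. q * c = q}"
    by (rule her_prop) (auto intro!: closed_Collect_eq continuous_intros simp: ac mult.assoc)
  then show "q \<in> her a \<Longrightarrow> q * c = q" by blast
qed

lemma her_S: "her a \<subseteq> S"
  by (rule her_prop[OF closed_S]) (auto intro: S_mult aS)

lemma her_seq: 
  assumes "q \<in> her a" obtains x where "\<And>n::nat. x n \<in> S" "(\<lambda>n. a * x n * a) \<longlonglongrightarrow> q"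
proof -
  obtain z where z: "\<And>n. z n \<in> {a * x * a | x. x \<in> S}" "z \<longlonglongrightarrow> q"
    using assms unfolding her_def closure_sequential by blast
  then obtain x where "\<And>n. x n \<in> S \<and> z n = a * x n * a" by (simp; metis)
  moreover then have "z = (\<lambda>n. a * x n * a)" by auto
  ultimately show ?thesis using that z(2) by blast
qed

lemma herI: "(\<And>n. x n \<in> S) \<Longrightarrow> (\<lambda>n::nat. a * x n * a) \<longlonglongrightarrow> q \<Longrightarrow> q \<in> her a"
  unfolding her_def closure_sequential by (intro exI[of _ "\<lambda>n. a * x n * a"]) auto

lemma her_add: "p \<in> her a \<Longrightarrow> q \<in> her a \<Longrightarrow> p + q \<in> her a"
proof -
  assume "p \<in> her a" "q \<in> her a"
  then obtain x y where "\<And>n. x n \<in> S" "(\<lambda>n. a * x n * a) \<longlonglongrightarrow> p" "\<And>n. y n \<in> S" "(\<lambda>n. a * y n * a) \<longlonglongrightarrow> q" by (metis her_seq)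
  then show ?thesis using tendsto_add[of "\<lambda>n. a * x n * a" p sequentially "\<lambda>n. a * y n * a" q]
    by (intro herI[of "\<lambda>n. x n + y n"]) (auto intro: S_add simp: distrib_left distrib_right)
qed

lemma her_mult: "p \<in> her a \<Longrightarrow> q \<in> her a \<Longrightarrow> p * q \<in> her a"
proof -
  assume "p \<in> her a" "q \<in> her a"
  then obtain x y where xy: "\<And>n. x n \<in> S" "(\<lambda>n. a * x n * a) \<longlonglongrightarrow> p" "\<And>n. y n \<in> S" "(\<lambda>n. a * y n * a) \<longlonglongrightarrow> q" by (metis her_seq)
  show ?thesis
    using tendsto_mult[OF xy(2,4)] xy(1,3) aS by (intro herI[of "\<lambda>n. x n * a * a * y n"]) (auto intro!: S_mult simp: mult.assoc)
qed

lemma her_sc: "q \<in> her a \<Longrightarrow> sc z * q \<in> her a"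
proof -
  assume "q \<in> her a"
  then obtain x where x: "\<And>n. x n \<in> S" "(\<lambda>n. a * x n * a) \<longlonglongrightarrow> q" by (metis her_seq)
  have "a * (sc z * x n) * a = sc z * (a * x n * a)" for n
  proof -
    have "a * (sc z * x n) * a = (a * sc z) * x n * a" by (simp only: mult.assoc)
    then show ?thesis by (simp only: sc_commute[of a] mult.assoc)
  qed
  then show ?thesis using tendsto_mult_left[OF x(2), of "sc z"] x(1) by (intro herI[of "\<lambda>n. sc z * x n"]) (auto intro: S_sc)
qed

lemma her_adj: "q \<in> her a \<Longrightarrow> adj q \<in> her a"
proof -
  assume "q \<in> her a"
  then obtain x where x: "\<And>n. x n \<in> S" "(\<lambda>n. a * x n * a) \<longlonglongrightarrow> q" by (metis her_seq)
  then show ?thesis using tendsto_adj[OF x(2)] by (intro herI[of "\<lambda>n. adj (x n)"]) (auto intro: S_adj simp: adj_mult sa mult.assoc)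
qed

lemma her_0: "0 \<in> her a"
  by (rule herI[of "\<lambda>_. 0"]) auto

lemma her_sum: "(\<And>i. i \<in> I \<Longrightarrow> f i \<in> her a) \<Longrightarrow> sum f I \<in> her a"
  by (induction I rule: infinite_finite_induct) (auto intro: her_add her_0)

text \<open>The two factors \<open>c\<close> arising from \<open>vv\<close> act as units on the
  hereditary subalgebra, so coefficients are recovered exactly and not merely approximately.\<close>

lemma blk_coeff:
  assumes Q: "\<And>g h. g \<in> carrier G \<Longrightarrow> h \<in> carrier G \<Longrightarrow> Q g h \<in> her a" and kl: "k \<in> carrier G" "l \<in> carrier G"
  shows "adj (v k) * blk v Q * v l = Q k l"
proof -
  have "adj (v k) * blk v Q * v l = (\<Sum>g\<in>carrier G. \<Sum>h\<in>carrier G. (adj (v k) * v g) * Q g h * (adj (v h) * v l))"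
    unfolding blk_def sum_distrib_left sum_distrib_right by (simp only: mult.assoc)
  also have "\<dots> = (\<Sum>g\<in>carrier G. if g = k then \<Sum>h\<in>carrier G. if h = l then c * Q g h * c else 0 else 0)"
    using kl by (auto intro!: sum.cong simp: vv)
  also have "\<dots> = c * Q k l * c" using kl finG by simp
  finally show ?thesis using her_c[OF Q[OF kl]] by simp
qed

lemma blocks_coeff: 
  assumes "b \<in> blocks a v" 
  shows "k \<in> carrier G \<Longrightarrow> l \<in> carrier G \<Longrightarrow> adj (v k) * b * v l \<in> her a" "b = blk v (\<lambda>k l. adj (v k) * b * v l)"
proof -
  obtain Q where Q: "\<And>g h. g \<in> carrier G \<Longrightarrow> h \<in> carrier G \<Longrightarrow> Q g h \<in> her a" "b = blk v Q"
    using assms unfolding blocks_def by blast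
  show "k \<in> carrier G \<Longrightarrow> l \<in> carrier G \<Longrightarrow> adj (v k) * b * v l \<in> her a" using Q blk_coeff by simp
  show "b = blk v (\<lambda>k l. adj (v k) * b * v l)" 
    unfolding Q(2) by (subst (1) blk_def, subst (1) blk_def) (auto intro!: sum.cong simp: blk_coeff[of Q, OF Q(1)])
qed

lemma blocksI: "(\<And>g h. g \<in> carrier G \<Longrightarrow> h \<in> carrier G \<Longrightarrow> Q g h \<in> her a) \<Longrightarrow> blk v Q \<in> blocks a v"
  unfolding blocks_def by blast

lemma blk_add: "blk v Q + blk v R = blk v (\<lambda>g h. Q g h + R g h)"
  by (simp add: blk_def sum.distrib algebra_simps)

lemma blk_sc: "sc z * blk v Q = blk v (\<lambda>g h. sc z * Q g h)"
proof -
  have "sc z * (x * q * y) = x * (sc z * q) * y" for x q y :: 'v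
  proof -
    have "x * (sc z * q) * y = (x * sc z) * q * y" by (simp only: mult.assoc)
    then show ?thesis by (simp only: sc_commute[of x] mult.assoc)
  qed
  then show ?thesis by (simp add: blk_def sum_distrib_left)
qed

lemma blk_adj: "adj (blk v Q) = blk v (\<lambda>g h. adj (Q h g))"
  unfolding blk_def by (subst sum.swap) (simp add: adj_sum adj_mult mult.assoc)

lemma blk_mult:
  assumes Q: "\<And>g h. g \<in> carrier G \<Longrightarrow> h \<in> carrier G \<Longrightarrow> Q g h \<in> her a"
  shows "blk v Q * blk v R = blk v (mmul (carrier G) Q R)"
proof -
  have inner: "(\<Sum>k\<in>carrier G. v g * Q g k * adj (v k)) * (\<Sum>l\<in>carrier G. v l * T l) = (\<Sum>k\<in>carrier G. v g * (Q g k * T k))"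
    if g: "g \<in> carrier G" for g T
  proof -
    have "(\<Sum>k\<in>carrier G. v g * Q g k * adj (v k)) * (\<Sum>l\<in>carrier G. v l * T l)
      = (\<Sum>k\<in>carrier G. \<Sum>l\<in>carrier G. v g * Q g k * (adj (v k) * v l) * T l)"
      unfolding sum_product by (simp only: mult.assoc)
    also have "\<dots> = (\<Sum>k\<in>carrier G. \<Sum>l\<in>carrier G. if l = k then v g * (Q g k * c) * T l else 0)"
      by (intro sum.cong refl) (auto simp: vv mult.assoc)
    also have "\<dots> = (\<Sum>k\<in>carrier G. v g * (Q g k * T k))"
      using finG g by (intro sum.cong refl) (simp add: her_c(2)[OF Q] mult.assoc[symmetric])
    finally show ?thesis .
  qed
  have R: "blk v R = (\<Sum>l\<in>carrier G. v l * (\<Sum>h\<in>carrier G. R l h * adj (v h)))"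
    by (simp add: blk_def sum_distrib_left mult.assoc)
  have "blk v Q * blk v R = (\<Sum>g\<in>carrier G. (\<Sum>k\<in>carrier G. v g * Q g k * adj (v k)) * blk v R)"
    unfolding blk_def[of v Q] by (simp only: sum_distrib_right)
  also have "\<dots> = (\<Sum>g\<in>carrier G. \<Sum>k\<in>carrier G. v g * (Q g k * (\<Sum>h\<in>carrier G. R k h * adj (v h))))"
    unfolding R by (intro sum.cong refl inner)
  also have "\<dots> = (\<Sum>g\<in>carrier G. \<Sum>k\<in>carrier G. \<Sum>h\<in>carrier G. v g * (Q g k * R k h) * adj (v h))"
    by (simp only: sum_distrib_left mult.assoc)
  also have "\<dots> = (\<Sum>g\<in>carrier G. \<Sum>h\<in>carrier G. \<Sum>k\<in>carrier G. v g * (Q g k * R k h) * adj (v h))"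
    by (intro sum.cong refl sum.swap)
  also have "\<dots> = blk v (mmul (carrier G) Q R)"
    by (simp only: blk_def mmul_def sum_distrib_left sum_distrib_right)
  finally show ?thesis .
qed

lemma blocks_add: 
  assumes "x \<in> blocks a v" "y \<in> blocks a v" shows "x + y \<in> blocks a v"
proof -
  obtain Q where "\<forall>g\<in>carrier G. \<forall>h\<in>carrier G. Q g h \<in> her a" and Q2: "x = blk v Q"
    using assms unfolding blocks_def by blast
  then have Q1: "\<And>g h. g \<in> carrier G \<Longrightarrow> h \<in> carrier G \<Longrightarrow> Q g h \<in> her a" by simp
  obtain R where "\<forall>g\<in>carrier G. \<forall>h\<in>carrier G. R g h \<in> her a" and R2: "y = blk v R"
    using assms unfolding blocks_def by blast
  then have R1: "\<And>g h. g \<in> carrier G \<Longrightarrow> h \<in> carrier G \<Longrightarrow> R g h \<in> her a" by simp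
  show ?thesis unfolding Q2 R2 blk_add by (rule blocksI[OF her_add[OF Q1 R1]])
qed

lemma blocks_sc: 
  assumes "x \<in> blocks a v" shows "sc z * x \<in> blocks a v"
proof -
  obtain Q where "\<forall>g\<in>carrier G. \<forall>h\<in>carrier G. Q g h \<in> her a" and Q2: "x = blk v Q"
    using assms unfolding blocks_def by blast
  then have Q1: "\<And>g h. g \<in> carrier G \<Longrightarrow> h \<in> carrier G \<Longrightarrow> Q g h \<in> her a" by simp
  show ?thesis unfolding Q2 blk_sc by (rule blocksI[OF her_sc[OF Q1]])
qed

lemma blocks_adj: 
  assumes "x \<in> blocks a v" shows "adj x \<in> blocks a v"
proof -
  obtain Q where "\<forall>g\<in>carrier G. \<forall>h\<in>carrier G. Q g h \<in> her a" and Q2: "x = blk v Q"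
    using assms unfolding blocks_def by blast
  then have Q1: "\<And>g h. g \<in> carrier G \<Longrightarrow> h \<in> carrier G \<Longrightarrow> Q g h \<in> her a" by simp
  show ?thesis unfolding Q2 blk_adj by (rule blocksI[OF her_adj[OF Q1]])
qed

lemma blocks_mult: 
  assumes "x \<in> blocks a v" "y \<in> blocks a v" shows "x * y \<in> blocks a v"
proof -
  obtain Q where "\<forall>g\<in>carrier G. \<forall>h\<in>carrier G. Q g h \<in> her a" and Q2: "x = blk v Q"
    using assms unfolding blocks_def by blast
  then have Q1: "\<And>g h. g \<in> carrier G \<Longrightarrow> h \<in> carrier G \<Longrightarrow> Q g h \<in> her a" by simp
  obtain R where "\<forall>g\<in>carrier G. \<forall>h\<in>carrier G. R g h \<in> her a" and R2: "y = blk v R"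
    using assms unfolding blocks_def by blast
  then have R1: "\<And>g h. g \<in> carrier G \<Longrightarrow> h \<in> carrier G \<Longrightarrow> R g h \<in> her a" by simp
  have "x * y = blk v (mmul (carrier G) Q R)" unfolding Q2 R2 by (rule blk_mult[OF Q1])
  moreover have "mmul (carrier G) Q R g h \<in> her a" if "g \<in> carrier G" "h \<in> carrier G" for g h
    unfolding mmul_def using Q1 R1 that by (intro her_sum her_mult) auto
  ultimately show ?thesis using blocksI by simp
qed

lemma blocks_0: "0 \<in> blocks a v"
  using blocksI[of "\<lambda>_ _. 0"] her_0 by (simp add: blk_def)

lemma blocks_e: "x \<in> blocks a v \<Longrightarrow> e * x = x"
proof -
  assume "x \<in> blocks a v"
  then obtain Q where Q: "x = blk v Q" unfolding blocks_def by blast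
  show ?thesis unfolding Q blk_def sum_distrib_left 
    by (intro sum.cong refl) (simp add: v_e flip: mult.assoc)
qed

text \<open>Taking coefficients and reassembling them are both continuous, so a limit of blocks is
  the block of the limiting coefficients.\<close>

lemma closed_blocks: "closed (blocks a v)"
proof (rule closed_sequential_limits[THEN iffD2], intro allI impI)
  fix X b assume Xb: "(\<forall>n. X n \<in> blocks a v) \<and> X \<longlonglongrightarrow> b"
  then have X: "\<forall>n. X n \<in> blocks a v" and lim: "X \<longlonglongrightarrow> b" by auto
  let ?Q = "\<lambda>b k l. adj (v k) * b * v l"
  have "?Q b k l \<in> her a" if "k \<in> carrier G" "l \<in> carrier G" for k l
  proof (rule closed_sequentially[OF closed_her])
    show "?Q (X n) k l \<in> her a" for n using X blocks_coeff(1) that by blast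
    show "(\<lambda>n. ?Q (X n) k l) \<longlonglongrightarrow> ?Q b k l" by (intro tendsto_intros lim)
  qed
  then have B: "blk v (?Q b) \<in> blocks a v" by (rule blocksI)
  have "X n = blk v (?Q (X n))" for n using X blocks_coeff(2) by blast
  moreover have "(\<lambda>n. blk v (?Q (X n))) \<longlonglongrightarrow> blk v (?Q b)" unfolding blk_def by (intro tendsto_intros lim)
  ultimately have "X \<longlonglongrightarrow> blk v (?Q b)" by simp
  then have "b = blk v (?Q b)" using lim LIMSEQ_unique by blast
  then show "b \<in> blocks a v" using B by simp
qed

end

section \<open>Exact matrix units out of Rokhlin elements\<close>

text \<open>The flat part up to \<open>\<tau> / 2\<close> is what permits dividing by a function of
  \<open>t\<close> that degenerates near 0 when the matrix units are constructed.\<close>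

definition ramp :: "real \<Rightarrow> real \<Rightarrow> real" where "ramp \<tau> t = min 1 (max 0 (2 * t / \<tau> - 1))"

lemma cont_ramp: "\<tau> > 0 \<Longrightarrow> cont (ramp \<tau>)"
  unfolding ramp_def by (intro continuous_intros) auto

lemma ramp_bounds: "0 \<le> ramp \<tau> t" "ramp \<tau> t \<le> 1"
  by (auto simp: ramp_def)

lemma ramp_eq: "\<tau> > 0 \<Longrightarrow> t \<le> \<tau> / 2 \<Longrightarrow> ramp \<tau> t = 0" "\<tau> > 0 \<Longrightarrow> \<tau> \<le> t \<Longrightarrow> ramp \<tau> t = 1"
  by (auto simp: ramp_def field_simps)

context rokhlin_alg begin

text \<open>The elements \<open>f g * u g * w\<close> have orthogonal ranges, and their moduli dominate the same
  function \<open>c\<close> of \<open>f \<one>\<close>. Their polar parts times \<open>sqrt c\<close> are exact matrix units over \<open>c\<close>.\<close>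
lemma matrix_units:
  assumes \<tau>: "0 < \<tau>" "\<tau> \<le> 1" and \<omega>: "\<omega> > 0"
  shows "\<exists>\<epsilon>>0. \<forall>f. (\<forall>g\<in>carrier G. f g \<in> S \<and> pos (f g) \<and> norm (f g) \<le> 1) \<longrightarrow>
    (\<forall>g\<in>carrier G. \<forall>h\<in>carrier G. g \<noteq> h \<longrightarrow> f g * f h = 0) \<longrightarrow>
    (\<forall>g\<in>carrier G. norm (u g * f \<one> * adj (u g) - f g) \<le> \<epsilon>) \<longrightarrow>
    (\<exists>v. (\<forall>g\<in>carrier G. e * v g = v g \<and> norm (v g - u g * fc (ramp \<tau>) (f \<one>)) < \<omega>) \<and>
      (\<forall>g\<in>carrier G. \<forall>h\<in>carrier G. adj (v g) * v h = (if g = h then fc (ramp \<tau>) (f \<one>) * fc (ramp \<tau>) (f \<one>) else 0)))"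
proof -
  let ?\<kappa> = "ramp \<tau>"
  \<comment> \<open>Half of \<open>(\<tau> / 2)\<^sup>2\<close>: wherever the ramp is nonzero,
    \<open>t * t - \<eta>\<close> exceeds \<open>\<eta>\<close>.\<close>
  define \<eta> where "\<eta> = \<tau> * \<tau> / 8"
  \<comment> \<open>A bound for \<open>\<nu>\<close>, and hence for the elements fed into the
    perturbation lemma for polar parts; it comes from
    \<open>sqrt \<eta> \<ge> \<tau> / 3\<close>.\<close>
  define R where "R = 3 / \<tau>"
  have \<eta>: "\<eta> > 0" using \<tau> by (simp add: \<eta>_def)
  have R: "R > 0" using \<tau> by (simp add: R_def)
  \<comment> \<open>Normalised so that conjugating \<open>p * p - of_real \<eta>\<close> by
    \<open>fc \<nu> p\<close> gives exactly the square of the ramp. The allowance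
    \<open>\<eta>\<close> covers the error of replacing \<open>p\<close> by a translated Rokhlin
    element, so \<open>c\<close> stays below the squared modulus of each \<open>x g\<close>.\<close>
  define \<nu> where "\<nu> = (\<lambda>t. ?\<kappa> t / sqrt (max (t * t - \<eta>) \<eta>))"
  have ne: "sqrt (max (t * t - \<eta>) \<eta>) > 0" for t using \<eta> by (simp add: less_max_iff_disj)
  have ck: "cont ?\<kappa>" by (rule cont_ramp[OF \<tau>(1)])
  have cn: "cont \<nu>" unfolding \<nu>_def by (intro continuous_intros ck) (use ne in \<open>auto simp: less_imp_neq[symmetric] dest: less_imp_neq\<close>)
  have sq\<eta>: "sqrt \<eta> \<ge> \<tau> / 3" using \<tau> by (intro real_le_rsqrt) (simp add: \<eta>_def power2_eq_square)
  have nu_bd: "0 \<le> \<nu> t" "\<nu> t \<le> R" for t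
  proof -
    show "0 \<le> \<nu> t" unfolding \<nu>_def using ramp_bounds(1) less_imp_le[OF ne] by (intro divide_nonneg_nonneg)
    have "sqrt \<eta> \<le> sqrt (max (t * t - \<eta>) \<eta>)" by simp
    then have "\<nu> t \<le> 1 / (\<tau> / 3)" unfolding \<nu>_def using \<tau>(1) by (intro frac_le[OF _ ramp_bounds(2) _ order_trans[OF sq\<eta>]]) auto
    then show "\<nu> t \<le> R" by (simp add: R_def)
  qed
  have nu_key: "\<nu> t * (t * t - \<eta>) * \<nu> t = ?\<kappa> t * ?\<kappa> t" if "0 \<le> t" for t
  proof (cases "t \<le> \<tau> / 2")
    case True
    then show ?thesis using ramp_eq(1)[OF \<tau>(1)] by (simp add: \<nu>_def)
  next
    case False
    then have "(\<tau> / 2) * (\<tau> / 2) \<le> t * t" using \<tau> by (intro mult_mono) auto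
    then have m: "max (t * t - \<eta>) \<eta> = t * t - \<eta>" "t * t - \<eta> > 0" using \<eta> by (auto simp: \<eta>_def)
    have "\<nu> t * (t * t - \<eta>) * \<nu> t = (?\<kappa> t * ?\<kappa> t) * (t * t - \<eta>) / (sqrt (t * t - \<eta>) * sqrt (t * t - \<eta>))"
      unfolding \<nu>_def m by (simp add: field_simps)
    then show ?thesis using m(2) by simp
  qed
  obtain dp where dp: "dp > 0" "\<And>x q c w :: 'v. pos q \<Longrightarrow> norm q \<le> R \<Longrightarrow> norm x \<le> R \<Longrightarrow> norm w \<le> 1 \<Longrightarrow>
     adj w * w * q = q \<Longrightarrow> pos c \<Longrightarrow> pos (adj x * x - c) \<Longrightarrow> pos (q * q - c) \<Longrightarrow> norm (x - w * q) < dp \<Longrightarrow>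
     (\<exists>y. adj y * y = c \<and> norm (y - w * rt c) < \<omega> \<and> (\<forall>t. t * x = 0 \<longrightarrow> t * y = 0))"
    using polar_near[OF R \<omega>, where ?'a='v] by blast
  define \<epsilon> where "\<epsilon> = min (\<eta> / 2) (dp / (2 * R))"
  have \<epsilon>: "\<epsilon> > 0" "2 * \<epsilon> \<le> \<eta>" "\<epsilon> * R < dp"
  proof -
    show "\<epsilon> > 0" using \<eta> dp(1) R by (simp add: \<epsilon>_def)
    show "2 * \<epsilon> \<le> \<eta>" unfolding \<epsilon>_def by linarith
    have "\<epsilon> \<le> dp / (2 * R)" unfolding \<epsilon>_def by (rule min.cobounded2)
    then have "\<epsilon> * R \<le> dp / (2 * R) * R" using R by (intro mult_right_mono) auto
    then show "\<epsilon> * R < dp" using R dp(1) by simp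
  qed
  have "\<exists>v. (\<forall>g\<in>carrier G. e * v g = v g \<and> norm (v g - u g * fc ?\<kappa> (f \<one>)) < \<omega>) \<and>
      (\<forall>g\<in>carrier G. \<forall>h\<in>carrier G. adj (v g) * v h = (if g = h then fc ?\<kappa> (f \<one>) * fc ?\<kappa> (f \<one>) else 0))"
    if f: "\<forall>g\<in>carrier G. f g \<in> S \<and> pos (f g) \<and> norm (f g) \<le> 1"
      and orth: "\<forall>g\<in>carrier G. \<forall>h\<in>carrier G. g \<noteq> h \<longrightarrow> f g * f h = 0"
      and near: "\<forall>g\<in>carrier G. norm (u g * f \<one> * adj (u g) - f g) \<le> \<epsilon>" for f
  proof -
    define p where "p = f \<one>"
    have p: "p \<in> S" "pos p" "norm p \<le> 1" using f by (auto simp: p_def)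
    note sp = pos_sa[OF p(2)]
    note btw = btw_pos[OF p(2,3)]
    define w where "w = fc \<nu> p"
    define c where "c = fc ?\<kappa> p * fc ?\<kappa> p"
    define q where "q = fc (\<lambda>t. t * \<nu> t) p"
    have sw: "adj w = w" unfolding w_def by (rule adj_fc[OF cn sp])
    have ckk: "cont (\<lambda>t. ?\<kappa> t * ?\<kappa> t)" and ctn: "cont (\<lambda>t. t * \<nu> t)" by (intro continuous_on_mult continuous_on_id ck cn)+
    have c_fc: "c = fc (\<lambda>t. ?\<kappa> t * ?\<kappa> t) p" unfolding c_def by (rule fc_mult[OF ck ck sp, symmetric])
    have pc: "pos c" unfolding c_fc by (rule fc_pos[OF ckk btw]) simp
    have pq: "pos q" unfolding q_def by (rule fc_pos[OF ctn btw]) (use nu_bd in simp)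
    have nw: "norm w \<le> R" unfolding w_def by (rule fc_norm_le[OF cn btw]) (use nu_bd in \<open>simp add: abs_of_nonneg\<close>)
    have nq: "norm q \<le> R" unfolding q_def
    proof (rule fc_norm_le[OF ctn btw])
      fix t :: real assume "0 \<le> t" "t \<le> 1"
      then have "t * \<nu> t \<le> 1 * R" by (intro mult_mono nu_bd) auto
      then show "\<bar>t * \<nu> t\<bar> \<le> R" using \<open>0 \<le> t\<close> nu_bd(1)[of t] by (simp add: abs_mult abs_of_nonneg)
    qed
    have ep: "e * p = p" by (rule S_e[OF p(1)])
    have eq: "e * q = q" unfolding q_def by (rule fc_corner[OF ctn sp _ ep]) simp
    have q_pw: "q = p * w" unfolding q_def w_def by (simp add: fc_mult[OF continuous_on_id cn sp] fc_id[OF sp])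
    have rtc: "rt c = fc ?\<kappa> p" unfolding c_def by (rule rt_fc_square[OF ck btw]) (rule ramp_bounds)
    have cpp: "cont (\<lambda>t. t * t - \<eta>)" by (intro continuous_intros)
    have wpw: "w * (p * p - of_real \<eta>) * w = c"
    proof -
      have "p * p - of_real \<eta> = fc (\<lambda>t. t * t - \<eta>) p"
        by (simp add: fc_diff continuous_on_mult fc_mult[OF continuous_on_id continuous_on_id sp] fc_id fc_const sp)
      then have "w * (p * p - of_real \<eta>) * w = fc (\<lambda>t. \<nu> t * (t * t - \<eta>) * \<nu> t) p"
        unfolding w_def fc_mult[OF continuous_on_mult[OF cn cpp] cn sp] fc_mult[OF cn cpp sp] by simp
      also have "\<dots> = fc (\<lambda>t. ?\<kappa> t * ?\<kappa> t) p"
        by (rule fc_cong[OF continuous_on_mult[OF continuous_on_mult[OF cn cpp] cn] ckk btw nu_key])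
      finally show ?thesis unfolding c_fc .
    qed
    have pqc: "pos (q * q - c)"
    proof -
      have "q * q - c = fc (\<lambda>t. (t * \<nu> t) * (t * \<nu> t) - ?\<kappa> t * ?\<kappa> t) p"
        unfolding fc_diff[OF continuous_on_mult[OF ctn ctn] ckk sp] fc_mult[OF ctn ctn sp] q_def c_fc ..
      also have "pos \<dots>"
      proof (rule fc_pos[OF continuous_on_diff[OF continuous_on_mult[OF ctn ctn] ckk] btw])
        fix t :: real assume t: "0 \<le> t"
        have "(t * \<nu> t) * (t * \<nu> t) - \<nu> t * (t * t - \<eta>) * \<nu> t = \<eta> * (\<nu> t * \<nu> t)" by (simp only: algebra_simps)
        then show "0 \<le> (t * \<nu> t) * (t * \<nu> t) - ?\<kappa> t * ?\<kappa> t" unfolding nu_key[OF t] using \<eta> by simp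
      qed
      finally show ?thesis .
    qed
    define x where "x g = f g * u g * w" for g
    have "\<exists>y. adj y * y = c \<and> norm (y - u g * rt c) < \<omega> \<and> (\<forall>t. t * x g = 0 \<longrightarrow> t * y = 0)" if g: "g \<in> carrier G" for g
    proof (rule dp(2)[OF pq nq _ norm_u_le[OF g] _ pc _ pqc])
      have fg: "f g \<in> S" "pos (f g)" "norm (f g) \<le> 1" using f g by auto
      note sf = pos_sa[OF fg(2)]
      have fe: "f g * e = f g" using S_e[OF fg(1)] by (simp only: e_comm)
      show "adj (u g) * u g * q = q" using g eq by simp
      have nfu: "norm (f g * u g) \<le> 1" using norm_mult_u_le(1)[OF g, of "f g"] fg(3) by simp
      show "norm (x g) \<le> R" unfolding x_def
        using order_trans[OF norm_mult_ineq mult_mono[OF nfu nw]] R by simp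
      \<comment> \<open>The element \<open>f g\<close> moved back to the identity of the group. It
        is close to \<open>p\<close>, and \<open>adj (x g) * x g\<close> is its square conjugated by
        \<open>w\<close>.\<close>
      define b where "b = adj (u g) * f g * u g"
      have sb: "adj b = b" by (simp add: b_def adj_mult sf mult.assoc)
      have bp: "norm (b - p) \<le> \<epsilon>"
      proof -
        have "adj (u g) * (u g * p * adj (u g)) * u g = (adj (u g) * u g) * p * (adj (u g) * u g)" by (simp only: mult.assoc)
        also have "\<dots> = p" using g ep by (simp add: e_comm[symmetric])
        finally have "b - p = adj (u g) * (f g - u g * p * adj (u g)) * u g"
          by (simp add: b_def right_diff_distrib left_diff_distrib)
        then have "norm (b - p) \<le> norm (f g - u g * p * adj (u g))"
          using order_trans[OF norm_mult_u_le(1)[OF g] norm_mult_u_le(4)[OF g]] by simp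
        then show ?thesis using near g by (fastforce simp: p_def norm_minus_commute)
      qed
      have nb: "norm b \<le> 1"
        using order_trans[OF norm_mult_u_le(1)[OF g] norm_mult_u_le(4)[OF g], of "f g"] fg(3) by (simp add: b_def)
      have "b * b - p * p = b * (b - p) + (b - p) * p" by (simp add: algebra_simps)
      also have "norm \<dots> \<le> 1 * \<epsilon> + \<epsilon> * 1"
        by (rule order_trans[OF norm_triangle_ineq add_mono[OF order_trans[OF norm_mult_ineq mult_mono[OF nb bp]]
          order_trans[OF norm_mult_ineq mult_mono[OF bp p(3)]]]]) (use \<epsilon>(1) in auto)
      finally have nbb: "norm (b * b - p * p) \<le> \<eta>" using \<epsilon>(2) by simp
      have bb: "b * b = adj (u g) * (f g * f g) * u g"
      proof -
        have "b * b = adj (u g) * f g * (u g * adj (u g)) * f g * u g" by (simp only: b_def mult.assoc)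
        also have "\<dots> = adj (u g) * (f g * e) * f g * u g" using g by (simp only: u_adj_u mult.assoc)
        finally show ?thesis by (simp only: fe mult.assoc)
      qed
      have "adj (x g) * x g = w * (b * b) * w" unfolding bb by (simp add: x_def adj_mult sf sw mult.assoc)
      then have "adj (x g) * x g - c = w * (of_real \<eta> + (b * b - p * p)) * w"
        unfolding wpw[symmetric] by (simp add: algebra_simps)
      moreover have "pos (of_real \<eta> + (b * b - p * p))"
        by (rule pos_of_real_plus[OF _ nbb]) (simp add: adj_diff adj_mult sb sp)
      ultimately show "pos (adj (x g) * x g - c)" using pos_conj_sa[OF _ sw] by simp
      have "(u g * p * adj (u g)) * u g = u g * p * (adj (u g) * u g)" by (simp only: mult.assoc)
      also have "\<dots> = u g * p" by (simp only: adj_u_u[OF g] mult.assoc e_comm[of p, symmetric] ep)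
      finally have "f g * u g - u g * p = (f g - u g * p * adj (u g)) * u g" by (simp add: left_diff_distrib)
      then have "norm (f g * u g - u g * p) \<le> norm (f g - u g * p * adj (u g))" using norm_mult_u_le(1)[OF g] by simp
      also have "\<dots> \<le> \<epsilon>" using near g by (fastforce simp: p_def norm_minus_commute)
      finally have fup: "norm (f g * u g - u g * p) \<le> \<epsilon>" .
      have "x g - u g * q = (f g * u g - u g * p) * w" by (simp add: x_def q_pw algebra_simps)
      then have "norm (x g - u g * q) \<le> \<epsilon> * R"
        using order_trans[OF norm_mult_ineq mult_mono[OF fup nw]] \<epsilon>(1) by simp
      then show "norm (x g - u g * q) < dp" using \<epsilon>(3) by simp
    qed
    then obtain v where v: "\<And>g. g \<in> carrier G \<Longrightarrow> adj (v g) * v g = c" "\<And>g. g \<in> carrier G \<Longrightarrow> norm (v g - u g * rt c) < \<omega>"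
      "\<And>g t. g \<in> carrier G \<Longrightarrow> t * x g = 0 \<Longrightarrow> t * v g = 0" by metis
    have "e * v g = v g" if g: "g \<in> carrier G" for g
    proof -
      have "e * f g = f g" using f g S_e by blast
      then have "(1 - e) * x g = 0" by (simp add: x_def left_diff_distrib flip: mult.assoc)
      then have "(1 - e) * v g = 0" by (rule v(3)[OF g])
      then show ?thesis by (simp add: left_diff_distrib)
    qed
    \<comment> \<open>Left annihilation passes from \<open>x g\<close> to \<open>v g\<close> and,
      after taking adjoints, from \<open>x h\<close> to \<open>v h\<close>.\<close>
    moreover have "adj (v g) * v h = 0" if gh: "g \<in> carrier G" "h \<in> carrier G" "g \<noteq> h" for g h
    proof -
      have sf: "adj (f h) = f h" using f gh pos_sa by blast
      have "f h * f g = 0" using orth gh by auto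
      have "adj (x h) * x g = w * adj (u h) * (f h * f g) * u g * w" by (simp add: x_def adj_mult sf sw mult.assoc)
      then have "adj (x h) * x g = 0" by (simp add: \<open>f h * f g = 0\<close>)
      then have "adj (x h) * v g = 0" by (rule v(3)[OF gh(1)])
      then have "adj (adj (x h) * v g) = 0" by simp
      then have "adj (v g) * x h = 0" by (simp add: adj_mult)
      then show ?thesis by (rule v(3)[OF gh(2)])
    qed
    ultimately show ?thesis using v(1,2) unfolding rtc unfolding c_def p_def by (intro exI[of _ v]) auto
  qed
  then show ?thesis using \<epsilon>(1) by blast
qed

section \<open>Construction of the block approximation\<close>

text \<open>By orthogonality \<open>f0 - f0 * f0\<close> is the sum of the positive elements
  \<open>f g - f g * f g\<close>, which forces \<open>f0\<close> to be a contraction.\<close>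

lemma rokhlin_sum:
  assumes f: "\<And>g. g \<in> carrier G \<Longrightarrow> f g \<in> S \<and> pos (f g) \<and> norm (f g) \<le> 1"
    and orth: "\<And>g h. g \<in> carrier G \<Longrightarrow> h \<in> carrier G \<Longrightarrow> g \<noteq> h \<Longrightarrow> f g * f h = 0"
  defines "f0 \<equiv> \<Sum>g\<in>carrier G. f g"
  shows "pos f0" "norm f0 \<le> 1" "f0 \<in> S" "pos (e - f0)"
proof -
  show pf: "pos f0" unfolding f0_def using f by (intro pos_sum) auto
  show fS: "f0 \<in> S" unfolding f0_def using f by (intro S_sum) auto
  have ff: "f0 * f0 = (\<Sum>g\<in>carrier G. f g * f g)"
  proof -
    have "f0 * f0 = (\<Sum>g\<in>carrier G. \<Sum>h\<in>carrier G. if h = g then f g * f g else 0)"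
      unfolding f0_def sum_product by (intro sum.cong refl) (auto simp: orth)
    then show ?thesis using finG by simp
  qed
  have "pos (f0 - f0 * f0)"
    unfolding ff unfolding f0_def sum_subtractf[symmetric]
  proof (rule pos_sum)
    fix g assume g: "g \<in> carrier G"
    note sf = pos_sa[of "f g"]
    have c: "cont (\<lambda>t. t - t * t)" by (intro continuous_intros)
    have "pos (fc (\<lambda>t. t - t * t) (f g))"
      by (rule fc_pos[OF c btw_pos[of "f g" 1]]) (use f[OF g] in \<open>auto simp: mult_left_le\<close>)
    then show "pos (f g - f g * f g)"
      using f[OF g] sf by (simp add: fc_diff continuous_on_mult fc_mult[OF continuous_on_id continuous_on_id] fc_id)
  qed
  then have "norm (f0 * f0) \<le> norm f0" by (rule pos_mono_norm[OF pos_square[OF pos_sa[OF pf]]])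
  then have "norm f0 * norm f0 \<le> norm f0 * 1" using norm_sq_sa[OF pos_sa[OF pf]] by (simp add: power2_eq_square)
  then show n1: "norm f0 \<le> 1" by (cases "norm f0 = 0") (auto simp: mult_le_cancel_left)
  have "pos (e * (of_real 1 - f0) * e)" by (rule pos_conj_sa[OF pos_of_real_minus[OF pos_sa[OF pf] n1] adj_e])
  moreover have "e * (of_real 1 - f0) * e = e - f0"
  proof -
    have fe: "f0 * e = f0" by (simp only: e_comm[of f0, symmetric] S_e[OF fS])
    show ?thesis by (simp add: right_diff_distrib left_diff_distrib S_e[OF fS] fe)
  qed
  ultimately show "pos (e - f0)" by simp
qed

lemma sum_shift:
  assumes "g \<in> carrier G" shows "(\<Sum>h\<in>carrier G. F (g \<otimes> inv h)) = (\<Sum>k\<in>carrier G. F k)"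
proof (rule sum.reindex_bij_witness[where j = "\<lambda>h. g \<otimes> inv h" and i = "\<lambda>k. inv k \<otimes> g"])
  fix h assume h: "h \<in> carrier G"
  show "inv (g \<otimes> inv h) \<otimes> g = h" using assms h by (simp add: inv_mult_group m_assoc)
  show "g \<otimes> inv (inv h \<otimes> g) = h" using assms h by (simp add: inv_mult_group flip: m_assoc)
qed (use assms in auto)

lemma sum_left_mult:
  assumes "k \<in> carrier G" shows "(\<Sum>g\<in>carrier G. F (k \<otimes> g)) = (\<Sum>g\<in>carrier G. F g)"
proof (rule sum.reindex_bij_witness[where j = "\<lambda>g. k \<otimes> g" and i = "\<lambda>g. inv k \<otimes> g"])
  fix h assume h: "h \<in> carrier G"
  show "inv k \<otimes> (k \<otimes> h) = h" "k \<otimes> (inv k \<otimes> h) = h" using assms h by (simp_all flip: m_assoc)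
qed (use assms in auto)

text \<open>The interval extends to \<open>1 + \<mu>\<close> because the diagonal element to be
  truncated is only known to have norm at most \<open>1 + \<mu>\<close>.\<close>

lemma trunc_bounds:
  assumes "0 < \<mu>" "\<mu> \<le> 1/8" "0 \<le> t" "t \<le> 1 + \<mu>"
  shows "0 \<le> trunc \<mu> t" "trunc \<mu> t \<le> 1" "\<bar>trunc \<mu> t - t\<bar> \<le> 3 * \<mu>"
proof -
  have p: "1 - 2 * \<mu> > 0" using assms by simp
  show "0 \<le> trunc \<mu> t" "trunc \<mu> t \<le> 1" using assms p by (simp_all add: trunc_def)
  show "\<bar>trunc \<mu> t - t\<bar> \<le> 3 * \<mu>"
  proof (cases "t \<le> 1 - 2 * \<mu>")
    case True
    then have "t / (1 - 2 * \<mu>) \<le> 1" using p by simp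
    then have k: "trunc \<mu> t = t / (1 - 2 * \<mu>)" by (simp add: trunc_def)
    have "t / (1 - 2 * \<mu>) - t = 2 * \<mu> * (t / (1 - 2 * \<mu>))" using p by (simp add: field_simps)
    moreover have "2 * \<mu> * (t / (1 - 2 * \<mu>)) \<le> 2 * \<mu> * 1" using \<open>t / (1 - 2 * \<mu>) \<le> 1\<close> assms by (intro mult_left_mono) auto
    moreover have "2 * \<mu> * (t / (1 - 2 * \<mu>)) \<ge> 0" using assms p by simp
    ultimately show ?thesis unfolding k using assms(1) by linarith
  next
    case False
    then have "t / (1 - 2 * \<mu>) \<ge> 1" using p by simp
    then have "trunc \<mu> t = 1" by (simp add: trunc_def)
    then show ?thesis using False assms by simp
  qed
qed

text \<open>For \<open>y\<close> with coefficients \<open>cf y k\<close>, the product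
  \<open>f g * y\<close> splits over \<open>h\<close> into \<open>f g * cf y k * u k\<close> with
  \<open>k = g \<otimes> inv h\<close>. Replacing \<open>f g\<close> by
  \<open>u g * p * adj (u g)\<close> turns each term into \<open>u g * (p * z) * adj (u h)\<close>
  with \<open>z\<close> in \<open>S\<close>, which has the shape of a block entry. Almost
  commutation of \<open>p\<close> and \<open>z\<close> moves this entry into the hereditary
  subalgebra of \<open>a\<close>.\<close>

theorem block_approximation:
  assumes Y: "finite Y" "\<And>y. y \<in> Y \<Longrightarrow> e * y = y" and \<delta>: "\<delta> > 0" and s: "e * s = s" "pos s" "s \<noteq> 0"
  shows "\<exists>a c v d. block_alg G e S u a c v \<and> pos a \<and> norm a \<le> 1 \<and>
    (\<exists>r\<in>blocks a v. d = adj r * r) \<and> d \<in> blocks a v \<and> norm d \<le> 1 \<and> norm d > 1 - \<delta> \<and>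
    (\<forall>y\<in>Y. norm (d * y - y * d) < \<delta>) \<and> (\<forall>y\<in>Y. \<exists>z\<in>blocks a v. norm (d * y - z) < \<delta>) \<and> cz (e - d) s"
proof -
  obtain s0 where s0: "s0 \<in> S" "pos s0" "s0 \<noteq> 0" "cz s0 s" using nonzero_below[OF s] by blast
  define \<sigma> where "\<sigma> = (1 / norm s0) *\<^sub>R s0"
  have \<sigma>: "\<sigma> \<in> S" "pos \<sigma>" "norm \<sigma> = 1" "cz \<sigma> s"
    unfolding \<sigma>_def using s0 by (auto intro!: S_scaleR pos_scaleR cz_scaleR)
  have "\<forall>y\<in>Y. \<exists>w. (\<forall>g\<in>carrier G. w g \<in> S) \<and> y = (\<Sum>g\<in>carrier G. w g * u g)" using coeffs Y(2) by blast
  then obtain cf where cf: "\<And>y g. y \<in> Y \<Longrightarrow> g \<in> carrier G \<Longrightarrow> cf y g \<in> S"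
    "\<And>y. y \<in> Y \<Longrightarrow> y = (\<Sum>g\<in>carrier G. cf y g * u g)" by metis
  \<comment> \<open>Coefficients moved by \<open>inv g\<close>. These are the elements that must
    almost commute with \<open>p\<close>, so all of them enter the finite set \<open>F\<close>; the
    case \<open>g = \<one>\<close> contributes the coefficients themselves.\<close>
  define zz where "zz y k g = adj (u g) * cf y k * u g" for y k g
  define F where "F = (\<lambda>(y, k, g). zz y k g) ` (Y \<times> carrier G \<times> carrier G)"
  have finF: "finite F" unfolding F_def using Y(1) finG by auto
  have zzF: "zz y k g \<in> F" if "y \<in> Y" "k \<in> carrier G" "g \<in> carrier G" for y k g
    unfolding F_def using that by force
  have zzS: "zz y k g \<in> S" if "y \<in> Y" "k \<in> carrier G" "g \<in> carrier G" for y k g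
    using u_conj[of "inv g" "cf y k"] that cf(1) by (simp add: zz_def adj_u)
  have FS: "F \<subseteq> S" unfolding F_def using zzS by auto
  have cfF: "cf y k \<in> F" if "y \<in> Y" "k \<in> carrier G" for y k
  proof -
    have "zz y k \<one> = cf y k" using S_e[OF cf(1)[OF that]] by (simp add: zz_def e_comm[of "cf y k", symmetric])
    then show ?thesis using zzF[OF that one_closed] by simp
  qed
  define T where "T = 1 + (\<Sum>z\<in>F. norm z) + (\<Sum>y\<in>Y. norm y)"
  have T: "T \<ge> 1" unfolding T_def by (simp add: sum_nonneg)
  have TF: "norm z \<le> T" if "z \<in> F" for z
  proof -
    have "norm z \<le> (\<Sum>z\<in>F. norm z)" by (rule member_le_sum) (use that finF in auto)
    moreover have "0 \<le> (\<Sum>y\<in>Y. norm y)" by (simp add: sum_nonneg)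
    ultimately show ?thesis unfolding T_def by linarith
  qed
  have TY: "norm y \<le> T" if "y \<in> Y" for y
  proof -
    have "norm y \<le> (\<Sum>y\<in>Y. norm y)" by (rule member_le_sum) (use that Y in auto)
    moreover have "0 \<le> (\<Sum>z\<in>F. norm z)" by (simp add: sum_nonneg)
    ultimately show ?thesis unfolding T_def by linarith
  qed
  define n where "n = real (card (carrier G))"
  have n: "n \<ge> 1" using card_pos by (simp add: n_def)
  \<comment> \<open>\<open>d\<close> ends up within \<open>4 * \<mu>\<close> of \<open>f0\<close>,
    which costs at most \<open>8 * (\<mu> * T)\<close> in a commutator with \<open>y\<close>; the
    remaining errors are at most \<open>\<mu> * T\<close>.\<close>
  define \<mu> where "\<mu> = min (1/8) (\<delta> / (20 * T))"
  have \<mu>: "\<mu> > 0" "\<mu> \<le> 1/8" "20 * (\<mu> * T) \<le> \<delta>"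
  proof -
    show "\<mu> > 0" using \<delta> T by (simp add: \<mu>_def)
    show "\<mu> \<le> 1/8" unfolding \<mu>_def by (rule min.cobounded1)
    have "\<mu> \<le> \<delta> / (20 * T)" unfolding \<mu>_def by (rule min.cobounded2)
    then show "20 * (\<mu> * T) \<le> \<delta>" using T by (simp add: pos_le_divide_eq ac_simps)
  qed
  \<comment> \<open>There are \<open>n * n\<close> block entries, each off by a few multiples of
    \<open>\<omega>\<close>.\<close>
  define \<omega> where "\<omega> = \<mu> / (8 * (n * n))"
  have nn: "n * n \<ge> n" using n by simp
  then have nn1: "n * n \<ge> 1" using n by linarith
  have \<omega>: "\<omega> > 0" "8 * (n * n * \<omega>) = \<mu>"
    using \<mu>(1) n by (simp_all add: \<omega>_def)
  have \<omega>1: "\<omega> \<le> n * n * \<omega>" "n * \<omega> \<le> n * n * \<omega>" 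
    using \<omega>(1) nn mult_right_mono[OF nn1, of \<omega>] by (auto intro!: mult_right_mono)
  have \<omega>2: "\<omega> \<le> 1" using \<omega>1(1) \<omega>(2) \<mu>(2) by linarith
  \<comment> \<open>Its value at \<open>p\<close> is the root \<open>ra\<close> of \<open>a\<close>.
    Working with the root allows one factor on each side of a block entry.\<close>
  define \<rho> where "\<rho> = (\<lambda>t. sqrt (max (t - \<omega>) 0))"
  have c\<rho>: "cont \<rho>" unfolding \<rho>_def by (intro continuous_intros)
  obtain d1 where d1: "d1 > 0" "\<And>a b x::'v. adj a = a \<Longrightarrow> adj b = b \<Longrightarrow> norm a \<le> T \<Longrightarrow> norm b \<le> T \<Longrightarrow> norm x \<le> T \<Longrightarrow>
     norm (a * x - x * b) < d1 \<Longrightarrow> norm (fc \<rho> a * x - x * fc \<rho> b) < \<omega>"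
    using fc_intertwine_approx[OF c\<rho> \<omega>(1), of T, where ?'a='v] by blast
  obtain d2 where d2: "d2 > 0" "\<And>f. (\<forall>g\<in>carrier G. f g \<in> S \<and> pos (f g) \<and> norm (f g) \<le> 1) \<Longrightarrow>
    (\<forall>g\<in>carrier G. \<forall>h\<in>carrier G. g \<noteq> h \<longrightarrow> f g * f h = 0) \<Longrightarrow>
    (\<forall>g\<in>carrier G. norm (u g * f \<one> * adj (u g) - f g) \<le> d2) \<Longrightarrow>
    (\<exists>v. (\<forall>g\<in>carrier G. e * v g = v g \<and> norm (v g - u g * fc (ramp \<omega>) (f \<one>)) < \<omega>) \<and>
      (\<forall>g\<in>carrier G. \<forall>h\<in>carrier G. adj (v g) * v h = (if g = h then fc (ramp \<omega>) (f \<one>) * fc (ramp \<omega>) (f \<one>) else 0)))"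
    using matrix_units[OF \<omega>(1) \<omega>2 \<omega>(1)] by blast
  \<comment> \<open>No tolerance so far refers to the Rokhlin elements; they are chosen only now,
    with this precision.\<close>
  define \<epsilon> where "\<epsilon> = min \<omega> (min d1 d2)"
  have \<epsilon>: "\<epsilon> > 0" "\<epsilon> \<le> \<omega>" "\<epsilon> \<le> d1" "\<epsilon> \<le> d2" using \<omega>(1) d1(1) d2(1) by (auto simp: \<epsilon>_def)
  obtain f where "rokhlin_family G e S u F \<epsilon> \<sigma> f" using rokhlin[OF finF FS \<epsilon>(1) \<sigma>(1-3)] by blast
  note f = rokhlin_familyD[OF this]
  define f0 where "f0 = (\<Sum>g\<in>carrier G. f g)"
  have f0: "pos f0" "norm f0 \<le> 1" "f0 \<in> S" "pos (e - f0)"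
    unfolding f0_def by (rule rokhlin_sum; (rule f(1) f(2); assumption))+
  define p where "p = f \<one>"
  have p: "p \<in> S" "pos p" "norm p \<le> 1" using f(1) by (auto simp: p_def)
  note sp = pos_sa[OF p(2)]
  note btw = btw_pos[OF p(2,3)]
  have upu: "norm (u g * p * adj (u g) - f g) \<le> \<epsilon>" if "g \<in> carrier G" for g
    using f(4)[OF that one_closed] that by (simp add: p_def)
  \<comment> \<open>The ramp reaches 1 at the level \<open>\<omega>\<close> where
    \<open>\<rho>\<close> starts, so \<open>K\<close> is a unit for \<open>ra\<close>, and
    \<open>c = K * K\<close> is one for \<open>a\<close>.\<close>
  define K where "K = fc (ramp \<omega>) p"
  have ck: "cont (ramp \<omega>)" by (rule cont_ramp[OF \<omega>(1)])
  have sK: "adj K = K" unfolding K_def by (rule adj_fc[OF ck sp])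
  have nK: "norm K \<le> 1" unfolding K_def by (rule fc_norm_le[OF ck btw]) (simp add: ramp_bounds)
  obtain v where v: "\<And>g. g \<in> carrier G \<Longrightarrow> e * v g = v g" "\<And>g. g \<in> carrier G \<Longrightarrow> norm (v g - u g * K) < \<omega>"
    "\<And>g h. g \<in> carrier G \<Longrightarrow> h \<in> carrier G \<Longrightarrow> adj (v g) * v h = (if g = h then K * K else 0)"
  proof -
    have 1: "\<forall>g\<in>carrier G. f g \<in> S \<and> pos (f g) \<and> norm (f g) \<le> 1" using f(1) by blast
    have 2: "\<forall>g\<in>carrier G. \<forall>h\<in>carrier G. g \<noteq> h \<longrightarrow> f g * f h = 0" using f(2) by blast
    have 3: "\<forall>g\<in>carrier G. norm (u g * f \<one> * adj (u g) - f g) \<le> d2" using upu \<epsilon>(4) unfolding p_def by fastforce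
    from d2(2)[OF 1 2 3] obtain v where "(\<forall>g\<in>carrier G. e * v g = v g \<and> norm (v g - u g * K) < \<omega>) \<and>
      (\<forall>g\<in>carrier G. \<forall>h\<in>carrier G. adj (v g) * v h = (if g = h then K * K else 0))" unfolding K_def p_def by blast
    then show ?thesis by (intro that[of v]) auto
  qed
  define ra where "ra = fc \<rho> p"
  define a where "a = ra * ra"
  have \<rho>0: "\<rho> t \<ge> 0" for t by (simp add: \<rho>_def)
  have sra: "adj ra = ra" unfolding ra_def by (rule adj_fc[OF c\<rho> sp])
  have raS: "ra \<in> S" unfolding ra_def by (rule S_fc[OF c\<rho> sp _ p(1)]) (use \<omega>(1) in \<open>simp add: \<rho>_def\<close>)
  have nra: "norm ra \<le> 1" unfolding ra_def by (rule fc_norm_le[OF c\<rho> btw]) (use \<omega>(1) in \<open>simp add: \<rho>_def\<close>)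
  have Kra: "K * ra = ra" "ra * K = ra"
  proof -
    have "fc (\<lambda>t. ramp \<omega> t * \<rho> t) p = fc \<rho> p"
    proof (rule fc_cong[OF continuous_on_mult[OF ck c\<rho>] c\<rho> btw])
      fix t show "ramp \<omega> t * \<rho> t = \<rho> t" using ramp_eq(2)[OF \<omega>(1), of t] by (cases "\<omega> \<le> t") (auto simp: \<rho>_def)
    qed
    then show 1: "K * ra = ra" by (simp add: K_def ra_def fc_mult[OF ck c\<rho> sp])
    have "ra * K = adj (K * ra)" by (simp add: adj_mult sK sra)
    then show "ra * K = ra" by (simp add: 1 sra)
  qed
  have aS: "a \<in> S" unfolding a_def by (rule S_mult[OF raS raS])
  have pa: "pos a" unfolding a_def by (rule pos_square[OF sra])
  note sa = pos_sa[OF pa]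
  have na: "norm a \<le> 1" unfolding a_def using norm_sq_sa[OF sra] nra by (simp add: power_le_one)
  have Ka: "K * a = a" "a * K = a" by (simp add: a_def Kra flip: mult.assoc) (simp add: a_def Kra mult.assoc)
  have rta: "rt a = ra" unfolding a_def ra_def by (rule rt_fc_square[OF c\<rho> btw \<rho>0])
  have ap: "norm (p - a) \<le> \<omega>"
  proof -
    have "norm (fc (\<lambda>t. t) p - fc (\<lambda>t. \<rho> t * \<rho> t) p) \<le> \<omega>"
      by (rule fc_norm_diff_le[OF continuous_on_id continuous_on_mult[OF c\<rho> c\<rho>] btw]) (use \<omega>(1) in \<open>auto simp: \<rho>_def max_def\<close>)
    then show ?thesis by (simp add: a_def ra_def fc_id[OF sp] fc_mult[OF c\<rho> c\<rho> sp])
  qed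
  define c where "c = K * K"
  have ca: "c * a = a" "a * c = a" by (simp_all add: c_def Ka mult.assoc) (simp add: Ka flip: mult.assoc)
  note vv = v(3)[folded c_def]
  interpret MU: block_alg G e S u a c v
    by unfold_locales (use aS sa v(1) vv ca in auto)
  have nv: "norm (v g) \<le> 1" if "g \<in> carrier G" for g
  proof -
    have "(norm (v g))\<^sup>2 = norm (K * K)" using vv[OF that that] by (simp add: cstar_norm[symmetric] c_def)
    also have "\<dots> \<le> 1" using norm_sq_sa[OF sK] nK by (simp add: power_le_one)
    finally show ?thesis using power2_le_imp_le[of "norm (v g)" 1] by simp
  qed
  have nuK: "norm (u g * K) \<le> 1" if "g \<in> carrier G" for g
    using norm_mult_u_le(2)[OF that, of K] nK by simp
  \<comment> \<open>The exact columns \<open>v\<close> may be exchanged for \<open>u\<close> around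
    an entry that absorbs \<open>K\<close>, because \<open>v g\<close> is within
    \<open>\<omega>\<close> of \<open>u g * K\<close>.\<close>
  have vqv: "norm (v g * q * adj (v h) - u g * q * adj (u h)) \<le> 2 * \<omega> * N"
    if gh: "g \<in> carrier G" "h \<in> carrier G" and q: "K * q = q" "q * K = q" "norm q \<le> N" for g h q N
  proof -
    have "(u g * K) * q * (K * adj (u h)) = u g * (K * q * K) * adj (u h)" by (simp only: mult.assoc)
    then have "u g * q * adj (u h) = (u g * K) * q * adj (u h * K)" by (simp only: q adj_mult sK)
    then have "v g * q * adj (v h) - u g * q * adj (u h) = (v g - u g * K) * q * adj (v h) + (u g * K) * q * adj (v h - u h * K)"
      by (simp add: algebra_simps adj_diff)
    also have "norm \<dots> \<le> \<omega> * N * 1 + 1 * N * \<omega>"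
    proof (rule order_trans[OF norm_triangle_ineq add_mono])
      have N: "0 \<le> N" using q(3) norm_ge_zero order_trans by blast
      show "norm ((v g - u g * K) * q * adj (v h)) \<le> \<omega> * N * 1"
        by (rule order_trans[OF norm_mult_ineq mult_mono[OF order_trans[OF norm_mult_ineq mult_mono[OF less_imp_le[OF v(2)[OF gh(1)]] q(3)]]]])
          (use nv[OF gh(2)] \<omega>(1) N in auto)
      show "norm ((u g * K) * q * adj (v h - u h * K)) \<le> 1 * N * \<omega>"
        by (rule order_trans[OF norm_mult_ineq mult_mono[OF order_trans[OF norm_mult_ineq mult_mono[OF nuK[OF gh(1)] q(3)]]]])
          (use less_imp_le[OF v(2)[OF gh(2)]] N in auto)
    qed
    finally show ?thesis by (simp add: algebra_simps)
  qed
  have her_ra: "ra * z * ra \<in> her a" if "z \<in> S" for z using her_rt[OF pa aS that] unfolding rta .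
  have aH: "a \<in> her a"
  proof -
    have "ra * e = ra" using S_e[OF raS] by (simp only: e_comm)
    then show ?thesis using her_ra[OF e_S] by (simp add: a_def)
  qed
  define d0 where "d0 = blk v (\<lambda>g h. if g = h then a else 0)"
  have d0B: "d0 \<in> blocks a v" unfolding d0_def by (rule MU.blocksI) (auto simp: aH MU.her_0)
  have d0_sum: "d0 = (\<Sum>g\<in>carrier G. v g * a * adj (v g))"
  proof -
    have "d0 = (\<Sum>g\<in>carrier G. \<Sum>h\<in>carrier G. if h = g then v g * a * adj (v g) else 0)"
      unfolding d0_def blk_def by (intro sum.cong refl) auto
    then show ?thesis using finG by simp
  qed
  have pd0: "pos d0" unfolding d0_sum by (intro pos_sum pos_conj' pa)
  note sd0 = pos_sa[OF pd0]
  have ed0: "e * d0 = d0" by (rule MU.blocks_e[OF d0B])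
  \<comment> \<open>Per summand the errors are \<open>2 * \<omega>\<close> from \<open>v\<close> to
    \<open>u\<close>, \<open>\<omega>\<close> from \<open>a\<close> to \<open>p\<close>, and
    \<open>\<omega>\<close> from covariance of the Rokhlin elements.\<close>
  have near0: "norm (d0 - f0) \<le> \<mu> / 2"
  proof -
    have "norm (v g * a * adj (v g) - f g) \<le> 4 * \<omega>" if g: "g \<in> carrier G" for g
    proof -
      have "v g * a * adj (v g) - f g = (v g * a * adj (v g) - u g * a * adj (u g)) + (u g * (a - p) * adj (u g) + (u g * p * adj (u g) - f g))"
        by (simp add: algebra_simps)
      also have "norm \<dots> \<le> 2 * \<omega> * 1 + (\<omega> + \<omega>)"
      proof (intro order_trans[OF norm_triangle_ineq] add_mono vqv g Ka na)
        show "norm (u g * (a - p) * adj (u g)) \<le> \<omega>"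
          using order_trans[OF norm_mult_u_le(3)[OF g] norm_mult_u_le(2)[OF g], of "a - p"] ap by (simp add: norm_minus_commute)
        show "norm (u g * p * adj (u g) - f g) \<le> \<omega>" using upu[OF g] \<epsilon>(2) by simp
      qed
      finally show ?thesis by simp
    qed
    then have "norm (d0 - f0) \<le> (\<Sum>g\<in>carrier G. 4 * \<omega>)"
      unfolding d0_sum f0_def sum_subtractf[symmetric] by (intro order_trans[OF norm_sum] sum_mono)
    also have "\<dots> = 4 * (n * \<omega>)" by (simp add: n_def)
    also have "\<dots> \<le> \<mu> / 2" using \<omega>1(2) \<omega>(2) by linarith
    finally show ?thesis .
  qed
  have nd0: "norm d0 \<le> 1 + \<mu>"
    using norm_triangle_ineq[of "d0 - f0" f0] near0 f0(2) \<mu>(1) by simp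
  note btw0 = btw_pos[OF pd0 nd0]
  let ?k = "trunc \<mu>"
  have ckk: "cont ?k" by (rule cont_trunc) (use \<mu>(2) in simp)
  have k0: "?k 0 = 0" by (simp add: trunc_def)
  define d where "d = fc ?k d0"
  have memB: "fc \<phi> d0 \<in> blocks a v" if "cont \<phi>" "\<phi> 0 = 0" for \<phi>
  proof (rule fc_mem[OF that(1) sd0 that(2) MU.closed_blocks d0B MU.blocks_add MU.blocks_mult])
    fix r x assume "x \<in> blocks a v"
    then have "sc (complex_of_real r) * x \<in> blocks a v" by (rule MU.blocks_sc)
    then show "r *\<^sub>R x \<in> blocks a v" by (simp add: sc_of_real scaleR_conv_of_real)
  qed
  have dB: "d \<in> blocks a v" unfolding d_def by (rule memB[OF ckk k0])
  \<comment> \<open>Positivity of \<open>d\<close> is demanded relative to the block algebra, so a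
    root of \<open>d\<close> is exhibited inside it.\<close>
  define r where "r = fc (\<lambda>t. sqrt (?k t)) d0"
  have cr: "cont (\<lambda>t. sqrt (?k t))" by (intro continuous_intros ckk)
  have rB: "r \<in> blocks a v" unfolding r_def by (rule memB[OF cr]) (simp add: k0)
  have rr: "d = adj r * r"
  proof -
    have "adj r * r = fc (\<lambda>t. sqrt (?k t) * sqrt (?k t)) d0"
      unfolding r_def adj_fc[OF cr sd0] by (rule fc_mult[OF cr cr sd0, symmetric])
    also have "\<dots> = d" unfolding d_def
    proof (rule fc_cong[OF continuous_on_mult[OF cr cr] ckk btw0])
      fix t assume "0 \<le> t" "t \<le> 1 + \<mu>"
      then show "sqrt (?k t) * sqrt (?k t) = ?k t" using trunc_bounds(1)[OF \<mu>(1,2), of t] by simp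
    qed
    finally show ?thesis by (rule sym)
  qed
  have nd: "norm d \<le> 1" unfolding d_def
  proof (rule fc_norm_le[OF ckk btw0])
    fix t assume "0 \<le> t" "t \<le> 1 + \<mu>"
    then show "\<bar>?k t\<bar> \<le> 1" using trunc_bounds(1,2)[OF \<mu>(1,2), of t] by simp
  qed
  have "norm (fc ?k d0 - fc (\<lambda>t. t) d0) \<le> 3 * \<mu>"
    by (rule fc_norm_diff_le[OF ckk continuous_on_id btw0]) (rule trunc_bounds(3)[OF \<mu>(1,2)])
  then have df: "norm (d - f0) \<le> 4 * \<mu>"
    using norm_triangle_ineq[of "d - d0" "d0 - f0"] near0 \<mu>(1) by (simp add: d_def fc_id[OF sd0])
  have \<mu>T: "\<mu> \<le> \<mu> * T" using \<mu>(1) T by (simp add: mult_le_cancel_left1)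
  have \<epsilon>\<mu>: "\<epsilon> \<le> \<mu> / 8" using \<epsilon>(2) \<omega>1(1) \<omega>(2) by linarith
  \<comment> \<open>From the last Rokhlin condition: \<open>f0 * (\<sigma> * f0)\<close> has norm at
    most that of \<open>f0\<close>, as \<open>\<sigma>\<close> and \<open>f0\<close> are
    contractions.\<close>
  have nd_low: "norm d > 1 - \<delta>"
  proof -
    have "1 - \<epsilon> < norm (f0 * (\<sigma> * f0))" using f(5) by (simp only: f0_def)
    also have "\<dots> \<le> norm f0 * (1 * 1)"
      by (rule order_trans[OF norm_mult_ineq mult_left_mono[OF order_trans[OF norm_mult_ineq mult_mono]]]) (use \<sigma>(3) f0(2) in auto)
    finally have "1 - \<epsilon> < norm f0" by simp
    moreover have "norm f0 \<le> norm d + 4 * \<mu>" using norm_triangle_ineq[of d "f0 - d"] df by (simp add: norm_minus_commute)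
    ultimately show ?thesis using \<epsilon>\<mu> \<mu>(1,3) \<mu>T by linarith
  qed
  have dfy: "norm ((d - f0) * y) \<le> 4 * (\<mu> * T)" "norm (y * (d - f0)) \<le> 4 * (\<mu> * T)" if "y \<in> Y" for y
  proof -
    show "norm ((d - f0) * y) \<le> 4 * (\<mu> * T)"
      using order_trans[OF norm_mult_ineq mult_mono[OF df TY[OF that]]] \<mu>(1) by (simp add: mult.assoc)
    show "norm (y * (d - f0)) \<le> 4 * (\<mu> * T)"
      using order_trans[OF norm_mult_ineq mult_mono[OF TY[OF that] df]] T by (simp add: ac_simps)
  qed
  have f0u: "norm (f0 * u k - u k * f0) \<le> n * \<omega>" if k: "k \<in> carrier G" for k
  proof -
    have "u k * f0 * adj (u k) * u k = u k * (f0 * (adj (u k) * u k))" by (simp only: mult.assoc)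
    also have "\<dots> = u k * f0" using S_e[OF f0(3)] by (simp only: adj_u_u[OF k] e_comm[of f0, symmetric])
    finally have "f0 * u k - u k * f0 = (f0 - u k * f0 * adj (u k)) * u k" by (simp add: left_diff_distrib)
    then have "norm (f0 * u k - u k * f0) \<le> norm (f0 - u k * f0 * adj (u k))" using norm_mult_u_le(1)[OF k] by simp
    also have "f0 - u k * f0 * adj (u k) = (\<Sum>g\<in>carrier G. f (k \<otimes> g) - u k * f g * adj (u k))"
      unfolding sum_subtractf sum_left_mult[OF k] by (simp only: f0_def sum_distrib_left sum_distrib_right)
    also have "norm \<dots> \<le> (\<Sum>g\<in>carrier G. \<omega>)"
    proof (rule order_trans[OF norm_sum sum_mono])
      fix g assume "g \<in> carrier G"
      then show "norm (f (k \<otimes> g) - u k * f g * adj (u k)) \<le> \<omega>" using f(4)[OF k] \<epsilon>(2) by (fastforce simp: norm_minus_commute)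
    qed
    finally show ?thesis by (simp add: n_def)
  qed
  have f0F: "norm (f0 * z - z * f0) \<le> n * \<omega>" if z: "z \<in> F" for z
  proof -
    have "f0 * z - z * f0 = (\<Sum>g\<in>carrier G. f g * z - z * f g)"
      by (simp only: f0_def sum_distrib_left sum_distrib_right sum_subtractf)
    also have "norm \<dots> \<le> (\<Sum>g\<in>carrier G. \<omega>)"
      by (rule order_trans[OF norm_sum sum_mono]) (use f(3)[OF z] \<epsilon>(2) in fastforce)
    finally show ?thesis by (simp add: n_def)
  qed
  have comm: "norm (d * y - y * d) < \<delta>" if y: "y \<in> Y" for y
  proof -
    have "f0 * y - y * f0 = (\<Sum>k\<in>carrier G. f0 * (cf y k * u k) - (cf y k * u k) * f0)"
      by (subst (1 2) cf(2)[OF y]) (simp only: sum_distrib_left sum_distrib_right sum_subtractf)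
    also have "norm \<dots> \<le> (\<Sum>k\<in>carrier G. n * \<omega> + T * (n * \<omega>))"
    proof (rule order_trans[OF norm_sum sum_mono])
      fix k assume k: "k \<in> carrier G"
      have "f0 * (cf y k * u k) - (cf y k * u k) * f0 = (f0 * cf y k - cf y k * f0) * u k + cf y k * (f0 * u k - u k * f0)"
        by (simp add: algebra_simps)
      also have "norm \<dots> \<le> n * \<omega> + T * (n * \<omega>)"
        by (intro order_trans[OF norm_triangle_ineq] add_mono order_trans[OF norm_mult_u_le(1)[OF k] f0F[OF cfF[OF y k]]]
            order_trans[OF norm_mult_ineq mult_mono[OF TF[OF cfF[OF y k]] f0u[OF k]]]) (use T in auto)
      finally show "norm (f0 * (cf y k * u k) - (cf y k * u k) * f0) \<le> n * \<omega> + T * (n * \<omega>)" .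
    qed
    also have "\<dots> = (1 + T) * (n * n * \<omega>)" by (simp add: n_def algebra_simps)
    also have "\<dots> \<le> (2 * T) * (n * n * \<omega>)" using T \<omega>(1) n by (intro mult_right_mono) auto
    also have "\<dots> = (\<mu> * T) / 4" using \<omega>(2) by (simp add: \<omega>(2)[symmetric])
    finally have 1: "norm (f0 * y - y * f0) \<le> (\<mu> * T) / 4" .
    have "d * y - y * d = (f0 * y - y * f0) + ((d - f0) * y - y * (d - f0))" by (simp add: algebra_simps)
    also have "norm \<dots> \<le> (\<mu> * T) / 4 + (4 * (\<mu> * T) + 4 * (\<mu> * T))"
      by (intro order_trans[OF norm_triangle_ineq] add_mono 1 order_trans[OF norm_triangle_ineq4] dfy y)
    also have "\<dots> < \<delta>" using \<mu>(1,3) \<mu>T \<delta> by linarith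
    finally show ?thesis .
  qed
  have appr: "\<exists>z\<in>blocks a v. norm (d * y - z) < \<delta>" if y: "y \<in> Y" for y
  proof
    \<comment> \<open>The coefficient of \<open>y\<close> at \<open>g \<otimes> inv h\<close>, moved
      back by \<open>g\<close> and compressed by the root of \<open>a\<close>.\<close>
    define Q where "Q g h = ra * zz y (g \<otimes> inv h) g * ra" for g h
    show "blk v Q \<in> blocks a v"
      by (rule MU.blocksI) (auto simp: Q_def intro!: her_ra zzS y)
    have term_le: "norm (f g * (cf y (g \<otimes> inv h) * u (g \<otimes> inv h)) - v g * Q g h * adj (v h)) \<le> 5 * \<omega> * T"
      if g: "g \<in> carrier G" and h: "h \<in> carrier G" for g h
    proof -
      let ?k = "g \<otimes> inv h"
      have k: "?k \<in> carrier G" using g h by simp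
      let ?z = "zz y ?k g" and ?Y = "cf y ?k"
      have zF: "?z \<in> F" by (rule zzF[OF y k g])
      have uu: "adj (u g) * ?Y * u ?k = ?z * adj (u h)"
      proof -
        have "?z * adj (u h) = adj (u g) * ?Y * (u g * u (inv h))" by (simp only: zz_def adj_u[OF h] mult.assoc)
        then show ?thesis using g h by (simp add: u_mult)
      qed
      \<comment> \<open>Three sources of error: \<open>f g\<close> against the translate of
        \<open>p\<close>, \<open>p * ?z\<close> against the compressed entry, and \<open>u\<close>
        against \<open>v\<close>.\<close>
      have e1: "f g * (?Y * u ?k) - v g * Q g h * adj (v h) =
         (f g - u g * p * adj (u g)) * ?Y * u ?k + (u g * (p * ?z - Q g h) * adj (u h) - (v g * Q g h * adj (v h) - u g * Q g h * adj (u h)))"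
      proof -
        have "u g * p * adj (u g) * ?Y * u ?k = u g * p * (adj (u g) * ?Y * u ?k)" by (simp only: mult.assoc)
        also have "\<dots> = u g * (p * ?z) * adj (u h)" unfolding uu by (simp only: mult.assoc)
        finally show ?thesis by (simp add: left_diff_distrib right_diff_distrib mult.assoc)
      qed
      have zr: "norm (p * ?z - ?z * p) < d1" using f(3)[OF zF one_closed] \<epsilon>(3) unfolding p_def by linarith
      have nz: "norm ?z \<le> T" by (rule TF[OF zF])
      have pT: "norm p \<le> T" using p(3) T by simp
      have raz: "norm (ra * ?z - ?z * ra) \<le> \<omega>" unfolding ra_def
        by (rule less_imp_le[OF d1(2)[OF sp sp pT pT nz zr]])
      have nQ: "norm (Q g h) \<le> T"
      proof -
        have "norm (ra * ?z) \<le> 1 * T" by (rule order_trans[OF norm_mult_ineq mult_mono[OF nra nz]]) auto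
        then have "norm (ra * ?z * ra) \<le> (1 * T) * 1" using T by (intro order_trans[OF norm_mult_ineq mult_mono[OF _ nra]]) auto
        then show ?thesis by (simp add: Q_def)
      qed
      have KQ: "K * Q g h = Q g h" "Q g h * K = Q g h"
        by (simp add: Q_def Kra flip: mult.assoc) (simp add: Q_def Kra mult.assoc)
      have n1: "norm ((f g - u g * p * adj (u g)) * ?Y * u ?k) \<le> \<omega> * T"
      proof (rule order_trans[OF norm_mult_u_le(1)[OF k] order_trans[OF norm_mult_ineq mult_mono[OF _ TF[OF cfF[OF y k]]]]])
        show "norm (f g - u g * p * adj (u g)) \<le> \<omega>" using upu[OF g] \<epsilon>(2) by (simp add: norm_minus_commute)
      qed (use \<omega>(1) in auto)
      have "p * ?z - Q g h = (p - a) * ?z + ra * (ra * ?z - ?z * ra)" by (simp add: Q_def a_def algebra_simps)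
      also have "norm \<dots> \<le> \<omega> * T + 1 * \<omega>"
        by (rule order_trans[OF norm_triangle_ineq add_mono[OF order_trans[OF norm_mult_ineq mult_mono[OF ap nz]]
             order_trans[OF norm_mult_ineq mult_mono[OF nra raz]]]]) (use \<omega>(1) in auto)
      finally have "norm (u g * (p * ?z - Q g h) * adj (u h)) \<le> \<omega> * T + 1 * \<omega>"
        using order_trans[OF norm_mult_u_le(3)[OF h] norm_mult_u_le(2)[OF g]] order_trans by blast
      then have "norm (f g * (?Y * u ?k) - v g * Q g h * adj (v h)) \<le> \<omega> * T + ((\<omega> * T + 1 * \<omega>) + 2 * \<omega> * T)"
        unfolding e1 by (intro order_trans[OF norm_triangle_ineq] add_mono n1 order_trans[OF norm_triangle_ineq4] vqv g h KQ nQ)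
      also have "\<dots> \<le> 5 * \<omega> * T" using T \<omega>(1) mult_left_mono[OF T, of \<omega>] by simp
      finally show ?thesis .
    qed
    have "f0 * y = (\<Sum>g\<in>carrier G. f g * y)" by (simp only: f0_def sum_distrib_right)
    also have "\<dots> = (\<Sum>g\<in>carrier G. \<Sum>h\<in>carrier G. f g * (cf y (g \<otimes> inv h) * u (g \<otimes> inv h)))"
    proof (rule sum.cong[OF refl])
      fix g assume g: "g \<in> carrier G"
      show "f g * y = (\<Sum>h\<in>carrier G. f g * (cf y (g \<otimes> inv h) * u (g \<otimes> inv h)))"
        by (subst cf(2)[OF y], subst sum_shift[OF g, symmetric]) (simp only: sum_distrib_left)
    qed
    finally have f0y: "f0 * y - blk v Q = (\<Sum>g\<in>carrier G. \<Sum>h\<in>carrier G. f g * (cf y (g \<otimes> inv h) * u (g \<otimes> inv h)) - v g * Q g h * adj (v h))"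
      by (simp only: blk_def sum_subtractf)
    have "norm (f0 * y - blk v Q) \<le> (\<Sum>g\<in>carrier G. \<Sum>h\<in>carrier G. 5 * \<omega> * T)"
      unfolding f0y by (intro order_trans[OF norm_sum] sum_mono term_le)
    also have "\<dots> = 5 * T * (n * n * \<omega>)" by (simp add: n_def)
    also have "\<dots> \<le> \<mu> * T" using \<omega>(2) T \<mu>(1) by (simp add: \<omega>(2)[symmetric])
    finally have 1: "norm (f0 * y - blk v Q) \<le> \<mu> * T" .
    have "d * y - blk v Q = (d - f0) * y + (f0 * y - blk v Q)" by (simp add: algebra_simps)
    also have "norm \<dots> \<le> 4 * (\<mu> * T) + \<mu> * T"
      by (intro order_trans[OF norm_triangle_ineq] add_mono 1 dfy y)
    also have "\<dots> < \<delta>" using \<mu>(1,3) \<mu>T \<delta> by linarith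
    finally show "norm (d * y - blk v Q) < \<delta>" .
  qed
  have "norm ((e - d0) - (e - f0)) \<le> \<mu>" using near0 \<mu>(1) by (simp add: norm_minus_commute)
  \<comment> \<open>\<open>d\<close> is the truncation of \<open>d0\<close> matching the distance
    \<open>\<mu>\<close> between \<open>e - d0\<close> and \<open>e - f0\<close>.\<close>
  then have "cz (e - d) (e - f0)" unfolding d_def
    by (intro cz_one_minus[OF e_comm e_e adj_e sd0 ed0 f0(4) \<mu>(1)]) (use \<mu>(2) in simp_all)
  then have "cz (e - d) s" using f(6) \<sigma>(4) cz_trans unfolding f0_def by blast
  then show ?thesis using MU.block_alg_axioms pa na rB rr dB nd nd_low comm appr
    by (intro exI[of _ a] exI[of _ c] exI[of _ v] exI[of _ d]) blast
qed

end

section \<open>Cuntz subequivalence through scalars\<close>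

lemma matrix_sel:
  "ca_carr (matrix_alg D m) = {X. (\<forall>i<m. \<forall>j<m. X i j \<in> ca_carr D) \<and> (\<forall>i j. \<not> (i < m \<and> j < m) \<longrightarrow> X i j = ca_zero D)}"
  "ca_add (matrix_alg D m) X Y = (\<lambda>i j. if i < m \<and> j < m then ca_add D (X i j) (Y i j) else ca_zero D)"
  "ca_smul (matrix_alg D m) c X = (\<lambda>i j. if i < m \<and> j < m then ca_smul D c (X i j) else ca_zero D)"
  "ca_mul (matrix_alg D m) X Y = (\<lambda>i j. if i < m \<and> j < m then ca_sum D (\<lambda>k. ca_mul D (X i k) (Y k j)) {..<m} else ca_zero D)"
  "ca_star (matrix_alg D m) X = (\<lambda>i j. if i < m \<and> j < m then ca_star D (X j i) else ca_zero D)"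
  unfolding matrix_alg_def cstar_alg.select_convs by (rule refl)+

context ucsalg begin

lemma matrix_norm:
  assumes X: "X \<in> ca_carr (matrix_alg D m)"
  shows "ca_norm (matrix_alg D m) X = opn {..<m} (\<lambda>i j. emb D (X i j))"
proof -
  have Xin: "i < m \<Longrightarrow> j < m \<Longrightarrow> X i j \<in> ca_carr D" for i j using X by (simp add: matrix_sel)
  have "ca_norm (matrix_alg D m) X = Sup {sqrt (ca_norm D (ca_sum D (\<lambda>i. ca_mul D (ca_star D (mat_vec D m X v i)) (mat_vec D m X v i)) {..<m})) | v.
      (\<forall>i\<in>{..<m}. v i \<in> ca_carr D) \<and> ca_norm D (ca_sum D (\<lambda>i. ca_mul D (ca_star D (v i)) (v i)) {..<m}) \<le> 1}"
    unfolding matrix_alg_def cstar_alg.select_convs vec_inner_def by (simp only: lessThan_iff Ball_def)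
  also have "\<dots> = opn {..<m} (\<lambda>i j. emb D (X i j))"
  proof (rule Sup_hilbert_module)
    fix v i assume v: "\<forall>i\<in>{..<m}. v i \<in> ca_carr D" and i: "i \<in> {..<m}"
    show "mat_vec D m X v i \<in> ca_carr D" unfolding mat_vec_def using v i Xin by (intro ca_sum_emb(1)) auto
    show "emb D (mat_vec D m X v i) = mvec {..<m} (\<lambda>i j. emb D (X i j)) (\<lambda>i. emb D (v i)) i"
      unfolding mat_vec_def mvec_def using v i Xin by (subst ca_sum_emb(2)) (auto simp: emb_mul)
  qed (use Xin in auto)
  finally show ?thesis .
qed

text \<open>The corner matrix of \<open>b\<close> has a single nonzero entry, so among the entries
  of \<open>X\<close> only \<open>X 0 0\<close> contributes to the conjugate at position 0,
  0.\<close>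

lemma matrix_conj_corner:
  assumes X: "X \<in> ca_carr (matrix_alg D m)" and m: "m \<ge> 1" and a: "a \<in> ca_carr D" and b: "b \<in> ca_carr D"
  defines "Z \<equiv> ca_minus (matrix_alg D m) (corner D a)
            (ca_mul (matrix_alg D m) (ca_mul (matrix_alg D m) (ca_star (matrix_alg D m) X) (corner D b)) X)"
  shows "Z \<in> ca_carr (matrix_alg D m)"
    and "emb D (Z 0 0) = emb D a - adj (emb D (X 0 0)) * emb D b * emb D (X 0 0)"
proof -
  let ?N = "matrix_alg D m"
  have Xin: "i < m \<Longrightarrow> j < m \<Longrightarrow> X i j \<in> ca_carr D" for i j using X by (simp add: matrix_sel)
  have cin: "corner D x i j \<in> ca_carr D" if "x \<in> ca_carr D" for x i j using that by (simp add: corner_def)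
  have mul_in: "ca_mul ?N U W \<in> ca_carr ?N" if "U \<in> ca_carr ?N" "W \<in> ca_carr ?N" for U W
    using that unfolding matrix_sel by (auto intro!: ca_sum_emb(1))
  have emb_mul': "emb D (ca_mul ?N U W i j) = (\<Sum>k<m. emb D (U i k) * emb D (W k j))"
    if "U \<in> ca_carr ?N" "W \<in> ca_carr ?N" "i < m" "j < m" for U W i j
  proof -
    have "U i k \<in> ca_carr D" "W k j \<in> ca_carr D" if "k < m" for k
      using \<open>U \<in> _\<close> \<open>W \<in> _\<close> \<open>i < m\<close> \<open>j < m\<close> that unfolding matrix_sel by auto
    then have "emb D (ca_sum D (\<lambda>k. ca_mul D (U i k) (W k j)) {..<m}) = (\<Sum>k<m. emb D (ca_mul D (U i k) (W k j)))"
      by (intro ca_sum_emb(2)) auto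
    also have "\<dots> = (\<Sum>k<m. emb D (U i k) * emb D (W k j))"
      by (intro sum.cong refl emb_mul) (use \<open>\<And>k. k < m \<Longrightarrow> U i k \<in> ca_carr D\<close> \<open>\<And>k. k < m \<Longrightarrow> W k j \<in> ca_carr D\<close> in auto)
    finally show ?thesis using that unfolding matrix_sel(4) by simp
  qed
  have star_in': "ca_star ?N X \<in> ca_carr ?N" using X unfolding matrix_sel by auto
  have corner_in: "corner D x \<in> ca_carr ?N" if "x \<in> ca_carr D" for x
    using that m unfolding matrix_sel by (auto simp: corner_def)
  define P where "P = ca_mul ?N (ca_star ?N X) (corner D b)"
  have Pin: "P \<in> ca_carr ?N" unfolding P_def by (intro mul_in star_in' corner_in b)
  define Q where "Q = ca_mul ?N P X"
  have Qin: "Q \<in> ca_carr ?N" unfolding Q_def by (intro mul_in Pin X)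
  have ZQ: "Z = ca_add ?N (corner D a) (ca_smul ?N (-1) Q)" unfolding Z_def ca_minus_def Q_def P_def ..
  show "Z \<in> ca_carr ?N" using Qin corner_in[OF a] unfolding ZQ matrix_sel by auto
  have m0: "0 < m" using m by simp
  have eP: "emb D (P 0 k) = (if k = 0 then adj (emb D (X 0 0)) * emb D b else 0)" if "k < m" for k
  proof -
    have "emb D (P 0 k) = (\<Sum>l<m. emb D (ca_star ?N X 0 l) * emb D (corner D b l k))"
      unfolding P_def by (rule emb_mul'[OF star_in' corner_in[OF b] m0 that])
    also have "\<dots> = (\<Sum>l<m. if l = 0 then (if k = 0 then adj (emb D (X 0 0)) * emb D b else 0) else 0)"
      using m0 Xin by (intro sum.cong refl) (auto simp: corner_def matrix_sel(5) emb_star)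
    finally show ?thesis using m0 by simp
  qed
  have "emb D (Q 0 0) = (\<Sum>k<m. emb D (P 0 k) * emb D (X k 0))" unfolding Q_def by (rule emb_mul'[OF Pin X m0 m0])
  also have "\<dots> = (\<Sum>k<m. if k = 0 then adj (emb D (X 0 0)) * emb D b * emb D (X 0 0) else 0)"
    by (intro sum.cong refl) (auto simp: eP)
  finally have eQ: "emb D (Q 0 0) = adj (emb D (X 0 0)) * emb D b * emb D (X 0 0)" using m0 by simp
  have "Q 0 0 \<in> ca_carr D" using Qin m0 by (simp add: matrix_sel)
  then have "emb D (Z 0 0) = emb D a - emb D (Q 0 0)"
    using m0 a by (simp add: ZQ matrix_sel corner_def emb_add emb_smul sc_minus_1)
  then show "emb D (Z 0 0) = emb D a - adj (emb D (X 0 0)) * emb D b * emb D (X 0 0)" by (simp only: eQ)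
qed

text \<open>A matrix witness is compressed to its entry \<open>X 0 0\<close>, which cannot increase
  the norm of the error; conversely an element of \<open>D\<close> is a matrix of size 1.\<close>

lemma cuntz_below_iff:
  assumes a: "a \<in> ca_carr D" and b: "b \<in> ca_carr D"
  shows "cuntz_below D a b \<longleftrightarrow> (\<forall>\<epsilon>>0. \<exists>r\<in>ca_carr D. norm (emb D a - adj (emb D r) * emb D b * emb D r) < \<epsilon>)"
proof
  assume cb: "cuntz_below D a b"
  show "\<forall>\<epsilon>>0. \<exists>r\<in>ca_carr D. norm (emb D a - adj (emb D r) * emb D b * emb D r) < \<epsilon>"
  proof (intro allI impI)
    fix \<epsilon> :: real assume "\<epsilon> > 0"
    then obtain m X where m: "m \<ge> 1" and X: "X \<in> ca_carr (matrix_alg D m)" and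
      n: "ca_norm (matrix_alg D m) (ca_minus (matrix_alg D m) (corner D a)
            (ca_mul (matrix_alg D m) (ca_mul (matrix_alg D m) (ca_star (matrix_alg D m) X) (corner D b)) X)) < \<epsilon>"
      using cb unfolding cuntz_below_def by blast
    note Z = matrix_conj_corner[OF X m a b]
    have "norm (emb D a - adj (emb D (X 0 0)) * emb D b * emb D (X 0 0)) < \<epsilon>"
      unfolding Z(2)[symmetric]
      by (rule le_less_trans[OF entry_le_opn[of "{..<m}" 0 0] n[unfolded matrix_norm[OF Z(1)]]]) (use m in auto)
    moreover have "X 0 0 \<in> ca_carr D" using X m by (simp add: matrix_sel)
    ultimately show "\<exists>r\<in>ca_carr D. norm (emb D a - adj (emb D r) * emb D b * emb D r) < \<epsilon>" by blast
  qed
next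
  assume cb: "\<forall>\<epsilon>>0. \<exists>r\<in>ca_carr D. norm (emb D a - adj (emb D r) * emb D b * emb D r) < \<epsilon>"
  show "cuntz_below D a b" unfolding cuntz_below_def
  proof (intro allI impI)
    fix \<epsilon> :: real assume "\<epsilon> > 0"
    then obtain r where r: "r \<in> ca_carr D" "norm (emb D a - adj (emb D r) * emb D b * emb D r) < \<epsilon>" using cb by blast
    have X: "corner D r \<in> ca_carr (matrix_alg D 1)" unfolding matrix_sel using r(1) by (auto simp: corner_def)
    note Z = matrix_conj_corner[OF X order_refl a b]
    have "ca_norm (matrix_alg D 1) (ca_minus (matrix_alg D 1) (corner D a)
            (ca_mul (matrix_alg D 1) (ca_mul (matrix_alg D 1) (ca_star (matrix_alg D 1) (corner D r)) (corner D b)) (corner D r))) < \<epsilon>"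
      unfolding matrix_norm[OF Z(1)]
      by (rule le_less_trans[OF opn_le_sum]) (use Z(2) r(2) in \<open>simp_all add: corner_def\<close>)
    then show "\<exists>m\<ge>1. \<exists>X\<in>ca_carr (matrix_alg D m). ca_norm (matrix_alg D m) (ca_minus (matrix_alg D m) (corner D a)
            (ca_mul (matrix_alg D m) (ca_mul (matrix_alg D m) (ca_star (matrix_alg D m) X) (corner D b)) X)) < \<epsilon>"
      using X by (intro exI[of _ 1]) auto
  qed
qed

end

text \<open>Each \<open>adj (d i) * d i\<close> is at most \<open>K\<^sup>2\<close>, and these
  inequalities are summed after conjugation by the coordinates of \<open>v\<close>. Unlike the bound
  by the sum of entry norms, the constant does not grow with \<open>I\<close>, as required for an
  isometry.\<close>

lemma opn_diag:
  fixes d :: "'i \<Rightarrow> 'a::cstar"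
  assumes fin: "finite I" and K: "\<And>i. i \<in> I \<Longrightarrow> norm (d i) \<le> K" "0 \<le> K"
  shows "opn I (\<lambda>i j. if i = j then d i else 0) \<le> K"
proof (rule opn_le[OF fin])
  fix v :: "'i \<Rightarrow> 'a" assume v: "vn I v \<le> 1"
  let ?w = "\<lambda>i. d i * v i"
  have eq: "vn I (mvec I (\<lambda>i j. if i = j then d i else 0) v) = vn I ?w"
  proof (rule vn_cong)
    fix i assume i: "i \<in> I"
    have "mvec I (\<lambda>i j. if i = j then d i else 0) v i = (\<Sum>k\<in>I. if k = i then d i * v i else 0)"
      unfolding mvec_def by (intro sum.cong) auto
    then show "mvec I (\<lambda>i j. if i = j then d i else 0) v i = d i * v i" using fin i by simp
  qed
  have "pos (K\<^sup>2 *\<^sub>R hip I v v - hip I ?w ?w)"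
  proof -
    have "pos (\<Sum>i\<in>I. adj (v i) * (of_real (K\<^sup>2) - adj (d i) * d i) * v i)"
    proof (intro pos_sum pos_conj pos_of_real_minus)
      fix i assume "i \<in> I"
      then show "norm (adj (d i) * d i) \<le> K\<^sup>2" using K by (simp add: cstar_norm power_mono)
    qed (simp add: adj_mult)
    also have "(\<Sum>i\<in>I. adj (v i) * (of_real (K\<^sup>2) - adj (d i) * d i) * v i) = K\<^sup>2 *\<^sub>R hip I v v - hip I ?w ?w"
      by (simp add: hip_def scaleR_sum_right sum_subtractf left_diff_distrib right_diff_distrib adj_mult mult.assoc of_real_def)
    finally show ?thesis .
  qed
  from pos_mono_norm[OF pos_hip this] have "(vn I ?w)\<^sup>2 \<le> K\<^sup>2 * (vn I v)\<^sup>2" by (simp add: vn_sq)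
  also have "\<dots> \<le> K\<^sup>2 * 1" using v by (intro mult_left_mono) (auto simp: power_le_one)
  finally have "(vn I ?w)\<^sup>2 \<le> K\<^sup>2" by simp
  then show "vn I (mvec I (\<lambda>i j. if i = j then d i else 0) v) \<le> K" unfolding eq by (rule power2_le_imp_le[OF _ K(2)])
qed

section \<open>The crossed product as a concrete algebra\<close>

context crossed begin

abbreviation j :: "'a \<Rightarrow> ('g \<Rightarrow> 'a) cprod" where "j a \<equiv> emb C (dlt \<one> a)"
abbreviation uu :: "'g \<Rightarrow> ('g \<Rightarrow> 'a) cprod" where "uu g \<equiv> emb C (dlt g (ca_one A))"

lemma dlt_mul:
  assumes g: "g \<in> carrier G" and h: "h \<in> carrier G" and a: "a \<in> ca_carr A" and b: "b \<in> ca_carr A"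
  shows "ca_mul C (dlt g a) (dlt h b) = dlt (g \<otimes> h) (ca_mul A a (\<alpha> g b))"
proof
  fix k show "ca_mul C (dlt g a) (dlt h b) k = dlt (g \<otimes> h) (ca_mul A a (\<alpha> g b)) k"
  proof (cases "k \<in> carrier G")
    case k: True
    let ?f = "\<lambda>l. ca_mul A (dlt g a l) (\<alpha> l (dlt h b (inv l \<otimes> k)))"
    have iff: "inv g \<otimes> k = h \<longleftrightarrow> k = g \<otimes> h" using g h k inv_solve_left' by blast
    have f: "l \<in> carrier G \<Longrightarrow> ?f l \<in> ca_carr A" for l using a b k by (auto simp: dlt_def)
    have "emb A (ca_sum A ?f (carrier G)) = (\<Sum>l\<in>carrier G. emb A (?f l))" by (rule ca_sum_emb(2)[OF finG f])
    also have "\<dots> = (\<Sum>l\<in>carrier G. if l = g then emb A (dlt (g \<otimes> h) (ca_mul A a (\<alpha> g b)) k) else 0)"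
      using a b g h k by (intro sum.cong refl) (auto simp: dlt_def iff)
    also have "\<dots> = emb A (dlt (g \<otimes> h) (ca_mul A a (\<alpha> g b)) k)" using g finG by simp
    finally have "ca_sum A ?f (carrier G) = dlt (g \<otimes> h) (ca_mul A a (\<alpha> g b)) k"
      using a b g h by (intro emb_inj ca_sum_emb(1) finG f) (auto simp: dlt_def)
    then show ?thesis using k by (simp add: C_simps)
  qed (use g h in \<open>auto simp: C_simps dlt_def\<close>)
qed

lemma dlt_star:
  assumes g: "g \<in> carrier G" and a: "a \<in> ca_carr A"
  shows "ca_star C (dlt g a) = dlt (inv g) (\<alpha> (inv g) (ca_star A a))"
proof
  fix k show "ca_star C (dlt g a) k = dlt (inv g) (\<alpha> (inv g) (ca_star A a)) k"
    using g a by (cases "k \<in> carrier G") (auto simp: C_simps dlt_def)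
qed

lemma dlt_add: "a \<in> ca_carr A \<Longrightarrow> b \<in> ca_carr A \<Longrightarrow> g \<in> carrier G \<Longrightarrow> ca_add C (dlt g a) (dlt g b) = dlt g (ca_add A a b)"
  by (auto simp: C_simps dlt_def fun_eq_iff)

lemma dlt_smul: "a \<in> ca_carr A \<Longrightarrow> g \<in> carrier G \<Longrightarrow> ca_smul C c (dlt g a) = dlt g (ca_smul A c a)"
  by (auto simp: C_simps dlt_def fun_eq_iff)

lemma j_add: "a \<in> ca_carr A \<Longrightarrow> b \<in> ca_carr A \<Longrightarrow> j (ca_add A a b) = j a + j b"
  by (simp add: C.emb_add[symmetric] dlt_add)

lemma j_smul: "a \<in> ca_carr A \<Longrightarrow> j (ca_smul A c a) = sc c * j a"
  by (simp add: C.emb_smul[symmetric] dlt_smul)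

lemma j_mul: "a \<in> ca_carr A \<Longrightarrow> b \<in> ca_carr A \<Longrightarrow> j (ca_mul A a b) = j a * j b"
  by (simp add: C.emb_mul[symmetric] dlt_mul)

lemma j_star: "a \<in> ca_carr A \<Longrightarrow> j (ca_star A a) = adj (j a)"
  by (simp add: C.emb_star[symmetric] dlt_star)

lemma j_minus: "a \<in> ca_carr A \<Longrightarrow> b \<in> ca_carr A \<Longrightarrow> j (ca_minus A a b) = j a - j b"
  by (simp add: ca_minus_def j_add j_smul sc_minus_1)

lemma j_zero [simp]: "j (ca_zero A) = 0"
proof -
  have "dlt \<one> (ca_zero A) = ca_zero C" by (auto simp: dlt_def C_simps)
  then show ?thesis by (simp only: C.emb_zero)
qed

lemma j_one: "j (ca_one A) = C.ue"
  by (simp add: C.ue_def one_C)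

lemma dlt_same [simp]: "dlt g a g = a" by (simp add: dlt_def)

lemma j_coeff: "a \<in> ca_carr A \<Longrightarrow> cmp (j a) C \<one> = a"
  by (simp add: C.cmp_emb_D)

lemma j_inj: "a \<in> ca_carr A \<Longrightarrow> b \<in> ca_carr A \<Longrightarrow> j a = j b \<Longrightarrow> a = b"
  using j_coeff by metis

text \<open>In the regular representation \<open>a\<close> becomes diagonal with entries
  \<open>\<alpha> (inv g) a\<close>, none longer than \<open>a\<close>; the lower bound is the
  coefficient estimate.\<close>

lemma norm_j:
  assumes a: "a \<in> ca_carr A" shows "norm (j a) = ca_norm A a"
proof (rule antisym)
  have d: "dlt \<one> a \<in> ca_carr C" using a by simp
  show "ca_norm A a \<le> norm (j a)" using norm_coeff_le[OF d one_closed] by (simp add: C.norm_emb d)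
  have "ca_norm C (dlt \<one> a) = opn (carrier G) (\<lambda>g k. if g = k then emb A (\<alpha> (inv g) a) else 0)"
    unfolding norm_C[OF d]
  proof (rule opn_cong[OF finG])
    fix g k assume gk: "g \<in> carrier G" "k \<in> carrier G"
    have "g \<otimes> inv k = \<one> \<longleftrightarrow> g = k" using gk by (metis inv_equality inv_inv r_inv inv_closed)
    then show "M (dlt \<one> a) g k = (if g = k then emb A (\<alpha> (inv g) a) else 0)" using gk a by (simp add: M_def dlt_def)
  qed
  also have "\<dots> \<le> ca_norm A a"
    by (rule opn_diag[OF finG]) (use a norm_act_le norm_nonneg in \<open>auto simp: norm_emb\<close>)
  finally show "norm (j a) \<le> ca_norm A a" by (simp add: C.norm_emb d)
qed

lemma j_sum:
  assumes "finite I" "\<And>i. i \<in> I \<Longrightarrow> f i \<in> ca_carr A" shows "j (ca_sum A f I) = (\<Sum>i\<in>I. j (f i))"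
proof -
  define xs where "xs = (SOME xs. set xs = I \<and> distinct xs)"
  have xs: "set xs = I \<and> distinct xs" unfolding xs_def by (rule someI_ex[OF finite_distinct_list[OF assms(1)]])
  have "set ys \<subseteq> I \<Longrightarrow> distinct ys \<Longrightarrow> foldr (\<lambda>h acc. ca_add A (f h) acc) ys (ca_zero A) \<in> ca_carr A \<and>
      j (foldr (\<lambda>h acc. ca_add A (f h) acc) ys (ca_zero A)) = (\<Sum>i\<in>set ys. j (f i))" for ys
    by (induction ys) (auto simp: j_add assms(2))
  then show ?thesis using xs unfolding ca_sum_def xs_def[symmetric] by auto
qed

lemma emb_coeffs:
  assumes x: "x \<in> ca_carr C" shows "emb C x = (\<Sum>g\<in>carrier G. j (x g) * uu g)"
proof -
  \<comment> \<open>The part of \<open>x\<close> supported on \<open>F\<close>, for an induction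
    adding one group element at a time.\<close>
  let ?r = "\<lambda>F g. if g \<in> F then x g else ca_zero A"
  have "F \<subseteq> carrier G \<Longrightarrow> ?r F \<in> ca_carr C \<and> emb C (?r F) = (\<Sum>g\<in>F. emb C (dlt g (x g)))" if "finite F" for F
    using that
  proof (induction F rule: finite_induct)
    case empty
    have "?r {} = ca_zero C" by (auto simp: C_simps)
    then show ?case by (simp add: C_closed)
  next
    case (insert g F)
    have g: "g \<in> carrier G" "x g \<in> ca_carr A" using insert.prems x by auto
    have "?r (insert g F) = ca_add C (dlt g (x g)) (?r F)"
      using insert.prems insert.hyps x g by (auto simp: C_simps dlt_def fun_eq_iff)
    then show ?case using insert g by (simp add: C_closed C.emb_add)
  qed
  from this[OF finG] have "emb C (?r (carrier G)) = (\<Sum>g\<in>carrier G. emb C (dlt g (x g)))" by simp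
  moreover have "?r (carrier G) = x" using x by (auto simp: carr_C)
  moreover have "emb C (dlt g (x g)) = j (x g) * uu g" if "g \<in> carrier G" for g
    using that x by (simp add: C.emb_mul[symmetric] dlt_mul)
  ultimately show ?thesis by simp
qed

definition SA :: "('g \<Rightarrow> 'a) cprod set" where "SA = j ` ca_carr A"

lemma SA_coeff: "t \<in> SA \<Longrightarrow> j (cmp t C \<one>) = t" "t \<in> SA \<Longrightarrow> cmp t C \<one> \<in> ca_carr A"
  unfolding SA_def by (auto simp: j_coeff)

text \<open>A limit of elements of \<open>SA\<close> stays in the corner, and its coefficients off
  the identity are bounded by the distance to the approximants.\<close>

lemma closed_SA: "closed SA"
proof (rule closed_sequential_limits[THEN iffD2], intro allI impI)
  fix X t assume Xt: "(\<forall>n. X n \<in> SA) \<and> X \<longlonglongrightarrow> t"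
  define b where "b n = cmp (X n) C \<one>" for n
  have b: "b n \<in> ca_carr A" "X n = j (b n)" for n using Xt SA_coeff by (auto simp: b_def)
  define x where "x = cmp t C"
  have x: "x \<in> ca_carr C" by (simp add: x_def)
  have lim: "(\<lambda>n. X n) \<longlonglongrightarrow> t" using Xt by blast
  have "C.ue * X n = X n" for n using b by simp
  moreover have "(\<lambda>n. C.ue * X n) \<longlonglongrightarrow> C.ue * t" by (intro tendsto_intros lim)
  ultimately have "X \<longlonglongrightarrow> C.ue * t" by simp
  then have "C.ue * t = t" using lim LIMSEQ_unique by blast
  then have ex: "emb C x = t" unfolding x_def by (rule C.emb_cmp)
  have "x g = ca_zero A" if g: "g \<in> carrier G" "g \<noteq> \<one>" for g
  proof -
    have xg: "x g \<in> ca_carr A" using x g by simp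
    have le: "ca_norm A (x g) \<le> norm (t - X n)" for n
    proof -
      have "ca_minus A (x g) (ca_zero A) = x g" using xg by (intro emb_inj) (auto simp: emb_minus)
      then have "ca_minus C x (dlt \<one> (b n)) g = x g" using g by (simp only: minus_coeff dlt_def if_False)
      then have "ca_norm A (x g) \<le> ca_norm C (ca_minus C x (dlt \<one> (b n)))"
        using norm_coeff_le[OF C_minus[OF x] g(1), of "dlt \<one> (b n)"] b by simp
      also have "\<dots> = norm (t - X n)" using x b by (simp add: C.norm_emb[symmetric] C_minus C.emb_minus ex)
      finally show ?thesis .
    qed
    have "(\<lambda>n. norm (t - X n)) \<longlonglongrightarrow> norm (t - t)" by (intro tendsto_intros lim)
    then have "ca_norm A (x g) \<le> norm (t - t)" by (rule LIMSEQ_le_const) (use le in blast)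
    then have "ca_norm A (x g) = 0" using norm_nonneg[OF xg] by simp
    then show ?thesis using norm_zero_iff[OF xg] by simp
  qed
  then have "x = dlt \<one> (x \<one>)" using x by (auto simp: dlt_def carr_C fun_eq_iff)
  then have "t = j (x \<one>)" using ex by simp
  then show "t \<in> SA" unfolding SA_def using x by auto
qed

end

section \<open>The copy of \<open>A\<close> satisfies the abstract hypotheses\<close>

locale crossed_rokhlin = crossed +
  assumes simple: "simple_alg A" and wtr: "weak_tracial_rokhlin A G \<alpha>"
begin

lemma SA_I: "a \<in> ca_carr A \<Longrightarrow> j a \<in> SA" by (simp add: SA_def)

lemma SA_E: assumes "t \<in> SA" obtains a where "a \<in> ca_carr A" "t = j a"
  using assms unfolding SA_def by blast

text \<open>If \<open>x\<close> is the product of \<open>ca_star C b\<close> and \<open>b\<close>,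
  its coefficient at the identity is the module inner product of \<open>w\<close> with itself, where
  \<open>w h\<close> is the image of \<open>\<alpha> h (b (inv h))\<close>. This is positive and
  vanishes only if all coefficients of \<open>b\<close> do.\<close>

lemma expectation:
  assumes s: "C.ue * s = s" "pos s" "s \<noteq> 0"
  shows "\<exists>y. (\<forall>g\<in>carrier G. y g \<in> SA) \<and> s = (\<Sum>g\<in>carrier G. y g * uu g) \<and> pos (y \<one>) \<and> y \<one> \<noteq> 0"
proof -
  define x where "x = cmp s C"
  have x: "x \<in> ca_carr C" "emb C x = s" using s by (auto simp: x_def C.emb_cmp)
  have "ca_positive C x" using C.positive_iff[OF x(1)] x(2) s(2) by simp
  then obtain b where b: "b \<in> ca_carr C" "x = ca_mul C (ca_star C b) b" unfolding ca_positive_def by blast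
  define w where "w h = emb A (\<alpha> h (b (inv h)))" for h
  have xone: "emb A (x \<one>) = hip (carrier G) w w"
  proof -
    have "emb A (x \<one>) = emb A (ca_sum A (\<lambda>h. ca_mul A (ca_star C b h) (\<alpha> h (b (inv h \<otimes> \<one>)))) (carrier G))"
      unfolding b(2) C_simps(4) by simp
    also have "\<dots> = (\<Sum>h\<in>carrier G. emb A (ca_mul A (ca_star C b h) (\<alpha> h (b (inv h \<otimes> \<one>)))))"
      using b by (intro ca_sum_emb finG) (auto simp: C_closed)
    also have "\<dots> = hip (carrier G) w w" unfolding hip_def
      using b by (intro sum.cong refl) (simp add: w_def C_simps emb_mul act_star emb_star)
    finally show ?thesis .
  qed
  have xA: "x \<one> \<in> ca_carr A" using x by simp
  have "pos (emb A (x \<one>))" unfolding xone by (rule pos_hip)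
  then have "ca_positive A (x \<one>)" using positive_iff[OF xA] by simp
  then obtain y where "y \<in> ca_carr A" "x \<one> = ca_mul A (ca_star A y) y" unfolding ca_positive_def by blast
  then have pj: "pos (j (x \<one>))" by (simp add: j_mul j_star pos_adj_mult)
  have "x \<one> \<noteq> ca_zero A"
  proof
    assume "x \<one> = ca_zero A"
    then have "vn (carrier G) w = 0" using xone by (simp add: vn_def)
    then have w0: "w h = 0" if "h \<in> carrier G" for h using norm_comp_le_vn[OF finG that, of w] by simp
    have b0: "b g = ca_zero A" if g: "g \<in> carrier G" for g
    proof -
      have bg: "b g \<in> ca_carr A" using b g by simp
      have "emb A (\<alpha> (inv g) (b g)) = emb A (ca_zero A)" using w0[of "inv g"] g by (simp add: w_def)
      then have "\<alpha> (inv g) (b g) = ca_zero A" using g bg by (intro emb_inj) auto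
      then have "\<alpha> (g \<otimes> inv g) (b g) = \<alpha> g (ca_zero A)" using act_mult[OF g _ bg, of "inv g"] g by simp
      then show ?thesis using g bg by simp
    qed
    have "b = ca_zero C" using b(1) b0 by (auto simp: carr_C C_simps fun_eq_iff)
    then have "x = ca_zero C" unfolding b(2) using C.mul_zero C.star_in C.zero_in by simp
    then show False using x(2) s(3) by simp
  qed
  then have "j (x \<one>) \<noteq> 0" using j_inj[OF xA zero_in] by auto
  then show ?thesis using emb_coeffs[OF x(1)] x pj by (intro exI[of _ "\<lambda>g. j (x g)"]) (auto intro: SA_I)
qed

text \<open>The ideal is pulled back along the isometry \<open>j\<close> to a closed ideal of
  \<open>A\<close>, where simplicity applies.\<close>

lemma ideal_simple:
  assumes I: "I \<subseteq> SA" "closed I" "0 \<in> I" "\<And>x y. x \<in> I \<Longrightarrow> y \<in> I \<Longrightarrow> x + y \<in> I"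
    "\<And>c x. x \<in> I \<Longrightarrow> sc c * x \<in> I" "\<And>x y. x \<in> I \<Longrightarrow> y \<in> SA \<Longrightarrow> x * y \<in> I \<and> y * x \<in> I" "\<exists>x\<in>I. x \<noteq> 0"
  shows "C.ue \<in> I"
proof -
  define J where "J = {a \<in> ca_carr A. j a \<in> I}"
  have "closed_ideal A J" unfolding closed_ideal_def
  proof (intro conjI ballI allI)
    show "ca_closure A J = J"
    proof
      show "ca_closure A J \<subseteq> J"
      proof
        fix x assume "x \<in> ca_closure A J"
        then have x: "x \<in> ca_carr A" "\<And>e. e > 0 \<Longrightarrow> \<exists>y\<in>J. ca_norm A (ca_minus A x y) < e" by (auto simp: ca_closure_def)
        have "j x \<in> closure I" unfolding closure_approachable
        proof (intro allI impI)
          fix e :: real assume "e > 0"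
          then obtain y where y: "y \<in> J" "ca_norm A (ca_minus A x y) < e" using x(2) by blast
          have yA: "y \<in> ca_carr A" using y(1) by (simp add: J_def)
          have "norm (j x - j y) = ca_norm A (ca_minus A x y)"
            using x(1) yA by (simp only: j_minus[symmetric] norm_j minus_in)
          then have "dist (j y) (j x) < e" using y(2) by (simp add: dist_norm norm_minus_commute)
          then show "\<exists>y\<in>I. dist y (j x) < e" using y(1) unfolding J_def by blast
        qed
        then show "x \<in> J" using I(2) x(1) by (simp add: J_def closure_closed)
      qed
      show "J \<subseteq> ca_closure A J"
      proof
        fix x assume x: "x \<in> J"
        then have "ca_norm A (ca_minus A x x) = 0" by (simp add: J_def flip: norm_j) (simp add: J_def j_minus)
        then show "x \<in> ca_closure A J" unfolding ca_closure_def using x J_def by fastforce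
      qed
    qed
  qed (use I(3) in \<open>auto simp: J_def j_add j_smul j_mul intro: I(4,5) dest: I(6)[OF _ SA_I]\<close>)
  then have "J = {ca_zero A} \<or> J = ca_carr A" using simple unfolding simple_alg_def by blast
  moreover obtain x where x: "x \<in> I" "x \<noteq> 0" using I(7) by blast
  obtain a where a: "a \<in> ca_carr A" "x = j a" using SA_E x(1) I(1) by blast
  have "a \<in> J" "a \<noteq> ca_zero A" using a x by (auto simp: J_def)
  ultimately have "J = ca_carr A" by auto
  then have "ca_one A \<in> J" by simp
  then show ?thesis by (simp add: J_def j_one)
qed

text \<open>The root of \<open>j a\<close> lies in the closed subalgebra \<open>SA\<close> because
  \<open>sqrt\<close> vanishes at 0, so it comes from an element of \<open>A\<close>.\<close>

lemma positive_j:
  assumes a: "a \<in> ca_carr A" and p: "pos (j a)" shows "ca_positive A a"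
proof -
  have "rt (j a) \<in> SA" unfolding rt_def
  proof (rule fc_mem[OF cont_sqrt pos_sa[OF p] _ closed_SA SA_I[OF a]])
    show "r *\<^sub>R x \<in> SA" if x: "x \<in> SA" for r and x
    proof -
      obtain b where "b \<in> ca_carr A" "x = j b" using SA_E[OF x] by blast
      then have "r *\<^sub>R x = j (ca_smul A (complex_of_real r) b)" by (simp add: j_smul sc_of_real scaleR_conv_of_real)
      then show ?thesis using \<open>b \<in> ca_carr A\<close> SA_I by simp
    qed
  qed (auto elim!: SA_E simp: SA_I simp flip: j_add j_mul)
  then obtain b where b: "b \<in> ca_carr A" "rt (j a) = j b" by (rule SA_E)
  have "j (ca_mul A (ca_star A b) b) = j a"
    using b rt_rt[OF p] adj_rt[OF p] by (simp add: j_mul j_star)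
  then have "a = ca_mul A (ca_star A b) b" using b a by (intro j_inj) auto
  then show ?thesis unfolding ca_positive_def using b by blast
qed

text \<open>The conditions are transported along the isometric homomorphism \<open>j\<close>, on
  whose image conjugation by \<open>uu g\<close> implements \<open>\<alpha> g\<close>.\<close>

lemma rokhlin_elements:
  assumes F: "finite F" "F \<subseteq> SA" and eps: "\<epsilon> > 0" and s: "s \<in> SA" "pos s" "norm s = 1"
  shows "\<exists>f. rokhlin_family G C.ue SA uu F \<epsilon> s f"
proof -
  define F' where "F' = (\<lambda>t. cmp t C \<one>) ` F"
  define s' where "s' = cmp s C \<one>"
  have s': "s' \<in> ca_carr A" "j s' = s" using SA_coeff[OF s(1)] by (simp_all add: s'_def)
  have F': "finite F'" "F' \<subseteq> ca_carr A" using F SA_coeff(2) by (auto simp: F'_def)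
  have "ca_positive A s'" using positive_j[OF s'(1)] s'(2) s(2) by simp
  moreover have "ca_norm A s' = 1" using norm_j[OF s'(1)] s' s(3) by simp
  ultimately have pre: "finite F' \<and> F' \<subseteq> ca_carr A \<and> \<epsilon> > 0 \<and> ca_positive A s' \<and> s' \<in> ca_carr A \<and> ca_norm A s' = 1"
    using F' s'(1) eps by simp
  from wtr[unfolded weak_tracial_rokhlin_def Let_def, THEN spec, THEN spec, THEN spec, THEN mp, OF pre]
  obtain f where f': "(\<forall>g\<in>carrier G. f g \<in> ca_carr A \<and> ca_pos1 A (f g)) \<and>
    (\<forall>g\<in>carrier G. \<forall>h\<in>carrier G. g \<noteq> h \<longrightarrow> ca_mul A (f g) (f h) = ca_zero A) \<and>
    (\<forall>x\<in>F'. \<forall>g\<in>carrier G. ca_norm A (ca_minus A (ca_mul A (f g) x) (ca_mul A x (f g))) < \<epsilon>) \<and>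
    (\<forall>g\<in>carrier G. \<forall>h\<in>carrier G. ca_norm A (ca_minus A (\<alpha> g (f h)) (f (g \<otimes> h))) < \<epsilon>) \<and>
    cuntz_below A (ca_minus A (ca_one A) (ca_sum A f (carrier G))) s' \<and>
    ca_norm A (ca_mul A (ca_sum A f (carrier G)) (ca_mul A s' (ca_sum A f (carrier G)))) > 1 - \<epsilon>"
    by (rule exE)
  note f1 = f'[THEN conjunct1, rule_format]
    and f2 = f'[THEN conjunct2, THEN conjunct1, rule_format]
    and f3 = f'[THEN conjunct2, THEN conjunct2, THEN conjunct1, rule_format]
    and f4 = f'[THEN conjunct2, THEN conjunct2, THEN conjunct2, THEN conjunct1, rule_format]
    and f5 = f'[THEN conjunct2, THEN conjunct2, THEN conjunct2, THEN conjunct2, THEN conjunct1]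
    and f6 = f'[THEN conjunct2, THEN conjunct2, THEN conjunct2, THEN conjunct2, THEN conjunct2]
  have fA: "g \<in> carrier G \<Longrightarrow> f g \<in> ca_carr A" for g using f1 by blast
  define f0 where "f0 = ca_sum A f (carrier G)"
  have f0: "f0 \<in> ca_carr A" "j f0 = (\<Sum>g\<in>carrier G. j (f g))"
    unfolding f0_def using fA finG by (auto intro: ca_sum_emb(1) j_sum)
  have "rokhlin_family G C.ue SA uu F \<epsilon> s (\<lambda>g. j (f g))" unfolding rokhlin_family_def
  proof (intro conjI ballI impI)
    fix g assume g: "g \<in> carrier G"
    show "j (f g) \<in> SA" using SA_I[OF fA[OF g]] .
    obtain b where "b \<in> ca_carr A" "f g = ca_mul A (ca_star A b) b" using f1[OF g] unfolding ca_pos1_def ca_positive_def by blast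
    then show "pos (j (f g))" by (simp add: j_mul j_star pos_adj_mult)
    show "norm (j (f g)) \<le> 1" using f1[OF g] unfolding ca_pos1_def by (simp add: norm_j)
    fix h assume h: "h \<in> carrier G"
    show "j (f g) * j (f h) = 0" if "g \<noteq> h" using f2[OF g h that] fA[OF g] fA[OF h] by (simp flip: j_mul)
    have "uu g * j (f h) * adj (uu g) = j (\<alpha> g (f h))"
      using g h fA[OF h] by (simp add: C.emb_mul[symmetric] C.emb_star[symmetric] dlt_mul dlt_star)
    then have "norm (uu g * j (f h) * adj (uu g) - j (f (g \<otimes> h))) = ca_norm A (ca_minus A (\<alpha> g (f h)) (f (g \<otimes> h)))"
      using g h fA by (simp add: norm_j flip: j_minus)
    then show "norm (uu g * j (f h) * adj (uu g) - j (f (g \<otimes> h))) < \<epsilon>" using f4[OF g h] by simp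
  next
    fix x g assume x: "x \<in> F" and g: "g \<in> carrier G"
    let ?x = "cmp x C \<one>"
    have xx: "?x \<in> F'" "?x \<in> ca_carr A" "j ?x = x" using x F SA_coeff by (auto simp: F'_def)
    have "norm (j (f g) * x - x * j (f g)) = ca_norm A (ca_minus A (ca_mul A (f g) ?x) (ca_mul A ?x (f g)))"
      using xx(2) fA[OF g] by (simp add: xx(3) j_minus j_mul flip: norm_j)
    then show "norm (j (f g) * x - x * j (f g)) < \<epsilon>" using f3[OF xx(1) g] by simp
  next
    show "cz (C.ue - (\<Sum>g\<in>carrier G. j (f g))) s" unfolding cz_def f0(2)[symmetric]
    proof (intro allI impI)
      fix \<eta> :: real assume "\<eta> > 0"
      then obtain r where r: "r \<in> ca_carr A" "norm (emb A (ca_minus A (ca_one A) f0) - adj (emb A r) * emb A s' * emb A r) < \<eta>"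
        using f5 cuntz_below_iff[of "ca_minus A (ca_one A) f0" s'] f0(1) s'(1) unfolding f0_def by blast
      \<comment> \<open>The error of the Cuntz witness is collected in one element of
        \<open>A\<close>, because its norm is the same under \<open>emb A\<close> and under
        \<open>j\<close>, which map into different types.\<close>
      let ?z = "ca_minus A (ca_minus A (ca_one A) f0) (ca_mul A (ca_mul A (ca_star A r) s') r)"
      have z: "?z \<in> ca_carr A" using r f0 s' by simp
      have "norm (emb A ?z) < \<eta>" using r f0 s' by (simp add: emb_minus emb_mul emb_star)
      then have "norm (j ?z) < \<eta>" using z by (simp add: norm_emb norm_j)
      then have "norm (C.ue - j f0 - adj (j r) * s * j r) < \<eta>" using r f0(1) s' by (simp add: j_minus j_mul j_star j_one)
      then show "\<exists>r. norm (C.ue - j f0 - adj r * s * r) < \<eta>" by blast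
    qed
    have "norm (j f0 * (s * j f0)) = ca_norm A (ca_mul A f0 (ca_mul A s' f0))"
      using f0(1) s' by (simp add: j_mul flip: norm_j)
    then show "norm ((\<Sum>g\<in>carrier G. j (f g)) * (s * (\<Sum>g\<in>carrier G. j (f g)))) > 1 - \<epsilon>"
      using f6 unfolding f0(2)[symmetric] f0_def by simp
  qed
  then show ?thesis by blast
qed

sublocale R: rokhlin_alg G C.ue SA uu
proof (unfold_locales)
  show "finite (carrier G)" by (rule finG)
  show "C.ue * x = x * C.ue" for x by (rule C.ue_comm)
  show "C.ue * C.ue = C.ue" "adj C.ue = C.ue" by simp_all
  show "closed SA" by (rule closed_SA)
  show "C.ue \<in> SA" using SA_I[OF one_in] by (simp add: j_one)
  show "x + y \<in> SA" "x * y \<in> SA" if "x \<in> SA" "y \<in> SA" for x y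
    using that by (auto elim!: SA_E simp: SA_I simp flip: j_add j_mul)
  show "adj x \<in> SA" "sc c * x \<in> SA" if "x \<in> SA" for x c
    using that by (auto elim!: SA_E simp: SA_I simp flip: j_star j_smul)
  show "C.ue * x = x" if "x \<in> SA" for x using that by (auto elim!: SA_E)
  show "C.ue * uu g = uu g" if "g \<in> carrier G" for g using that by simp
  show "uu g * uu h = uu (g \<otimes> h)" if "g \<in> carrier G" "h \<in> carrier G" for g h
    using that by (simp add: C.emb_mul[symmetric] dlt_mul)
  show "uu \<one> = C.ue" by (rule j_one)
  show "adj (uu g) = uu (inv g)" if "g \<in> carrier G" for g
    using that by (simp add: C.emb_star[symmetric] dlt_star)
  show "uu g * x * adj (uu g) \<in> SA" if g: "g \<in> carrier G" and x: "x \<in> SA" for g x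
  proof -
    obtain a where a: "a \<in> ca_carr A" "x = j a" using SA_E[OF x] by blast
    have "uu g * j a * adj (uu g) = j (\<alpha> g a)"
      using g a by (simp add: C.emb_mul[symmetric] C.emb_star[symmetric] dlt_mul dlt_star)
    then show ?thesis using a g SA_I by simp
  qed
  show "\<exists>y. (\<forall>g\<in>carrier G. y g \<in> SA) \<and> x = (\<Sum>g\<in>carrier G. y g * uu g)" if "C.ue * x = x" for x
  proof (intro exI[of _ "\<lambda>g. j (cmp x C g)"] conjI ballI)
    show "x = (\<Sum>g\<in>carrier G. j (cmp x C g) * uu g)" using emb_coeffs[of "cmp x C"] C.emb_cmp[OF that] by simp
  qed (auto intro!: SA_I)
  show "\<exists>y. (\<forall>g\<in>carrier G. y g \<in> SA) \<and> s = (\<Sum>g\<in>carrier G. y g * uu g) \<and> pos (y \<one>) \<and> y \<one> \<noteq> 0"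
    if "C.ue * s = s" "pos s" "s \<noteq> 0" for s by (rule expectation[OF that])
  show "C.ue \<in> I" if "I \<subseteq> SA" "closed I" "0 \<in> I" "\<And>x y. x \<in> I \<Longrightarrow> y \<in> I \<Longrightarrow> x + y \<in> I"
    "\<And>c x. x \<in> I \<Longrightarrow> sc c * x \<in> I" "\<And>x y. x \<in> I \<Longrightarrow> y \<in> SA \<Longrightarrow> x * y \<in> I \<and> y * x \<in> I" "\<exists>x\<in>I. x \<noteq> 0" for I
    by (rule ideal_simple[OF that])
  show "\<exists>f. rokhlin_family G C.ue SA uu F \<epsilon> s f"
    if "finite F" "F \<subseteq> SA" "\<epsilon> > 0" "s \<in> SA" "pos s" "norm s = 1" for F \<epsilon> s by (rule rokhlin_elements[OF that])
qed

end

section \<open>Blocks in the crossed product\<close>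

lemma subalg_sel [simp]:
  "ca_carr (subalg D S) = S" "ca_zero (subalg D S) = ca_zero D" "ca_add (subalg D S) = ca_add D"
  "ca_smul (subalg D S) = ca_smul D" "ca_mul (subalg D S) = ca_mul D" "ca_star (subalg D S) = ca_star D"
  "ca_norm (subalg D S) = ca_norm D" "ca_sum (subalg D S) = ca_sum D"
  by (simp_all add: subalg_def ca_sum_def fun_eq_iff)

context crossed_rokhlin begin

lemma dist_j: "x \<in> ca_carr A \<Longrightarrow> y \<in> ca_carr A \<Longrightarrow> dist (j y) (j x) = ca_norm A (ca_minus A x y)"
  by (subst dist_commute) (simp only: dist_norm j_minus[symmetric] norm_j minus_in)

lemma dist_emb: "x \<in> ca_carr C \<Longrightarrow> y \<in> ca_carr C \<Longrightarrow> dist (emb C y) (emb C x) = ca_norm C (ca_minus C x y)"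
  by (subst dist_commute) (simp only: dist_norm C.emb_minus[symmetric] C.norm_emb C.minus_in)

text \<open>Both sides are closures of corresponding sets, and \<open>j\<close> preserves
  distances.\<close>

lemma hered_iff:
  assumes a: "a \<in> ca_carr A"
  shows "x \<in> hered A a \<longleftrightarrow> x \<in> ca_carr A \<and> j x \<in> R.her (j a)"
proof (cases "x \<in> ca_carr A")
  case x: True
  let ?f = "\<lambda>z. ca_mul A a (ca_mul A z a)"
  have jf: "j (?f z) = j a * j z * j a" if "z \<in> ca_carr A" for z using a that by (simp add: j_mul mult.assoc)
  have set: "{j a * t * j a | t. t \<in> SA} = (\<lambda>z. j (?f z)) ` ca_carr A"
    unfolding SA_def using jf by (auto simp: image_iff)
  have "j x \<in> R.her (j a) \<longleftrightarrow> (\<forall>e>0. \<exists>z\<in>ca_carr A. dist (j (?f z)) (j x) < e)"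
    unfolding R.her_def set closure_approachable by simp
  also have "\<dots> \<longleftrightarrow> (\<forall>e>0. \<exists>z\<in>ca_carr A. ca_norm A (ca_minus A x (?f z)) < e)"
    using a x by (simp add: dist_j)
  also have "\<dots> \<longleftrightarrow> x \<in> hered A a" unfolding hered_def ca_closure_def using x by auto
  finally show ?thesis using x by simp
qed (simp add: hered_def ca_closure_def)

context
  fixes a c v assumes aA: "a \<in> ca_carr A" and ba: "block_alg G C.ue SA uu (j a) c v"
begin

interpretation B: block_alg G C.ue SA uu "j a" c v by (rule ba)

definition block_set where "block_set = {x \<in> ca_carr C. emb C x \<in> R.blocks (j a) v}"

lemma block_setI:
  assumes "t \<in> R.blocks (j a) v" shows "cmp t C \<in> block_set" "emb C (cmp t C) = t"
proof -
  show "emb C (cmp t C) = t" by (rule C.emb_cmp[OF B.blocks_e[OF assms]])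
  then show "cmp t C \<in> block_set" using assms by (simp add: block_set_def)
qed

lemma block_subalgebra: "cstar_subalgebra C block_set"
  unfolding cstar_subalgebra_def
proof (intro conjI ballI allI)
  show "ca_closure C block_set = block_set"
  proof
    show "ca_closure C block_set \<subseteq> block_set"
    proof
      fix x assume "x \<in> ca_closure C block_set"
      then have x: "x \<in> ca_carr C" "\<And>e. e > 0 \<Longrightarrow> \<exists>y\<in>block_set. ca_norm C (ca_minus C x y) < e" by (auto simp: ca_closure_def)
      have "emb C x \<in> closure (R.blocks (j a) v)" unfolding closure_approachable
      proof (intro allI impI)
        fix e :: real assume "e > 0"
        then obtain y where y: "y \<in> block_set" "ca_norm C (ca_minus C x y) < e" using x(2) by blast
        then show "\<exists>t\<in>R.blocks (j a) v. dist t (emb C x) < e"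
          using x(1) by (intro bexI[of _ "emb C y"]) (auto simp: block_set_def dist_emb)
      qed
      then show "x \<in> block_set" using B.closed_blocks x(1) by (simp add: block_set_def closure_closed)
    qed
    show "block_set \<subseteq> ca_closure C block_set"
    proof
      fix x assume x: "x \<in> block_set"
      then have "ca_norm C (ca_minus C x x) = 0" by (simp add: block_set_def flip: dist_emb)
      then show "x \<in> ca_closure C block_set" unfolding ca_closure_def using x block_set_def by fastforce
    qed
  qed
qed (auto simp: block_set_def C.emb_add C.emb_mul C.emb_smul C.emb_star
    intro: B.blocks_add B.blocks_mult B.blocks_sc B.blocks_adj B.blocks_0)

text \<open>A block coefficient lies in the copy of \<open>A\<close>, so it is read back as its
  coefficient at the identity.\<close>

definition ent where "ent b g h = cmp (adj (v g) * emb C b * v h) C \<one>"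

lemma ent:
  assumes "b \<in> block_set" "g \<in> carrier G" "h \<in> carrier G"
  shows "ent b g h \<in> ca_carr A" "j (ent b g h) = adj (v g) * emb C b * v h" "ent b g h \<in> hered A a"
proof -
  have h: "adj (v g) * emb C b * v h \<in> R.her (j a)"
    using assms by (intro B.blocks_coeff(1)) (simp_all add: block_set_def)
  then have "adj (v g) * emb C b * v h \<in> SA" using B.her_S by blast
  then show 1: "ent b g h \<in> ca_carr A" and 2: "j (ent b g h) = adj (v g) * emb C b * v h"
    unfolding ent_def by (rule SA_coeff)+
  show "ent b g h \<in> hered A a" unfolding hered_iff[OF aA] using 1 2 h by simp
qed

lemma emb_blk: "b \<in> block_set \<Longrightarrow> emb C b = R.blk v (\<lambda>g h. j (ent b g h))"
proof -
  assume b: "b \<in> block_set"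
  have "emb C b = R.blk v (\<lambda>g h. adj (v g) * emb C b * v h)"
    using b by (intro B.blocks_coeff(2)) (simp add: block_set_def)
  also have "\<dots> = R.blk v (\<lambda>g h. j (ent b g h))"
    unfolding R.blk_def by (intro sum.cong refl) (simp only: ent(2)[OF b])
  finally show ?thesis .
qed

lemma ent_blk:
  assumes X: "\<And>g h. g \<in> carrier G \<Longrightarrow> h \<in> carrier G \<Longrightarrow> X g h \<in> hered A a"
  shows "cmp (R.blk v (\<lambda>g h. j (X g h))) C \<in> block_set"
    "g \<in> carrier G \<Longrightarrow> h \<in> carrier G \<Longrightarrow> ent (cmp (R.blk v (\<lambda>g h. j (X g h))) C) g h = X g h"
proof -
  have X': "j (X g h) \<in> R.her (j a)" "X g h \<in> ca_carr A" if "g \<in> carrier G" "h \<in> carrier G" for g h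
    using X[OF that] unfolding hered_iff[OF aA] by auto
  have b: "R.blk v (\<lambda>g h. j (X g h)) \<in> R.blocks (j a) v" by (rule B.blocksI[OF X'(1)])
  show "cmp (R.blk v (\<lambda>g h. j (X g h))) C \<in> block_set" by (rule block_setI(1)[OF b])
  show "g \<in> carrier G \<Longrightarrow> h \<in> carrier G \<Longrightarrow> ent (cmp (R.blk v (\<lambda>g h. j (X g h))) C) g h = X g h"
    unfolding ent_def block_setI(2)[OF b] using B.blk_coeff[of "\<lambda>g h. j (X g h)"] X' by (simp add: j_coeff)
qed

lemma ent_mul:
  assumes x: "x \<in> block_set" and y: "y \<in> block_set" and gh: "g \<in> carrier G" "h \<in> carrier G"
  shows "j (ent (ca_mul C x y) g h) = (\<Sum>k\<in>carrier G. j (ent x g k) * j (ent y k h))"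
proof -
  have xy: "ca_mul C x y \<in> block_set" using block_subalgebra x y unfolding cstar_subalgebra_def by blast
  have her: "j (ent z k l) \<in> R.her (j a)" if "z \<in> block_set" "k \<in> carrier G" "l \<in> carrier G" for z k l
    using ent(3)[OF that] unfolding hered_iff[OF aA] by blast
  have "emb C (ca_mul C x y) = emb C x * emb C y" using x y by (simp add: block_set_def C.emb_mul)
  also have "\<dots> = R.blk v (mmul (carrier G) (\<lambda>g h. j (ent x g h)) (\<lambda>g h. j (ent y g h)))"
    unfolding emb_blk[OF x] emb_blk[OF y] by (rule B.blk_mult[OF her[OF x]])
  finally have e: "emb C (ca_mul C x y) = \<dots>" .
  have "j (ent (ca_mul C x y) g h) = mmul (carrier G) (\<lambda>g h. j (ent x g h)) (\<lambda>g h. j (ent y g h)) g h"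
    unfolding ent(2)[OF xy gh] e
    by (rule B.blk_coeff[OF _ gh]) (auto simp: mmul_def intro!: B.her_sum B.her_mult her x y)
  then show ?thesis by (simp add: mmul_def)
qed

text \<open>Block coefficients multiply like matrix entries, so after enumerating the group by
  \<open>\<gamma>\<close> the isomorphism sends a block to its coefficient matrix. Surjectivity is
  the exact recovery of prescribed coefficients.\<close>

lemma block_iso:
  assumes n: "card (carrier G) = n"
  shows "\<exists>\<phi>. star_iso (subalg C block_set) (matrix_alg (subalg A (hered A a)) n) \<phi>"
proof -
  obtain \<gamma> where \<gamma>: "bij_betw \<gamma> {..<n} (carrier G)"
    using ex_bij_betw_nat_finite[OF finG] n by (auto simp: atLeast0LessThan)
  have \<gamma>G: "i < n \<Longrightarrow> \<gamma> i \<in> carrier G" for i using \<gamma> by (auto simp: bij_betw_def)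
  define \<delta> where "\<delta> = inv_into {..<n} \<gamma>"
  have \<delta>: "g \<in> carrier G \<Longrightarrow> \<delta> g < n" "g \<in> carrier G \<Longrightarrow> \<gamma> (\<delta> g) = g" "i < n \<Longrightarrow> \<delta> (\<gamma> i) = i" for g i
    using \<gamma> bij_betw_inv_into_right[OF \<gamma>] bij_betw_inv_into_left[OF \<gamma>] bij_betw_apply[OF bij_betw_inv_into[OF \<gamma>]]
    by (auto simp: \<delta>_def)
  let ?E = "matrix_alg (subalg A (hered A a)) n"
  define \<phi> where "\<phi> b = (\<lambda>i k. if i < n \<and> k < n then ent b (\<gamma> i) (\<gamma> k) else ca_zero A)" for b
  have sub: "x \<in> block_set \<Longrightarrow> y \<in> block_set \<Longrightarrow> ca_add C x y \<in> block_set"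
    "x \<in> block_set \<Longrightarrow> y \<in> block_set \<Longrightarrow> ca_mul C x y \<in> block_set"
    "x \<in> block_set \<Longrightarrow> ca_star C x \<in> block_set" "x \<in> block_set \<Longrightarrow> ca_smul C z x \<in> block_set" for x y z
    using block_subalgebra unfolding cstar_subalgebra_def by blast+
  have carr: "x \<in> block_set \<Longrightarrow> x \<in> ca_carr C" for x by (simp add: block_set_def)
  have inj: "inj_on \<phi> block_set"
  proof (rule inj_onI)
    fix x y assume x: "x \<in> block_set" and y: "y \<in> block_set" and eq: "\<phi> x = \<phi> y"
    have "ent x g h = ent y g h" if "g \<in> carrier G" "h \<in> carrier G" for g h
      using fun_cong[OF fun_cong[OF eq, of "\<delta> g"], of "\<delta> h"] that by (simp add: \<phi>_def \<delta>)
    then have "emb C x = emb C y"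
      unfolding emb_blk[OF x] emb_blk[OF y] R.blk_def by (intro sum.cong refl) simp
    then show "x = y" using carr[OF x] carr[OF y] by (intro C.emb_inj)
  qed
  have img: "\<phi> ` block_set = ca_carr ?E"
  proof
    show "\<phi> ` block_set \<subseteq> ca_carr ?E" unfolding matrix_sel by (auto simp: \<phi>_def intro!: ent(3) \<gamma>G)
    show "ca_carr ?E \<subseteq> \<phi> ` block_set"
    proof
      fix X assume X: "X \<in> ca_carr ?E"
      let ?X = "\<lambda>g h. X (\<delta> g) (\<delta> h)"
      have H: "?X g h \<in> hered A a" if "g \<in> carrier G" "h \<in> carrier G" for g h
        using X that by (simp add: matrix_sel \<delta>)
      let ?b = "cmp (R.blk v (\<lambda>g h. j (?X g h))) C"
      have b: "?b \<in> block_set" by (rule ent_blk(1)[OF H])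
      have "\<phi> ?b i k = X i k" for i k
      proof (cases "i < n \<and> k < n")
        case True
        then show ?thesis using ent_blk(2)[of ?X "\<gamma> i" "\<gamma> k", OF H] by (simp add: \<phi>_def \<gamma>G \<delta>)
      next
        case False
        then show ?thesis using X unfolding matrix_sel by (auto simp: \<phi>_def)
      qed
      then have "X = \<phi> ?b" by (intro ext) simp
      then show "X \<in> \<phi> ` block_set" using b by blast
    qed
  qed
  have add: "\<phi> (ca_add C x y) = ca_add ?E (\<phi> x) (\<phi> y)" if x: "x \<in> block_set" and y: "y \<in> block_set" for x y
  proof -
    have "ent (ca_add C x y) g h = ca_add A (ent x g h) (ent y g h)" if g: "g \<in> carrier G" "h \<in> carrier G" for g h
    proof (rule j_inj)
      show "j (ent (ca_add C x y) g h) = j (ca_add A (ent x g h) (ent y g h))"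
        using ent(1,2)[OF x g] ent(1,2)[OF y g] ent(2)[OF sub(1)[OF x y] g] carr[OF x] carr[OF y]
        by (simp add: j_add C.emb_add distrib_left distrib_right)
    qed (use ent(1)[OF x g] ent(1)[OF y g] ent(1)[OF sub(1)[OF x y] g] in auto)
    then show ?thesis unfolding matrix_sel by (auto simp: fun_eq_iff \<phi>_def \<gamma>G)
  qed
  have mul: "\<phi> (ca_mul C x y) = ca_mul ?E (\<phi> x) (\<phi> y)" if x: "x \<in> block_set" and y: "y \<in> block_set" for x y
  proof (intro ext)
    fix i l show "\<phi> (ca_mul C x y) i l = ca_mul ?E (\<phi> x) (\<phi> y) i l"
    proof (cases "i < n \<and> l < n")
      case il: True
      let ?f = "\<lambda>k. ca_mul A (\<phi> x i k) (\<phi> y k l)"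
      have f: "?f k \<in> ca_carr A" if "k \<in> {..<n}" for k
        using that il ent(1)[OF x] ent(1)[OF y] by (simp add: \<phi>_def \<gamma>G)
      have "j (ca_sum A ?f {..<n}) = (\<Sum>k<n. j (?f k))" by (rule j_sum[OF _ f]) simp
      also have "\<dots> = (\<Sum>k<n. j (ent x (\<gamma> i) (\<gamma> k)) * j (ent y (\<gamma> k) (\<gamma> l)))"
        using il ent(1)[OF x] ent(1)[OF y] by (intro sum.cong refl) (simp add: \<phi>_def \<gamma>G j_mul)
      also have "\<dots> = (\<Sum>g\<in>carrier G. j (ent x (\<gamma> i) g) * j (ent y g (\<gamma> l)))"
        by (rule sum.reindex_bij_betw[OF \<gamma>])
      also have "\<dots> = j (ent (ca_mul C x y) (\<gamma> i) (\<gamma> l))" using ent_mul[OF x y] il by (simp add: \<gamma>G)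
      finally have "ca_sum A ?f {..<n} = ent (ca_mul C x y) (\<gamma> i) (\<gamma> l)"
        using il by (intro j_inj ca_sum_emb(1) f ent(1) sub(2) x y \<gamma>G) auto
      then show ?thesis using il unfolding matrix_sel by (simp add: \<phi>_def)
    qed (auto simp: matrix_sel \<phi>_def)
  qed
  have star: "\<phi> (ca_star C x) = ca_star ?E (\<phi> x)" if x: "x \<in> block_set" for x
  proof -
    have "ent (ca_star C x) g h = ca_star A (ent x h g)" if g: "g \<in> carrier G" "h \<in> carrier G" for g h
    proof (rule j_inj)
      show "j (ent (ca_star C x) g h) = j (ca_star A (ent x h g))"
        using ent(1,2)[OF x g(2,1)] ent(2)[OF sub(3)[OF x] g] carr[OF x]
        by (simp add: j_star C.emb_star adj_mult mult.assoc)
    qed (use ent(1)[OF x g(2,1)] ent(1)[OF sub(3)[OF x] g] in auto)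
    then show ?thesis unfolding matrix_sel by (auto simp: fun_eq_iff \<phi>_def \<gamma>G)
  qed
  have smul: "\<phi> (ca_smul C z x) = ca_smul ?E z (\<phi> x)" if x: "x \<in> block_set" for x z
  proof -
    have com: "p * (sc z * t) * q = sc z * (p * t * q)" for p t q :: "('g \<Rightarrow> 'a) cprod"
    proof -
      have "p * (sc z * t) * q = (p * sc z) * t * q" by (simp only: mult.assoc)
      then show ?thesis by (simp only: sc_commute[of p] mult.assoc)
    qed
    have "ent (ca_smul C z x) g h = ca_smul A z (ent x g h)" if g: "g \<in> carrier G" "h \<in> carrier G" for g h
    proof (rule j_inj)
      show "j (ent (ca_smul C z x) g h) = j (ca_smul A z (ent x g h))"
        using ent(1,2)[OF x g] ent(2)[OF sub(4)[OF x] g] carr[OF x] by (simp add: j_smul C.emb_smul com)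
    qed (use ent(1)[OF x g] ent(1)[OF sub(4)[OF x] g] in auto)
    then show ?thesis unfolding matrix_sel by (auto simp: fun_eq_iff \<phi>_def \<gamma>G)
  qed
  have "star_iso (subalg C block_set) ?E \<phi>"
    unfolding star_iso_def subalg_sel bij_betw_def using inj img add mul star smul by simp
  then show ?thesis by (intro exI[of _ \<phi>])
qed

end

section \<open>Return to the records of the statement\<close>

text \<open>The witness \<open>r\<close> of positivity lies in the block algebra itself, as
  positivity relative to the subalgebra demands.\<close>

lemma emb_pos1_blocks:
  assumes "a \<in> ca_carr A" "block_alg G C.ue SA uu (j a) c v" and r: "r \<in> R.blocks (j a) v" and n: "norm (adj r * r) \<le> 1"
  shows "ca_pos1 (subalg C (block_set a v)) (cmp (adj r * r) C)"
proof -
  interpret B: block_alg G C.ue SA uu "j a" c v by fact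
  note bs = block_setI[OF assms(1,2)]
  have er: "emb C (cmp r C) = r" by (rule bs(2)[OF r])
  have ed: "emb C (cmp (adj r * r) C) = adj r * r" by (rule bs(2)[OF B.blocks_mult[OF B.blocks_adj[OF r] r]])
  have "cmp (adj r * r) C = ca_mul C (ca_star C (cmp r C)) (cmp r C)"
  proof (rule C.emb_inj)
    show "emb C (cmp (adj r * r) C) = emb C (ca_mul C (ca_star C (cmp r C)) (cmp r C))"
      unfolding ed by (simp only: C.emb_mul C.emb_star C.cmp_in_D C.star_in er)
  qed (intro C.cmp_in_D C.mul_in C.star_in)+
  moreover have "ca_norm C (cmp (adj r * r) C) \<le> 1"
    using C.norm_emb[OF C.cmp_in_D, of "adj r * r"] n by (simp only: ed)
  ultimately show ?thesis unfolding ca_pos1_def ca_positive_def subalg_sel using bs(1)[OF r] by blast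
qed

text \<open>A witness of the ambient type is multiplied by the central projection
  \<open>C.ue\<close>, which puts it into the crossed product and leaves the conjugate of
  \<open>s\<close> unchanged.\<close>

lemma cuntz_below_cz:
  assumes t: "t \<in> ca_carr C" and s: "s \<in> ca_carr C" and cz: "cz (emb C t) (emb C s)"
  shows "cuntz_below C t s"
  unfolding C.cuntz_below_iff[OF t s]
proof (intro allI impI)
  fix \<epsilon> :: real assume "\<epsilon> > 0"
  then obtain r where r: "norm (emb C t - adj r * emb C s * r) < \<epsilon>" using cz unfolding cz_def by blast
  have "adj (C.ue * r) * emb C s * (C.ue * r) = adj r * (C.ue * (emb C s * C.ue)) * r"
    by (simp only: adj_mult C.adj_ue mult.assoc)
  also have "emb C s * C.ue = emb C s" using C.ue_emb[OF s] by (simp only: C.ue_comm)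
  also have "C.ue * emb C s = emb C s" by (rule C.ue_emb[OF s])
  finally have "adj (emb C (cmp r C)) * emb C s * emb C (cmp r C) = adj r * emb C s * r" by (simp only: C.ue_mult)
  then show "\<exists>r\<in>ca_carr C. norm (emb C t - adj (emb C r) * emb C s * emb C r) < \<epsilon>"
    using r by (intro bexI[of _ "cmp r C"]) auto
qed

theorem approximation:
  assumes n: "card (carrier G) = n" and F: "finite F" "F \<subseteq> ca_carr C" and e: "e > 0"
    and s: "s \<in> ca_carr C" "ca_positive C s" "s \<noteq> ca_zero C"
  shows "\<exists>a B d.
            a \<in> ca_carr A \<and> ca_pos1 A a \<and>
            cstar_subalgebra C B \<and>
            (\<exists>\<phi>. star_iso (subalg C B) (matrix_alg (subalg A (hered A a)) n) \<phi>) \<and>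
            d \<in> B \<and> ca_pos1 (subalg C B) d \<and>
            (\<forall>x\<in>F. ca_norm C (ca_minus C (ca_mul C d x) (ca_mul C x d)) < e) \<and>
            (\<forall>x\<in>F. \<exists>y\<in>B. ca_norm C (ca_minus C (ca_mul C d x) y) < e) \<and>
            cuntz_below C (ca_minus C (ca_one C) d) s \<and>
            (\<forall>x\<in>F. ca_norm C (ca_mul C d (ca_mul C x d)) > ca_norm C x - e)"
proof -
  have FC: "x \<in> F \<Longrightarrow> x \<in> ca_carr C" for x using F(2) by blast
  \<comment> \<open>For each \<open>x\<close> in \<open>F\<close> norm detection yields a finite
    test set and a tolerance. The block approximation is then applied once, to all test sets
    together with \<open>F\<close> and to the smallest tolerance.\<close>
  let ?P = "\<lambda>x Y \<delta>. finite Y \<and> (\<forall>y\<in>Y. C.ue * y = y) \<and> \<delta> > 0 \<and>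
    (\<forall>d. pos d \<longrightarrow> norm d \<le> 1 \<longrightarrow> C.ue * d = d \<longrightarrow> norm d > 1 - \<delta> \<longrightarrow>
      (\<forall>y\<in>Y. norm (d * y - y * d) < \<delta>) \<longrightarrow> norm (d * (emb C x * d)) > norm (emb C x) - e)"
  have "\<forall>x\<in>F. \<exists>Y. \<exists>\<delta>::real. ?P x Y \<delta>"
  proof
    fix x assume "x \<in> F"
    then show "\<exists>Y \<delta>. ?P x Y \<delta>" using R.norm_detect[OF C.ue_emb[OF FC] e] by simp
  qed
  from bchoice[OF this] obtain Y where "\<forall>x\<in>F. \<exists>\<delta>::real. ?P x (Y x) \<delta>" by (rule exE)
  from bchoice[OF this] obtain \<delta> where YD: "\<forall>x\<in>F. ?P x (Y x) (\<delta> x)" by (rule exE)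
  note Y1 = bspec[OF YD, THEN conjunct1]
    and Y2 = bspec[OF YD, THEN conjunct2, THEN conjunct1, rule_format]
    and Y3 = bspec[OF YD, THEN conjunct2, THEN conjunct2, THEN conjunct1]
    and Y4 = bspec[OF YD, THEN conjunct2, THEN conjunct2, THEN conjunct2, rule_format]
  define \<eta> where "\<eta> = Min (insert e (\<delta> ` F))"
  have \<eta>: "\<eta> > 0" "\<eta> \<le> e" "x \<in> F \<Longrightarrow> \<eta> \<le> \<delta> x" for x
    using F(1) e Y3 by (auto simp: \<eta>_def)
  define Z where "Z = emb C ` F \<union> (\<Union>x\<in>F. Y x)"
  have Z: "finite Z" "\<And>y. y \<in> Z \<Longrightarrow> C.ue * y = y"
    using F(1) Y1 Y2 FC by (auto simp: Z_def)
  have sE: "C.ue * emb C s = emb C s" "pos (emb C s)" "emb C s \<noteq> 0"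
    using s C.positive_iff[OF s(1)] C.emb_inj[OF s(1) C.zero_in] by auto
  have "\<exists>a' c v d'. block_alg G C.ue SA uu a' c v \<and> pos a' \<and> norm a' \<le> 1 \<and>
    (\<exists>r\<in>R.blocks a' v. d' = adj r * r) \<and> d' \<in> R.blocks a' v \<and> norm d' \<le> 1 \<and> norm d' > 1 - \<eta> \<and>
    (\<forall>y\<in>Z. norm (d' * y - y * d') < \<eta>) \<and> (\<forall>y\<in>Z. \<exists>z\<in>R.blocks a' v. norm (d' * y - z) < \<eta>) \<and> cz (C.ue - d') (emb C s)"
    by (rule R.block_approximation[OF Z \<eta>(1) sE])
  then obtain a' c v d' where bx: "block_alg G C.ue SA uu a' c v \<and> pos a' \<and> norm a' \<le> 1 \<and>
    (\<exists>r\<in>R.blocks a' v. d' = adj r * r) \<and> d' \<in> R.blocks a' v \<and> norm d' \<le> 1 \<and> norm d' > 1 - \<eta> \<and>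
    (\<forall>y\<in>Z. norm (d' * y - y * d') < \<eta>) \<and> (\<forall>y\<in>Z. \<exists>z\<in>R.blocks a' v. norm (d' * y - z) < \<eta>) \<and> cz (C.ue - d') (emb C s)"
    by (elim exE) (rule that)
  from bx have ba': "block_alg G C.ue SA uu a' c v" and a': "pos a'" "norm a' \<le> 1"
    and "\<exists>r\<in>R.blocks a' v. d' = adj r * r" and d': "d' \<in> R.blocks a' v" "norm d' \<le> 1" "norm d' > 1 - \<eta>"
    and com: "\<forall>y\<in>Z. norm (d' * y - y * d') < \<eta>" and app: "\<forall>y\<in>Z. \<exists>z\<in>R.blocks a' v. norm (d' * y - z) < \<eta>"
    and cz: "cz (C.ue - d') (emb C s)"
    by - (elim conjE, assumption)+
  then obtain r where r: "r \<in> R.blocks a' v" "d' = adj r * r" by (elim bexE)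
  have "a' \<in> SA" by (rule block_alg.aS[OF ba'])
  then obtain a where a: "a \<in> ca_carr A" "a' = j a" by (rule SA_E)
  note ba = ba'[unfolded a(2)]
  interpret B: block_alg G C.ue SA uu "j a" c v by (rule ba)
  note bs = block_setI[OF a(1) ba]
  let ?B = "block_set a v"
  define d where "d = cmp d' C"
  have d: "d \<in> ?B" "emb C d = d'" "d \<in> ca_carr C" using bs[of d'] d'(1) unfolding d_def a(2) by auto
  have pd: "pos d'" unfolding r(2) by (rule pos_adj_mult)
  have comx: "norm (d' * emb C x - emb C x * d') < \<eta>" if "x \<in> F" for x using com that by (simp add: Z_def)
  show ?thesis
  proof (intro exI conjI ballI)
    show "a \<in> ca_carr A" by (rule a(1))
    show "ca_pos1 A a" unfolding ca_pos1_def using positive_j[OF a(1)] a' norm_j[OF a(1)] a(2) by simp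
    show "cstar_subalgebra C ?B" by (rule block_subalgebra[OF a(1) ba])
    show "star_iso (subalg C ?B) (matrix_alg (subalg A (hered A a)) n) (SOME \<phi>. star_iso (subalg C ?B) (matrix_alg (subalg A (hered A a)) n) \<phi>)"
      by (rule someI_ex[OF block_iso[OF a(1) ba n]])
    show "d \<in> ?B" by (rule d(1))
    show "ca_pos1 (subalg C ?B) d"
      using emb_pos1_blocks[OF a(1) ba, of r] r d'(2) unfolding d_def a(2) by simp
    show "cuntz_below C (ca_minus C (ca_one C) d) s"
      using cz d s(1) by (intro cuntz_below_cz) (simp_all add: C.emb_minus C.ue_def)
  next
    fix x assume x: "x \<in> F"
    have "norm (d' * emb C x - emb C x * d') = ca_norm C (ca_minus C (ca_mul C d x) (ca_mul C x d))"
      using FC[OF x] d by (simp add: C.emb_minus C.emb_mul flip: C.norm_emb)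
    then show "ca_norm C (ca_minus C (ca_mul C d x) (ca_mul C x d)) < e" using comx[OF x] \<eta>(2) by simp
  next
    fix x assume x: "x \<in> F"
    then obtain z where z: "z \<in> R.blocks (j a) v" "norm (d' * emb C x - z) < \<eta>" using app unfolding a(2) Z_def by blast
    have "ca_norm C (ca_minus C (ca_mul C d x) (cmp z C)) = norm (d' * emb C x - z)"
      using FC[OF x] d bs(2)[OF z(1)] by (simp add: C.emb_minus C.emb_mul flip: C.norm_emb)
    then show "\<exists>y\<in>?B. ca_norm C (ca_minus C (ca_mul C d x) y) < e"
      using z(2) \<eta>(2) bs(1)[OF z(1)] by (intro bexI[of _ "cmp z C"]) auto
  next
    fix x assume x: "x \<in> F"
    have "norm (emb C x) - e < norm (d' * (emb C x * d'))"
    proof (rule Y4[OF x pd d'(2)])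
      show "C.ue * d' = d'" using C.ue_emb[OF d(3)] d(2) by simp
      show "1 - \<delta> x < norm d'" using d'(3) \<eta>(3)[OF x] by simp
      show "norm (d' * y - y * d') < \<delta> x" if "y \<in> Y x" for y
      proof -
        have "y \<in> Z" using that x by (auto simp: Z_def)
        then show ?thesis using com \<eta>(3)[OF x] by fastforce
      qed
    qed
    then show "ca_norm C (ca_mul C d (ca_mul C x d)) > ca_norm C x - e"
      using FC[OF x] d by (simp add: C.emb_mul flip: C.norm_emb)
  qed
qed

end

theorem theorem3p4:
  fixes A :: "'a cstar_alg" and G :: "('g, 'b) monoid_scheme" and \<alpha> :: "'g \<Rightarrow> 'a \<Rightarrow> 'a"
    and n :: nat
  assumes "cstar_algebra A" and "unital A" and "simple_alg A" and "infinite_dim A"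
    and "group G" and "finite (carrier G)" and "card (carrier G) = n"
    and "group_action G A \<alpha>"
    and "weak_tracial_rokhlin A G \<alpha>"
  shows "\<forall>F e s. finite F \<and> F \<subseteq> ca_carr (crossed_product A G \<alpha>) \<and> e > 0 \<and>
           s \<in> ca_carr (crossed_product A G \<alpha>) \<and> ca_positive (crossed_product A G \<alpha>) s \<and>
           s \<noteq> ca_zero (crossed_product A G \<alpha>) \<longrightarrow>
         (\<exists>a B d.
            a \<in> ca_carr A \<and> ca_pos1 A a \<and>
            cstar_subalgebra (crossed_product A G \<alpha>) B \<and>
            (\<exists>\<phi>. star_iso (subalg (crossed_product A G \<alpha>) B) (matrix_alg (subalg A (hered A a)) n) \<phi>) \<and>
            d \<in> B \<and> ca_pos1 (subalg (crossed_product A G \<alpha>) B) d \<and>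
            (\<forall>x\<in>F. ca_norm (crossed_product A G \<alpha>)
                 (ca_minus (crossed_product A G \<alpha>) (ca_mul (crossed_product A G \<alpha>) d x)
                    (ca_mul (crossed_product A G \<alpha>) x d)) < e) \<and>
            (\<forall>x\<in>F. \<exists>y\<in>B. ca_norm (crossed_product A G \<alpha>)
                 (ca_minus (crossed_product A G \<alpha>) (ca_mul (crossed_product A G \<alpha>) d x) y) < e) \<and>
            cuntz_below (crossed_product A G \<alpha>)
               (ca_minus (crossed_product A G \<alpha>) (ca_one (crossed_product A G \<alpha>)) d) s \<and>
            (\<forall>x\<in>F. ca_norm (crossed_product A G \<alpha>)
                 (ca_mul (crossed_product A G \<alpha>) d (ca_mul (crossed_product A G \<alpha>) x d))
               > ca_norm (crossed_product A G \<alpha>) x - e))"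
  using assms crossed_rokhlin.approximation[of A G \<alpha> n]
  unfolding crossed_rokhlin_def crossed_def ucsalg_def csalg_def ucsalg_axioms_def crossed_axioms_def crossed_rokhlin_axioms_def
  by simp

end
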